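(* Let $\boldsymbol{Q}\subset\mathbb{R}^d$ with interfaces $(\Gamma_k)_{k\in\mathbb{N}}$ and constants $(C_k)_{k\in\mathbb{N}}$ be a multiscale interface network, let $\mathfrak{c}>0$, and let $\mathcal{H}=\mathcal{H}_{\mathfrak{c}}$ be the associated fractal space with norm $\|\cdot\|$ and closed subspaces $\mathcal{H}_K$, $K\in\mathbb{N}$. Let $A:\Gamma\to\mathbb{R}$ be measurable with $0<\mathfrak{a}\le A\le\mathfrak{A}<\infty$ a.e. on $\Gamma$, where $\mathfrak{a}\le1\le\mathfrak{A}$, let $f\in L^2(\boldsymbol{Q})$, $\ell(v)=\int_{\boldsymbol{Q}}fv\,dx$, and $$a(v,w)=\int_{\boldsymbol{Q}\setminus\Gamma}\nabla v\cdot\nabla w\,dx+\sum_{k=1}^\infty(1+\mathfrak{c})^kC_k\int_{\Gamma_k}A\,[\![v]\!][\![w]\!]\,d\Gamma_k,\qquad v,w\in\mathcal{H}.$$ Then the problem of finding a minimizer $u\in\mathcal{H}$ of $\mathcal{E}(v)=\frac12a(v,v)-\ell(v)$ over $v\in\mathcal{H}$ is equivalent to the variational problem of finding $u\in\mathcal{H}$ such that $$a(u,v)=\ell(v)\qquad\forall v\in\mathcal{H},$$ and admits a unique solution. Moreover, if for each $K\in\mathbb{N}$ the function $u_K\in\mathcal{H}_K$ denotes the unique minimizer over $\mathcal{H}_K$ of $\mathcal{E}_K(v)=\frac12a_K(v,v)-\ell(v)$, where $$a_K(v,w)=\int_{\boldsymbol{Q}\setminus\Gamma^{(K)}}\nabla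 v\cdot\nabla w\,dx+\sum_{k=1}^K(1+\mathfrak{c})^kC_k\int_{\Gamma_k}A\,[\![v]\!][\![w]\!]\,d\Gamma_k,$$ then the error estimate $$\|u-u_K\|\le\frac{\mathfrak{A}}{\mathfrak{a}}\inf_{v\in\mathcal{H}_K}\|u-v\|$$ holds and implies $\|u-u_K\|\to0$ for $K\to\infty$.
   Context: **Multiscale interface network.** $\boldsymbol{Q}\subset\mathbb{R}^d$ is a bounded domain with Lipschitz boundary containing mutually disjoint interfaces $\Gamma_k$, $k\in\mathbb{N}$, each piecewise affine with finite $(d-1)$-dimensional Hausdorff measure. Put $\Gamma=\bigcup_{k=1}^\infty\Gamma_k$ and $\Gamma^{(K)}=\bigcup_{k=1}^K\Gamma_k$. For each $K\in\mathbb{N}$, $\boldsymbol{Q}\setminus\Gamma^{(K)}=\bigcup_{G\in\mathcal{G}^{(K)}}G$ splits into mutually disjoint, open, simply connected cells $G$ with $\partial G=\partial\overline G$. Let $\mathcal{G}^{(K)}_\infty=\{G\in\mathcal{G}^{(K)}: G\in\mathcal{G}^{(L)}\ \forall L>K\}$ and $d_K=\max\{\operatorname{diam}G: G\in\mathcal{G}^{(K)}\setminus\mathcal{G}^{(K)}_\infty\}$; it is assumed that $d_K\to0$ as $K\to\infty$. With $(x,y)=\{x+s(y-x): s\in(0,1)\}$, it is assumed that $\#\big((x,y)\cap\Gamma_k\big)\le C_k$ for almost all $x,y\in\boldsymbol{Q}$, with $C_k\in\mathbb{N}$ depending only on $k$. **Level-$K$ spaces.** $\mathcal{C}^1_{K,0}(\boldsymbol{Q})$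 is the space of $v:\overline{\boldsymbol{Q}}\setminus\Gamma^{(K)}\to\mathbb{R}$ with $v|_G\in C^1(\overline G)$ for all $G\in\mathcal{G}^{(K)}$ and $v|_{\partial\boldsymbol{Q}}\equiv0$. At almost every $\xi\in\Gamma_k$ there is a unit normal $\nu_\xi$, oriented so that $\nu_\xi\cdot e_m>0$ where $m=\min\{i:\nu_\xi\cdot e_i\ne0\}$ ($e_1,\dots,e_d$ the canonical basis). The normal jump is $[\![v]\!](\xi)=\lim_{s\downarrow0}\big(v(\xi+s\nu_\xi)-v(\xi-s\nu_\xi)\big)$. For $\mathfrak{c}>0$ set $$\langle v,w\rangle_{K,\mathfrak{c}}=\int_{\boldsymbol{Q}\setminus\Gamma^{(K)}}\nabla v\cdot\nabla w\,dx+\sum_{k=1}^K(1+\mathfrak{c})^kC_k\int_{\Gamma_k}[\![v]\!][\![w]\!]\,d\Gamma_k,\qquad \|v\|_{K,\mathfrak{c}}=\langle v,v\rangle_{K,\mathfrak{c}}^{1/2},$$ and let $\mathcal{H}_K$ be the closure (completion) of $\mathcal{C}^1_{K,0}(\boldsymbol{Q})$ in $\|\cdot\|_{K,\mathfrak{c}}$ (gradients and jumps extend by continuity). Then $\mathcal{H}_1\subset\mathcal{H}_2\subset\cdots$ with isometric embeddings. **Fractal space.** $\mathcal{H}^\circ=\bigcup_K\mathcal{H}_K$ carries the scalar product $\langle v,w\rangle_{\mathfrak{c}}=\langle v,w\rangle_{\max\{K,L\},\mathfrak{c}}$ for $v\in\mathcal{H}_L$, $w\in\mathcal{H}_K$.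 $\mathcal{H}=\mathcal{H}_{\mathfrak{c}}$ is the completion of $\mathcal{H}^\circ$, i.e. the set of equivalence classes of Cauchy sequences, each represented by some $(v_K)_{K\in\mathbb{N}}$ with $v_K\in\mathcal{H}_K$; its norm is $\|v\|=\lim_K\|v_K\|_{K,\mathfrak{c}}$. The spaces $\mathcal{H}_K$ are identified with their isometric images in $\mathcal{H}$. Elements of $\mathcal{H}$ are identified with functions in $L^2(\boldsymbol{Q})$ (the $L^2$-limit of $(v_K)_K$, via the continuous embedding $\mathcal{H}\subset L^2(\boldsymbol{Q})$), which gives meaning to $\ell(v)$. **Weak gradient and generalized jump.** For $v=(v_K)_K\in\mathcal{H}$, $\nabla v=\lim_K\nabla v_K$ in $L^2(\boldsymbol{Q}\setminus\Gamma)^d$ and $[\![v]\!]=\lim_K[\![v_K]\!]$ in the space of sequences $(j_k)_k$, $j_k\in L^2(\Gamma_k)$, with norm $\big(\sum_k(1+\mathfrak{c})^kC_k\|j_k\|_{L^2(\Gamma_k)}^2\big)^{1/2}$ (both limits exist). *)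

theory Defs
  imports "HOL-Analysis.Analysis"
begin

section \<open>Hausdorff measure\<close>

(* Gauge of a single covering set. Sets of diameter larger than \<delta> get the value \<infinity>, so that
   they never occur in an efficient covering. The factor volume (m-dim. unit ball) / 2^m is the
   usual normalisation, and 0 ^ 0 = 1 makes the case m = 0 counting measure. *)
definition hausdorff_gauge :: "nat \<Rightarrow> real \<Rightarrow> 'a::metric_space set \<Rightarrow> ennreal" where
  "hausdorff_gauge m \<delta> U =
     (if U = {} then 0
      else if bounded U \<and> diameter U \<le> \<delta> then ennreal (unit_ball_vol (real m) * (diameter U / 2) ^ m)
      else \<infinity>)"

(* The library's outer_measure takes the infimum over countable disjoint coverings by arbitrary
   sets; as the gauge is monotone, disjointness makes no difference. *)
definition hausdorff_outer :: "nat \<Rightarrow> 'a::metric_space set \<Rightarrow> ennreal" where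
  "hausdorff_outer m A = (SUP \<delta>\<in>{0<..}. outer_measure UNIV (hausdorff_gauge m \<delta>) A)"

definition hausdorff_measure :: "nat \<Rightarrow> 'a::metric_space measure" where
  "hausdorff_measure m = measure_of UNIV (lambda_system UNIV UNIV (hausdorff_outer m)) (hausdorff_outer m)"

lemma outer_measure_space_hausdorff:
  "outer_measure_space UNIV (hausdorff_outer m :: 'a::metric_space set \<Rightarrow> ennreal)"
proof -
  interpret sigma_algebra "UNIV :: 'a set" "UNIV :: 'a set set"
    using sigma_algebra_Pow[of "UNIV :: 'a set"] by simp
  have inc: "increasing UNIV (hausdorff_gauge m \<delta> :: 'a set \<Rightarrow> ennreal)" for \<delta>
  proof (unfold increasing_def, intro ballI impI)
    fix S T :: "'a set" assume "S \<subseteq> T"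
    show "hausdorff_gauge m \<delta> S \<le> hausdorff_gauge m \<delta> T"
    proof (cases "S \<noteq> {} \<and> bounded T \<and> diameter T \<le> \<delta>")
      case True
      have "diameter S \<le> diameter T" "bounded S"
        using True \<open>S \<subseteq> T\<close> diameter_subset bounded_subset by blast+
      moreover have "0 \<le> diameter S"
        using \<open>bounded S\<close> by (rule diameter_ge_0)
      ultimately show ?thesis
        using True \<open>S \<subseteq> T\<close> unfolding hausdorff_gauge_def
        by (auto intro!: ennreal_leI mult_left_mono power_mono)
    next
      case False
      then show ?thesis
        using \<open>S \<subseteq> T\<close> by (auto simp: hausdorff_gauge_def)
    qed
  qed
  have pos: "positive UNIV (hausdorff_gauge m \<delta> :: 'a set \<Rightarrow> ennreal)" for \<delta>
    by (simp add: positive_def hausdorff_gauge_def)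
  have oms: "outer_measure_space UNIV (outer_measure UNIV (hausdorff_gauge m \<delta> :: 'a set \<Rightarrow> ennreal))" for \<delta>
    using outer_measure_space_outer_measure[OF pos inc] by simp
  show ?thesis
    unfolding outer_measure_space_def
  proof (intro conjI)
    show "positive UNIV (hausdorff_outer m :: 'a set \<Rightarrow> ennreal)"
      using oms by (auto simp: hausdorff_outer_def positive_def outer_measure_space_def)
    show "increasing UNIV (hausdorff_outer m :: 'a set \<Rightarrow> ennreal)"
      using oms by (auto simp: hausdorff_outer_def increasing_def outer_measure_space_def intro!: SUP_mono)
    show "countably_subadditive UNIV (hausdorff_outer m :: 'a set \<Rightarrow> ennreal)"
      unfolding countably_subadditive_def
    proof (intro allI impI)
      fix A :: "nat \<Rightarrow> 'a set" assume "disjoint_family A"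
      have "outer_measure UNIV (hausdorff_gauge m \<delta>) (\<Union>i. A i) \<le> (\<Sum>i. hausdorff_outer m (A i))"
        if "\<delta> \<in> {0<..}" for \<delta>
      proof -
        have "outer_measure UNIV (hausdorff_gauge m \<delta>) (\<Union>i. A i)
            \<le> (\<Sum>i. outer_measure UNIV (hausdorff_gauge m \<delta>) (A i))"
          using oms[of \<delta>] \<open>disjoint_family A\<close>
          by (simp add: outer_measure_space_def countably_subadditive_def)
        also have "\<dots> \<le> (\<Sum>i. hausdorff_outer m (A i))"
          unfolding hausdorff_outer_def using that by (intro suminf_le SUP_upper) auto
        finally show ?thesis .
      qed
      then show "hausdorff_outer m (\<Union>i. A i) \<le> (\<Sum>i. hausdorff_outer m (A i))"
        by (subst hausdorff_outer_def) (rule SUP_least)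
    qed
  qed
qed

lemma
  fixes A :: "'a::metric_space set"
  shows sets_hausdorff_measure:
      "sets (hausdorff_measure m :: 'a measure) = lambda_system UNIV UNIV (hausdorff_outer m)"
    and emeasure_hausdorff_measure:
      "A \<in> sets (hausdorff_measure m) \<Longrightarrow> emeasure (hausdorff_measure m) A = hausdorff_outer m A"
proof -
  interpret sigma_algebra "UNIV :: 'a set" "UNIV :: 'a set set"
    using sigma_algebra_Pow[of "UNIV :: 'a set"] by simp
  have ms: "measure_space UNIV (lambda_system UNIV UNIV (hausdorff_outer m :: 'a set \<Rightarrow> ennreal)) (hausdorff_outer m)"
    by (rule caratheodory_lemma[OF outer_measure_space_hausdorff])
  then interpret L: sigma_algebra "UNIV :: 'a set" "lambda_system UNIV UNIV (hausdorff_outer m)"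
    by (simp add: measure_space_def)
  show s: "sets (hausdorff_measure m :: 'a measure) = lambda_system UNIV UNIV (hausdorff_outer m)"
    by (simp add: hausdorff_measure_def L.sets_measure_of_eq)
  show "emeasure (hausdorff_measure m) A = hausdorff_outer m A"
    if "A \<in> sets (hausdorff_measure m)"
    unfolding hausdorff_measure_def
    by (rule emeasure_measure_of_sigma)
       (use ms that[unfolded s] in \<open>auto simp: measure_space_def\<close>)
qed

definition surface_measure :: "(real^'n) set \<Rightarrow> (real^'n) measure" where
  "surface_measure S = restrict_space (hausdorff_measure (CARD('n) - 1)) S"

section \<open>Multiscale interface networks\<close>

(* The level index runs through k \<ge> 1; the values at 0 are never used. *)
record 'n network =
  region :: "(real^'n) set"
  ifc :: "nat \<Rightarrow> (real^'n) set"
  crossings :: "nat \<Rightarrow> nat"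
  cells :: "nat \<Rightarrow> (real^'n) set set"

definition ifc_upto :: "'n::finite network \<Rightarrow> nat \<Rightarrow> (real^'n) set" where
  "ifc_upto N K = (\<Union>k\<in>{1..K}. ifc N k)"

definition ifc_all :: "'n::finite network \<Rightarrow> (real^'n) set" where
  "ifc_all N = (\<Union>k\<in>{1..}. ifc N k)"

definition permanent_cells :: "'n::finite network \<Rightarrow> nat \<Rightarrow> (real^'n) set set" where
  "permanent_cells N K = {G \<in> cells N K. \<forall>L>K. G \<in> cells N L}"

(* The 0 only fixes the value when every cell is permanent. *)
definition mesh_size :: "'n::finite network \<Rightarrow> nat \<Rightarrow> real" where
  "mesh_size N K = Sup (insert 0 (diameter ` (cells N K - permanent_cells N K)))"

(* Near each boundary point, the set is the region strictly above a Lipschitz graph over the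
   hyperplane orthogonal to \<nu>. *)
definition lipschitz_boundary :: "(real^'n) set \<Rightarrow> bool" where
  "lipschitz_boundary Q \<longleftrightarrow>
     (\<forall>p\<in>frontier Q. \<exists>\<nu> \<phi> L r. norm \<nu> = 1 \<and> 0 < r \<and> L-lipschitz_on {y. y \<bullet> \<nu> = 0} \<phi> \<and>
        Q \<inter> ball p r = {x \<in> ball p r. \<phi> (x - (x \<bullet> \<nu>) *\<^sub>R \<nu>) < x \<bullet> \<nu>})"

(* Finitely many flat pieces. No shape is prescribed for the pieces: inside a network the
   condition frontier G = frontier (closure G) on the cells forces the interface to be a full
   hyperplane near each of its points that lies on only one of the hyperplanes involved. *)
definition piecewise_affine :: "(real^'n) set \<Rightarrow> bool" where
  "piecewise_affine S \<longleftrightarrow>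
     (\<exists>\<P>. finite \<P> \<and> S = \<Union>\<P> \<and> (\<forall>P\<in>\<P>. \<exists>a b. a \<noteq> 0 \<and> P \<subseteq> {x. a \<bullet> x = b}))"

locale multiscale_network =
  fixes N :: "'n::finite network"
  assumes domain: "open (region N)" "connected (region N)" "region N \<noteq> {}" "bounded (region N)"
    and lipschitz: "lipschitz_boundary (region N)"
    and ifc_subset: "\<And>k. 1 \<le> k \<Longrightarrow> ifc N k \<subseteq> region N"
    and ifc_disjoint: "disjoint_family_on (ifc N) {1..}"
    and ifc_affine: "\<And>k. 1 \<le> k \<Longrightarrow> piecewise_affine (ifc N k)"
    and ifc_finite: "\<And>k. 1 \<le> k \<Longrightarrow> hausdorff_outer (CARD('n) - 1) (ifc N k) < \<infinity>"
    and cells_Union: "\<And>K. 1 \<le> K \<Longrightarrow> \<Union>(cells N K) = region N - ifc_upto N K"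
    and cells_disjoint: "\<And>K. 1 \<le> K \<Longrightarrow> disjoint (cells N K)"
    and cells_open: "\<And>K G. 1 \<le> K \<Longrightarrow> G \<in> cells N K \<Longrightarrow> open G"
    and cells_simply_connected: "\<And>K G. 1 \<le> K \<Longrightarrow> G \<in> cells N K \<Longrightarrow> simply_connected G"
    and cells_frontier: "\<And>K G. 1 \<le> K \<Longrightarrow> G \<in> cells N K \<Longrightarrow> frontier G = frontier (closure G)"
    and mesh_size_tendsto_0: "mesh_size N \<longlonglongrightarrow> 0"
    and crossings: "\<And>k. 1 \<le> k \<Longrightarrow>
      AE p in (lborel :: ((real^'n) \<times> (real^'n)) measure).
        fst p \<in> region N \<and> snd p \<in> region N \<longrightarrow>
          finite (open_segment (fst p) (snd p) \<inter> ifc N k) \<and>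
          card (open_segment (fst p) (snd p) \<inter> ifc N k) \<le> crossings N k"

section \<open>Gradients and jumps of piecewise smooth functions\<close>

type_synonym 'n point = "real^'n"

definition grad :: "('n::finite point \<Rightarrow> real) \<Rightarrow> 'n point \<Rightarrow> 'n point" where
  "grad v x = (THE g. GDERIV v x :> g)"

(* The unit vector orthogonal to the hyperplane with which S coincides near \<xi>, oriented so that
   its first nonzero component is positive. *)
definition unit_normal :: "'n::{finite,linorder} point set \<Rightarrow> 'n point \<Rightarrow> 'n point" where
  "unit_normal S \<xi> =
     (THE \<nu>. norm \<nu> = 1 \<and> 0 < \<nu> $ Min {i. \<nu> $ i \<noteq> 0} \<and>
        (\<exists>r>0. S \<inter> ball \<xi> r = {x \<in> ball \<xi> r. (x - \<xi>) \<bullet> \<nu> = 0}))"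

definition normal_jump ::
    "'n::{finite,linorder} point set \<Rightarrow> ('n point \<Rightarrow> real) \<Rightarrow> 'n point \<Rightarrow> real" where
  "normal_jump S v \<xi> =
     Lim (at_right 0) (\<lambda>s. v (\<xi> + s *\<^sub>R unit_normal S \<xi>) - v (\<xi> - s *\<^sub>R unit_normal S \<xi>))"

definition L2 :: "'a measure \<Rightarrow> ('a \<Rightarrow> 'b::{real_normed_vector}) set" where
  "L2 M = {f \<in> borel_measurable M. integrable M (\<lambda>x. (norm (f x))\<^sup>2)}"

definition L2_tendsto ::
    "'a measure \<Rightarrow> (nat \<Rightarrow> 'a \<Rightarrow> 'b::{real_normed_vector}) \<Rightarrow> ('a \<Rightarrow> 'b) \<Rightarrow> bool" where
  "L2_tendsto M F f \<longleftrightarrow>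
     (\<forall>n. F n \<in> L2 M) \<and> f \<in> L2 M \<and> (\<lambda>n. LINT x|M. (norm (F n x - f x))\<^sup>2) \<longlonglongrightarrow> 0"

section \<open>Level-\<open>K\<close> spaces\<close>

(* Functions on closure Q - \<Gamma>^(K) are represented by total functions whose other values are
   irrelevant. The restriction of v to a cell G is C^1 up to the boundary: v agrees on
   closure G - \<Gamma>^(K) with a continuous function u on closure G, and its gradient on G extends
   continuously to closure G. In particular the boundary condition is attained continuously.
   The two L2 conditions say that the norm is finite; they only matter when there are infinitely
   many cells of level K. *)
definition C1_level :: "'n::{finite,linorder} network \<Rightarrow> nat \<Rightarrow> ('n point \<Rightarrow> real) set" where
  "C1_level N K = {v.
     (\<forall>G\<in>cells N K. \<exists>u g. continuous_on (closure G) u \<and> continuous_on (closure G) g \<and>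
        (\<forall>x\<in>closure G - ifc_upto N K. v x = u x) \<and> (\<forall>x\<in>G. GDERIV v x :> g x)) \<and>
     (\<forall>x\<in>frontier (region N). v x = 0) \<and>
     grad v \<in> L2 (lebesgue_on (region N - ifc_upto N K)) \<and>
     (\<forall>k\<in>{1..K}. normal_jump (ifc N k) v \<in> L2 (surface_measure (ifc N k)))}"

definition weight :: "'n::finite network \<Rightarrow> real \<Rightarrow> nat \<Rightarrow> real" where
  "weight N c k = (1 + c) ^ k * real (crossings N k)"

definition level_inner ::
    "'n::{finite,linorder} network \<Rightarrow> real \<Rightarrow> nat \<Rightarrow> ('n point \<Rightarrow> real) \<Rightarrow> ('n point \<Rightarrow> real) \<Rightarrow> real" where
  "level_inner N c K v w =
     (LINT x|lebesgue_on (region N - ifc_upto N K). grad v x \<bullet> grad w x) +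
     (\<Sum>k=1..K. weight N c k *
        (LINT \<xi>|surface_measure (ifc N k). normal_jump (ifc N k) v \<xi> * normal_jump (ifc N k) w \<xi>))"

section \<open>The fractal space\<close>

definition C1_union :: "'n::{finite,linorder} network \<Rightarrow> ('n point \<Rightarrow> real) set" where
  "C1_union N = (\<Union>K\<in>{1..}. C1_level N K)"

definition level :: "'n::{finite,linorder} network \<Rightarrow> ('n point \<Rightarrow> real) \<Rightarrow> nat" where
  "level N v = (LEAST K. 1 \<le> K \<and> v \<in> C1_level N K)"

definition union_inner ::
    "'n::{finite,linorder} network \<Rightarrow> real \<Rightarrow> ('n point \<Rightarrow> real) \<Rightarrow> ('n point \<Rightarrow> real) \<Rightarrow> real" where
  "union_inner N c v w = level_inner N c (max (level N v) (level N w)) v w"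

definition union_norm :: "'n::{finite,linorder} network \<Rightarrow> real \<Rightarrow> ('n point \<Rightarrow> real) \<Rightarrow> real" where
  "union_norm N c v = sqrt (union_inner N c v v)"

definition cauchy_seqs ::
    "'n::{finite,linorder} network \<Rightarrow> real \<Rightarrow> (nat \<Rightarrow> 'n point \<Rightarrow> real) set" where
  "cauchy_seqs N c = {X. (\<forall>n. X n \<in> C1_union N) \<and>
     (\<forall>e>0. \<exists>n0. \<forall>m\<ge>n0. \<forall>n\<ge>n0. union_norm N c (\<lambda>x. X m x - X n x) < e)}"

definition cauchy_rel ::
    "'n::{finite,linorder} network \<Rightarrow> real \<Rightarrow> ((nat \<Rightarrow> 'n point \<Rightarrow> real) \<times> (nat \<Rightarrow> 'n point \<Rightarrow> real)) set" where
  "cauchy_rel N c = {(X, Y). X \<in> cauchy_seqs N c \<and> Y \<in> cauchy_seqs N c \<and>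
     (\<lambda>n. union_norm N c (\<lambda>x. X n x - Y n x)) \<longlonglongrightarrow> 0}"

type_synonym 'n fractal_elem = "(nat \<Rightarrow> 'n point \<Rightarrow> real) set"

(* \<H> is the set of equivalence classes of Cauchy sequences. The sequences are taken in the union
   of the spaces C^1_(K,0), which is dense in the union \<H>\<degree> of their completions \<H>_K, so the
   completion is that of \<H>\<degree>. *)
definition fractal_space :: "'n::{finite,linorder} network \<Rightarrow> real \<Rightarrow> 'n fractal_elem set" where
  "fractal_space N c = cauchy_seqs N c // cauchy_rel N c"

(* \<H>_K as a subspace of \<H>: the classes represented by Cauchy sequences in C^1_(K,0), i.e. the
   closure (completion) of C^1_(K,0). *)
definition fractal_level :: "'n::{finite,linorder} network \<Rightarrow> real \<Rightarrow> nat \<Rightarrow> 'n fractal_elem set" where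
  "fractal_level N c K = {V \<in> fractal_space N c. \<exists>X\<in>V. \<forall>n. X n \<in> C1_level N K}"

definition fractal_minus ::
    "'n::{finite,linorder} network \<Rightarrow> real \<Rightarrow> 'n fractal_elem \<Rightarrow> 'n fractal_elem \<Rightarrow> 'n fractal_elem" where
  "fractal_minus N c V W = {Z. \<exists>X\<in>V. \<exists>Y\<in>W. ((\<lambda>n x. X n x - Y n x), Z) \<in> cauchy_rel N c}"

definition fractal_norm :: "'n::{finite,linorder} network \<Rightarrow> real \<Rightarrow> 'n fractal_elem \<Rightarrow> real" where
  "fractal_norm N c V = (THE r. \<exists>X\<in>V. (\<lambda>n. union_norm N c (X n)) \<longlonglongrightarrow> r)"

(* The L^2 limits below are unique up to null sets; SOME picks a representative. *)
definition fractal_fun :: "'n::{finite,linorder} network \<Rightarrow> 'n fractal_elem \<Rightarrow> 'n point \<Rightarrow> real" where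
  "fractal_fun N V = (SOME u. \<exists>X\<in>V. L2_tendsto (lebesgue_on (region N)) X u)"

definition weak_grad :: "'n::{finite,linorder} network \<Rightarrow> 'n fractal_elem \<Rightarrow> 'n point \<Rightarrow> 'n point" where
  "weak_grad N V =
     (SOME g. \<exists>X\<in>V. L2_tendsto (lebesgue_on (region N - ifc_all N)) (\<lambda>n. grad (X n)) g)"

definition jump_norm :: "'n::{finite,linorder} network \<Rightarrow> real \<Rightarrow> (nat \<Rightarrow> 'n point \<Rightarrow> real) \<Rightarrow> real" where
  "jump_norm N c j =
     sqrt (\<Sum>k. weight N c (Suc k) * (LINT \<xi>|surface_measure (ifc N (Suc k)). (j (Suc k) \<xi>)\<^sup>2))"

definition jump_space :: "'n::{finite,linorder} network \<Rightarrow> real \<Rightarrow> (nat \<Rightarrow> 'n point \<Rightarrow> real) set" where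
  "jump_space N c = {j. (\<forall>k\<ge>1. j k \<in> L2 (surface_measure (ifc N k))) \<and>
     summable (\<lambda>k. weight N c (Suc k) * (LINT \<xi>|surface_measure (ifc N (Suc k)). (j (Suc k) \<xi>)\<^sup>2))}"

definition gen_jump ::
    "'n::{finite,linorder} network \<Rightarrow> real \<Rightarrow> 'n fractal_elem \<Rightarrow> nat \<Rightarrow> 'n point \<Rightarrow> real" where
  "gen_jump N c V =
     (SOME j. j \<in> jump_space N c \<and>
        (\<exists>X\<in>V. (\<lambda>n. jump_norm N c (\<lambda>k \<xi>. normal_jump (ifc N k) (X n) \<xi> - j k \<xi>)) \<longlonglongrightarrow> 0))"

section \<open>Bilinear forms, load and energies\<close>

definition form ::
    "'n::{finite,linorder} network \<Rightarrow> real \<Rightarrow> ('n point \<Rightarrow> real) \<Rightarrow> 'n fractal_elem \<Rightarrow> 'n fractal_elem \<Rightarrow> real" where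
  "form N c A V W =
     (LINT x|lebesgue_on (region N - ifc_all N). weak_grad N V x \<bullet> weak_grad N W x) +
     (\<Sum>k. weight N c (Suc k) *
        (LINT \<xi>|surface_measure (ifc N (Suc k)). A \<xi> * gen_jump N c V (Suc k) \<xi> * gen_jump N c W (Suc k) \<xi>))"

definition level_form ::
    "'n::{finite,linorder} network \<Rightarrow> real \<Rightarrow> ('n point \<Rightarrow> real) \<Rightarrow> nat \<Rightarrow> 'n fractal_elem \<Rightarrow> 'n fractal_elem \<Rightarrow> real" where
  "level_form N c A K V W =
     (LINT x|lebesgue_on (region N - ifc_upto N K). weak_grad N V x \<bullet> weak_grad N W x) +
     (\<Sum>k=1..K. weight N c k *
        (LINT \<xi>|surface_measure (ifc N k). A \<xi> * gen_jump N c V k \<xi> * gen_jump N c W k \<xi>))"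

definition load :: "'n::{finite,linorder} network \<Rightarrow> ('n point \<Rightarrow> real) \<Rightarrow> 'n fractal_elem \<Rightarrow> real" where
  "load N f V = (LINT x|lebesgue_on (region N). f x * fractal_fun N V x)"

definition energy ::
    "'n::{finite,linorder} network \<Rightarrow> real \<Rightarrow> ('n point \<Rightarrow> real) \<Rightarrow> ('n point \<Rightarrow> real) \<Rightarrow> 'n fractal_elem \<Rightarrow> real" where
  "energy N c A f V = 1 / 2 * form N c A V V - load N f V"

definition level_energy ::
    "'n::{finite,linorder} network \<Rightarrow> real \<Rightarrow> ('n point \<Rightarrow> real) \<Rightarrow> ('n point \<Rightarrow> real) \<Rightarrow> nat \<Rightarrow> 'n fractal_elem \<Rightarrow> real" where
  "level_energy N c A f K V = 1 / 2 * level_form N c A K V V - load N f V"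

end

(* The forms A and \<langle>_, _\<rangle> are equivalent, so once the load is known to be continuous the theorem
   follows from the theory of coercive quadratic functionals: midpoints show that minimising
   sequences are Cauchy, and Galerkin orthogonality gives the error estimate. All of this only
   needs a semi-inner product and therefore applies directly to the Cauchy sequences, before
   passing to classes.

   The load is continuous by a Poincare inequality whose constant does not depend on K. For almost
   every direction \<theta>, the line through almost every point meets each interface transversally and at
   most C_k times inside Q, and it reaches the boundary, where v vanishes, after a bounded time. The
   fundamental theorem along the line bounds v by the integral of its derivative and the sum of the
   jumps. The Cauchy-Schwarz inequality with the weights (1 + c)^k C_k costs only the geometric
   series, and integrating over all base points turns the jumps at the crossings into surface
   integrals, because the points that reach a set E within time T along \<theta> have measure at most a
   constant times the (d-1)-dimensional Hausdorff measure of E.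

   That jumps exist at almost every point of an interface follows from the condition on the
   frontiers of the cells: off the null set where two of the hyperplanes meet, each interface is
   locally a full hyperplane, with a cell on either side. *)

theory Submission
  imports Defs "HOL-Library.Function_Algebras"
begin

section \<open>Quadratic minimisation in semi-inner product spaces\<close>

text \<open>The pieces of an interface have no prescribed shape, and the crossing condition speaks
  of almost all pairs of points, not of lines. Two devices answer this. Each interface is covered by
  finitely many full hyperplanes (\<open>hyps\<close>), through which all geometry runs, and lines
  are sampled at countably many step lengths. Surface integrals are then dominated by volume
  integrals of Borel majorants: an inequality with some constant is enough, so neither an exact area
  formula nor measurability of swept sets enters. One majorant per hyperplane is summed, but these
  majorants belong to disjoint parts of the interface, so the constant depends neither on k nor on
  K. On the way to the completion, three maps into L2 spaces carry everything: gradient, jump and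
  the function itself, each bounded by the norm. For the jumps this requires all interfaces to be
  glued into one measure space whose density is the weight. Form and load of a class then become
  limits along any representing sequence, and the level-K energy is the restriction of the full one.
  The condition \<open>\<aa> \<le> 1 \<le> \<AA>\<close> lets the gradient term, whose coefficient
  is 1, obey the same two bounds as the jump term.\<close>

instantiation "fun" :: (type, scaleR) scaleR
begin
definition "r *\<^sub>R f = (\<lambda>x. r *\<^sub>R f x)"
instance ..
end

lemma scaleR_fun_apply [simp]: "(r *\<^sub>R f) x = r *\<^sub>R f x"
  by (simp add: scaleR_fun_def)

text \<open>Functions, and by a second application sequences of functions, become vectors, so that
  \<open>subspace\<close> and the locales below apply at both levels.\<close>

instance "fun" :: (type, real_vector) real_vector
  by standard (simp_all add: fun_eq_iff scaleR_add_right scaleR_add_left)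

text \<open>The form is only semidefinite, because functions equal almost everywhere and sequences
  with the same limit are different vectors at distance 0. The laws are confined to
  \<open>D\<close>, since integrals are additive only on integrable functions.\<close>

locale semi_inner =
  fixes D :: "'a::real_vector set" and I :: "'a \<Rightarrow> 'a \<Rightarrow> real"
  assumes D: "subspace D"
    and sym: "\<And>v w. v \<in> D \<Longrightarrow> w \<in> D \<Longrightarrow> I v w = I w v"
    and add: "\<And>v w z. v \<in> D \<Longrightarrow> w \<in> D \<Longrightarrow> z \<in> D \<Longrightarrow> I (v + w) z = I v z + I w z"
    and scale: "\<And>r v z. v \<in> D \<Longrightarrow> z \<in> D \<Longrightarrow> I (r *\<^sub>R v) z = r * I v z"
    and nonneg: "\<And>v. v \<in> D \<Longrightarrow> 0 \<le> I v v"
begin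

definition nrm :: "'a \<Rightarrow> real" where "nrm v = sqrt (I v v)"

lemmas D_add = subspace_add[OF D] and D_diff = subspace_diff[OF D]
  and D_scale = subspace_scale[OF D] and D_0 = subspace_0[OF D]

lemma add_right: "v \<in> D \<Longrightarrow> w \<in> D \<Longrightarrow> z \<in> D \<Longrightarrow> I z (v + w) = I z v + I z w"
  using add sym D_add by metis

lemma scale_right: "v \<in> D \<Longrightarrow> z \<in> D \<Longrightarrow> I z (r *\<^sub>R v) = r * I z v"
  using scale sym D_scale by metis

lemma diff_left: "v \<in> D \<Longrightarrow> w \<in> D \<Longrightarrow> z \<in> D \<Longrightarrow> I (v - w) z = I v z - I w z"
  using add[of "v - w" w z] D_diff[of v w] by simp

lemma diff_right: "v \<in> D \<Longrightarrow> w \<in> D \<Longrightarrow> z \<in> D \<Longrightarrow> I z (v - w) = I z v - I z w"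
  using diff_left sym D_diff by metis

text \<open>The algebra behind continuity of a bilinear form: each term on the right contains a
  difference that tends to zero in the applications.\<close>

lemma diff_split:
  "v \<in> D \<Longrightarrow> w \<in> D \<Longrightarrow> f \<in> D \<Longrightarrow> g \<in> D \<Longrightarrow>
     I v w - I f g = I (v - f) (w - g) + I (v - f) g + I f (w - g)"
  by (simp add: diff_left diff_right D_diff)

lemma zero_left: "z \<in> D \<Longrightarrow> I 0 z = 0"
  using scale[of z z 0] by simp

lemma nrm_sq: "v \<in> D \<Longrightarrow> (nrm v)\<^sup>2 = I v v"
  by (simp add: nrm_def nonneg)

lemma nrm_nonneg: "v \<in> D \<Longrightarrow> 0 \<le> nrm v"
  by (simp add: nrm_def nonneg)

lemma nrm_0: "nrm 0 = 0"
  using zero_left[of 0] D_0 by (simp add: nrm_def)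

lemma expand:
  assumes "v \<in> D" "w \<in> D"
  shows "I (v + t *\<^sub>R w) (v + t *\<^sub>R w) = I v v + 2 * t * I v w + t\<^sup>2 * I w w"
  using assms sym[of v w]
  by (simp add: add add_right scale scale_right D_add D_scale power2_eq_square algebra_simps)

lemma Cauchy_Schwarz_sq:
  assumes v: "v \<in> D" and w: "w \<in> D"
  shows "(I v w)\<^sup>2 \<le> I v v * I w w"
proof (cases "I w w = 0")
  case True
  have "I v w = 0"
  proof (rule ccontr)
    assume n: "I v w \<noteq> 0"
    \<comment> \<open>With \<open>I w w = 0\<close> the square expands to a function affine in
      \<open>t\<close>, which is unbounded below unless \<open>I v w = 0\<close>; this
      \<open>t\<close> gives it the value -1.\<close>
    define t where "t = - (I v v + 1) / (2 * I v w)"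
    have "0 \<le> I (v + t *\<^sub>R w) (v + t *\<^sub>R w)" using v w by (intro nonneg D_add D_scale)
    also have "\<dots> = I v v + 2 * t * I v w" using expand[OF v w] True by simp
    also have "\<dots> = -1" using n by (simp add: t_def field_simps)
    finally show False by simp
  qed
  then show ?thesis by (simp add: True)
next
  case False
  then have pos: "I w w > 0" using nonneg[OF w] by simp
  \<comment> \<open>The minimiser of the quadratic polynomial
    \<open>t \<mapsto> I (v + t w) (v + t w)\<close>.\<close>
  define t where "t = - I v w / I w w"
  have "0 \<le> I (v + t *\<^sub>R w) (v + t *\<^sub>R w)" using v w by (intro nonneg D_add D_scale)
  also have "\<dots> = I v v - (I v w)\<^sup>2 / I w w"
    using expand[OF v w, of t] False by (simp add: t_def power2_eq_square field_simps)
  finally show ?thesis using pos by (simp add: field_simps)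
qed

lemma Cauchy_Schwarz:
  assumes "v \<in> D" "w \<in> D" shows "\<bar>I v w\<bar> \<le> nrm v * nrm w"
  using real_sqrt_le_mono[OF Cauchy_Schwarz_sq[OF assms]]
  by (simp add: nrm_def real_sqrt_mult)

lemma nrm_triangle:
  assumes v: "v \<in> D" and w: "w \<in> D" shows "nrm (v + w) \<le> nrm v + nrm w"
proof (rule power2_le_imp_le)
  have "(nrm (v + w))\<^sup>2 = I v v + 2 * I v w + I w w"
    using expand[OF v w, of 1] v w by (simp add: nrm_sq D_add)
  also have "\<dots> \<le> (nrm v + nrm w)\<^sup>2"
    using Cauchy_Schwarz[OF v w] nrm_sq v w by (simp add: power2_sum)
  finally show "(nrm (v + w))\<^sup>2 \<le> (nrm v + nrm w)\<^sup>2" .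
qed (use v w nrm_nonneg in auto)

lemma nrm_scale: "v \<in> D \<Longrightarrow> nrm (r *\<^sub>R v) = \<bar>r\<bar> * nrm v"
  by (simp add: nrm_def scale scale_right D_scale real_sqrt_mult)

lemma nrm_minus_commute: "v \<in> D \<Longrightarrow> w \<in> D \<Longrightarrow> nrm (v - w) = nrm (w - v)"
  using nrm_scale[of "w - v" "-1"] D_diff by simp

lemma nrm_triangle_diff:
  "v \<in> D \<Longrightarrow> w \<in> D \<Longrightarrow> z \<in> D \<Longrightarrow> nrm (v - z) \<le> nrm (v - w) + nrm (w - z)"
  using nrm_triangle[of "v - w" "w - z"] D_diff by simp

lemma nrm_diff_le:
  assumes "v \<in> D" "w \<in> D" shows "\<bar>nrm v - nrm w\<bar> \<le> nrm (v - w)"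
  using nrm_triangle[of "v - w" w] nrm_triangle[of "w - v" v] nrm_minus_commute[OF assms] assms D_diff
  by simp

section \<open>Cauchy sequences and limits of bounded bilinear forms along them\<close>

definition cauchy_sequences :: "(nat \<Rightarrow> 'a) set" where
  "cauchy_sequences = {X. (\<forall>n. X n \<in> D) \<and> (\<forall>e>0. \<exists>n0. \<forall>m\<ge>n0. \<forall>n\<ge>n0. nrm (X m - X n) < e)}"

lemma cauchy_D: "X \<in> cauchy_sequences \<Longrightarrow> X n \<in> D"
  by (simp add: cauchy_sequences_def)

lemma cauchyE:
  assumes "X \<in> cauchy_sequences" "e > 0"
  obtains n0 where "\<And>m n. m \<ge> n0 \<Longrightarrow> n \<ge> n0 \<Longrightarrow> nrm (X m - X n) < e"
  using assms unfolding cauchy_sequences_def by blast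

lemma const_cauchy: "v \<in> D \<Longrightarrow> (\<lambda>_. v) \<in> cauchy_sequences"
  by (simp add: cauchy_sequences_def nrm_0)

lemma cauchy_bounded:
  assumes X: "X \<in> cauchy_sequences"
  obtains C where "\<And>n. nrm (X n) \<le> C" "C > 0"
proof -
  obtain n0 where n0: "\<And>m n. m \<ge> n0 \<Longrightarrow> n \<ge> n0 \<Longrightarrow> nrm (X m - X n) < 1"
    using cauchyE[OF X, of 1] by auto
  define C where "C = Max (insert 0 ((\<lambda>n. nrm (X n)) ` {..n0})) + 1"
  have le: "nrm (X n) \<le> C - 1" if "n \<le> n0" for n
    unfolding C_def using that by (auto simp del: Max_insert intro!: Max_ge)
  have "nrm (X n) \<le> C" for n
  proof (cases "n \<le> n0")
    case False
    then have "nrm (X n - X n0) < 1" using n0 by simp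
    then show ?thesis
      using le[of n0] nrm_triangle[of "X n - X n0" "X n0"] cauchy_D[OF X] D_diff by simp
  qed (use le[of n] in simp)
  moreover have "C > 0" using le[of 0] nrm_nonneg[OF cauchy_D[OF X, of 0]]
    unfolding C_def by (auto simp: add_nonneg_pos simp del: Max_insert intro!: Max_ge)
  ultimately show ?thesis using that by blast
qed

text \<open>Formulated for an arbitrary \<open>F\<close>, because it serves the inner product with
  constant 1 and the energy form with constant \<open>\<bar>\<beta>\<bar>\<close>. The values
  converge because both sequences are bounded and \<open>F\<close> is bilinear.\<close>

lemma bounded_bilinear_converges:
  fixes F :: "'a \<Rightarrow> 'a \<Rightarrow> real"
  assumes F1: "\<And>v w z. v \<in> D \<Longrightarrow> w \<in> D \<Longrightarrow> z \<in> D \<Longrightarrow> F (v - w) z = F v z - F w z"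
    and F2: "\<And>v w z. v \<in> D \<Longrightarrow> w \<in> D \<Longrightarrow> z \<in> D \<Longrightarrow> F z (v - w) = F z v - F z w"
    and F3: "\<And>v w. v \<in> D \<Longrightarrow> w \<in> D \<Longrightarrow> \<bar>F v w\<bar> \<le> b * (nrm v * nrm w)"
    and X: "X \<in> cauchy_sequences" and Y: "Y \<in> cauchy_sequences"
  shows "convergent (\<lambda>n. F (X n) (Y n))"
proof (rule Cauchy_convergent, rule metric_CauchyI)
  fix e :: real assume e: "e > 0"
  obtain C where C: "\<And>n. nrm (X n) \<le> C" "C > 0" using cauchy_bounded[OF X] by blast
  obtain C' where C': "\<And>n. nrm (Y n) \<le> C'" "C' > 0" using cauchy_bounded[OF Y] by blast
  \<comment> \<open>A positive upper bound for \<open>b\<close>, so that it can be divided by in the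
    choice of \<open>d\<close>.\<close>
  define b' where "b' = \<bar>b\<bar> + 1"
  have b': "b' > 0" "b \<le> b'" by (auto simp: b'_def)
  define d where "d = e / (b' * (C + C'))"
  have d: "d > 0" using e b' C C' by (simp add: d_def)
  obtain n1 where n1: "\<And>m n. m \<ge> n1 \<Longrightarrow> n \<ge> n1 \<Longrightarrow> nrm (X m - X n) < d" using cauchyE[OF X d] by blast
  obtain n2 where n2: "\<And>m n. m \<ge> n2 \<Longrightarrow> n \<ge> n2 \<Longrightarrow> nrm (Y m - Y n) < d" using cauchyE[OF Y d] by blast
  have XD: "X n \<in> D" and YD: "Y n \<in> D" for n using cauchy_D X Y by auto
  have F3': "\<bar>F v w\<bar> \<le> b' * (nrm v * nrm w)" if "v \<in> D" "w \<in> D" for v w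
    using F3[OF that] mult_right_mono[OF b'(2), of "nrm v * nrm w"] nrm_nonneg[OF that(1)] nrm_nonneg[OF that(2)]
    by auto
  show "\<exists>M. \<forall>m\<ge>M. \<forall>n\<ge>M. dist (F (X m) (Y m)) (F (X n) (Y n)) < e"
  proof (intro exI allI impI)
    fix m n assume m: "m \<ge> max n1 n2" and n: "n \<ge> max n1 n2"
    have "dist (F (X m) (Y m)) (F (X n) (Y n)) = \<bar>F (X m - X n) (Y m) + F (X n) (Y m - Y n)\<bar>"
      using F1[of "X m" "X n" "Y m"] F2[of "Y m" "Y n" "X n"] XD YD by (simp add: dist_real_def)
    also have "\<dots> \<le> \<bar>F (X m - X n) (Y m)\<bar> + \<bar>F (X n) (Y m - Y n)\<bar>" by (rule abs_triangle_ineq)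
    also have "\<dots> \<le> b' * (nrm (X m - X n) * nrm (Y m)) + b' * (nrm (X n) * nrm (Y m - Y n))"
      using F3' XD YD D_diff by (intro add_mono) auto
    also have "\<dots> \<le> b' * (nrm (X m - X n) * C') + b' * (C * nrm (Y m - Y n))"
      using C C' b' nrm_nonneg XD YD D_diff by (intro add_mono mult_left_mono mult_right_mono) auto
    also have "\<dots> < b' * (d * C') + b' * (C * d)"
      using n1[of m n] n2[of m n] m n C C' b'
      by (intro add_strict_mono mult_strict_left_mono mult_strict_right_mono) auto
    also have "\<dots> = b' * (C + C') * d" by (simp add: algebra_simps)
    also have "\<dots> = e" using b' C C' by (simp add: d_def)
    finally show "dist (F (X m) (Y m)) (F (X n) (Y n)) < e" .
  qed
qed

text \<open>The extension of \<open>F\<close> to the completion, on representatives. The value of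
  \<open>lim\<close> is meaningful once convergence is known, which \<open>ext_I_tendsto\<close> and
  \<open>ext_B_tendsto\<close> supply.\<close>

definition ext :: "('a \<Rightarrow> 'a \<Rightarrow> real) \<Rightarrow> (nat \<Rightarrow> 'a) \<Rightarrow> (nat \<Rightarrow> 'a) \<Rightarrow> real" where
  "ext F X Y = lim (\<lambda>n. F (X n) (Y n))"

lemma ext_I_tendsto:
  assumes "X \<in> cauchy_sequences" "Y \<in> cauchy_sequences"
  shows "(\<lambda>n. I (X n) (Y n)) \<longlonglongrightarrow> ext I X Y"
  unfolding ext_def convergent_LIMSEQ_iff[symmetric]
  by (rule bounded_bilinear_converges[where b = 1])
     (use assms diff_left diff_right Cauchy_Schwarz in auto)

lemma nrm_tendsto:
  assumes "X \<in> cauchy_sequences"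
  shows "(\<lambda>n. nrm (X n)) \<longlonglongrightarrow> sqrt (ext I X X)"
  unfolding nrm_def by (intro tendsto_real_sqrt ext_I_tendsto assms)

lemma subspace_cauchy_sequences: "subspace cauchy_sequences"
proof (rule subspaceI)
  show "0 \<in> cauchy_sequences" using const_cauchy[OF D_0] by (simp add: zero_fun_def)
  fix X Y assume X: "X \<in> cauchy_sequences" and Y: "Y \<in> cauchy_sequences"
  note XD = cauchy_D[OF X] and YD = cauchy_D[OF Y]
  show "X + Y \<in> cauchy_sequences"
    unfolding cauchy_sequences_def
  proof (clarsimp simp: D_add XD YD)
    fix e :: real assume e: "e > 0"
    obtain n1 where n1: "\<And>m n. m \<ge> n1 \<Longrightarrow> n \<ge> n1 \<Longrightarrow> nrm (X m - X n) < e / 2"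
      using cauchyE[OF X, of "e / 2"] e by auto
    obtain n2 where n2: "\<And>m n. m \<ge> n2 \<Longrightarrow> n \<ge> n2 \<Longrightarrow> nrm (Y m - Y n) < e / 2"
      using cauchyE[OF Y, of "e / 2"] e by auto
    have "nrm (X m + Y m - (X n + Y n)) < e" if "m \<ge> max n1 n2" "n \<ge> max n1 n2" for m n
      using n1[of m n] n2[of m n] that nrm_triangle[of "X m - X n" "Y m - Y n"] XD YD D_diff
      by (simp add: algebra_simps)
    then show "\<exists>n0. \<forall>m\<ge>n0. \<forall>n\<ge>n0. nrm (X m + Y m - (X n + Y n)) < e" by blast
  qed
next
  fix r X assume X: "X \<in> cauchy_sequences"
  note XD = cauchy_D[OF X]
  show "r *\<^sub>R X \<in> cauchy_sequences"
    unfolding cauchy_sequences_def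
  proof (clarsimp simp: D_scale XD)
    fix e :: real assume e: "e > 0"
    obtain n1 where n1: "\<And>m n. m \<ge> n1 \<Longrightarrow> n \<ge> n1 \<Longrightarrow> nrm (X m - X n) < e / (\<bar>r\<bar> + 1)"
      using cauchyE[OF X, of "e / (\<bar>r\<bar> + 1)"] e by auto
    have "nrm (r *\<^sub>R X m - r *\<^sub>R X n) < e" if "m \<ge> n1" "n \<ge> n1" for m n
    proof -
      have "nrm (r *\<^sub>R X m - r *\<^sub>R X n) = \<bar>r\<bar> * nrm (X m - X n)"
        using nrm_scale[of "X m - X n" r] XD D_diff by (simp add: scaleR_diff_right)
      also have "\<dots> \<le> (\<bar>r\<bar> + 1) * nrm (X m - X n)"
        using nrm_nonneg[of "X m - X n"] XD D_diff by (intro mult_right_mono) auto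
      also have "\<dots> < e" using n1[OF that] by (simp add: field_simps)
      finally show ?thesis .
    qed
    then show "\<exists>n0. \<forall>m\<ge>n0. \<forall>n\<ge>n0. nrm (r *\<^sub>R X m - r *\<^sub>R X n) < e" by blast
  qed
qed

end

text \<open>Coercivity and boundedness are required on the diagonal only; symmetry and
  Cauchy-Schwarz for \<open>B\<close> supply the rest. The quotient of the two constants becomes the
  constant of the error estimate.\<close>

locale energy_space = semi_inner +
  fixes B :: "'a \<Rightarrow> 'a \<Rightarrow> real" and l :: "'a \<Rightarrow> real" and \<alpha> \<beta> M :: real
  assumes \<alpha>: "0 < \<alpha>"
    and B_sym: "\<And>v w. v \<in> D \<Longrightarrow> w \<in> D \<Longrightarrow> B v w = B w v"
    and B_add: "\<And>v w z. v \<in> D \<Longrightarrow> w \<in> D \<Longrightarrow> z \<in> D \<Longrightarrow> B (v + w) z = B v z + B w z"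
    and B_scale: "\<And>r v z. v \<in> D \<Longrightarrow> z \<in> D \<Longrightarrow> B (r *\<^sub>R v) z = r * B v z"
    and B_lower: "\<And>v. v \<in> D \<Longrightarrow> \<alpha> * I v v \<le> B v v"
    and B_upper: "\<And>v. v \<in> D \<Longrightarrow> B v v \<le> \<beta> * I v v"
    and l_add: "\<And>v w. v \<in> D \<Longrightarrow> w \<in> D \<Longrightarrow> l (v + w) = l v + l w"
    and l_scale: "\<And>r v. v \<in> D \<Longrightarrow> l (r *\<^sub>R v) = r * l v"
    and l_bound: "\<And>v. v \<in> D \<Longrightarrow> \<bar>l v\<bar> \<le> M * sqrt (I v v)"
begin

sublocale B: semi_inner D B
proof
  fix v assume v: "v \<in> D"
  show "0 \<le> B v v"
    using B_lower[OF v] nonneg[OF v] \<alpha> by (meson mult_nonneg_nonneg order_less_imp_le order_trans)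
qed (use D B_sym B_add B_scale in auto)

lemma l_diff: "v \<in> D \<Longrightarrow> w \<in> D \<Longrightarrow> l (v - w) = l v - l w"
  using l_add[of "v - w" w] D_diff by simp

text \<open>Cauchy-Schwarz is applied to \<open>B\<close> itself, and each of the two factors then
  contributes the square root of \<open>\<bar>\<beta>\<bar>\<close>. The absolute value is there
  because no sign of \<open>\<beta>\<close> is assumed.\<close>

lemma B_bound:
  assumes v: "v \<in> D" and w: "w \<in> D" shows "\<bar>B v w\<bar> \<le> \<bar>\<beta>\<bar> * (nrm v * nrm w)"
proof -
  have "sqrt (B x x) \<le> sqrt \<bar>\<beta>\<bar> * nrm x" if "x \<in> D" for x
  proof -
    have "B x x \<le> \<bar>\<beta>\<bar> * I x x"
      using B_upper[OF that] mult_right_mono[of \<beta> "\<bar>\<beta>\<bar>" "I x x"] nonneg[OF that] by linarith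
    then show ?thesis unfolding nrm_def using real_sqrt_mult real_sqrt_le_mono by metis
  qed
  then have "B.nrm v * B.nrm w \<le> (sqrt \<bar>\<beta>\<bar> * nrm v) * (sqrt \<bar>\<beta>\<bar> * nrm w)"
    unfolding B.nrm_def using v w nrm_nonneg B.nonneg by (intro mult_mono) auto
  also have "\<dots> = (sqrt \<bar>\<beta>\<bar> * sqrt \<bar>\<beta>\<bar>) * (nrm v * nrm w)" by (simp only: ac_simps)
  finally show ?thesis using B.Cauchy_Schwarz[OF v w] by simp
qed

definition E :: "'a \<Rightarrow> real" where "E v = 1 / 2 * B v v - l v"

lemma E_expand:
  assumes "v \<in> D" "w \<in> D"
  shows "E (v + t *\<^sub>R w) = E v + t * (B v w - l w) + t\<^sup>2 / 2 * B w w"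
  using assms B.expand[OF assms, of t] by (simp add: E_def l_add l_scale D_scale algebra_simps)

text \<open>On a line through \<open>u\<close> the energy is a quadratic polynomial in the step,
  with linear coefficient \<open>B u v - l v\<close> and nonnegative leading coefficient.\<close>

theorem minimizer_iff:
  assumes U: "subspace U" "U \<subseteq> D" and u: "u \<in> U"
  shows "(\<forall>w\<in>U. E u \<le> E w) \<longleftrightarrow> (\<forall>v\<in>U. B u v = l v)"
proof
  assume min: "\<forall>w\<in>U. E u \<le> E w"
  show "\<forall>v\<in>U. B u v = l v"
  proof (rule ballI, rule ccontr)
    fix v assume v: "v \<in> U" and n: "B u v \<noteq> l v"
    define d where "d = B u v - l v"
    \<comment> \<open>The optimal step would be \<open>- d / B v v\<close>. Adding 1 to the
      denominator avoids division by zero and still makes the energy drop strictly.\<close>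
    define t where "t = - d / (B v v + 1)"
    have uD: "u \<in> D" and vD: "v \<in> D" using U u v by auto
    have Bv: "0 \<le> B v v" using B.nonneg[OF vD] .
    have "E u \<le> E (u + t *\<^sub>R v)"
      using min U u v by (auto intro: subspace_add subspace_scale)
    then have "0 \<le> t * d + t\<^sup>2 / 2 * B v v" using E_expand[OF uD vD, of t] by (simp add: d_def)
    also have "\<dots> = - (d\<^sup>2 * (B v v + 2)) / (2 * (B v v + 1)\<^sup>2)"
      using Bv by (simp add: t_def field_simps power2_eq_square add_nonneg_eq_0_iff)
    also have "\<dots> < 0"
      using n Bv by (simp add: d_def divide_less_0_iff)
    finally show False by simp
  qed
next
  assume eq: "\<forall>v\<in>U. B u v = l v"
  show "\<forall>w\<in>U. E u \<le> E w"
  proof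
    fix w assume w: "w \<in> U"
    have "u \<in> D" "w - u \<in> D" "w - u \<in> U" using U u w by (auto intro: subspace_diff)
    then show "E u \<le> E w"
      using E_expand[of u "w - u" 1] eq B.nonneg[of "w - u"] by simp
  qed
qed

text \<open>Semidefiniteness allows no more than vanishing distance; in the quotient this becomes
  equality of classes, by \<open>cls_eq_iff\<close>.\<close>

lemma solution_unique:
  assumes U: "subspace U" "U \<subseteq> D" and "u \<in> U" "w \<in> U"
    and "\<And>v. v \<in> U \<Longrightarrow> B u v = l v" "\<And>v. v \<in> U \<Longrightarrow> B w v = l v"
  shows "nrm (u - w) = 0"
proof -
  have uw: "u - w \<in> U" using U assms by (auto intro: subspace_diff)
  then have "B (u - w) (u - w) = 0"
    using B.diff_left[of u w "u - w"] assms by auto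
  then have "I (u - w) (u - w) = 0"
    using B_lower[of "u - w"] nonneg[of "u - w"] \<alpha> uw U
    by (metis mult_le_0_iff nle_le not_less subsetD)
  then show ?thesis by (simp add: nrm_def)
qed

text \<open>Galerkin orthogonality.\<close>

theorem Cea:
  assumes U: "subspace U" "U \<subseteq> D" and u: "u \<in> D" and w: "w \<in> U" and z: "z \<in> U"
    and eu: "\<And>v. v \<in> U \<Longrightarrow> B u v = l v" and ew: "\<And>v. v \<in> U \<Longrightarrow> B w v = l v"
    and \<beta>: "0 \<le> \<beta>"
  shows "nrm (u - w) \<le> \<beta> / \<alpha> * nrm (u - z)"
proof -
  have wD: "w \<in> D" and zD: "z \<in> D" using U w z by auto
  have wz: "w - z \<in> U" "w - z \<in> D" using U w z by (auto intro: subspace_diff)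
  have 1: "u - w \<in> D" "u - z \<in> D" using u wD zD D_diff by auto
  have "\<alpha> * (nrm (u - w))\<^sup>2 \<le> B (u - w) (u - w)" using B_lower[OF 1(1)] nrm_sq[OF 1(1)] by simp
  also have "\<dots> = B (u - w) (u - z) - B (u - w) (w - z)"
    using B.diff_right[of "u - z" "w - z" "u - w"] 1 wz by simp
  also have "B (u - w) (w - z) = 0"
    using B.diff_left[of u w "w - z"] u wD wz eu ew by simp
  finally have *: "\<alpha> * (nrm (u - w))\<^sup>2 \<le> \<beta> * nrm (u - z) * nrm (u - w)"
    using B_bound[OF 1] \<beta> by (simp add: ac_simps)
  \<comment> \<open>The estimate \<open>*\<close> has one factor \<open>nrm (u - w)\<close> too many
    on either side; it is cancelled unless it vanishes.\<close>
  show ?thesis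
  proof (cases "nrm (u - w) = 0")
    case True
    then show ?thesis using nrm_nonneg[OF 1(2)] \<alpha> \<beta> by simp
  next
    case False
    then have "nrm (u - w) > 0" using nrm_nonneg[OF 1(1)] by simp
    then have "\<alpha> * nrm (u - w) \<le> \<beta> * nrm (u - z)"
      using * by (simp add: power2_eq_square mult.assoc[symmetric])
    then show ?thesis using \<alpha> by (simp add: field_simps)
  qed
qed

lemma ext_B_tendsto:
  assumes "X \<in> cauchy_sequences" "Y \<in> cauchy_sequences"
  shows "(\<lambda>n. B (X n) (Y n)) \<longlonglongrightarrow> ext B X Y"
  unfolding ext_def convergent_LIMSEQ_iff[symmetric]
  by (rule bounded_bilinear_converges[where b = "\<bar>\<beta>\<bar>"])
     (use assms B.diff_left B.diff_right B_bound in auto)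

definition ext_l :: "(nat \<Rightarrow> 'a) \<Rightarrow> real" where
  "ext_l X = lim (\<lambda>n. l (X n))"

lemma ext_l_tendsto:
  assumes X: "X \<in> cauchy_sequences" shows "(\<lambda>n. l (X n)) \<longlonglongrightarrow> ext_l X"
proof -
  note XD = cauchy_D[OF X]
  have "Cauchy (\<lambda>n. l (X n))"
  proof (rule metric_CauchyI)
    fix e :: real assume e: "e > 0"
    obtain n0 where n0: "\<And>m n. m \<ge> n0 \<Longrightarrow> n \<ge> n0 \<Longrightarrow> nrm (X m - X n) < e / (\<bar>M\<bar> + 1)"
      using cauchyE[OF X, of "e / (\<bar>M\<bar> + 1)"] e by auto
    have "dist (l (X m)) (l (X n)) < e" if "m \<ge> n0" "n \<ge> n0" for m n
    proof -
      have d: "X m - X n \<in> D" using XD D_diff by auto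
      have "dist (l (X m)) (l (X n)) = \<bar>l (X m - X n)\<bar>" using l_diff XD by (simp add: dist_real_def)
      also have "\<dots> \<le> M * nrm (X m - X n)" using l_bound[OF d] by (simp add: nrm_def)
      also have "\<dots> \<le> (\<bar>M\<bar> + 1) * nrm (X m - X n)" using nrm_nonneg[OF d] by (intro mult_right_mono) auto
      also have "\<dots> < e" using n0[OF that] by (simp add: field_simps)
      finally show ?thesis .
    qed
    then show "\<exists>M. \<forall>m\<ge>M. \<forall>n\<ge>M. dist (l (X m)) (l (X n)) < e" by blast
  qed
  then show ?thesis unfolding ext_l_def by (simp add: Cauchy_convergent convergent_LIMSEQ_iff[symmetric])
qed

text \<open>\<open>U\<close> is not assumed complete, so the infimum need not be attained in it.
  What is produced is a Cauchy sequence in \<open>U\<close> whose limiting energy lies below every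
  energy on \<open>U\<close>.\<close>

theorem minimizing_sequence:
  assumes U: "subspace U" "U \<subseteq> D"
  obtains X where "X \<in> cauchy_sequences" "\<And>n. X n \<in> U"
    "\<And>v. v \<in> U \<Longrightarrow> 1 / 2 * ext B X X - ext_l X \<le> E v"
proof -
  \<comment> \<open>Completing the square: coercivity dominates the linear term.\<close>
  have below: "- (M\<^sup>2 / (2 * \<alpha>)) \<le> E v" if "v \<in> U" for v
  proof -
    have v: "v \<in> D" using that U by auto
    have "0 \<le> (\<alpha> * nrm v - M)\<^sup>2 / (2 * \<alpha>)" using \<alpha> by simp
    also have "\<dots> = 1 / 2 * (\<alpha> * (nrm v)\<^sup>2) - M * nrm v + M\<^sup>2 / (2 * \<alpha>)"
      using \<alpha> by (simp add: field_simps power2_eq_square)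
    also have "\<dots> \<le> E v + M\<^sup>2 / (2 * \<alpha>)"
      using B_lower[OF v] l_bound[OF v] nrm_sq[OF v] by (simp add: E_def nrm_def)
    finally show ?thesis by simp
  qed
  define m where "m = Inf (E ` U)"
  have bdd: "bdd_below (E ` U)" using below by (intro bdd_belowI2) auto
  have m_le: "m \<le> E v" if "v \<in> U" for v unfolding m_def using bdd that by (intro cINF_lower)
  have "\<exists>v\<in>U. E v < m + inverse (real (Suc n))" for n
  proof -
    have "E ` U \<noteq> {}" using subspace_0[OF U(1)] by auto
    then show ?thesis
      using cInf_lessD[of "E ` U" "m + inverse (real (Suc n))"] unfolding m_def by auto
  qed
  then obtain X where XU: "\<And>n. X n \<in> U" and X: "\<And>n. E (X n) < m + inverse (real (Suc n))"
    by metis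
  have XD: "X n \<in> D" for n using XU U by auto
  (* compare X i and X j with their midpoint *)
  have key: "\<alpha> * (nrm (X i - X j))\<^sup>2 \<le> 4 * (inverse (real (Suc i)) + inverse (real (Suc j)))" for i j
  proof -
    have d: "X i - X j \<in> D" using XD D_diff by auto
    have "X j + (1/2) *\<^sub>R (X i - X j) \<in> U"
      using XU U by (auto intro: subspace_add subspace_scale subspace_diff)
    then have "m \<le> E (X j + (1/2) *\<^sub>R (X i - X j))" by (rule m_le)
    then have "2 * m \<le> 2 * E (X j) + (B (X j) (X i - X j) - l (X i - X j)) + 1/4 * B (X i - X j) (X i - X j)"
      using E_expand[OF XD[of j] d, of "1/2"] by (simp add: power2_eq_square field_simps)
    moreover have "E (X i) = E (X j) + (B (X j) (X i - X j) - l (X i - X j)) + 1/2 * B (X i - X j) (X i - X j)"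
      using E_expand[OF XD[of j] d, of 1] by simp
    ultimately have "B (X i - X j) (X i - X j) \<le> 4 * (E (X i) + E (X j) - 2 * m)" by simp
    also have "\<dots> \<le> 4 * (inverse (real (Suc i)) + inverse (real (Suc j)))"
      using X[of i] X[of j] by simp
    finally show ?thesis using B_lower[OF d] nrm_sq[OF d] by simp
  qed
  have XC: "X \<in> cauchy_sequences"
    unfolding cauchy_sequences_def
  proof (clarsimp simp: XD)
    fix e :: real assume e: "e > 0"
    \<comment> \<open>Two reciprocals below \<open>\<kappa> / 8\<close>, multiplied by 4, stay below
      \<open>\<kappa>\<close>, the threshold that corresponds to distance \<open>e\<close> after
      division by \<open>\<alpha>\<close>.\<close>
    define \<kappa> where "\<kappa> = \<alpha> * e\<^sup>2"
    have "\<kappa> / 8 > 0" using e \<alpha> by (simp add: \<kappa>_def)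
    then obtain n0 where n0: "inverse (real (Suc n0)) < \<kappa> / 8"
      using reals_Archimedean by blast
    have "nrm (X i - X j) < e" if "i \<ge> n0" "j \<ge> n0" for i j
    proof -
      have *: "inverse (real (Suc k)) \<le> inverse (real (Suc n0))" if "k \<ge> n0" for k
        using that by (intro le_imp_inverse_le) auto
      have "\<alpha> * (nrm (X i - X j))\<^sup>2 \<le> 4 * (inverse (real (Suc i)) + inverse (real (Suc j)))" by (rule key)
      also have "\<dots> < \<kappa>"
        using *[OF that(1)] *[OF that(2)] n0 unfolding distrib_left by linarith
      finally have "(nrm (X i - X j))\<^sup>2 < e\<^sup>2" using \<alpha> by (simp add: \<kappa>_def)
      then show ?thesis using e by (simp add: power_less_imp_less_base)
    qed
    then show "\<exists>n0. \<forall>i\<ge>n0. \<forall>j\<ge>n0. nrm (X i - X j) < e" by blast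
  qed
  have lim: "(\<lambda>n. E (X n)) \<longlonglongrightarrow> 1 / 2 * ext B X X - ext_l X"
    unfolding E_def by (intro tendsto_intros ext_B_tendsto ext_l_tendsto XC)
  have "(\<lambda>n. m + inverse (real (Suc n))) \<longlonglongrightarrow> m + 0"
    by (intro tendsto_intros LIMSEQ_inverse_real_of_nat)
  then have "1 / 2 * ext B X X - ext_l X \<le> m"
    using LIMSEQ_le[OF lim, of "\<lambda>n. m + inverse (real (Suc n))" "m + 0"] X less_imp_le by auto
  then have "1 / 2 * ext B X X - ext_l X \<le> E v" if "v \<in> U" for v using m_le[OF that] by simp
  then show ?thesis using that XC XU by blast
qed

text \<open>The Cauchy sequences carry the same structure; their quotient by null sequences is the completion.\<close>

lemma energy_space_cauchy_sequences:
  "energy_space cauchy_sequences (ext I) (ext B) ext_l \<alpha> \<beta> M"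
proof
  show "subspace cauchy_sequences" by (rule subspace_cauchy_sequences)
next
  fix X Y assume X: "X \<in> cauchy_sequences" and Y: "Y \<in> cauchy_sequences"
  note XD = cauchy_D[OF X] and YD = cauchy_D[OF Y]
  show "ext I X Y = ext I Y X" "ext B X Y = ext B Y X"
    unfolding ext_def using sym B_sym XD YD by auto
  have "(\<lambda>n. l (X n) + l (Y n)) \<longlonglongrightarrow> ext_l X + ext_l Y"
    using X Y by (intro tendsto_intros ext_l_tendsto)
  then show "ext_l (X + Y) = ext_l X + ext_l Y"
    unfolding ext_l_def[of "X + Y"] using l_add XD YD by (auto intro!: limI)
next
  fix X Y Z assume X: "X \<in> cauchy_sequences" and Y: "Y \<in> cauchy_sequences" and Z: "Z \<in> cauchy_sequences"
  note XD = cauchy_D[OF X] and YD = cauchy_D[OF Y] and ZD = cauchy_D[OF Z]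
  have "(\<lambda>n. I (X n) (Z n) + I (Y n) (Z n)) \<longlonglongrightarrow> ext I X Z + ext I Y Z"
    using X Y Z by (intro tendsto_intros ext_I_tendsto)
  then show "ext I (X + Y) Z = ext I X Z + ext I Y Z"
    unfolding ext_def[of I "X + Y"] using add XD YD ZD by (auto intro!: limI)
  have "(\<lambda>n. B (X n) (Z n) + B (Y n) (Z n)) \<longlonglongrightarrow> ext B X Z + ext B Y Z"
    using X Y Z by (intro tendsto_intros ext_B_tendsto)
  then show "ext B (X + Y) Z = ext B X Z + ext B Y Z"
    unfolding ext_def[of B "X + Y"] using B_add XD YD ZD by (auto intro!: limI)
next
  fix r X Z assume X: "X \<in> cauchy_sequences" and Z: "Z \<in> cauchy_sequences"
  note XD = cauchy_D[OF X] and ZD = cauchy_D[OF Z]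
  have "(\<lambda>n. r * I (X n) (Z n)) \<longlonglongrightarrow> r * ext I X Z"
    using X Z by (intro tendsto_intros ext_I_tendsto)
  then show "ext I (r *\<^sub>R X) Z = r * ext I X Z"
    unfolding ext_def[of I "r *\<^sub>R X"] using scale XD ZD by (auto intro!: limI)
  have "(\<lambda>n. r * B (X n) (Z n)) \<longlonglongrightarrow> r * ext B X Z"
    using X Z by (intro tendsto_intros ext_B_tendsto)
  then show "ext B (r *\<^sub>R X) Z = r * ext B X Z"
    unfolding ext_def[of B "r *\<^sub>R X"] using B_scale XD ZD by (auto intro!: limI)
next
  fix X assume X: "X \<in> cauchy_sequences"
  note XD = cauchy_D[OF X]
  show "0 \<le> ext I X X"
    using LIMSEQ_le_const[OF ext_I_tendsto[OF X X], of 0] nonneg XD by auto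
  show "\<alpha> * ext I X X \<le> ext B X X"
    using LIMSEQ_le[OF tendsto_mult_left[OF ext_I_tendsto[OF X X]] ext_B_tendsto[OF X X]]
      B_lower XD by auto
  show "ext B X X \<le> \<beta> * ext I X X"
    using LIMSEQ_le[OF ext_B_tendsto[OF X X] tendsto_mult_left[OF ext_I_tendsto[OF X X]]]
      B_upper XD by auto
  show "\<bar>ext_l X\<bar> \<le> M * sqrt (ext I X X)"
    using LIMSEQ_le[OF tendsto_rabs[OF ext_l_tendsto[OF X]] tendsto_mult_left[OF nrm_tendsto[OF X]]]
      l_bound XD by (auto simp: nrm_def)
  fix r
  have "(\<lambda>n. r * l (X n)) \<longlonglongrightarrow> r * ext_l X"
    using X by (intro tendsto_intros ext_l_tendsto)
  then show "ext_l (r *\<^sub>R X) = r * ext_l X"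
    unfolding ext_l_def[of "r *\<^sub>R X"] using l_scale XD by (auto intro!: limI)
next
  show "0 < \<alpha>" by (rule \<alpha>)
qed

end

section \<open>Square-integrable functions\<close>

lemma tendsto_0_le:
  fixes f g :: "nat \<Rightarrow> real"
  assumes "g \<longlonglongrightarrow> 0" "\<And>n. \<bar>f n\<bar> \<le> g n"
  shows "f \<longlonglongrightarrow> 0"
  by (rule Lim_null_comparison[OF _ assms(1)]) (use assms(2) in simp)

lemma finite_ennrealE:
  assumes "x \<noteq> (\<infinity>::ennreal)"
  obtains r where "0 \<le> r" "x = ennreal r"
  using assms by (cases x) auto

lemma ennreal_le_suminf: "f k \<le> suminf f" for f :: "nat \<Rightarrow> ennreal"
  using sum_le_suminf[of f "{k}"] by simp

lemma L2_D:
  assumes "f \<in> L2 M"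
  shows "f \<in> borel_measurable M" "integrable M (\<lambda>x. (norm (f x))\<^sup>2)"
  using assms by (auto simp: L2_def)

lemma L2_I_bound:
  fixes f :: "'a \<Rightarrow> 'b::euclidean_space"
  assumes "f \<in> borel_measurable M" "integrable M g" "AE x in M. (norm (f x))\<^sup>2 \<le> g x"
  shows "f \<in> L2 M"
proof -
  have "integrable M (\<lambda>x. (norm (f x))\<^sup>2)"
    by (rule Bochner_Integration.integrable_bound[OF assms(2)]) (use assms in auto)
  then show ?thesis using assms by (simp add: L2_def)
qed

lemma L2_I_nn:
  fixes f :: "'a \<Rightarrow> 'b::euclidean_space"
  assumes "f \<in> borel_measurable M" "(\<integral>\<^sup>+x. ennreal ((norm (f x))\<^sup>2) \<partial>M) < \<infinity>"
  shows "f \<in> L2 M"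
  using assms by (auto simp: L2_def integrable_iff_bounded)

lemma L2_AE_cong:
  fixes f g :: "'a \<Rightarrow> 'b::euclidean_space"
  assumes "f \<in> L2 M" "g \<in> borel_measurable M" "AE x in M. f x = g x"
  shows "g \<in> L2 M"
  by (rule L2_I_bound[OF assms(2) L2_D(2)[OF assms(1)]]) (use assms(3) in auto)

lemma subspace_L2: "subspace (L2 M :: ('a \<Rightarrow> 'b::euclidean_space) set)"
proof (rule subspaceI)
  show "0 \<in> (L2 M :: ('a \<Rightarrow> 'b) set)" by (simp add: L2_def zero_fun_def)
  fix f g :: "'a \<Rightarrow> 'b" and c :: real
  assume f: "f \<in> L2 M"
  show "c *\<^sub>R f \<in> L2 M"
    using L2_D[OF f] by (simp add: L2_def scaleR_fun_def power_mult_distrib)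
  assume g: "g \<in> L2 M"
  have le: "(norm (a + b))\<^sup>2 \<le> 2 * (norm a)\<^sup>2 + 2 * (norm b)\<^sup>2" for a b :: 'b
  proof -
    have "(norm (a + b))\<^sup>2 \<le> (norm a + norm b)\<^sup>2" by (intro power_mono norm_triangle_ineq) auto
    also have "\<dots> \<le> 2 * (norm a)\<^sup>2 + 2 * (norm b)\<^sup>2"
      using sum_squares_bound[of "norm a" "norm b"] by (simp add: power2_sum)
    finally show ?thesis .
  qed
  show "f + g \<in> L2 M"
    using L2_D[OF f] L2_D[OF g] le
    by (intro L2_I_bound[where g = "\<lambda>x. 2 * (norm (f x))\<^sup>2 + 2 * (norm (g x))\<^sup>2"])
       (auto simp: plus_fun_def)
qed

lemma L2_integrable_inner:
  fixes f g :: "'a \<Rightarrow> 'b::euclidean_space"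
  assumes "f \<in> L2 M" "g \<in> L2 M"
  shows "integrable M (\<lambda>x. f x \<bullet> g x)"
proof (rule Bochner_Integration.integrable_bound)
  show "integrable M (\<lambda>x. (norm (f x))\<^sup>2 + (norm (g x))\<^sup>2)"
    by (intro Bochner_Integration.integrable_add L2_D assms)
  show "(\<lambda>x. f x \<bullet> g x) \<in> borel_measurable M"
    by (intro borel_measurable_inner L2_D(1) assms)
  have "\<bar>a \<bullet> b\<bar> \<le> (norm a)\<^sup>2 + (norm b)\<^sup>2" for a b :: 'b
  proof -
    have "\<bar>a \<bullet> b\<bar> \<le> norm a * norm b" by (rule Cauchy_Schwarz_ineq2)
    also have "\<dots> \<le> (norm a)\<^sup>2 + (norm b)\<^sup>2"
      using sum_squares_bound[of "norm a" "norm b"] mult_nonneg_nonneg[OF norm_ge_zero[of a] norm_ge_zero[of b]] by linarith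
    finally show ?thesis .
  qed
  then show "AE x in M. norm (f x \<bullet> g x) \<le> norm ((norm (f x))\<^sup>2 + (norm (g x))\<^sup>2)" by simp
qed

text \<open>No quotient by null sets is formed. The semi-inner product calculus gives Cauchy-Schwarz
  and the triangle inequality for honest functions.\<close>

lemma semi_inner_L2:
  "semi_inner (L2 M :: ('a \<Rightarrow> 'b::euclidean_space) set) (\<lambda>f g. LINT x|M. f x \<bullet> g x)"
proof
  fix f g h :: "'a \<Rightarrow> 'b" assume "f \<in> L2 M" "g \<in> L2 M" "h \<in> L2 M"
  then show "(LINT x|M. (f + g) x \<bullet> h x) = (LINT x|M. f x \<bullet> h x) + (LINT x|M. g x \<bullet> h x)"
    by (simp add: inner_add_left L2_integrable_inner)
next
  fix f g :: "'a \<Rightarrow> 'b"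
  show "(LINT x|M. f x \<bullet> g x) = (LINT x|M. g x \<bullet> f x)" by (simp add: inner_commute)
qed (auto simp: subspace_L2)

text \<open>Replaces integrals of squares by the seminorm, for which the triangle inequality is
  available.\<close>

lemma L2_tendsto_iff:
  "L2_tendsto M F f \<longleftrightarrow>
     (\<forall>n. F n \<in> L2 M) \<and> f \<in> L2 M \<and>
     (\<lambda>n. semi_inner.nrm (\<lambda>f g. LINT x|M. f x \<bullet> g x) (F n - f)) \<longlonglongrightarrow> 0"
  for f :: "'a \<Rightarrow> 'b::euclidean_space"
proof -
  interpret semi_inner "L2 M :: ('a \<Rightarrow> 'b) set" "\<lambda>f g. LINT x|M. f x \<bullet> g x"
    by (rule semi_inner_L2)
  have "(\<lambda>n. LINT x|M. (norm (F n x - f x))\<^sup>2) \<longlonglongrightarrow> 0 \<longleftrightarrow> (\<lambda>n. nrm (F n - f)) \<longlonglongrightarrow> 0"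
    if "\<forall>n. F n \<in> L2 M" "f \<in> L2 M"
  proof -
    have eq: "(LINT x|M. (norm (F n x - f x))\<^sup>2) = (nrm (F n - f))\<^sup>2" for n
      using that by (subst nrm_sq) (auto simp: power2_norm_eq_inner D_diff)
    show ?thesis unfolding eq
    proof
      assume "(\<lambda>n. (nrm (F n - f))\<^sup>2) \<longlonglongrightarrow> 0"
      from tendsto_real_sqrt[OF this] show "(\<lambda>n. nrm (F n - f)) \<longlonglongrightarrow> 0"
        using that by (simp add: nrm_nonneg D_diff)
    next
      assume "(\<lambda>n. nrm (F n - f)) \<longlonglongrightarrow> 0"
      from tendsto_power[OF this, of 2] show "(\<lambda>n. (nrm (F n - f))\<^sup>2) \<longlonglongrightarrow> 0" by simp
    qed
  qed
  then show ?thesis unfolding L2_tendsto_def by blast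
qed

lemma L2_tendsto_inner:
  fixes f g :: "'a \<Rightarrow> 'b::euclidean_space"
  assumes F: "L2_tendsto M F f" and G: "L2_tendsto M G g"
  shows "(\<lambda>n. LINT x|M. F n x \<bullet> G n x) \<longlonglongrightarrow> (LINT x|M. f x \<bullet> g x)"
proof -
  let ?I = "\<lambda>f g :: 'a \<Rightarrow> 'b. LINT x|M. f x \<bullet> g x"
  interpret semi_inner "L2 M :: ('a \<Rightarrow> 'b) set" ?I
    by (rule semi_inner_L2)
  have D: "F n \<in> L2 M" "G n \<in> L2 M" "f \<in> L2 M" "g \<in> L2 M" for n
    using F G by (auto simp: L2_tendsto_def)
  have F0: "(\<lambda>n. nrm (F n - f)) \<longlonglongrightarrow> 0" and G0: "(\<lambda>n. nrm (G n - g)) \<longlonglongrightarrow> 0"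
    using F G by (auto simp: L2_tendsto_iff)
  have bound: "\<bar>?I (F n) (G n) - ?I f g\<bar>
      \<le> nrm (F n - f) * nrm (G n - g) + nrm (F n - f) * nrm g + nrm f * nrm (G n - g)" for n
  proof -
    have "\<bar>?I (F n) (G n) - ?I f g\<bar> = \<bar>?I (F n - f) (G n - g) + ?I (F n - f) g + ?I f (G n - g)\<bar>"
      by (rule arg_cong[OF diff_split[OF D(1,2,3,4)]])
    also have "\<dots> \<le> \<bar>?I (F n - f) (G n - g)\<bar> + \<bar>?I (F n - f) g\<bar> + \<bar>?I f (G n - g)\<bar>" by linarith
    also have "\<dots> \<le> nrm (F n - f) * nrm (G n - g) + nrm (F n - f) * nrm g + nrm f * nrm (G n - g)"
      by (rule add_mono[OF add_mono[OF Cauchy_Schwarz[OF D_diff[OF D(1,3)] D_diff[OF D(2,4)]]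
            Cauchy_Schwarz[OF D_diff[OF D(1,3)] D(4)]] Cauchy_Schwarz[OF D(3) D_diff[OF D(2,4)]]])
    finally show ?thesis .
  qed
  have "(\<lambda>n. nrm (F n - f) * nrm (G n - g) + nrm (F n - f) * nrm g + nrm f * nrm (G n - g))
      \<longlonglongrightarrow> 0 * 0 + 0 * nrm g + nrm f * 0"
    by (intro tendsto_intros F0 G0)
  then have "(\<lambda>n. ?I (F n) (G n) - ?I f g) \<longlonglongrightarrow> 0"
    by (intro tendsto_0_le[OF _ bound]) simp
  then show ?thesis by (simp add: LIM_zero_iff)
qed

text \<open>Used to pass from one representing sequence of a class to another: sequences whose L2
  distance vanishes share their limits.\<close>

lemma L2_tendsto_transfer:
  fixes f :: "'a \<Rightarrow> 'b::euclidean_space"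
  assumes F: "L2_tendsto M F f" and G: "\<And>n. G n \<in> L2 M"
    and FG: "(\<lambda>n. LINT x|M. (norm (F n x - G n x))\<^sup>2) \<longlonglongrightarrow> 0"
  shows "L2_tendsto M G f"
proof -
  interpret semi_inner "L2 M :: ('a \<Rightarrow> 'b) set" "\<lambda>f g. LINT x|M. f x \<bullet> g x"
    by (rule semi_inner_L2)
  have D: "F n \<in> L2 M" "f \<in> L2 M" for n
    using F by (auto simp: L2_tendsto_def)
  have "(\<lambda>n. nrm (F n - G n)) \<longlonglongrightarrow> 0"
    using tendsto_real_sqrt[OF FG] by (simp add: nrm_def power2_norm_eq_inner)
  moreover have "(\<lambda>n. nrm (F n - f)) \<longlonglongrightarrow> 0" using F by (auto simp: L2_tendsto_iff)
  ultimately have "(\<lambda>n. nrm (F n - G n) + nrm (F n - f)) \<longlonglongrightarrow> 0"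
    using tendsto_add by fastforce
  moreover have "\<bar>nrm (G n - f)\<bar> \<le> nrm (F n - G n) + nrm (F n - f)" for n
    using nrm_triangle_diff[of "G n" "F n" f] nrm_minus_commute[of "F n" "G n"]
      nrm_nonneg[of "G n - f"] D_diff D G by simp
  ultimately have "(\<lambda>n. nrm (G n - f)) \<longlonglongrightarrow> 0" by (rule tendsto_0_le)
  then show ?thesis using D G by (auto simp: L2_tendsto_iff)
qed

lemma L2_mult_bounded:
  fixes f :: "'a \<Rightarrow> real"
  assumes A: "A \<in> borel_measurable M" "AE x in M. \<bar>A x\<bar> \<le> C" and f: "f \<in> L2 M"
  shows "(\<lambda>x. A x * f x) \<in> L2 M"
proof (rule L2_I_bound)
  show "integrable M (\<lambda>x. C\<^sup>2 * (norm (f x))\<^sup>2)" using L2_D[OF f] by simp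
  show "AE x in M. (norm (A x * f x))\<^sup>2 \<le> C\<^sup>2 * (norm (f x))\<^sup>2"
    using A(2)
  proof eventually_elim
    case (elim x)
    then have "(A x)\<^sup>2 \<le> C\<^sup>2" by (simp add: power2_le_iff_abs_le)
    then show ?case by (simp add: power_mult_distrib mult_right_mono)
  qed
qed (use A L2_D[OF f] in auto)

lemma L2_tendsto_mult_bounded:
  fixes f :: "'a \<Rightarrow> real"
  assumes A: "A \<in> borel_measurable M" "AE x in M. \<bar>A x\<bar> \<le> C" and F: "L2_tendsto M F f"
  shows "L2_tendsto M (\<lambda>n x. A x * F n x) (\<lambda>x. A x * f x)"
proof -
  have D: "F n \<in> L2 M" "f \<in> L2 M" for n
    using F by (auto simp: L2_tendsto_def)
  have d: "(\<lambda>x. F n x - f x) \<in> L2 M" for n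
    using subspace_diff[OF subspace_L2 D(1)[of n] D(2)] by (simp add: fun_diff_def)
  have d': "(\<lambda>x. A x * (F n x - f x)) \<in> L2 M" for n
    by (rule L2_mult_bounded[OF A d])
  have le: "(LINT x|M. (norm (A x * F n x - A x * f x))\<^sup>2) \<le> C\<^sup>2 * (LINT x|M. (norm (F n x - f x))\<^sup>2)" for n
  proof -
    have "(LINT x|M. (norm (A x * (F n x - f x)))\<^sup>2) \<le> (LINT x|M. C\<^sup>2 * (norm (F n x - f x))\<^sup>2)"
    proof (rule integral_mono_AE)
      show "AE x in M. (norm (A x * (F n x - f x)))\<^sup>2 \<le> C\<^sup>2 * (norm (F n x - f x))\<^sup>2"
        using A(2)
      proof eventually_elim
        case (elim x)
        then have "(A x)\<^sup>2 \<le> C\<^sup>2" by (simp add: power2_le_iff_abs_le)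
        then show ?case by (simp add: power_mult_distrib mult_right_mono)
      qed
    qed (use L2_D(2)[OF d] L2_D(2)[OF d'] in auto)
    then show ?thesis by (simp add: right_diff_distrib)
  qed
  have "(\<lambda>n. C\<^sup>2 * (LINT x|M. (norm (F n x - f x))\<^sup>2)) \<longlonglongrightarrow> C\<^sup>2 * 0"
    using F unfolding L2_tendsto_def by (intro tendsto_intros) auto
  then have lim: "(\<lambda>n. C\<^sup>2 * (LINT x|M. (norm (F n x - f x))\<^sup>2)) \<longlonglongrightarrow> 0" by simp
  have "(\<lambda>n. LINT x|M. (norm (A x * F n x - A x * f x))\<^sup>2) \<longlonglongrightarrow> 0"
    by (rule tendsto_0_le[OF lim], subst abs_of_nonneg) (use le in simp_all)
  then show ?thesis using D L2_mult_bounded[OF A] by (auto simp: L2_tendsto_def)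
qed

text \<open>Riesz-Fischer: a rapidly converging subsequence converges almost everywhere, and Fatou's
  lemma carries the Cauchy bound over to its limit.\<close>

theorem L2_complete:
  fixes F :: "nat \<Rightarrow> 'a \<Rightarrow> 'b::euclidean_space"
  assumes F: "\<And>n. F n \<in> L2 M"
    and Cauchy: "\<And>e. e > 0 \<Longrightarrow> \<exists>n0. \<forall>m\<ge>n0. \<forall>n\<ge>n0. (LINT x|M. (norm (F m x - F n x))\<^sup>2) < e"
  obtains f where "L2_tendsto M F f"
proof -
  have [measurable]: "F n \<in> borel_measurable M" for n using L2_D(1)[OF F] .
  have int: "integrable M (\<lambda>x. (norm (F m x - F n x))\<^sup>2)" for m n
    using L2_D(2)[OF subspace_diff[OF subspace_L2 F[of m] F[of n]]] by simp
  have "\<exists>n0. \<forall>m\<ge>n0. \<forall>n\<ge>n0. (LINT x|M. (norm (F m x - F n x))\<^sup>2) < (1/8)^k" for k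
    by (rule Cauchy) simp
  then obtain q where q: "\<And>k m n. m \<ge> q k \<Longrightarrow> n \<ge> q k \<Longrightarrow> (LINT x|M. (norm (F m x - F n x))\<^sup>2) < (1/8)^k"
    by metis
  \<comment> \<open>Partial sums of \<open>q\<close> dominate \<open>q\<close> and are monotone,
    which yields a monotone choice of indices without recursion.\<close>
  define r where "r k = (\<Sum>i\<le>k. q i)" for k
  have rq: "r k \<ge> q k" for k unfolding r_def using member_le_sum[of k "{..k}" q] by simp
  have r_mono: "r k \<le> r k'" if "k \<le> k'" for k k' unfolding r_def using that by (intro sum_mono2) auto
  have small: "(\<integral>\<^sup>+x. ennreal ((norm (F m x - F n x))\<^sup>2) \<partial>M) \<le> ennreal ((1/8)^k)"
    if "m \<ge> r k" "n \<ge> r k" for m n k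
  proof -
    have "(\<integral>\<^sup>+x. ennreal ((norm (F m x - F n x))\<^sup>2) \<partial>M) = ennreal (LINT x|M. (norm (F m x - F n x))\<^sup>2)"
      by (intro nn_integral_eq_integral int) auto
    also have "\<dots> \<le> ennreal ((1/8)^k)"
      using q[of k m n] that rq[of k] by (intro ennreal_leI) auto
    finally show ?thesis .
  qed
  \<comment> \<open>The integral of \<open>?d k\<close> is at most \<open>(1/8)^k\<close>. Weighting
    with \<open>4^k\<close> leaves a convergent series, and finiteness of the weighted sum at a
    point forces increments of order \<open>(1/2)^k\<close> there.\<close>
  let ?d = "\<lambda>k x. (norm (F (r (Suc k)) x - F (r k) x))\<^sup>2"
  have "(\<integral>\<^sup>+x. (\<Sum>k. ennreal (4^k * ?d k x)) \<partial>M) = (\<Sum>k. \<integral>\<^sup>+x. ennreal (4^k * ?d k x) \<partial>M)"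
    by (rule nn_integral_suminf) auto
  also have "\<dots> \<le> (\<Sum>k. ennreal ((1/2)^k))"
  proof (rule suminf_le)
    fix k :: nat
    have "(\<integral>\<^sup>+x. ennreal (4^k * ?d k x) \<partial>M) = ennreal (4^k) * (\<integral>\<^sup>+x. ennreal (?d k x) \<partial>M)"
      by (simp add: ennreal_mult' nn_integral_cmult)
    also have "\<dots> \<le> ennreal (4^k) * ennreal ((1/8)^k)"
      by (intro mult_left_mono small r_mono) auto
    also have "\<dots> = ennreal ((1/2)^k)"
      by (simp add: ennreal_mult[symmetric] power_mult_distrib[symmetric])
    finally show "(\<integral>\<^sup>+x. ennreal (4^k * ?d k x) \<partial>M) \<le> ennreal ((1/2)^k)" .
  qed auto
  also have "\<dots> = ennreal (\<Sum>k. (1/2)^k)"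
    by (intro suminf_ennreal2) (auto intro: summable_geometric)
  finally have "(\<integral>\<^sup>+x. (\<Sum>k. ennreal (4^k * ?d k x)) \<partial>M) \<noteq> \<infinity>"
    by (auto simp: top_unique)
  then have "AE x in M. (\<Sum>k. ennreal (4^k * ?d k x)) \<noteq> \<infinity>"
    by (intro nn_integral_PInf_AE) auto
  then have conv: "AE x in M. convergent (\<lambda>k. F (r k) x)"
  proof eventually_elim
    case (elim x)
    then obtain C where C: "0 \<le> C" "(\<Sum>k. ennreal (4^k * ?d k x)) = ennreal C"
      by (rule finite_ennrealE)
    have "norm (F (r (Suc k)) x - F (r k) x) \<le> sqrt C * (1/2)^k" for k
    proof (rule power2_le_imp_le)
      have "ennreal (4^k * ?d k x) \<le> ennreal C"
        unfolding C(2)[symmetric] by (rule ennreal_le_suminf)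
      then have "4^k * ?d k x \<le> C" using C(1) by (simp add: ennreal_le_iff)
      then show "?d k x \<le> (sqrt C * (1/2)^k)\<^sup>2"
        using C(1) by (simp add: power_mult_distrib power_divide power2_eq_square field_simps
            flip: power_mult_distrib)
    qed (use C in auto)
    then have "summable (\<lambda>k. F (r (Suc k)) x - F (r k) x)"
      by (rule summable_comparison_test'[OF summable_mult[OF summable_geometric], of "1/2" 0 _ "sqrt C", rotated])
         simp_all
    then have "convergent (\<lambda>n. \<Sum>k<n. F (r (Suc k)) x - F (r k) x)"
      by (simp add: summable_iff_convergent)
    then have "convergent (\<lambda>n. F (r n) x - F (r 0) x)"
      by (subst (asm) sum_lessThan_telescope)
    then have "convergent (\<lambda>n. (F (r n) x - F (r 0) x) + F (r 0) x)"
      by (intro convergent_add convergent_const)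
    then show ?case by simp
  qed
  define f where "f x = lim (\<lambda>k. F (r k) x)" for x
  have [measurable]: "f \<in> borel_measurable M"
    unfolding f_def by measurable
  have lim: "AE x in M. (\<lambda>k. F (r k) x) \<longlonglongrightarrow> f x"
    using conv by eventually_elim (simp add: f_def convergent_LIMSEQ_iff)
  \<comment> \<open>Fatou's lemma along the subsequence, for fixed \<open>n\<close>.\<close>
  have close: "(\<integral>\<^sup>+x. ennreal ((norm (F n x - f x))\<^sup>2) \<partial>M) \<le> ennreal ((1/8)^k)" if "n \<ge> r k" for n k
  proof -
    have "(\<integral>\<^sup>+x. ennreal ((norm (F n x - f x))\<^sup>2) \<partial>M)
        = (\<integral>\<^sup>+x. liminf (\<lambda>j. ennreal ((norm (F n x - F (r j) x))\<^sup>2)) \<partial>M)"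
    proof (rule nn_integral_cong_AE)
      show "AE x in M. ennreal ((norm (F n x - f x))\<^sup>2) = liminf (\<lambda>j. ennreal ((norm (F n x - F (r j) x))\<^sup>2))"
        using lim
      proof eventually_elim
        case (elim x)
        have "(\<lambda>j. ennreal ((norm (F n x - F (r j) x))\<^sup>2)) \<longlonglongrightarrow> ennreal ((norm (F n x - f x))\<^sup>2)"
          by (intro tendsto_intros elim)
        then show ?case by (intro lim_imp_Liminf[symmetric]) auto
      qed
    qed
    also have "\<dots> \<le> liminf (\<lambda>j. \<integral>\<^sup>+x. ennreal ((norm (F n x - F (r j) x))\<^sup>2) \<partial>M)"
      by (rule nn_integral_liminf) auto
    also have "\<dots> \<le> ennreal ((1/8)^k)"
    proof -
      have "\<forall>\<^sub>F j in sequentially. (\<integral>\<^sup>+x. ennreal ((norm (F n x - F (r j) x))\<^sup>2) \<partial>M) \<le> ennreal ((1/8)^k)"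
        using eventually_ge_at_top[of k] by eventually_elim (intro small that r_mono)
      then have "liminf (\<lambda>j. \<integral>\<^sup>+x. ennreal ((norm (F n x - F (r j) x))\<^sup>2) \<partial>M)
          \<le> liminf (\<lambda>j. ennreal ((1/8)^k))"
        by (rule Liminf_mono)
      then show ?thesis by (simp add: Liminf_const)
    qed
    finally show ?thesis .
  qed
  have diff: "(F n - f) \<in> L2 M" if "n \<ge> r k" for n k
    using close[OF that] by (intro L2_I_nn) (auto simp: fun_diff_def le_less_trans[OF _ ennreal_less_top])
  have fL2: "f \<in> L2 M"
    using subspace_diff[OF subspace_L2 F[of "r 0"] diff[of 0 "r 0"]] by simp
  have "(\<lambda>n. LINT x|M. (norm (F n x - f x))\<^sup>2) \<longlonglongrightarrow> 0"
  proof (rule LIMSEQ_I)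
    fix e :: real assume "e > 0"
    then obtain k where k: "(1/8)^k < e" using real_arch_pow_inv[of e "1/8"] by auto
    have "norm ((LINT x|M. (norm (F n x - f x))\<^sup>2) - 0) < e" if "n \<ge> r k" for n
    proof -
      have "integrable M (\<lambda>x. (norm (F n x - f x))\<^sup>2)" using L2_D(2)[OF diff[OF that]] by simp
      then have "ennreal (LINT x|M. (norm (F n x - f x))\<^sup>2) \<le> ennreal ((1/8)^k)"
        using close[OF that] by (subst nn_integral_eq_integral[symmetric]) auto
      then have "(LINT x|M. (norm (F n x - f x))\<^sup>2) \<le> (1/8)^k" by (simp add: ennreal_le_iff)
      then show ?thesis using k by simp
    qed
    then show "\<exists>n0. \<forall>n\<ge>n0. norm ((LINT x|M. (norm (F n x - f x))\<^sup>2) - 0) < e" by blast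
  qed
  then show ?thesis using that F fL2 by (simp add: L2_tendsto_def)
qed

section \<open>Hausdorff measure\<close>

text \<open>Subadditivity is given for disjoint families; \<open>disjointed\<close> together with
  monotonicity extends it to all countable families.\<close>

lemma outer_measure_space_Union_le:
  fixes A :: "nat \<Rightarrow> 'a set"
  assumes f: "outer_measure_space UNIV f"
  shows "f (\<Union>i. A i) \<le> (\<Sum>i. f (A i))"
proof -
  have "f (\<Union>i. A i) = f (\<Union>i. disjointed A i)" by (simp add: UN_disjointed_eq)
  also have "\<dots> \<le> (\<Sum>i. f (disjointed A i))"
    using f disjoint_family_disjointed[of A]
    unfolding outer_measure_space_def countably_subadditive_def by blast
  also have "\<dots> \<le> (\<Sum>i. f (A i))"
    using f disjointed_subset[of A]
    by (intro suminf_le) (auto simp: outer_measure_space_def increasing_def)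
  finally show ?thesis .
qed

lemma outer_measure_space_Un_le:
  assumes f: "outer_measure_space UNIV f"
  shows "f (A \<union> B) \<le> f A + f B"
proof -
  have "f (A \<union> B) = f (\<Union>i. binaryset A B i)" by (simp add: UN_binaryset_eq)
  also have "\<dots> \<le> (\<Sum>i. f (binaryset A B i))" by (rule outer_measure_space_Union_le[OF f])
  also have "\<dots> = f A + f B"
    using f by (intro suminf_binaryset_eq) (simp add: outer_measure_space_def positive_def)
  finally show ?thesis .
qed

lemma outer_measure_space_finite_Union_le:
  assumes f: "outer_measure_space UNIV f" and "finite I"
  shows "f (\<Union>i\<in>I. A i) \<le> (\<Sum>i\<in>I. f (A i))"
  using \<open>finite I\<close>
proof induction
  case empty
  then show ?case using f by (simp add: outer_measure_space_def positive_def)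
next
  case (insert x F)
  have "f (\<Union>i\<in>insert x F. A i) \<le> f (A x) + f (\<Union>i\<in>F. A i)"
    using outer_measure_space_Un_le[OF f] by simp
  also have "\<dots> \<le> f (A x) + (\<Sum>i\<in>F. f (A i))" using insert by (intro add_mono) auto
  finally show ?case using insert by simp
qed

lemma hausdorff_outer_mono: "A \<subseteq> B \<Longrightarrow> hausdorff_outer m A \<le> hausdorff_outer m B"
  using outer_measure_space_hausdorff[of m] by (auto simp: outer_measure_space_def increasing_def)

lemma hausdorff_gauge_mono:
  assumes "S \<subseteq> T" shows "hausdorff_gauge m \<delta> S \<le> hausdorff_gauge m \<delta> T"
proof (cases "S \<noteq> {} \<and> bounded T \<and> diameter T \<le> \<delta>")
  case True
  have "diameter S \<le> diameter T" "bounded S"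
    using True assms diameter_subset bounded_subset by blast+
  moreover have "0 \<le> diameter S"
    using \<open>bounded S\<close> by (rule diameter_ge_0)
  ultimately show ?thesis
    using True assms unfolding hausdorff_gauge_def
    by (auto intro!: ennreal_leI mult_left_mono power_mono)
next
  case False
  then show ?thesis
    using assms by (auto simp: hausdorff_gauge_def)
qed

lemma outer_measure_space_gauge:
  "outer_measure_space UNIV (outer_measure UNIV (hausdorff_gauge m \<delta> :: 'a::metric_space set \<Rightarrow> ennreal))"
proof -
  interpret sigma_algebra "UNIV :: 'a set" "UNIV :: 'a set set"
    using sigma_algebra_Pow[of "UNIV :: 'a set"] by simp
  have "positive UNIV (hausdorff_gauge m \<delta> :: 'a set \<Rightarrow> ennreal)"
    by (simp add: positive_def hausdorff_gauge_def)
  moreover have "increasing UNIV (hausdorff_gauge m \<delta> :: 'a set \<Rightarrow> ennreal)"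
    by (simp add: increasing_def hausdorff_gauge_mono)
  ultimately show ?thesis using outer_measure_space_outer_measure by simp
qed

lemma hausdorff_coverE:
  fixes A :: "'a::metric_space set"
  assumes "hausdorff_outer m A < \<infinity>" "0 < \<delta>" "0 < \<epsilon>"
  obtains U where "A \<subseteq> (\<Union>i::nat. U i)" "(\<Sum>i. hausdorff_gauge m \<delta> (U i)) \<le> hausdorff_outer m A + ennreal \<epsilon>"
proof -
  interpret sigma_algebra "UNIV :: 'a set" "UNIV :: 'a set set"
    using sigma_algebra_Pow[of "UNIV :: 'a set"] by simp
  have "outer_measure UNIV (hausdorff_gauge m \<delta>) A \<le> hausdorff_outer m A"
    unfolding hausdorff_outer_def using assms(2) by (intro SUP_upper) auto
  also have "\<dots> < hausdorff_outer m A + ennreal \<epsilon>"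
    using assms by (cases "hausdorff_outer m A") (auto simp: ennreal_plus[symmetric] ennreal_less_iff simp del: ennreal_plus)
  finally show ?thesis using outer_measure_close that less_imp_le by metis
qed

section \<open>Metric outer measures and Caratheodory's criterion\<close>

lemma outer_measure_gauge_le:
  fixes S :: "'a::metric_space set"
  shows "outer_measure UNIV (hausdorff_gauge m \<delta>) S \<le> hausdorff_gauge m \<delta> S"
proof -
  interpret sigma_algebra "UNIV :: 'a set" "UNIV :: 'a set set"
    using sigma_algebra_Pow[of "UNIV :: 'a set"] by simp
  have "outer_measure UNIV (hausdorff_gauge m \<delta>) S \<le> (\<Sum>i. hausdorff_gauge m \<delta> (binaryset S {} i))"
    unfolding outer_measure_def
    by (intro INF_lower) (auto simp: UN_binaryset_eq disjoint_family_on_def binaryset_def)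
  also have "\<dots> = hausdorff_gauge m \<delta> S"
    by (subst suminf_binaryset_eq) (auto simp: hausdorff_gauge_def)
  finally show ?thesis .
qed

text \<open>A set of diameter below \<open>\<rho>\<close> cannot meet both \<open>E\<close> and
  \<open>F\<close>, so every fine covering of the union splits into a covering of each.\<close>

lemma hausdorff_outer_separated:
  fixes E F :: "'a::metric_space set"
  assumes \<rho>: "\<rho> > 0" and sep: "\<And>x y. x \<in> E \<Longrightarrow> y \<in> F \<Longrightarrow> \<rho> \<le> dist x y"
  shows "hausdorff_outer m E + hausdorff_outer m F \<le> hausdorff_outer m (E \<union> F)"
proof -
  interpret sigma_algebra "UNIV :: 'a set" "UNIV :: 'a set set"
    using sigma_algebra_Pow[of "UNIV :: 'a set"] by simp
  let ?p = "\<lambda>\<delta>. outer_measure UNIV (hausdorff_gauge m \<delta> :: 'a set \<Rightarrow> ennreal)"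
  have antimono: "?p \<delta> A \<le> ?p \<delta>' A" if "\<delta>' \<le> \<delta>" for \<delta> \<delta>' A
    unfolding outer_measure_def using that
    by (intro INF_mono) (auto intro!: suminf_le bexI simp: hausdorff_gauge_def)
  have main: "?p \<delta> E + ?p \<delta> F \<le> hausdorff_outer m (E \<union> F)" if \<delta>: "0 < \<delta>" "\<delta> < \<rho>" for \<delta>
  proof -
    have "?p \<delta> E + ?p \<delta> F \<le> ?p \<delta> (E \<union> F)"
      unfolding outer_measure_def[of _ _ "E \<union> F"]
    proof (rule INF_greatest, clarsimp)
      fix A :: "nat \<Rightarrow> 'a set" assume A: "disjoint_family A" "E \<subseteq> (\<Union>i. A i)" "F \<subseteq> (\<Union>i. A i)"
      \<comment> \<open>Covering sets that miss \<open>E\<close> are replaced by the empty set, of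
        gauge 0, which keeps the family disjoint. A set meeting both \<open>E\<close> and
        \<open>F\<close> has infinite gauge.\<close>
      define UE where "UE i = (if A i \<inter> E \<noteq> {} then A i else {})" for i
      define UF where "UF i = (if A i \<inter> F \<noteq> {} then A i else {})" for i
      have a: "?p \<delta> E \<le> (\<Sum>i. hausdorff_gauge m \<delta> (UE i))"
        unfolding outer_measure_def using A by (intro INF_lower) (fastforce simp: UE_def disjoint_family_on_def)
      have b: "?p \<delta> F \<le> (\<Sum>i. hausdorff_gauge m \<delta> (UF i))"
        unfolding outer_measure_def using A by (intro INF_lower) (fastforce simp: UF_def disjoint_family_on_def)
      have c: "(\<Sum>i. hausdorff_gauge m \<delta> (UE i)) + (\<Sum>i. hausdorff_gauge m \<delta> (UF i))
          = (\<Sum>i. hausdorff_gauge m \<delta> (UE i) + hausdorff_gauge m \<delta> (UF i))"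
        by (rule suminf_add) auto
      also have "\<dots> \<le> (\<Sum>i. hausdorff_gauge m \<delta> (A i))"
      proof (rule suminf_le)
        fix i
        show "hausdorff_gauge m \<delta> (UE i) + hausdorff_gauge m \<delta> (UF i) \<le> hausdorff_gauge m \<delta> (A i)"
        proof (cases "A i \<inter> E \<noteq> {} \<and> A i \<inter> F \<noteq> {}")
          case True
          then obtain x y where xy: "x \<in> A i" "x \<in> E" "y \<in> A i" "y \<in> F" by blast
          have "\<not> (bounded (A i) \<and> diameter (A i) \<le> \<delta>)"
            using diameter_bounded_bound[of "A i" x y] xy sep[of x y] \<delta> by auto
          then show ?thesis using xy by (auto simp: hausdorff_gauge_def)
        qed (auto simp: UE_def UF_def hausdorff_gauge_def)
      qed auto
      finally show "?p \<delta> E + ?p \<delta> F \<le> (\<Sum>i. hausdorff_gauge m \<delta> (A i))"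
        by (rule order_trans[OF add_mono[OF a b]])
    qed
    also have "\<dots> \<le> hausdorff_outer m (E \<union> F)"
      unfolding hausdorff_outer_def using \<delta> by (intro SUP_upper) auto
    finally show ?thesis .
  qed
  \<comment> \<open>The supremum over all scales is taken along one sequence of scales, all below
    \<open>\<rho>\<close>. Monotonicity along it allows the two suprema to be added.\<close>
  have lim: "(SUP n. ?p (\<rho> / (2 + real n)) A) = hausdorff_outer m A" for A
    unfolding hausdorff_outer_def
  proof (rule antisym)
    show "(SUP n. ?p (\<rho> / (2 + real n)) A) \<le> (SUP \<delta>\<in>{0<..}. ?p \<delta> A)"
      using \<rho> by (intro SUP_mono) (auto intro!: divide_pos_pos)
    show "(SUP \<delta>\<in>{0<..}. ?p \<delta> A) \<le> (SUP n. ?p (\<rho> / (2 + real n)) A)"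
    proof (rule SUP_mono)
      fix \<delta> :: real assume d: "\<delta> \<in> {0<..}"
      obtain n where n: "\<rho> / \<delta> < real n" using reals_Archimedean2 by blast
      have "\<rho> / (2 + real n) \<le> \<delta>" using n d \<rho>
        by (simp add: field_simps)
      then show "\<exists>n\<in>UNIV. ?p \<delta> A \<le> ?p (\<rho> / (2 + real n)) A" using antimono by blast
    qed
  qed
  have inc: "incseq (\<lambda>n. ?p (\<rho> / (2 + real n)) A)" for A
    using \<rho> by (intro incseq_SucI antimono) (simp add: frac_le)
  have "hausdorff_outer m E + hausdorff_outer m F
      = (SUP n. ?p (\<rho> / (2 + real n)) E + ?p (\<rho> / (2 + real n)) F)"
    unfolding lim[symmetric] by (rule ennreal_SUP_add[symmetric]) (rule inc)+
  also have "\<dots> \<le> hausdorff_outer m (E \<union> F)"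
    using \<rho> by (intro SUP_least main) (auto simp: field_simps add_pos_nonneg)
  finally show ?thesis .
qed

text \<open>Caratheodory's criterion. The part of \<open>E\<close> away from \<open>A\<close> is
  additive with \<open>A \<inter> E\<close> by separation, and the remaining layers near
  \<open>A\<close> have small total measure.\<close>

lemma closed_hausdorff_measurable:
  fixes A :: "'a::metric_space set"
  assumes "closed A" shows "A \<in> sets (hausdorff_measure m)"
proof (cases "A = {}")
  case False
  let ?H = "hausdorff_outer m :: 'a set \<Rightarrow> ennreal"
  note oms = outer_measure_space_hausdorff[where 'a = 'a, of m]
  have key: "?H (A \<inter> E) + ?H (E - A) \<le> ?H E" if fin: "?H E < \<infinity>" for E
  proof -
    \<comment> \<open>\<open>S n\<close> keeps a fixed distance from \<open>A\<close>; the layers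
      \<open>R n\<close> are the shells between consecutive such distances.\<close>
    define S where "S n = {x \<in> E. inverse (real (Suc n)) \<le> infdist x A}" for n
    define R where "R n = {x \<in> E. inverse (real (Suc (Suc n))) \<le> infdist x A \<and> infdist x A < inverse (real (Suc n))}" for n
    \<comment> \<open>Among layers of the same parity a full shell lies between any two, so they are
      separated and their measures add up to at most that of the union.\<close>
    have alt: "(\<Sum>j<N. ?H (R (2 * j + p))) \<le> ?H (\<Union>j<N. R (2 * j + p))" for N p
    proof (induction N)
      case (Suc N)
      define \<rho> where "\<rho> = inverse (real (2 * N + p)) - inverse (real (Suc (2 * N + p)))"
      have "?H (\<Union>j<N. R (2 * j + p)) + ?H (R (2 * N + p)) \<le> ?H ((\<Union>j<N. R (2 * j + p)) \<union> R (2 * N + p))"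
      proof (cases "N = 0")
        case True
        then show ?thesis using oms by (simp add: outer_measure_space_def positive_def)
      next
        case False
        show ?thesis
        proof (rule hausdorff_outer_separated)
          show "\<rho> > 0" unfolding \<rho>_def using False by (simp only: diff_gt_0_iff_gt) (intro less_imp_inverse_less, auto)
          fix x y assume "x \<in> (\<Union>j<N. R (2 * j + p))" and y: "y \<in> R (2 * N + p)"
          then obtain j where j: "j < N" "x \<in> R (2 * j + p)" by blast
          have "inverse (real (2 * N + p)) \<le> inverse (real (Suc (Suc (2 * j + p))))"
            using j by (intro le_imp_inverse_le) auto
          also have "\<dots> \<le> infdist x A" using j by (simp add: R_def)
          finally show "\<rho> \<le> dist x y"
            using y infdist_triangle[of x A y] by (simp add: R_def \<rho>_def)
        qed
      qed
      moreover have "(\<Union>j<Suc N. R (2 * j + p)) = (\<Union>j<N. R (2 * j + p)) \<union> R (2 * N + p)"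
        by (auto simp: less_Suc_eq)
      ultimately show ?case
        using order_trans[OF add_right_mono[OF Suc, of "?H (R (2 * N + p))"]] by simp
    qed (simp add: oms)
    have two: "(\<Sum>k<2 * N. ?H (R k)) = (\<Sum>j<N. ?H (R (2 * j + 0))) + (\<Sum>j<N. ?H (R (2 * j + 1)))" for N
      by (induction N) (simp_all add: algebra_simps)
    \<comment> \<open>Even and odd layers each contribute at most the measure of \<open>E\<close>,
      which makes the series of all layers converge.\<close>
    have "(\<Sum>k<N. ?H (R k)) \<le> 2 * ?H E" for N
    proof -
      have "(\<Sum>k<N. ?H (R k)) \<le> (\<Sum>k<2 * N. ?H (R k))" by (intro sum_mono2) auto
      also have "\<dots> \<le> ?H E + ?H E"
        unfolding two by (intro add_mono order_trans[OF alt] hausdorff_outer_mono) (auto simp: R_def)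
      finally show ?thesis by (simp add: mult_2)
    qed
    then have "(\<Sum>k. ?H (R k)) \<le> 2 * ?H E" by (intro suminf_le_const) auto
    also have "\<dots> < \<infinity>" using fin by (simp add: ennreal_mult_less_top)
    finally have finR: "(\<Sum>k. ?H (R k)) \<noteq> \<infinity>" by simp
    have tail: "(\<lambda>n. \<Sum>k. ?H (R (k + n))) \<longlonglongrightarrow> 0"
    proof -
      define r where "r k = enn2real (?H (R k))" for k
      have r: "?H (R k) = ennreal (r k)" for k
        using finR ennreal_le_suminf[of "\<lambda>k. ?H (R k)" k] by (simp add: r_def top.not_eq_extremum le_less_trans)
      have sr: "summable r" using finR unfolding r by (intro summable_suminf_not_top) (auto simp: r_def)
      have "(\<Sum>k. ?H (R (k + n))) = ennreal (suminf r - (\<Sum>k<n. r k))" for n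
        unfolding r suminf_minus_initial_segment[OF sr, symmetric]
        by (intro suminf_ennreal2 summable_ignore_initial_segment sr) (simp add: r_def)
      moreover have "(\<lambda>n. ennreal (suminf r - (\<Sum>k<n. r k))) \<longlonglongrightarrow> ennreal (suminf r - suminf r)"
        by (intro tendsto_intros summable_LIMSEQ sr)
      ultimately show ?thesis by simp
    qed
    have le: "?H (A \<inter> E) + ?H (E - A) \<le> ?H E + (\<Sum>k. ?H (R (k + n)))" for n
    proof -
      \<comment> \<open>A point off the closed set \<open>A\<close> has positive distance from it,
        hence lies in \<open>S n\<close> or in one of the layers from index \<open>n\<close>
        on.\<close>
      have "E - A \<subseteq> S n \<union> (\<Union>k. R (k + n))"
      proof
        fix x assume x: "x \<in> E - A"
        then have pos: "infdist x A > 0"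
          using infdist_pos_not_in_closed[OF \<open>closed A\<close> False] by auto
        show "x \<in> S n \<union> (\<Union>k. R (k + n))"
        proof (cases "x \<in> S n")
          case f: False
          define P where "P k = (inverse (real (Suc k)) \<le> infdist x A)" for k
          obtain k0 where "P k0" using reals_Archimedean[OF pos] by (auto simp: P_def intro: less_imp_le)
          define k where "k = (LEAST k. P k)"
          have Pk: "P k" unfolding k_def using \<open>P k0\<close> by (rule LeastI)
          have "\<not> P n" using f x by (auto simp: S_def P_def)
          moreover have "P i" if "k \<le> i" for i
            using Pk order_trans[OF le_imp_inverse_le[of "real (Suc k)" "real (Suc i)"]] that by (simp add: P_def)
          ultimately have kn: "n < k" using not_less by blast
          then obtain j where j: "k = Suc (j + n)" by (metis add.commute less_natE)
          have "\<not> P (j + n)" unfolding k_def j[symmetric] using not_less_Least[of "j + n" P] j k_def by simp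
          then have "x \<in> R (j + n)" using Pk x by (auto simp: P_def R_def j)
          then show ?thesis by blast
        qed simp
      qed
      then have "?H (E - A) \<le> ?H (S n) + ?H (\<Union>k. R (k + n))"
        using order_trans[OF hausdorff_outer_mono outer_measure_space_Un_le[OF oms]] by blast
      also have "\<dots> \<le> ?H (S n) + (\<Sum>k. ?H (R (k + n)))"
        by (intro add_left_mono outer_measure_space_Union_le oms)
      finally have "?H (A \<inter> E) + ?H (E - A) \<le> (?H (A \<inter> E) + ?H (S n)) + (\<Sum>k. ?H (R (k + n)))"
        by (simp add: add_left_mono add.assoc)
      also have "?H (A \<inter> E) + ?H (S n) \<le> ?H ((A \<inter> E) \<union> S n)"
      proof (rule hausdorff_outer_separated)
        show "inverse (real (Suc n)) > 0" by simp
        fix x y assume "x \<in> A \<inter> E" "y \<in> S n"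
        then show "inverse (real (Suc n)) \<le> dist x y"
          using infdist_triangle[of y A x] by (auto simp: S_def dist_commute)
      qed
      also have "\<dots> \<le> ?H E" by (rule hausdorff_outer_mono) (auto simp: S_def)
      finally show ?thesis by (simp add: add_right_mono)
    qed
    have "(\<lambda>n. ?H E + (\<Sum>k. ?H (R (k + n)))) \<longlonglongrightarrow> ?H E + 0"
      by (intro tendsto_intros tail)
    then show ?thesis using LIMSEQ_le_const[of "\<lambda>n. ?H E + (\<Sum>k. ?H (R (k + n)))" "?H E"] le by auto
  qed
  have "?H (A \<inter> E) + ?H ((UNIV - A) \<inter> E) = ?H E" for E
  proof (rule antisym)
    have eq: "(UNIV - A) \<inter> E = E - A" by auto
    show "?H (A \<inter> E) + ?H ((UNIV - A) \<inter> E) \<le> ?H E"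
      unfolding eq using key[of E] by (cases "?H E < \<infinity>") (auto simp: less_top[symmetric])
    have "E = (A \<inter> E) \<union> ((UNIV - A) \<inter> E)" by auto
    then show "?H E \<le> ?H (A \<inter> E) + ?H ((UNIV - A) \<inter> E)"
      using outer_measure_space_Un_le[OF oms] by metis
  qed
  then show ?thesis by (simp add: sets_hausdorff_measure lambda_system_def)
qed simp

lemma space_hausdorff_measure [simp]: "space (hausdorff_measure m) = UNIV"
  by (simp add: hausdorff_measure_def space_measure_of_conv)

lemma borel_hausdorff_measurable:
  assumes "A \<in> sets borel" shows "A \<in> sets (hausdorff_measure m)"
proof -
  have "sigma_sets UNIV (Collect closed) \<subseteq> sets (hausdorff_measure m)"
    using sets.sigma_sets_subset[of "Collect closed" "hausdorff_measure m"] closed_hausdorff_measurable by auto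
  then show ?thesis using assms by (auto simp: borel_eq_closed)
qed

lemma hausdorff_null:
  fixes A :: "'a::metric_space set"
  assumes "hausdorff_outer m A = 0" shows "A \<in> null_sets (hausdorff_measure m)"
proof -
  note oms = outer_measure_space_hausdorff[where 'a = 'a, of m]
  have "A \<in> sets (hausdorff_measure m)"
    unfolding sets_hausdorff_measure lambda_system_def
  proof (clarsimp, rule antisym)
    fix E :: "'a set"
    have 0: "hausdorff_outer m (A \<inter> E) = 0"
      using hausdorff_outer_mono[of "A \<inter> E" A m] assms by simp
    show "hausdorff_outer m (A \<inter> E) + hausdorff_outer m ((UNIV - A) \<inter> E) \<le> hausdorff_outer m E"
      unfolding 0 by (auto intro: hausdorff_outer_mono)
    have "E = (A \<inter> E) \<union> ((UNIV - A) \<inter> E)" by auto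
    then show "hausdorff_outer m E \<le> hausdorff_outer m (A \<inter> E) + hausdorff_outer m ((UNIV - A) \<inter> E)"
      using outer_measure_space_Un_le[OF oms] by metis
  qed
  then show ?thesis using assms by (simp add: null_sets_def emeasure_hausdorff_measure)
qed

text \<open>The coordinates in \<open>I\<close> control all distances, so a grid on them covers
  \<open>S\<close> by about \<open>M ^ card I\<close> sets of diameter of order
  \<open>1 / M\<close>. Their gauges are of order \<open>M ^ (- m)\<close>, and the total decays at
  least like \<open>1 / M\<close>.\<close>

lemma hausdorff_outer_lower_dim:
  fixes S :: "(real^'n) set" and I :: "'n set"
  assumes S: "bounded S" and I: "card I < m" and L: "0 \<le> L"
    and dist: "\<And>x y. x \<in> S \<Longrightarrow> y \<in> S \<Longrightarrow> dist x y \<le> L * (\<Sum>i\<in>I. \<bar>x $ i - y $ i\<bar>)"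
  shows "hausdorff_outer m S = 0"
proof -
  obtain R where R: "R > 0" "\<And>x. x \<in> S \<Longrightarrow> norm x \<le> R"
    using S by (meson bounded_pos)
  define c where "c = card I"
  \<comment> \<open>A bound for \<open>M\<close> times the diameter of a grid cell; the added 1
    keeps it positive when \<open>L\<close> or \<open>card I\<close> is 0.\<close>
  define D where "D = L * real c * (2 * R) + 1"
  have D: "D > 0" using L R by (simp add: D_def add_nonneg_pos)
  \<comment> \<open>The factor \<open>2 ^ c\<close> comes from replacing the number
    \<open>(M + 1) ^ c\<close> of cells by \<open>(2 * M) ^ c\<close>.\<close>
  define w where "w = unit_ball_vol (real m) * 2 ^ c * (D / 2) ^ m"
  have w: "w \<ge> 0" using D by (simp add: w_def)
  have bound: "outer_measure UNIV (hausdorff_gauge m \<delta>) S \<le> ennreal (w / real M)"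
    if \<delta>: "\<delta> > 0" and M: "M > 0" "D / real M \<le> \<delta>" for \<delta> M
  proof -
    \<comment> \<open>The index of the slab of width \<open>2 * R / M\<close> that contains the
      coordinate. The right end gets index \<open>M\<close>, hence \<open>M + 1\<close> values per
      coordinate.\<close>
    define q where "q x = (\<lambda>i. nat \<lfloor>(x $ i + R) / (2 * R) * real M\<rfloor>)" for x :: "real^'n"
    define U where "U h = {x \<in> S. \<forall>i\<in>I. q x i = h i}" for h
    define F where "F = (PiE I (\<lambda>_. {..M}))"
    have finI: "finite I" by simp
    have fin: "finite F" unfolding F_def by (intro finite_PiE) auto
    have cardF: "card F = (M + 1) ^ c"
      unfolding F_def c_def by (subst card_PiE) auto
    have comp: "\<bar>x $ i\<bar> \<le> R" if "x \<in> S" for x i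
      using R(2)[OF that] component_le_norm_cart[of x i] by simp
    have q_le: "q x i \<le> M" if "x \<in> S" for x i
    proof -
      have "(x $ i + R) / (2 * R) \<le> 1" using comp[OF that, of i] R by (simp add: field_simps)
      then have "(x $ i + R) / (2 * R) * real M \<le> real M" using mult_right_mono[of "(x $ i + R) / (2 * R)" 1 "real M"] by simp
      then have "\<lfloor>(x $ i + R) / (2 * R) * real M\<rfloor> \<le> int M" by linarith
      then show ?thesis by (simp add: q_def)
    qed
    have cover: "S \<subseteq> (\<Union>h\<in>F. U h)"
    proof
      fix x assume x: "x \<in> S"
      have "restrict (q x) I \<in> F" using q_le[OF x] by (auto simp: F_def)
      moreover have "x \<in> U (restrict (q x) I)" using x by (auto simp: U_def)
      ultimately show "x \<in> (\<Union>h\<in>F. U h)" by blast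
    qed
    have diam: "dist x y \<le> D / real M" if "x \<in> U h" "y \<in> U h" for x y h
    proof -
      have xy: "x \<in> S" "y \<in> S" using that by (auto simp: U_def)
      have "\<bar>x $ i - y $ i\<bar> \<le> 2 * R / real M" if i: "i \<in> I" for i
      proof -
        define a where "a = (x $ i + R) / (2 * R) * real M"
        define b where "b = (y $ i + R) / (2 * R) * real M"
        have nn: "a \<ge> 0" "b \<ge> 0" using comp[OF xy(1), of i] comp[OF xy(2), of i] R by (auto simp: a_def b_def)
        have "nat \<lfloor>a\<rfloor> = nat \<lfloor>b\<rfloor>"
          using \<open>x \<in> U h\<close> \<open>y \<in> U h\<close> i by (simp add: U_def q_def a_def b_def)
        then have "\<lfloor>a\<rfloor> = \<lfloor>b\<rfloor>" using nn by (simp add: nat_eq_iff)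
        then have "\<bar>a - b\<bar> \<le> 1" by linarith
        moreover have "x $ i - y $ i = (a - b) * (2 * R / real M)"
          using R M by (simp add: a_def b_def field_simps)
        ultimately show ?thesis
          using R M mult_right_mono[of "\<bar>a - b\<bar>" 1 "2 * R / real M"] by (simp add: abs_mult)
      qed
      then have "(\<Sum>i\<in>I. \<bar>x $ i - y $ i\<bar>) \<le> real c * (2 * R / real M)"
        unfolding c_def by (rule sum_bounded_above)
      then have "dist x y \<le> L * (real c * (2 * R / real M))"
        using dist[OF xy] L by (meson mult_left_mono order_trans)
      also have "\<dots> \<le> D / real M" using M by (simp add: D_def divide_right_mono)
      finally show ?thesis .
    qed
    have gauge: "hausdorff_gauge m \<delta> (U h) \<le> ennreal (unit_ball_vol (real m) * (D / real M / 2) ^ m)" for h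
    proof (cases "U h = {}")
      case False
      have bd: "bounded (U h)" using S bounded_subset[of S "U h"] by (auto simp: U_def)
      have "diameter (U h) \<le> D / real M"
        using diam False by (intro diameter_le) (auto simp: dist_norm)
      then show ?thesis using M bd False diameter_ge_0[OF bd]
        by (auto simp: hausdorff_gauge_def intro!: ennreal_leI mult_left_mono power_mono divide_right_mono)
    qed (simp add: hausdorff_gauge_def)
    note oms = outer_measure_space_gauge[where 'a = "real^'n", of m \<delta>]
    let ?p = "outer_measure UNIV (hausdorff_gauge m \<delta>) :: (real^'n) set \<Rightarrow> ennreal"
    have "?p S \<le> ?p (\<Union>h\<in>F. U h)"
      using cover oms by (auto simp: outer_measure_space_def increasing_def)
    also have "\<dots> \<le> (\<Sum>h\<in>F. ?p (U h))"
      by (rule outer_measure_space_finite_Union_le[OF oms fin])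
    also have "\<dots> \<le> (\<Sum>h\<in>F. ennreal (unit_ball_vol (real m) * (D / real M / 2) ^ m))"
      by (intro sum_mono order_trans[OF outer_measure_gauge_le gauge])
    also have "\<dots> = ennreal (real ((M + 1) ^ c) * (unit_ball_vol (real m) * (D / real M / 2) ^ m))"
      using D by (simp add: cardF ennreal_of_nat_eq_real_of_nat ennreal_mult')
    also have "\<dots> \<le> ennreal (w / real M)"
    proof (rule ennreal_leI)
      have "real ((M + 1) ^ c) \<le> (2 * real M) ^ c" unfolding of_nat_power using M by (intro power_mono) auto
      then have "real ((M + 1) ^ c) * (unit_ball_vol (real m) * (D / real M / 2) ^ m)
          \<le> (2 * real M) ^ c * (unit_ball_vol (real m) * (D / real M / 2) ^ m)"
        using D by (intro mult_right_mono) auto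
      also have "\<dots> = w * (real M ^ c / real M ^ m)"
        by (simp add: w_def power_mult_distrib power_divide field_simps)
      also have "real M ^ c / real M ^ m \<le> 1 / real M"
      proof -
        have "real M ^ Suc c \<le> real M ^ m" using I M by (intro power_increasing) (auto simp: c_def)
        then show ?thesis using M by (simp add: field_simps)
      qed
      finally show "real ((M + 1) ^ c) * (unit_ball_vol (real m) * (D / real M / 2) ^ m) \<le> w / real M"
        using w by (simp add: mult_left_mono)
    qed
    finally show ?thesis .
  qed
  have "outer_measure UNIV (hausdorff_gauge m \<delta>) S \<le> 0" if \<delta>: "\<delta> > 0" for \<delta>
  proof -
    obtain M0 where M0: "D / \<delta> < real M0" using reals_Archimedean2 by blast
    have "(\<lambda>n. ennreal (w / real n)) \<longlonglongrightarrow> ennreal 0"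
      by (intro tendsto_ennrealI lim_const_over_n)
    moreover have "\<forall>n\<ge>max 1 M0. outer_measure UNIV (hausdorff_gauge m \<delta>) S \<le> ennreal (w / real n)"
    proof (intro allI impI bound \<delta>)
      fix n assume n: "n \<ge> max 1 M0"
      then have "D / \<delta> \<le> real n" using M0 by simp
      then show "D / real n \<le> \<delta>" using n \<delta> by (simp add: field_simps)
    qed auto
    ultimately show ?thesis using LIMSEQ_le_const by fastforce
  qed
  then have "hausdorff_outer m S \<le> 0"
    unfolding hausdorff_outer_def by (intro SUP_least) auto
  then show ?thesis by simp
qed

text \<open>The points that reach \<open>U\<close> form a thickened segment along
  \<open>- \<theta>\<close>. About \<open>T * norm \<theta> / \<rho> + 1\<close> balls of radius
  \<open>2 * \<rho>\<close> cover it, and one power of \<open>\<rho>\<close> cancels against their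
  number, which leaves the power of a surface measure.\<close>

lemma tube_cover:
  fixes \<theta> :: "real^'n" and U :: "(real^'n) set"
  assumes T: "0 \<le> T" and U: "bounded U" "diameter U < \<rho>"
  shows "\<exists>B\<in>sets borel. {x. \<exists>t\<in>{0..T}. x + t *\<^sub>R \<theta> \<in> U} \<subseteq> B \<and>
     emeasure lborel B \<le> ennreal (unit_ball_vol (real CARD('n)) * 2 ^ CARD('n) * (T * norm \<theta> + \<rho>) * \<rho> ^ (CARD('n) - 1))"
proof (cases "U = {}")
  case False
  then obtain p where p: "p \<in> U" by blast
  have \<rho>: "\<rho> > 0" using U diameter_ge_0[of U] by simp
  define J where "J = nat \<lfloor>T * norm \<theta> / \<rho>\<rfloor>"
  define z where "z j = p - (real j * \<rho> / norm \<theta>) *\<^sub>R \<theta>" for j :: nat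
  define B where "B = (\<Union>j\<le>J. cball (z j) (2 * \<rho>))"
  have "{x. \<exists>t\<in>{0..T}. x + t *\<^sub>R \<theta> \<in> U} \<subseteq> B"
  proof clarify
    fix x t assume t: "t \<in> {0..T}" and y: "x + t *\<^sub>R \<theta> \<in> U"
    \<comment> \<open>The centre is chosen at arc length at most \<open>\<rho>\<close> before that
      of \<open>x\<close>; with the diameter of \<open>U\<close> this explains the radius
      \<open>2 * \<rho>\<close>.\<close>
    define j where "j = nat \<lfloor>t * norm \<theta> / \<rho>\<rfloor>"
    have "t * norm \<theta> / \<rho> \<le> T * norm \<theta> / \<rho>"
      using t \<rho> by (intro divide_right_mono mult_right_mono) auto
    then have jJ: "j \<le> J" unfolding j_def J_def by (intro nat_mono floor_mono)
    have "0 \<le> t * norm \<theta> / \<rho>" using t \<rho> by simp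
    then have "real j \<le> t * norm \<theta> / \<rho>" "t * norm \<theta> / \<rho> \<le> real j + 1"
      unfolding j_def by linarith+
    then have j: "\<bar>t * norm \<theta> - real j * \<rho>\<bar> \<le> \<rho>" using \<rho> by (simp add: field_simps abs_le_iff)
    have "dist (z j) x = norm (((x + t *\<^sub>R \<theta>) - p) - (t - real j * \<rho> / norm \<theta>) *\<^sub>R \<theta>)"
      by (simp add: z_def dist_norm norm_minus_commute algebra_simps)
    also have "\<dots> \<le> norm ((x + t *\<^sub>R \<theta>) - p) + norm ((t - real j * \<rho> / norm \<theta>) *\<^sub>R \<theta>)"
      by (rule norm_triangle_ineq4)
    also have "norm ((x + t *\<^sub>R \<theta>) - p) \<le> \<rho>"
      using diameter_bounded_bound[OF U(1) y p] U(2) by (simp add: dist_norm)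
    also have "norm ((t - real j * \<rho> / norm \<theta>) *\<^sub>R \<theta>) \<le> \<rho>"
    proof (cases "\<theta> = 0")
      case False
      then have "norm ((t - real j * \<rho> / norm \<theta>) *\<^sub>R \<theta>) = \<bar>t * norm \<theta> - real j * \<rho>\<bar>"
        by (simp add: abs_mult[symmetric, of _ "norm \<theta>", simplified] left_diff_distrib)
      then show ?thesis using j by simp
    qed (use \<rho> in simp)
    finally show "x \<in> B" using jJ by (auto simp: B_def)
  qed
  moreover have "emeasure lborel B \<le> ennreal (unit_ball_vol (real CARD('n)) * 2 ^ CARD('n) * (T * norm \<theta> + \<rho>) * \<rho> ^ (CARD('n) - 1))"
  proof -
    have "emeasure lborel B \<le> (\<Sum>j\<le>J. emeasure lborel (cball (z j) (2 * \<rho>)))"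
      unfolding B_def by (rule emeasure_subadditive_finite) auto
    also have "\<dots> = (\<Sum>j\<le>J. ennreal (unit_ball_vol (real CARD('n)) * (2 * \<rho>) ^ CARD('n)))"
      using \<rho> by (simp add: emeasure_cball)
    also have "\<dots> = ennreal ((real J + 1) * (unit_ball_vol (real CARD('n)) * (2 * \<rho>) ^ CARD('n)))"
      using \<rho> by (simp add: ennreal_of_nat_eq_real_of_nat[symmetric] ennreal_mult ennreal_plus add.commute)
    also have "\<dots> \<le> ennreal ((T * norm \<theta> / \<rho> + 1) * (unit_ball_vol (real CARD('n)) * (2 * \<rho>) ^ CARD('n)))"
    proof (intro ennreal_leI mult_right_mono add_right_mono)
      have "0 \<le> T * norm \<theta> / \<rho>" using T \<rho> by simp
      then show "real J \<le> T * norm \<theta> / \<rho>" unfolding J_def by linarith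
    qed (use \<rho> in auto)
    also have "(T * norm \<theta> / \<rho> + 1) * (unit_ball_vol (real CARD('n)) * (2 * \<rho>) ^ CARD('n))
        = unit_ball_vol (real CARD('n)) * 2 ^ CARD('n) * (T * norm \<theta> + \<rho>) * \<rho> ^ (CARD('n) - 1)"
    proof -
      have "\<rho> ^ CARD('n) = \<rho> * \<rho> ^ (CARD('n) - 1)" by (rule power_eq_if[THEN trans]) simp
      then show ?thesis using \<rho> by (simp add: power_mult_distrib field_simps)
    qed
    finally show ?thesis .
  qed
  moreover have "B \<in> sets borel" unfolding B_def by (intro borel_closed closed_UN) auto
  ultimately show ?thesis by blast
next
  case True
  then show ?thesis by (intro bexI[of _ "{}"]) simp_all
qed

text \<open>A one-sided substitute for an area formula. Asking for a Borel superset \<open>B\<close>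
  makes it applicable to arbitrary sets \<open>E\<close>, in particular to null sets.\<close>

lemma tube_measure:
  fixes \<theta> :: "real^'n"
  assumes T: "0 \<le> T"
  obtains C where "0 < C"
    "\<And>E. \<exists>B\<in>sets borel. {x. \<exists>t\<in>{0..T}. x + t *\<^sub>R \<theta> \<in> E} \<subseteq> B \<and>
       emeasure lborel B \<le> ennreal C * hausdorff_outer (CARD('n) - 1) E"
proof -
  define m where "m = CARD('n) - 1"
  \<comment> \<open>The constant of \<open>tube_cover\<close> for radii
    \<open>\<rho> \<le> 2\<close>, which suffices for covering sets of diameter at most 1.\<close>
  define C1 where "C1 = unit_ball_vol (real CARD('n)) * 2 ^ CARD('n) * (T * norm \<theta> + 2)"
  have C1: "C1 > 0" using T by (simp add: C1_def add_nonneg_pos)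
  \<comment> \<open>Undoes the normalisation in \<open>hausdorff_gauge\<close>.\<close>
  define C where "C = C1 * 2 ^ m / unit_ball_vol (real m)"
  have C: "C > 0" using C1 by (simp add: C_def)
  let ?T = "\<lambda>E. {x. \<exists>t\<in>{0..T}. x + t *\<^sub>R \<theta> \<in> E}"
  have single: "\<exists>B\<in>sets borel. ?T U \<subseteq> B \<and> emeasure lborel B \<le> ennreal C * hausdorff_gauge m 1 U + ennreal \<epsilon>"
    if \<epsilon>: "\<epsilon> > 0" for U \<epsilon>
  proof -
    consider "U = {}" | "U \<noteq> {}" "\<not> (bounded U \<and> diameter U \<le> 1)" | "U \<noteq> {}" "bounded U" "diameter U \<le> 1" by blast
    then show ?thesis
    proof cases
      case 1
      then show ?thesis by (intro bexI[of _ "{}"]) auto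
    next
      case 2
      then have "ennreal C * hausdorff_gauge m 1 U = \<infinity>"
        using C by (auto simp: hausdorff_gauge_def ennreal_mult_top)
      then show ?thesis by (intro bexI[of _ UNIV]) auto
    next
      case 3
      define e where "e = diameter U"
      have e: "e \<ge> 0" "e \<le> 1" using 3 by (auto simp: e_def diameter_ge_0)
      \<comment> \<open>\<open>tube_cover\<close> needs a radius strictly above the diameter, which
        may be 0. By continuity the loss is absorbed by \<open>\<epsilon>\<close>.\<close>
      have "((\<lambda>r. C1 * r ^ m) \<longlongrightarrow> C1 * e ^ m) (at_right e)"
        by (intro tendsto_intros)
      then have "\<forall>\<^sub>F r in at_right e. C1 * r ^ m < C1 * e ^ m + \<epsilon>"
        by (rule order_tendstoD) (use \<epsilon> in simp)
      moreover have "\<forall>\<^sub>F r in at_right e. r < e + 1"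
        unfolding eventually_at_right_field by (rule exI[of _ "e + 1"]) simp
      moreover have "\<forall>\<^sub>F r in at_right e. e < r" by (rule eventually_at_right_less)
      ultimately have "\<forall>\<^sub>F r in at_right e. C1 * r ^ m < C1 * e ^ m + \<epsilon> \<and> r < e + 1 \<and> e < r"
        by eventually_elim simp
      then obtain \<rho> where \<rho>: "C1 * \<rho> ^ m < C1 * e ^ m + \<epsilon>" "\<rho> < e + 1" "e < \<rho>"
        using eventually_happens'[of "at_right e"] by auto
      obtain B where B: "B \<in> sets borel" "?T U \<subseteq> B"
        "emeasure lborel B \<le> ennreal (unit_ball_vol (real CARD('n)) * 2 ^ CARD('n) * (T * norm \<theta> + \<rho>) * \<rho> ^ m)"
        using tube_cover[OF T 3(2), of \<rho> \<theta>] \<rho> by (auto simp: e_def m_def)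
      note B(3)
      also have "ennreal (unit_ball_vol (real CARD('n)) * 2 ^ CARD('n) * (T * norm \<theta> + \<rho>) * \<rho> ^ m) \<le> ennreal (C1 * \<rho> ^ m)"
        unfolding C1_def using \<rho> e T by (intro ennreal_leI mult_right_mono mult_left_mono add_left_mono) auto
      also have "\<dots> \<le> ennreal (C1 * e ^ m + \<epsilon>)" using \<rho> by (intro ennreal_leI) auto
      also have "\<dots> = ennreal (C1 * e ^ m) + ennreal \<epsilon>" using C1 e \<epsilon> by (intro ennreal_plus) auto
      also have "ennreal (C1 * e ^ m) = ennreal C * hausdorff_gauge m 1 U"
      proof -
        have "unit_ball_vol (real m) \<noteq> 0" using unit_ball_vol_pos[of "real m"] by linarith
        then have "C1 * e ^ m = C * (unit_ball_vol (real m) * (e / 2) ^ m)"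
          by (simp add: C_def power_divide)
        then show ?thesis using 3 C by (simp add: hausdorff_gauge_def e_def ennreal_mult')
      qed
      finally show ?thesis using B by blast
    qed
  qed
  have "\<exists>B\<in>sets borel. ?T E \<subseteq> B \<and> emeasure lborel B \<le> ennreal C * hausdorff_outer m E" for E
  proof (cases "hausdorff_outer m E < \<infinity>")
    case False
    then show ?thesis using C by (intro bexI[of _ UNIV]) (auto simp: ennreal_mult_top less_top[symmetric])
  next
    case fin: True
    have eps: "\<exists>B\<in>sets borel. ?T E \<subseteq> B \<and> emeasure lborel B \<le> ennreal C * hausdorff_outer m E + ennreal \<epsilon>" if \<epsilon>: "\<epsilon> > 0" for \<epsilon>
    proof -
      \<comment> \<open>One half of \<open>\<epsilon>\<close> pays for the covering, scaled by
        \<open>C\<close>; the other half is spread geometrically over the tubes of its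
        members.\<close>
      obtain U where U: "E \<subseteq> (\<Union>i::nat. U i)"
        "(\<Sum>i. hausdorff_gauge m 1 (U i)) \<le> hausdorff_outer m E + ennreal (\<epsilon> / (2 * C))"
        using hausdorff_coverE[OF fin, of 1 "\<epsilon> / (2 * C)"] \<epsilon> C by auto
      have "\<forall>i. \<exists>B. B \<in> sets borel \<and> ?T (U i) \<subseteq> B \<and>
          emeasure lborel B \<le> ennreal C * hausdorff_gauge m 1 (U i) + ennreal (\<epsilon> / 2 * (1 / 2) ^ Suc i)"
      proof
        fix i
        show "\<exists>B. B \<in> sets borel \<and> ?T (U i) \<subseteq> B \<and>
          emeasure lborel B \<le> ennreal C * hausdorff_gauge m 1 (U i) + ennreal (\<epsilon> / 2 * (1 / 2) ^ Suc i)"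
          using single[of "\<epsilon> / 2 * (1 / 2) ^ Suc i" "U i"] \<epsilon> by auto
      qed
      from choice[OF this] obtain B where B: "\<And>i. B i \<in> sets borel" "\<And>i. ?T (U i) \<subseteq> B i"
        "\<And>i. emeasure lborel (B i) \<le> ennreal C * hausdorff_gauge m 1 (U i) + ennreal (\<epsilon> / 2 * (1 / 2) ^ Suc i)"
        by blast
      have "?T E \<subseteq> (\<Union>i. B i)"
      proof
        fix x assume "x \<in> ?T E"
        then obtain t i where "t \<in> {0..T}" "x + t *\<^sub>R \<theta> \<in> U i" using U(1) by blast
        then have "x \<in> ?T (U i)" by blast
        then show "x \<in> (\<Union>i. B i)" using B(2) by blast
      qed
      moreover have "emeasure lborel (\<Union>i. B i) \<le> ennreal C * hausdorff_outer m E + ennreal \<epsilon>"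
      proof -
        have half: "(\<lambda>i. \<epsilon> / 2 * (1 / 2) ^ Suc i) sums (\<epsilon> / 2 * 1)"
          by (intro sums_mult power_half_series)
        have "emeasure lborel (\<Union>i. B i) \<le> (\<Sum>i. emeasure lborel (B i))"
          using B(1) by (intro emeasure_subadditive_countably) auto
        also have "\<dots> \<le> (\<Sum>i. ennreal C * hausdorff_gauge m 1 (U i) + ennreal (\<epsilon> / 2 * (1 / 2) ^ Suc i))"
          by (intro suminf_le B) auto
        also have "\<dots> = (\<Sum>i. ennreal C * hausdorff_gauge m 1 (U i)) + (\<Sum>i. ennreal (\<epsilon> / 2 * (1 / 2) ^ Suc i))"
          by (intro suminf_add[symmetric]) auto
        also have "(\<Sum>i. ennreal C * hausdorff_gauge m 1 (U i)) = ennreal C * (\<Sum>i. hausdorff_gauge m 1 (U i))"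
          by (rule ennreal_suminf_cmult)
        also have "(\<Sum>i. ennreal (\<epsilon> / 2 * (1 / 2) ^ Suc i)) = ennreal (\<epsilon> / 2)"
          using half \<epsilon> by (subst suminf_ennreal_eq[of _ "\<epsilon> / 2"]) auto
        also have "ennreal C * (\<Sum>i. hausdorff_gauge m 1 (U i)) + ennreal (\<epsilon> / 2)
            \<le> ennreal C * (hausdorff_outer m E + ennreal (\<epsilon> / (2 * C))) + ennreal (\<epsilon> / 2)"
          by (intro add_right_mono mult_left_mono U) auto
        also have "\<dots> = ennreal C * hausdorff_outer m E + (ennreal (\<epsilon> / 2) + ennreal (\<epsilon> / 2))"
          using C \<epsilon> by (simp add: distrib_left ennreal_mult[symmetric] add.assoc)
        also have "ennreal (\<epsilon> / 2) + ennreal (\<epsilon> / 2) = ennreal \<epsilon>"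
          using \<epsilon> by (subst ennreal_plus[symmetric]) auto
        finally show ?thesis .
      qed
      moreover have "(\<Union>i. B i) \<in> sets borel" using B(1) by blast
      ultimately show ?thesis by blast
    qed
    \<comment> \<open>Intersecting the supersets for \<open>\<epsilon> = 1 / (n + 1)\<close> removes
      the error term, so null sets have null tubes.\<close>
    have "\<forall>n. \<exists>B. B \<in> sets borel \<and> ?T E \<subseteq> B \<and>
        emeasure lborel B \<le> ennreal C * hausdorff_outer m E + ennreal (inverse (real (Suc n)))"
    proof
      fix n
      show "\<exists>B. B \<in> sets borel \<and> ?T E \<subseteq> B \<and>
          emeasure lborel B \<le> ennreal C * hausdorff_outer m E + ennreal (inverse (real (Suc n)))"
        using eps[of "inverse (real (Suc n))"] by auto
    qed
    from choice[OF this] obtain B where B: "\<And>n. B n \<in> sets borel" "\<And>n. ?T E \<subseteq> B n"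
      "\<And>n. emeasure lborel (B n) \<le> ennreal C * hausdorff_outer m E + ennreal (inverse (real (Suc n)))"
      by blast
    have "emeasure lborel (\<Inter>n. B n) \<le> ennreal C * hausdorff_outer m E + ennreal (inverse (real (Suc n)))" for n
      using B(1) by (intro order_trans[OF emeasure_mono B(3)[of n]]) auto
    moreover have "(\<lambda>n. ennreal C * hausdorff_outer m E + ennreal (inverse (real (Suc n)))) \<longlonglongrightarrow> ennreal C * hausdorff_outer m E + ennreal 0"
      by (intro tendsto_intros tendsto_ennrealI LIMSEQ_inverse_real_of_nat)
    ultimately have "emeasure lborel (\<Inter>n. B n) \<le> ennreal C * hausdorff_outer m E + ennreal 0"
      by (intro LIMSEQ_le_const[of _ _ "emeasure lborel (\<Inter>n. B n)"]) auto
    moreover have "?T E \<subseteq> (\<Inter>n. B n)" using B(2) by blast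
    moreover have "(\<Inter>n. B n) \<in> sets borel" using B(1) by blast
    ultimately show ?thesis by (intro bexI[of _ "\<Inter>n. B n"]) auto
  qed
  then show ?thesis using that C unfolding m_def by blast
qed

text \<open>Lifts the tube bound from indicators to nonnegative functions by the usual induction.
  The result \<open>h\<close> majorises \<open>g\<close> along the whole segment, not its
  average.\<close>

lemma tube_function:
  fixes \<theta> :: "real^'n"
  assumes T: "0 \<le> T"
  obtains C where "0 < C"
    "\<And>g. g \<in> borel_measurable (hausdorff_measure (CARD('n) - 1)) \<Longrightarrow>
       \<exists>h\<in>borel_measurable borel. (\<forall>x. \<forall>t\<in>{0..T}. g (x + t *\<^sub>R \<theta>) \<le> (h x :: ennreal)) \<and>
         (\<integral>\<^sup>+x. h x \<partial>lborel) \<le> ennreal C * (\<integral>\<^sup>+\<xi>. g \<xi> \<partial>hausdorff_measure (CARD('n) - 1))"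
proof -
  obtain C where C: "0 < C" and tube: "\<And>E. \<exists>B\<in>sets borel. {x. \<exists>t\<in>{0..T}. x + t *\<^sub>R \<theta> \<in> E} \<subseteq> B \<and>
       emeasure lborel B \<le> ennreal C * hausdorff_outer (CARD('n) - 1) E"
    using tube_measure[OF T, of \<theta>] by blast
  let ?H = "hausdorff_measure (CARD('n) - 1) :: (real^'n) measure"
  have "\<exists>h\<in>borel_measurable borel. (\<forall>x. \<forall>t\<in>{0..T}. g (x + t *\<^sub>R \<theta>) \<le> (h x :: ennreal)) \<and>
         (\<integral>\<^sup>+x. h x \<partial>lborel) \<le> ennreal C * (\<integral>\<^sup>+\<xi>. g \<xi> \<partial>?H)"
    if "g \<in> borel_measurable ?H" for g
    using that
  proof (induction rule: borel_measurable_induct)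
    case (cong f g)
    then have "f = g" by auto
    then show ?case using cong by simp
  next
    case (set A)
    obtain B where B: "B \<in> sets borel" "{x. \<exists>t\<in>{0..T}. x + t *\<^sub>R \<theta> \<in> A} \<subseteq> B"
       "emeasure lborel B \<le> ennreal C * hausdorff_outer (CARD('n) - 1) A" using tube by blast
    show ?case
    proof (intro bexI[of _ "indicator B"] conjI allI ballI)
      fix x t assume "t \<in> {0..T}"
      then have "x + t *\<^sub>R \<theta> \<in> A \<Longrightarrow> x \<in> B" using B(2) by blast
      then show "indicator A (x + t *\<^sub>R \<theta>) \<le> (indicator B x :: ennreal)"
        by (auto simp: indicator_def)
    qed (use B set in \<open>auto simp: emeasure_hausdorff_measure\<close>)
  next
    case (mult u c)
    then obtain h where h: "h \<in> borel_measurable borel" "\<And>x t. t \<in> {0..T} \<Longrightarrow> u (x + t *\<^sub>R \<theta>) \<le> h x"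
      "(\<integral>\<^sup>+x. h x \<partial>lborel) \<le> ennreal C * (\<integral>\<^sup>+\<xi>. u \<xi> \<partial>?H)" by blast
    show ?case
    proof (intro bexI[of _ "\<lambda>x. c * h x"] conjI allI ballI)
      show "(\<integral>\<^sup>+x. c * h x \<partial>lborel) \<le> ennreal C * (\<integral>\<^sup>+\<xi>. c * u \<xi> \<partial>?H)"
        using h mult by (simp add: nn_integral_cmult mult.left_commute mult_left_mono)
    qed (use h in \<open>auto intro!: mult_left_mono\<close>)
  next
    case (add u v)
    obtain h where h: "h \<in> borel_measurable borel" "\<And>x t. t \<in> {0..T} \<Longrightarrow> u (x + t *\<^sub>R \<theta>) \<le> h x"
      "(\<integral>\<^sup>+x. h x \<partial>lborel) \<le> ennreal C * (\<integral>\<^sup>+\<xi>. u \<xi> \<partial>?H)" using add by blast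
    obtain k where k: "k \<in> borel_measurable borel" "\<And>x t. t \<in> {0..T} \<Longrightarrow> v (x + t *\<^sub>R \<theta>) \<le> k x"
      "(\<integral>\<^sup>+x. k x \<partial>lborel) \<le> ennreal C * (\<integral>\<^sup>+\<xi>. v \<xi> \<partial>?H)" using add by blast
    show ?case
    proof (intro bexI[of _ "\<lambda>x. k x + h x"] conjI allI ballI)
      show "(\<integral>\<^sup>+x. k x + h x \<partial>lborel) \<le> ennreal C * (\<integral>\<^sup>+\<xi>. v \<xi> + u \<xi> \<partial>?H)"
        using h k add by (simp add: nn_integral_add distrib_left add_mono)
    qed (use h k in \<open>auto intro!: add_mono\<close>)
  next
    case (seq U)
    have "\<exists>h. h \<in> borel_measurable borel \<and> (\<forall>x t. t \<in> {0..T} \<longrightarrow> U i (x + t *\<^sub>R \<theta>) \<le> h x) \<and>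
      (\<integral>\<^sup>+x. h x \<partial>lborel) \<le> ennreal C * (\<integral>\<^sup>+\<xi>. U i \<xi> \<partial>?H)" for i using seq by blast
    then have "\<forall>i. \<exists>h. h \<in> borel_measurable borel \<and> (\<forall>x t. t \<in> {0..T} \<longrightarrow> U i (x + t *\<^sub>R \<theta>) \<le> h x) \<and>
      (\<integral>\<^sup>+x. h x \<partial>lborel) \<le> ennreal C * (\<integral>\<^sup>+\<xi>. U i \<xi> \<partial>?H)" by blast
    from choice[OF this]
    obtain h where h: "\<And>i. h i \<in> borel_measurable borel" "\<And>i x t. t \<in> {0..T} \<Longrightarrow> U i (x + t *\<^sub>R \<theta>) \<le> h i x"
      "\<And>i. (\<integral>\<^sup>+x. h i x \<partial>lborel) \<le> ennreal C * (\<integral>\<^sup>+\<xi>. U i \<xi> \<partial>?H)" by blast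
    show ?case
    \<comment> \<open>The majorants of an increasing sequence need not increase, so Fatou's lemma
      takes the place of monotone convergence.\<close>
    proof (intro bexI[of _ "\<lambda>x. liminf (\<lambda>i. h i x)"] conjI allI ballI)
      fix x t assume t: "t \<in> {0..T}"
      have "U i (x + t *\<^sub>R \<theta>) \<le> liminf (\<lambda>i. h i x)" for i
      proof (rule Liminf_bounded)
        show "\<forall>\<^sub>F j in sequentially. U i (x + t *\<^sub>R \<theta>) \<le> h j x"
          using eventually_ge_at_top[of i]
        proof eventually_elim
          case (elim j)
          have "U i (x + t *\<^sub>R \<theta>) \<le> U j (x + t *\<^sub>R \<theta>)"
            using \<open>incseq U\<close> elim by (auto simp: incseq_def le_fun_def)
          also have "\<dots> \<le> h j x" using h(2)[OF t] .
          finally show ?case .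
        qed
      qed
      then show "(SUP i. U i) (x + t *\<^sub>R \<theta>) \<le> liminf (\<lambda>i. h i x)"
        by (auto simp: SUP_apply intro!: SUP_least)
    next
      have "(\<integral>\<^sup>+x. liminf (\<lambda>i. h i x) \<partial>lborel) \<le> liminf (\<lambda>i. \<integral>\<^sup>+x. h i x \<partial>lborel)"
        using h(1) by (intro nn_integral_liminf) auto
      also have "\<dots> \<le> liminf (\<lambda>i. ennreal C * (\<integral>\<^sup>+\<xi>. (SUP i. U i) \<xi> \<partial>?H))"
      proof (intro Liminf_mono always_eventually allI order_trans[OF h(3)] mult_left_mono nn_integral_mono)
        show "U i \<xi> \<le> (SUP i. U i) \<xi>" for i \<xi> unfolding SUP_apply by (rule SUP_upper) simp
      qed auto
      finally show "(\<integral>\<^sup>+x. liminf (\<lambda>i. h i x) \<partial>lborel) \<le> ennreal C * (\<integral>\<^sup>+\<xi>. (SUP i. U i) \<xi> \<partial>?H)"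
        by (simp add: Liminf_const)
    qed (use h(1) in auto)
  qed
  then show ?thesis using that C by blast
qed

section \<open>Local structure of the interfaces\<close>

definition hyperplane :: "'a::real_inner set \<Rightarrow> bool" where
  "hyperplane H \<longleftrightarrow> (\<exists>a b. a \<noteq> 0 \<and> H = {x. a \<bullet> x = b})"

lemma closed_hyperplane': "hyperplane H \<Longrightarrow> closed H"
  unfolding hyperplane_def using closed_hyperplane by blast

lemma hausdorff_outer_empty [simp]: "hausdorff_outer m {} = 0"
  using outer_measure_space_hausdorff[of m] by (auto simp: outer_measure_space_def positive_def)

text \<open>Two normals of distinct intersecting hyperplanes have a nonzero 2x2 minor. By Cramer's
  rule two coordinates of a difference of common points are combinations of the others, so one
  coordinate fewer than the surface dimension controls distances.\<close>

lemma hausdorff_outer_hyperplane_Int: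
  fixes H H' Q :: "(real^'n) set"
  assumes H: "hyperplane H" "hyperplane H'" "H \<noteq> H'" and Q: "bounded Q"
  shows "hausdorff_outer (CARD('n) - 1) (H \<inter> H' \<inter> Q) = 0"
proof (cases "H \<inter> H' = {}")
  case True
  then show ?thesis by simp
next
  case False
  then obtain x0 where x0: "x0 \<in> H" "x0 \<in> H'" by blast
  obtain a b where ab: "a \<noteq> 0" "H = {x. a \<bullet> x = b}" using H by (auto simp: hyperplane_def)
  obtain a' b' where ab': "a' \<noteq> 0" "H' = {x. a' \<bullet> x = b'}" using H by (auto simp: hyperplane_def)
  \<comment> \<open>If all minors vanish, the normals are proportional, and the common point makes
    the hyperplanes equal.\<close>
  have "\<exists>i j. a $ i * a' $ j \<noteq> a $ j * a' $ i"
  proof (rule ccontr)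
    assume "\<not> ?thesis"
    then have all: "a $ i * a' $ j = a $ j * a' $ i" for i j by blast
    obtain i where i: "a $ i \<noteq> 0" using ab(1) by (metis vec_eq_iff zero_index)
    define c where "c = a' $ i / a $ i"
    have a': "a' = c *\<^sub>R a" unfolding vec_eq_iff using all[of i] i by (auto simp: c_def field_simps)
    then have "c \<noteq> 0" using ab'(1) by auto
    have "b' = c * b" using x0 ab(2) ab'(2) a' by auto
    then have "H = H'" using ab(2) ab'(2) a' \<open>c \<noteq> 0\<close> by auto
    then show False using H(3) by blast
  qed
  then obtain i j where ij: "a $ i * a' $ j \<noteq> a $ j * a' $ i" by blast
  then have "i \<noteq> j" by (auto simp: mult.commute)
  define \<Delta> where "\<Delta> = a $ i * a' $ j - a $ j * a' $ i"
  have \<Delta>: "\<Delta> \<noteq> 0" using ij by (simp add: \<Delta>_def)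
  define I where "I = UNIV - {i, j}"
  have cardI: "card I < CARD('n) - 1"
  proof -
    have "card I = CARD('n) - 2" unfolding I_def using \<open>i \<noteq> j\<close> by (subst card_Diff_subset) auto
    moreover have "card {i, j} \<le> CARD('n)" by (intro card_mono) auto
    ultimately show ?thesis using \<open>i \<noteq> j\<close> by simp
  qed
  have UN: "(\<Sum>l\<in>UNIV. g l) = g i + g j + (\<Sum>l\<in>I. g l)" for g :: "'n \<Rightarrow> real"
  proof -
    have "UNIV = insert i (insert j I)" by (auto simp: I_def)
    then have "(\<Sum>l\<in>UNIV. g l) = (\<Sum>l\<in>insert i (insert j I). g l)" by simp
    also have "\<dots> = g i + g j + (\<Sum>l\<in>I. g l)"
      using \<open>i \<noteq> j\<close> by (subst sum.insert; simp add: I_def)+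
    finally show ?thesis .
  qed
  \<comment> \<open>Bounds every coefficient that Cramer's rule produces, that is, every minor
    divided by \<open>\<Delta>\<close>.\<close>
  define C where "C = (\<Sum>l\<in>UNIV. \<bar>a $ l\<bar>) * (\<Sum>l\<in>UNIV. \<bar>a' $ l\<bar>) * 2 / \<bar>\<Delta>\<bar>"
  have C: "C \<ge> 0" unfolding C_def by (intro divide_nonneg_nonneg mult_nonneg_nonneg sum_nonneg) auto
  have minor: "\<bar>(a' $ p * a $ l - a $ p * a' $ l) / \<Delta>\<bar> \<le> C" for p l
  proof -
    have comp: "\<bar>v $ q\<bar> \<le> (\<Sum>l\<in>UNIV. \<bar>v $ l\<bar>)" for v :: "real^'n" and q
      by (rule member_le_sum) auto
    have "\<bar>a' $ p * a $ l - a $ p * a' $ l\<bar> \<le> \<bar>a $ l\<bar> * \<bar>a' $ p\<bar> + \<bar>a $ p\<bar> * \<bar>a' $ l\<bar>"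
      using abs_triangle_ineq4[of "a' $ p * a $ l" "a $ p * a' $ l"] by (simp add: abs_mult mult.commute)
    also have "\<dots> \<le> (\<Sum>l\<in>UNIV. \<bar>a $ l\<bar>) * (\<Sum>l\<in>UNIV. \<bar>a' $ l\<bar>) + (\<Sum>l\<in>UNIV. \<bar>a $ l\<bar>) * (\<Sum>l\<in>UNIV. \<bar>a' $ l\<bar>)"
      by (intro add_mono mult_mono comp sum_nonneg) auto
    finally show ?thesis unfolding C_def abs_divide mult_2_right by (intro divide_right_mono) auto
  qed
  show ?thesis
  proof (rule hausdorff_outer_lower_dim[where I = I and L = "1 + 2 * C"])
    show "bounded (H \<inter> H' \<inter> Q)" using Q bounded_subset[of Q] by blast
    show "card I < CARD('n) - 1" by (rule cardI)
    show "0 \<le> 1 + 2 * C" using C by simp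
    fix x y assume xy: "x \<in> H \<inter> H' \<inter> Q" "y \<in> H \<inter> H' \<inter> Q"
    define z where "z = x - y"
    define S where "S = (\<Sum>l\<in>I. \<bar>z $ l\<bar>)"
    have az: "(\<Sum>l\<in>UNIV. a $ l * z $ l) = 0" "(\<Sum>l\<in>UNIV. a' $ l * z $ l) = 0"
      using xy ab(2) ab'(2) by (auto simp: z_def inner_diff_right inner_vec_def right_diff_distrib sum_subtractf)
    \<comment> \<open>The combination of both equations in which the coordinate \<open>p\<close>
      drops out; \<open>p = j\<close> then determines coordinate \<open>i\<close>, and
      \<open>p = i\<close> coordinate \<open>j\<close>.\<close>
    have elim: "(\<Sum>l\<in>UNIV. (a' $ p * a $ l - a $ p * a' $ l) * z $ l) = 0" for p
    proof -
      have "(\<Sum>l\<in>UNIV. (a' $ p * a $ l - a $ p * a' $ l) * z $ l)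
          = a' $ p * (\<Sum>l\<in>UNIV. a $ l * z $ l) - a $ p * (\<Sum>l\<in>UNIV. a' $ l * z $ l)"
        by (simp add: left_diff_distrib sum_subtractf sum_distrib_left mult.assoc)
      then show ?thesis using az by simp
    qed
    have bound: "\<bar>w\<bar> \<le> C * S" if "\<bar>w\<bar> = \<bar>\<Sum>l\<in>I. (a' $ p * a $ l - a $ p * a' $ l) / \<Delta> * z $ l\<bar>" for w p
    proof -
      have "\<bar>w\<bar> \<le> (\<Sum>l\<in>I. \<bar>(a' $ p * a $ l - a $ p * a' $ l) / \<Delta>\<bar> * \<bar>z $ l\<bar>)"
        unfolding that abs_mult[symmetric] by (rule sum_abs)
      also have "\<dots> \<le> (\<Sum>l\<in>I. C * \<bar>z $ l\<bar>)"
        by (intro sum_mono mult_right_mono minor) auto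
      finally show ?thesis by (simp add: S_def sum_distrib_left)
    qed
    have "(\<Sum>l\<in>I. (a' $ j * a $ l - a $ j * a' $ l) * z $ l) = - (\<Delta> * z $ i)"
      using elim[of j] by (simp add: UN \<Delta>_def algebra_simps)
    then have "(\<Sum>l\<in>I. (a' $ j * a $ l - a $ j * a' $ l) / \<Delta> * z $ l) = - z $ i"
      using \<Delta> by (simp add: sum_divide_distrib[symmetric])
    then have zi: "\<bar>z $ i\<bar> \<le> C * S" by (intro bound[of _ j]) simp
    have "(\<Sum>l\<in>I. (a' $ i * a $ l - a $ i * a' $ l) * z $ l) = \<Delta> * z $ j"
      using elim[of i] by (simp add: UN \<Delta>_def algebra_simps)
    then have "(\<Sum>l\<in>I. (a' $ i * a $ l - a $ i * a' $ l) / \<Delta> * z $ l) = z $ j"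
      using \<Delta> by (simp add: sum_divide_distrib[symmetric])
    then have zj: "\<bar>z $ j\<bar> \<le> C * S" by (intro bound[of _ i]) simp
    have "dist x y \<le> (\<Sum>l\<in>UNIV. \<bar>z $ l\<bar>)"
      unfolding dist_norm z_def by (rule norm_le_l1_cart)
    also have "\<dots> = \<bar>z $ i\<bar> + \<bar>z $ j\<bar> + S" unfolding S_def by (rule UN)
    also have "\<dots> \<le> (1 + 2 * C) * S" using zi zj by (simp add: algebra_simps)
    finally show "dist x y \<le> (1 + 2 * C) * (\<Sum>i\<in>I. \<bar>x $ i - y $ i\<bar>)"
      by (simp add: S_def z_def)
  qed
qed

lemma hyperplane_oriented_normal:
  fixes H :: "(real^'n::{finite,linorder}) set"
  assumes "hyperplane H"
  obtains \<nu> \<beta> where "norm \<nu> = 1" "0 < \<nu> $ Min {i. \<nu> $ i \<noteq> 0}" "H = {x. \<nu> \<bullet> x = \<beta>}"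
proof -
  obtain a b where ab: "a \<noteq> 0" "H = {x. a \<bullet> x = b}" using assms by (auto simp: hyperplane_def)
  define s where "s = (if 0 < a $ Min {i. a $ i \<noteq> 0} then 1 else - 1 :: real) / norm a"
  have s: "s \<noteq> 0" using ab by (simp add: s_def)
  define \<nu> where "\<nu> = s *\<^sub>R a"
  have "{i. a $ i \<noteq> 0} \<noteq> {}" using ab(1) by (auto simp: vec_eq_iff)
  then have "Min {i. a $ i \<noteq> 0} \<in> {i. a $ i \<noteq> 0}" by (intro Min_in) auto
  then have "a $ Min {i. a $ i \<noteq> 0} \<noteq> 0" by simp
  moreover have "{i. \<nu> $ i \<noteq> 0} = {i. a $ i \<noteq> 0}" using s by (simp add: \<nu>_def)
  ultimately have "0 < \<nu> $ Min {i. \<nu> $ i \<noteq> 0}"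
    using ab(1) by (auto simp: \<nu>_def s_def zero_less_mult_iff)
  moreover have "norm \<nu> = 1" using ab(1) by (simp add: \<nu>_def s_def)
  moreover have "H = {x. \<nu> \<bullet> x = s * b}" using ab(2) s by (auto simp: \<nu>_def)
  ultimately show ?thesis using that by blast
qed

text \<open>Near \<open>\<xi>\<close> the set determines the hyperplane, hence its unit normal up to
  sign, and the orientation fixes the sign. This discharges the \<open>THE\<close> in
  \<open>unit_normal\<close>.\<close>

lemma unit_normal_eq:
  fixes S :: "'n::{finite,linorder} point set"
  assumes \<nu>: "norm \<nu> = 1" "0 < \<nu> $ Min {i. \<nu> $ i \<noteq> 0}"
    and r: "0 < r" and S: "S \<inter> ball \<xi> r = {x \<in> ball \<xi> r. (x - \<xi>) \<bullet> \<nu> = 0}"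
  shows "unit_normal S \<xi> = \<nu>"
  unfolding unit_normal_def
proof (rule the_equality)
  show "norm \<nu> = 1 \<and> 0 < \<nu> $ Min {i. \<nu> $ i \<noteq> 0} \<and> (\<exists>r>0. S \<inter> ball \<xi> r = {x \<in> ball \<xi> r. (x - \<xi>) \<bullet> \<nu> = 0})"
    using assms by blast
next
  fix \<mu> assume "norm \<mu> = 1 \<and> 0 < \<mu> $ Min {i. \<mu> $ i \<noteq> 0} \<and> (\<exists>r>0. S \<inter> ball \<xi> r = {x \<in> ball \<xi> r. (x - \<xi>) \<bullet> \<mu> = 0})"
  then obtain q where \<mu>: "norm \<mu> = 1" "0 < \<mu> $ Min {i. \<mu> $ i \<noteq> 0}" "q > 0"
    and S': "S \<inter> ball \<xi> q = {x \<in> ball \<xi> q. (x - \<xi>) \<bullet> \<mu> = 0}" by blast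
  \<comment> \<open>The two descriptions may hold on different balls; vectors are scaled down into
    both before they are compared.\<close>
  have same: "y \<bullet> \<mu> = 0" if y: "y \<bullet> \<nu> = 0" for y
  proof -
    define n where "n = norm y + 1"
    have n: "n > 0" "norm y < n" by (auto simp: n_def add_nonneg_pos)
    define t where "t = min r q / n"
    have t: "t > 0" using r \<mu> n by (simp add: t_def)
    have "norm (t *\<^sub>R y) < min r q"
    proof -
      have "norm (t *\<^sub>R y) = t * norm y" using t by simp
      also have "\<dots> < t * n" using t n by (intro mult_strict_left_mono) auto
      also have "\<dots> = min r q" unfolding t_def using n by simp
      finally show ?thesis .
    qed
    then have inr: "\<xi> + t *\<^sub>R y \<in> ball \<xi> r" and inq: "\<xi> + t *\<^sub>R y \<in> ball \<xi> q" by (auto simp: dist_norm)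
    have "\<xi> + t *\<^sub>R y \<in> S \<inter> ball \<xi> r" unfolding S using inr y by simp
    then have "\<xi> + t *\<^sub>R y \<in> S \<inter> ball \<xi> q" using inq by simp
    then have "(t *\<^sub>R y) \<bullet> \<mu> = 0" unfolding S' by simp
    then show ?thesis using t by simp
  qed
  \<comment> \<open>The part of \<open>\<mu>\<close> orthogonal to \<open>\<nu>\<close> is by
    \<open>same\<close> orthogonal to \<open>\<mu>\<close> as well, and therefore zero.\<close>
  define c where "c = \<mu> \<bullet> \<nu>"
  have \<nu>1: "\<nu> \<bullet> \<nu> = 1" and \<mu>1: "\<mu> \<bullet> \<mu> = 1" using \<nu> \<mu> by (auto simp: norm_eq_1)
  have "(\<mu> - c *\<^sub>R \<nu>) \<bullet> \<nu> = 0" using \<nu>1 by (simp add: inner_diff_left c_def)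
  from same[OF this] have c2: "c\<^sup>2 = 1"
    using \<mu>1 by (simp add: inner_diff_left c_def inner_commute[of \<nu> \<mu>] power2_eq_square)
  have "(\<mu> - c *\<^sub>R \<nu>) \<bullet> (\<mu> - c *\<^sub>R \<nu>) = 1 - c\<^sup>2"
    using \<nu>1 \<mu>1 by (simp add: inner_diff_left inner_diff_right c_def inner_commute[of \<nu> \<mu>] power2_eq_square)
  then have \<mu>c: "\<mu> = c *\<^sub>R \<nu>" using c2 by simp
  have "c = 1"
  proof (rule ccontr)
    assume "c \<noteq> 1"
    then have "c = - 1" using c2 by (simp add: power2_eq_1_iff)
    then have m: "\<mu> = - \<nu>" using \<mu>c by simp
    show False using \<mu>(2) \<nu>(2) unfolding m by simp
  qed
  then show "\<mu> = \<nu>" using \<mu>c by simp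
qed

text \<open>Only the order on coordinates is added, on which the orientation of the normals
  rests.\<close>

locale network = multiscale_network N for N :: "'n::{finite,linorder} network"
begin

text \<open>Some finite cover of the interface by complete hyperplanes. The flat pieces may be
  irregular and may miss parts of their hyperplane.\<close>

definition hyps :: "nat \<Rightarrow> 'n point set set" where
  "hyps k = (SOME P. finite P \<and> (\<forall>H\<in>P. hyperplane H) \<and> ifc N k \<subseteq> \<Union>P)"

lemma hyps:
  assumes "1 \<le> k"
  shows "finite (hyps k)" "\<And>H. H \<in> hyps k \<Longrightarrow> hyperplane H" "ifc N k \<subseteq> \<Union>(hyps k)"
proof -
  obtain P where P: "finite P" "ifc N k = \<Union>P" "\<forall>S\<in>P. \<exists>a b. a \<noteq> 0 \<and> S \<subseteq> {x. a \<bullet> x = b}"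
    using ifc_affine[OF assms] by (auto simp: piecewise_affine_def)
  have "\<forall>S\<in>P. \<exists>H. hyperplane H \<and> S \<subseteq> H"
  proof
    fix S assume "S \<in> P"
    then obtain a b where "a \<noteq> 0" "S \<subseteq> {x. a \<bullet> x = b}" using P(3) by blast
    then show "\<exists>H. hyperplane H \<and> S \<subseteq> H" unfolding hyperplane_def by blast
  qed
  from bchoice[OF this] obtain h where h: "\<forall>S\<in>P. hyperplane (h S) \<and> S \<subseteq> h S" by blast
  have "finite (h ` P) \<and> (\<forall>H\<in>h ` P. hyperplane H) \<and> ifc N k \<subseteq> \<Union>(h ` P)"
    using P h by blast
  then have "finite (hyps k) \<and> (\<forall>H\<in>hyps k. hyperplane H) \<and> ifc N k \<subseteq> \<Union>(hyps k)"
    unfolding hyps_def by (rule someI)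
  then show "finite (hyps k)" "\<And>H. H \<in> hyps k \<Longrightarrow> hyperplane H" "ifc N k \<subseteq> \<Union>(hyps k)" by auto
qed

definition hyps_upto :: "nat \<Rightarrow> 'n point set set" where
  "hyps_upto K = (\<Union>k\<in>{1..K}. hyps k)"

lemma hyps_upto:
  "finite (hyps_upto K)" "H \<in> hyps_upto K \<Longrightarrow> hyperplane H" "ifc_upto N K \<subseteq> \<Union>(hyps_upto K)"
proof -
  show "finite (hyps_upto K)" unfolding hyps_upto_def using hyps(1) by (intro finite_UN_I) auto
  show "H \<in> hyps_upto K \<Longrightarrow> hyperplane H" unfolding hyps_upto_def using hyps(2) by auto
  show "ifc_upto N K \<subseteq> \<Union>(hyps_upto K)"
  proof
    fix x assume "x \<in> ifc_upto N K"
    then obtain k where k: "1 \<le> k" "k \<le> K" "x \<in> ifc N k" by (auto simp: ifc_upto_def)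
    then obtain H where "H \<in> hyps k" "x \<in> H" using hyps(3)[of k] by blast
    then show "x \<in> \<Union>(hyps_upto K)" using k by (auto simp: hyps_upto_def)
  qed
qed

text \<open>The points of the network where the interface need not be locally flat.\<close>

definition bad :: "nat \<Rightarrow> 'n point set" where
  "bad K = {x \<in> region N. \<exists>H\<in>hyps_upto K. \<exists>H'\<in>hyps_upto K. H \<noteq> H' \<and> x \<in> H \<and> x \<in> H'}"

text \<open>Finitely many intersections of two distinct hyperplanes; the bounded region cuts each
  down to a set to which the grid argument applies.\<close>

lemma hausdorff_bad: "hausdorff_outer (CARD('n) - 1) (bad K) = 0"
proof -
  define P where "P = {(H, H'). H \<in> hyps_upto K \<and> H' \<in> hyps_upto K \<and> H \<noteq> H'}"
  have "P \<subseteq> hyps_upto K \<times> hyps_upto K" by (auto simp: P_def)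
  then have fin: "finite P" using hyps_upto(1) finite_subset by blast
  have eq: "bad K = (\<Union>p\<in>P. fst p \<inter> snd p \<inter> region N)"
    by (rule set_eqI) (unfold bad_def P_def UN_iff Bex_def split_paired_Ex mem_Collect_eq Int_iff prod.case fst_conv snd_conv, blast)
  have "hausdorff_outer (CARD('n) - 1) (bad K) \<le> (\<Sum>p\<in>P. hausdorff_outer (CARD('n) - 1) (fst p \<inter> snd p \<inter> region N))"
    unfolding eq by (rule outer_measure_space_finite_Union_le[OF outer_measure_space_hausdorff fin])
  also have "\<dots> = 0"
    by (intro sum.neutral ballI hausdorff_outer_hyperplane_Int domain) (auto simp: P_def hyps_upto)
  finally show ?thesis by simp
qed

section \<open>Connected sets in cells, and flatness of the interfaces at good points\<close>

lemma ifc_upto_subset: "ifc_upto N K \<subseteq> region N"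
  unfolding ifc_upto_def using ifc_subset by (intro UN_least) auto

lemma ifc_upto_mono: "K \<le> L \<Longrightarrow> ifc_upto N K \<subseteq> ifc_upto N L"
  unfolding ifc_upto_def by (intro UN_mono) auto

lemma ifc_upto_ifc_all: "ifc_upto N K \<subseteq> ifc_all N"
  by (auto simp: ifc_upto_def ifc_all_def)

lemma open_level: "1 \<le> K \<Longrightarrow> open (region N - ifc_upto N K)"
  using cells_Union[of K] cells_open[of K] by (metis open_Union)

lemma cell_subset: "1 \<le> K \<Longrightarrow> G \<in> cells N K \<Longrightarrow> G \<subseteq> region N - ifc_upto N K"
  using cells_Union by blast

text \<open>The cells are open and disjoint, so the cell of one point and the union of all others
  would separate a connected set that meets both.\<close>

lemma connected_in_cell:
  assumes K: "1 \<le> K" and C: "connected C" "C \<noteq> {}" "C \<subseteq> region N - ifc_upto N K"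
  obtains G where "G \<in> cells N K" "C \<subseteq> G"
proof -
  obtain x where x: "x \<in> C" using C by blast
  then obtain G where G: "G \<in> cells N K" "x \<in> G" using C(3) cells_Union[OF K] by blast
  define V where "V = \<Union>(cells N K - {G})"
  have "open G" "open V" using cells_open[OF K] G by (auto simp: V_def)
  moreover have "G \<inter> V \<inter> C = {}"
    using cells_disjoint[OF K] G by (auto simp: V_def disjoint_def)
  moreover have "C \<subseteq> G \<union> V" using C(3) cells_Union[OF K] by (auto simp: V_def)
  ultimately have "G \<inter> C = {} \<or> V \<inter> C = {}" by (rule connectedD[OF C(1)])
  then have "C \<subseteq> G" using x G \<open>C \<subseteq> G \<union> V\<close> by blast
  then show ?thesis using that G by blast
qed

lemma cell_coarsen:
  assumes "1 \<le> K" "K \<le> L" "G \<in> cells N L" "G \<noteq> {}"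
  obtains G' where "G' \<in> cells N K" "G \<subseteq> G'"
proof -
  have "connected G"
    using cells_simply_connected[of L G] assms simply_connected_imp_path_connected path_connected_imp_connected
    by auto
  moreover have "G \<subseteq> region N - ifc_upto N K"
    using cell_subset[of L G] ifc_upto_mono[of K L] assms by auto
  ultimately show ?thesis using connected_in_cell[of K G] assms that by blast
qed

text \<open>A gap of the interface inside a hyperplane would join both sides in one cell \<open>G\<close>, and then
  \<open>frontier G\<close> would meet the interior of \<open>closure G\<close>.\<close>

lemma interface_fills_hyperplane:
  assumes K: "1 \<le> K" and S: "open S" "convex S" "S \<subseteq> region N"
    and \<nu>: "\<nu> \<noteq> 0" and sub: "S \<inter> ifc_upto N K \<subseteq> {x. \<nu> \<bullet> x = \<beta>}" and \<xi>: "\<xi> \<in> S" "\<xi> \<in> ifc_upto N K"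
  shows "S \<inter> {x. \<nu> \<bullet> x = \<beta>} \<subseteq> ifc_upto N K"
proof (rule ccontr)
  assume "\<not> ?thesis"
  then obtain \<eta> where \<eta>: "\<eta> \<in> S" "\<nu> \<bullet> \<eta> = \<beta>" "\<eta> \<notin> ifc_upto N K" by auto
  have nn: "\<nu> \<bullet> \<nu> > 0" using \<nu> by simp
  have "open (S \<inter> (region N - ifc_upto N K))" using S open_level[OF K] by auto
  moreover have "\<eta> \<in> S \<inter> (region N - ifc_upto N K)" using \<eta> S by auto
  ultimately obtain s where s: "s > 0" "ball \<eta> s \<subseteq> S \<inter> (region N - ifc_upto N K)"
    using open_contains_ball by metis
  \<comment> \<open>The two sides of the hyperplane in \<open>S\<close>. Both are free of
    interfaces, and the ball around the gap \<open>\<eta>\<close> connects them.\<close>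
  define U where "U = S \<inter> {x. \<nu> \<bullet> x > \<beta>}"
  define V where "V = S \<inter> {x. \<nu> \<bullet> x < \<beta>}"
  have conv: "convex U" "convex V"
    unfolding U_def V_def using S by (auto intro!: convex_Int convex_halfspace_gt convex_halfspace_lt)
  define t where "t = s / (2 * norm \<nu>)"
  have t: "t > 0" using s \<nu> by (simp add: t_def)
  have "\<eta> + t *\<^sub>R \<nu> \<in> ball \<eta> s" "\<eta> - t *\<^sub>R \<nu> \<in> ball \<eta> s"
    using s \<nu> by (auto simp: dist_norm t_def)
  moreover have "\<nu> \<bullet> (\<eta> + t *\<^sub>R \<nu>) > \<beta>" "\<nu> \<bullet> (\<eta> - t *\<^sub>R \<nu>) < \<beta>"
    using \<eta> t nn by (auto simp: inner_add_right inner_diff_right)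
  ultimately have "\<eta> + t *\<^sub>R \<nu> \<in> U \<inter> ball \<eta> s" "\<eta> - t *\<^sub>R \<nu> \<in> V \<inter> ball \<eta> s"
    using s(2) unfolding U_def V_def by blast+
  then have meet: "U \<inter> ball \<eta> s \<noteq> {}" "V \<inter> ball \<eta> s \<noteq> {}" by blast+
  have "connected (U \<union> ball \<eta> s)"
    using conv meet by (intro connected_Un convex_connected) auto
  then have "connected ((U \<union> ball \<eta> s) \<union> V)"
    using conv meet by (intro connected_Un convex_connected) auto
  moreover have "(U \<union> ball \<eta> s) \<union> V \<subseteq> region N - ifc_upto N K"
    using sub S s by (auto simp: U_def V_def)
  moreover have "(U \<union> ball \<eta> s) \<union> V \<noteq> {}" using meet by auto
  ultimately obtain G where G: "G \<in> cells N K" "(U \<union> ball \<eta> s) \<union> V \<subseteq> G"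
    using connected_in_cell[OF K] by metis
  \<comment> \<open>A point on the hyperplane is approached from \<open>U\<close> along the normal,
    so the closure of the single cell contains the interface point \<open>\<xi>\<close> in its
    interior.\<close>
  have "S \<subseteq> closure G"
  proof
    fix x assume x: "x \<in> S"
    show "x \<in> closure G"
    proof (cases "\<nu> \<bullet> x = \<beta>")
      case False
      then have "x \<in> U \<union> V" using x by (auto simp: U_def V_def)
      then show ?thesis using G(2) closure_subset by blast
    next
      case True
      obtain e where e: "e > 0" "ball x e \<subseteq> S" using x S open_contains_ball by metis
      show ?thesis unfolding closure_approachable
      proof (intro allI impI)
        fix d :: real assume d: "d > 0"
        define y where "y = x + (min d e / (2 * norm \<nu>)) *\<^sub>R \<nu>"
        have "dist y x = min d e / 2" using d e \<nu> by (simp add: y_def dist_norm)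
        then have "dist y x < d" "y \<in> ball x e" using d e by (auto simp: dist_commute)
        moreover have "\<nu> \<bullet> y > \<beta>" using True d e nn \<nu> by (simp add: y_def inner_add_right)
        ultimately have "y \<in> U" "dist y x < d" using e by (auto simp: U_def)
        then show "\<exists>y\<in>G. dist y x < d" using G(2) by blast
      qed
    qed
  qed
  then have "\<xi> \<in> interior (closure G)" using S \<xi> interior_maximal by blast
  then have "\<xi> \<notin> frontier (closure G)" by (simp add: frontier_def)
  moreover have "\<xi> \<in> frontier G"
    using \<open>S \<subseteq> closure G\<close> \<xi> cell_subset[OF K G(1)] interior_subset[of G] by (auto simp: frontier_def)
  ultimately show False using cells_frontier[OF K G(1)] by simp
qed

lemma ifc_upto_ifc: "1 \<le> k \<Longrightarrow> k \<le> K \<Longrightarrow> ifc N k \<subseteq> ifc_upto N K"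
  by (auto simp: ifc_upto_def)

lemma ifc_disjointD: "1 \<le> k \<Longrightarrow> 1 \<le> j \<Longrightarrow> x \<in> ifc N k \<Longrightarrow> x \<in> ifc N j \<Longrightarrow> j = k"
  using ifc_disjoint by (auto simp: disjoint_family_on_def)

text \<open>Off \<open>bad K\<close> a single hyperplane passes through \<open>\<xi>\<close> and the
  others stay at positive distance, so the network near \<open>\<xi>\<close> lies in one hyperplane
  and fills it. Disjointness of the interfaces decides which of them does so.\<close>

lemma good_point:
  assumes k: "1 \<le> k" "k \<le> K" and \<xi>: "\<xi> \<in> ifc N k" "\<xi> \<notin> bad K"
  obtains \<nu> \<beta> r where "norm \<nu> = 1" "0 < \<nu> $ Min {i. \<nu> $ i \<noteq> 0}" "{x. \<nu> \<bullet> x = \<beta>} \<in> hyps_upto K"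
    "\<nu> \<bullet> \<xi> = \<beta>" "0 < r" "ball \<xi> r \<subseteq> region N"
    "ifc_upto N K \<inter> ball \<xi> r = {x \<in> ball \<xi> r. \<nu> \<bullet> x = \<beta>}"
    "ifc N k \<inter> ball \<xi> r = {x \<in> ball \<xi> r. \<nu> \<bullet> x = \<beta>}"
proof -
  have K: "1 \<le> K" using k by simp
  have \<xi>Q: "\<xi> \<in> region N" using ifc_subset k \<xi> by blast
  have \<xi>K: "\<xi> \<in> ifc_upto N K" using ifc_upto_ifc k \<xi> by blast
  then obtain H where H: "H \<in> hyps_upto K" "\<xi> \<in> H" using hyps_upto(3) by blast
  have uniq: "H' = H" if "H' \<in> hyps_upto K" "\<xi> \<in> H'" for H'
    using that H \<xi>(2) \<xi>Q by (auto simp: bad_def)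
  \<comment> \<open>The finitely many other hyperplanes form a closed set that avoids
    \<open>\<xi>\<close>; a small ball misses them all.\<close>
  define F where "F = \<Union>(hyps_upto K - {H})"
  have "closed F" unfolding F_def using hyps_upto(1)[of K] hyps_upto(2)[where K = K] closed_hyperplane' by (intro closed_Union) auto
  moreover have "\<xi> \<notin> F" using uniq by (auto simp: F_def)
  ultimately have "open (region N - F)" "\<xi> \<in> region N - F" using domain \<xi>Q by auto
  then obtain r where r: "r > 0" "ball \<xi> r \<subseteq> region N - F" using open_contains_ball by metis
  obtain \<nu> \<beta> where \<nu>: "norm \<nu> = 1" "0 < \<nu> $ Min {i. \<nu> $ i \<noteq> 0}" "H = {x. \<nu> \<bullet> x = \<beta>}"
    using hyperplane_oriented_normal hyps_upto(2) H by metis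
  have \<nu>0: "\<nu> \<noteq> 0" using \<nu>(1) by auto
  have sub: "ball \<xi> r \<inter> ifc_upto N K \<subseteq> H"
    using hyps_upto(3)[of K] r(2) by (auto simp: F_def)
  \<comment> \<open>Applied at any level \<open>j\<close> up to \<open>K\<close>: one point of that
    level in the ball already forces it to contain the whole disc.\<close>
  have fill: "ball \<xi> r \<inter> H \<subseteq> ifc_upto N j" if "1 \<le> j" "j \<le> K" "x \<in> ball \<xi> r" "x \<in> ifc_upto N j" for j x
    unfolding \<nu>(3)
    by (rule interface_fills_hyperplane[OF that(1), where \<xi> = x])
       (use that r sub ifc_upto_mono[of j K] \<nu>0 \<nu>(3) in auto)
  have 1: "ifc_upto N K \<inter> ball \<xi> r = {x \<in> ball \<xi> r. \<nu> \<bullet> x = \<beta>}"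
    using fill[OF K, of \<xi>] sub \<xi>K r \<nu>(3) by auto
  have "ball \<xi> r \<inter> H \<subseteq> ifc N k"
  proof
    fix x assume x: "x \<in> ball \<xi> r \<inter> H"
    have "ball \<xi> r \<inter> H \<subseteq> ifc_upto N k" using k \<xi> r ifc_upto_ifc[of k k] by (intro fill) auto
    then have "x \<in> ifc_upto N k" using x by blast
    then obtain j where j: "1 \<le> j" "j \<le> k" "x \<in> ifc N j" by (auto simp: ifc_upto_def)
    show "x \<in> ifc N k"
    proof (rule ccontr)
      assume "x \<notin> ifc N k"
      then have "j < k" using j by (metis le_neq_implies_less)
      \<comment> \<open>A disc point on an earlier interface would make the levels up to
        \<open>j\<close> fill the disc, and with it \<open>\<xi>\<close>, which belongs to
        \<open>ifc N k\<close> alone.\<close>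
      have "ball \<xi> r \<inter> H \<subseteq> ifc_upto N j"
        using x j k ifc_upto_ifc[of j j] by (intro fill[of j x]) auto
      then have "\<xi> \<in> ifc_upto N j" using H r by auto
      then obtain i where "1 \<le> i" "i \<le> j" "\<xi> \<in> ifc N i" by (auto simp: ifc_upto_def)
      then show False using ifc_disjointD[of k i \<xi>] k \<xi> \<open>j < k\<close> by simp
    qed
  qed
  then have 2: "ifc N k \<inter> ball \<xi> r = {x \<in> ball \<xi> r. \<nu> \<bullet> x = \<beta>}"
    using sub ifc_upto_ifc[OF k] \<nu>(3) by auto
  show ?thesis using that[of \<nu> \<beta> r] \<nu> H r 1 2 by auto
qed

end

section \<open>Surface measures\<close>

lemma space_surface_measure [simp]: "space (surface_measure S) = S"
  by (simp add: surface_measure_def space_restrict_space)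

lemma sets_surface_measure:
  fixes S :: "(real^'n) set"
  assumes "S \<in> sets borel"
  shows "A \<in> sets (surface_measure S) \<longleftrightarrow> A \<subseteq> S \<and> A \<in> sets (hausdorff_measure (CARD('n) - 1) :: (real^'n) measure)"
  unfolding surface_measure_def
  by (rule sets_restrict_space_iff) (simp add: borel_hausdorff_measurable assms)

lemma borel_Int_surface:
  fixes S :: "(real^'n) set"
  assumes "S \<in> sets borel"
  shows "S \<inter> space (hausdorff_measure (CARD('n) - 1) :: (real^'n) measure) \<in> sets (hausdorff_measure (CARD('n) - 1))"
  by (simp add: borel_hausdorff_measurable assms)

lemma surface_null:
  fixes S :: "(real^'n) set"
  assumes S: "S \<in> sets borel" and "A \<subseteq> S" "hausdorff_outer (CARD('n) - 1) A = 0"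
  shows "A \<in> null_sets (surface_measure S)"
proof -
  have A: "A \<in> null_sets (hausdorff_measure (CARD('n) - 1) :: (real^'n) measure)"
    using assms(3) by (rule hausdorff_null)
  then have "emeasure (surface_measure S) A = 0"
    unfolding surface_measure_def
    using emeasure_restrict_space[OF borel_Int_surface[OF S] assms(2)] by (simp add: null_sets_def)
  then show ?thesis using A assms by (auto simp: null_sets_def sets_surface_measure)
qed

lemma surface_AE_I:
  fixes S :: "(real^'n) set"
  assumes S: "S \<in> sets borel" and B: "hausdorff_outer (CARD('n) - 1) B = 0"
    and P: "\<And>x. x \<in> S \<Longrightarrow> x \<notin> B \<Longrightarrow> P x"
  shows "AE x in surface_measure S. P x"
proof (rule AE_I')
  have "hausdorff_outer (CARD('n) - 1) (B \<inter> S) = 0"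
    using hausdorff_outer_mono[of "B \<inter> S" B "CARD('n) - 1"] B by simp
  then show "B \<inter> S \<in> null_sets (surface_measure S)" using S by (intro surface_null) auto
  show "{x \<in> space (surface_measure S). \<not> P x} \<subseteq> B \<inter> S" using P by auto
qed

text \<open>Rests on completeness of the Hausdorff measure. Jumps have unspecified values at bad
  points, so identities for them can only be used up to a null set \<open>B\<close>.\<close>

lemma surface_measurable_cong:
  fixes S :: "(real^'n) set"
  assumes S: "S \<in> sets borel" and B: "hausdorff_outer (CARD('n) - 1) B = 0"
    and f: "f \<in> measurable (surface_measure S) M" and g: "\<And>x. x \<in> S \<Longrightarrow> g x \<in> space M"
    and eq: "\<And>x. x \<in> S \<Longrightarrow> x \<notin> B \<Longrightarrow> f x = g x"
  shows "g \<in> measurable (surface_measure S) M"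
proof (rule measurableI)
  fix A assume A: "A \<in> sets M"
  have null: "C \<in> sets (surface_measure S)" if "C \<subseteq> B \<inter> S" for C
  proof -
    have "hausdorff_outer (CARD('n) - 1) C = 0"
      using hausdorff_outer_mono[of C B "CARD('n) - 1"] B that by simp
    then show ?thesis using surface_null[OF S, of C] that by (auto simp: null_sets_def)
  qed
  have "g -` A \<inter> S = (f -` A \<inter> S - B \<inter> S) \<union> (g -` A \<inter> S \<inter> B)" using eq by auto
  also have "\<dots> \<in> sets (surface_measure S)"
    using measurable_sets[OF f A] null[of "B \<inter> S"] null[of "g -` A \<inter> S \<inter> B"] by auto
  finally show "g -` A \<inter> space (surface_measure S) \<in> sets (surface_measure S)" by simp
qed (use g in simp)

lemma surface_L2_cong:
  fixes S :: "(real^'n) set" and f g :: "_ \<Rightarrow> 'b::euclidean_space"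
  assumes S: "S \<in> sets borel" and B: "hausdorff_outer (CARD('n) - 1) B = 0"
    and f: "f \<in> L2 (surface_measure S)"
    and eq: "\<And>x. x \<in> S \<Longrightarrow> x \<notin> B \<Longrightarrow> f x = g x"
  shows "g \<in> L2 (surface_measure S)"
proof (rule L2_AE_cong[OF f])
  show "g \<in> borel_measurable (surface_measure S)"
    by (rule surface_measurable_cong[OF S B L2_D(1)[OF f]]) (use eq in auto)
  show "AE x in surface_measure S. f x = g x" by (rule surface_AE_I[OF S B eq])
qed

lemma L2_cong:
  fixes f g :: "'a \<Rightarrow> 'b::real_normed_vector"
  assumes "\<And>x. x \<in> space M \<Longrightarrow> f x = g x" and "f \<in> L2 M"
  shows "g \<in> L2 M"
proof -
  have "(\<lambda>x. (norm (g x))\<^sup>2) \<in> borel_measurable M \<longleftrightarrow> (\<lambda>x. (norm (f x))\<^sup>2) \<in> borel_measurable M"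
    by (rule measurable_cong) (simp add: assms)
  moreover have "g \<in> borel_measurable M \<longleftrightarrow> f \<in> borel_measurable M"
    by (rule measurable_cong) (simp add: assms)
  moreover have "integrable M (\<lambda>x. (norm (g x))\<^sup>2) \<longleftrightarrow> integrable M (\<lambda>x. (norm (f x))\<^sup>2)"
    by (rule Bochner_Integration.integrable_cong) (auto simp: assms)
  ultimately show ?thesis using assms(2) by (simp add: L2_def)
qed

section \<open>Gradients\<close>

lemma grad_eqI:
  assumes "GDERIV v x :> g" shows "grad v x = g"
  unfolding grad_def
proof (rule the_equality[where a = g])
  fix h assume "GDERIV v x :> h"
  then have "(\<lambda>y. y \<bullet> h) = (\<lambda>y. y \<bullet> g)"
    using assms has_derivative_unique unfolding gderiv_def by blast
  then have "(h - g) \<bullet> h = (h - g) \<bullet> g" by metis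
  then have "(h - g) \<bullet> (h - g) = 0" by (simp add: inner_diff_right)
  then show "h = g" by simp
qed (rule assms)

lemma GDERIV_scale:
  fixes f :: "'a::real_inner \<Rightarrow> real"
  assumes "GDERIV f x :> d" shows "GDERIV (\<lambda>y. c * f y) x :> c *\<^sub>R d"
  using has_derivative_mult_right[of f "\<lambda>h. h \<bullet> d" "at x" c] assms by (simp add: gderiv_def)

context network
begin

lemma C1_levelE:
  assumes "v \<in> C1_level N K" "G \<in> cells N K"
  obtains u g where "continuous_on (closure G) u" "continuous_on (closure G) g"
    "\<And>x. x \<in> closure G - ifc_upto N K \<Longrightarrow> v x = u x" "\<And>x. x \<in> G \<Longrightarrow> GDERIV v x :> g x"
proof -
  have "\<exists>u g. continuous_on (closure G) u \<and> continuous_on (closure G) g \<and>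
      (\<forall>x\<in>closure G - ifc_upto N K. v x = u x) \<and> (\<forall>x\<in>G. GDERIV v x :> g x)"
    by (rule bspec[OF conjunct1[OF assms(1)[unfolded C1_level_def mem_Collect_eq]] assms(2)])
  then obtain u g where *: "continuous_on (closure G) u" "continuous_on (closure G) g"
    "\<forall>x\<in>closure G - ifc_upto N K. v x = u x" "\<forall>x\<in>G. GDERIV v x :> g x" by (elim exE conjE)
  show ?thesis by (rule that[OF *(1,2) bspec[OF *(3)] bspec[OF *(4)]])
qed

lemma C1_GDERIV:
  assumes K: "1 \<le> K" and v: "v \<in> C1_level N K" and x: "x \<in> region N - ifc_upto N K"
  shows "GDERIV v x :> grad v x"
proof -
  obtain G where "G \<in> cells N K" "x \<in> G" using x cells_Union[OF K] by blast
  then obtain g where "GDERIV v x :> g" using C1_levelE[OF v] by metis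
  then show ?thesis using grad_eqI by metis
qed

lemma C1_continuous_grad:
  assumes K: "1 \<le> K" and v: "v \<in> C1_level N K"
  shows "continuous_on (region N - ifc_upto N K) (grad v)"
  unfolding cells_Union[OF K, symmetric]
proof (rule continuous_on_open_Union)
  fix G assume G: "G \<in> cells N K"
  then show "open G" using cells_open[OF K] by simp
  obtain u g where *: "continuous_on (closure G) u" "continuous_on (closure G) g"
    "\<And>x. x \<in> closure G - ifc_upto N K \<Longrightarrow> v x = u x" "\<And>x. x \<in> G \<Longrightarrow> GDERIV v x :> g x"
    by (rule C1_levelE[OF v G]) (rule that)
  have "continuous_on G g" by (rule continuous_on_subset[OF *(2) closure_subset])
  then show "continuous_on G (grad v)"
    by (rule continuous_on_eq) (simp add: grad_eqI[OF *(4)])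
qed

lemma C1_isCont:
  assumes "1 \<le> K" "v \<in> C1_level N K" "x \<in> region N - ifc_upto N K"
  shows "isCont v x"
  using C1_GDERIV[OF assms] has_derivative_continuous unfolding gderiv_def by blast

lemma C1_continuous:
  assumes "1 \<le> K" "v \<in> C1_level N K"
  shows "continuous_on (region N - ifc_upto N K) v"
  using C1_isCont[OF assms] continuous_at_imp_continuous_on by blast

lemma grad_add_C1:
  assumes "1 \<le> K" "v \<in> C1_level N K" "w \<in> C1_level N K" "x \<in> region N - ifc_upto N K"
  shows "grad (v + w) x = grad v x + grad w x"
  unfolding plus_fun_def using assms by (intro grad_eqI GDERIV_add C1_GDERIV)

lemma grad_scale_C1:
  assumes "1 \<le> K" "v \<in> C1_level N K" "x \<in> region N - ifc_upto N K"
  shows "grad (c *\<^sub>R v) x = c *\<^sub>R grad v x"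
  unfolding scaleR_fun_def real_scaleR_def using assms by (intro grad_eqI GDERIV_scale C1_GDERIV)

section \<open>One-sided limits and jumps\<close>

text \<open>The limits are taken along every direction on the correct side, because
  \<open>normal_jump\<close> looks along the normal while the Poincare argument crosses along a
  generic \<open>\<theta>\<close>. The hyperplane is returned so that transversality of
  \<open>\<theta>\<close> can be applied to it.\<close>

lemma jump_limits:
  assumes k: "1 \<le> k" "k \<le> K" and \<xi>: "\<xi> \<in> ifc N k" "\<xi> \<notin> bad K"
  obtains \<nu> \<beta> where "{x. \<nu> \<bullet> x = \<beta>} \<in> hyps_upto K" "\<nu> \<bullet> \<xi> = \<beta>" "\<nu> \<bullet> unit_normal (ifc N k) \<xi> > 0"
    "\<And>v. v \<in> C1_level N K \<Longrightarrow> \<exists>p m. normal_jump (ifc N k) v \<xi> = p - m \<and>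
       (\<forall>\<eta>. \<nu> \<bullet> \<eta> > 0 \<longrightarrow> ((\<lambda>s. v (\<xi> + s *\<^sub>R \<eta>)) \<longlongrightarrow> p) (at_right 0) \<and> ((\<lambda>s. v (\<xi> - s *\<^sub>R \<eta>)) \<longlongrightarrow> m) (at_right 0))"
proof -
  have K: "1 \<le> K" using k by simp
  obtain \<nu> \<beta> r where \<nu>: "norm \<nu> = 1" "0 < \<nu> $ Min {i. \<nu> $ i \<noteq> 0}" "{x. \<nu> \<bullet> x = \<beta>} \<in> hyps_upto K"
    "\<nu> \<bullet> \<xi> = \<beta>" and r: "0 < r" "ball \<xi> r \<subseteq> region N"
    and up: "ifc_upto N K \<inter> ball \<xi> r = {x \<in> ball \<xi> r. \<nu> \<bullet> x = \<beta>}"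
    and ifc: "ifc N k \<inter> ball \<xi> r = {x \<in> ball \<xi> r. \<nu> \<bullet> x = \<beta>}"
    using good_point[OF k \<xi>] by blast
  have "ifc N k \<inter> ball \<xi> r = {x \<in> ball \<xi> r. (x - \<xi>) \<bullet> \<nu> = 0}"
    unfolding ifc using \<nu>(4) by (auto simp: inner_diff_right inner_commute[of _ \<nu>])
  from unit_normal_eq[OF \<nu>(1,2) r(1) this] have un: "unit_normal (ifc N k) \<xi> = \<nu>" .
  have \<nu>\<nu>: "\<nu> \<bullet> \<nu> = 1" using \<nu>(1) by (simp add: norm_eq_1)
  \<comment> \<open>A half ball is convex and free of interfaces, hence lies in one cell; the limit
    is the value at \<open>\<xi>\<close> of the continuous extension from that cell, whatever the
    direction.\<close>
  have side: "\<exists>l. \<forall>\<eta>. \<mu> \<bullet> \<eta> > 0 \<longrightarrow> ((\<lambda>s. v (\<xi> + s *\<^sub>R \<eta>)) \<longlongrightarrow> l) (at_right 0)"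
    if v: "v \<in> C1_level N K" and \<mu>: "\<mu> = \<nu> \<or> \<mu> = - \<nu>" for v \<mu>
  proof -
    define U where "U = ball \<xi> r \<inter> {x. \<mu> \<bullet> x > \<mu> \<bullet> \<xi>}"
    have "convex U" unfolding U_def by (intro convex_Int convex_ball convex_halfspace_gt)
    moreover have "U \<subseteq> region N - ifc_upto N K"
    proof
      fix x assume x: "x \<in> U"
      then have "\<nu> \<bullet> x \<noteq> \<beta>" using \<mu> \<nu>(4) by (auto simp: U_def)
      then have "x \<notin> ifc_upto N K" using up x unfolding U_def by blast
      then show "x \<in> region N - ifc_upto N K" using r x by (auto simp: U_def)
    qed
    moreover have "\<xi> + (r / 2) *\<^sub>R \<mu> \<in> U"
      using r \<nu>(1) \<nu>\<nu> \<mu> by (auto simp: U_def dist_norm inner_add_right)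
    ultimately obtain G where G: "G \<in> cells N K" "U \<subseteq> G"
      using connected_in_cell[OF K, of U] convex_connected by blast
    obtain u g where u: "continuous_on (closure G) u" "\<And>x. x \<in> closure G - ifc_upto N K \<Longrightarrow> v x = u x"
      using C1_levelE[OF v G(1)] by metis
    have inU: "\<forall>\<^sub>F s in at_right 0. \<xi> + s *\<^sub>R \<eta> \<in> U" if \<eta>: "\<mu> \<bullet> \<eta> > 0" for \<eta>
    proof -
      define n where "n = norm \<eta> + 1"
      have n: "n > 0" "norm \<eta> < n" by (auto simp: n_def add_nonneg_pos)
      have "\<forall>\<^sub>F s in at_right 0. (0::real) < s \<and> s < r / n"
        using r n by (auto simp: eventually_at_right_field intro!: exI[of _ "r / n"])
      then show ?thesis
      proof eventually_elim
        case (elim s)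
        have "s * norm \<eta> \<le> s * n" using elim n by (intro mult_left_mono) auto
        also have "\<dots> < r" using elim n by (simp add: field_simps)
        finally show ?case using elim \<eta> by (auto simp: U_def dist_norm inner_add_right)
      qed
    qed
    have "\<xi> \<in> closure G"
    proof -
      have "((\<lambda>s. \<xi> + s *\<^sub>R \<mu>) \<longlongrightarrow> \<xi> + 0 *\<^sub>R \<mu>) (at_right 0)" by (intro tendsto_intros)
      then have lim: "((\<lambda>s. \<xi> + s *\<^sub>R \<mu>) \<longlongrightarrow> \<xi>) (at_right 0)" by simp
      have "\<mu> \<bullet> \<mu> > 0" using \<mu> \<nu>\<nu> by auto
      from inU[OF this] have "\<forall>\<^sub>F s in at_right 0. \<xi> + s *\<^sub>R \<mu> \<in> closure G"
        by (rule eventually_mono) (use G(2) closure_subset in blast)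
      then show ?thesis using lim by (intro Lim_in_closed_set[of "closure G"]) auto
    qed
    have "((\<lambda>s. v (\<xi> + s *\<^sub>R \<eta>)) \<longlongrightarrow> u \<xi>) (at_right 0)" if \<eta>: "\<mu> \<bullet> \<eta> > 0" for \<eta>
    proof -
      have "((\<lambda>s. \<xi> + s *\<^sub>R \<eta>) \<longlongrightarrow> \<xi> + 0 *\<^sub>R \<eta>) (at_right 0)" by (intro tendsto_intros)
      then have lim: "((\<lambda>s. \<xi> + s *\<^sub>R \<eta>) \<longlongrightarrow> \<xi>) (at_right 0)" by simp
      have "\<forall>\<^sub>F s in at_right 0. \<xi> + s *\<^sub>R \<eta> \<in> closure G"
        using inU[OF \<eta>] by (rule eventually_mono) (use G(2) closure_subset in blast)
      from continuous_on_tendsto_compose[OF u(1) lim \<open>\<xi> \<in> closure G\<close> this]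
      have "((\<lambda>s. u (\<xi> + s *\<^sub>R \<eta>)) \<longlongrightarrow> u \<xi>) (at_right 0)" .
      moreover have "\<forall>\<^sub>F s in at_right 0. u (\<xi> + s *\<^sub>R \<eta>) = v (\<xi> + s *\<^sub>R \<eta>)"
        using inU[OF \<eta>]
      proof eventually_elim
        case (elim s)
        then have "\<xi> + s *\<^sub>R \<eta> \<in> G" using G(2) by blast
        then have "\<xi> + s *\<^sub>R \<eta> \<in> closure G - ifc_upto N K"
          using cell_subset[OF K G(1)] closure_subset by blast
        then show ?case using u(2) by simp
      qed
      ultimately show ?thesis by (rule Lim_transform_eventually)
    qed
    then show ?thesis by blast
  qed
  show ?thesis
  proof (rule that[OF \<nu>(3,4)])
    show "\<nu> \<bullet> unit_normal (ifc N k) \<xi> > 0" unfolding un using \<nu>\<nu> by simp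
    fix v assume v: "v \<in> C1_level N K"
    obtain p where p: "\<And>\<eta>. \<nu> \<bullet> \<eta> > 0 \<Longrightarrow> ((\<lambda>s. v (\<xi> + s *\<^sub>R \<eta>)) \<longlongrightarrow> p) (at_right 0)"
      using side[OF v, of \<nu>] by blast
    obtain m where m: "\<And>\<eta>. - \<nu> \<bullet> \<eta> > 0 \<Longrightarrow> ((\<lambda>s. v (\<xi> + s *\<^sub>R \<eta>)) \<longlongrightarrow> m) (at_right 0)"
      using side[OF v, of "- \<nu>"] by blast
    have m': "((\<lambda>s. v (\<xi> - s *\<^sub>R \<eta>)) \<longlongrightarrow> m) (at_right 0)" if "\<nu> \<bullet> \<eta> > 0" for \<eta>
      using m[of "- \<eta>"] that by simp
    have "((\<lambda>s. v (\<xi> + s *\<^sub>R \<nu>) - v (\<xi> - s *\<^sub>R \<nu>)) \<longlongrightarrow> p - m) (at_right 0)"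
      using p[of \<nu>] m'[of \<nu>] \<nu>\<nu> by (intro tendsto_diff) auto
    then have "normal_jump (ifc N k) v \<xi> = p - m"
      unfolding normal_jump_def un by (intro tendsto_Lim) auto
    then show "\<exists>p m. normal_jump (ifc N k) v \<xi> = p - m \<and>
       (\<forall>\<eta>. \<nu> \<bullet> \<eta> > 0 \<longrightarrow> ((\<lambda>s. v (\<xi> + s *\<^sub>R \<eta>)) \<longlongrightarrow> p) (at_right 0) \<and> ((\<lambda>s. v (\<xi> - s *\<^sub>R \<eta>)) \<longlongrightarrow> m) (at_right 0))"
      using p m' by blast
  qed
qed

lemma normal_jump_tendsto:
  assumes k: "1 \<le> k" "k \<le> K" and \<xi>: "\<xi> \<in> ifc N k" "\<xi> \<notin> bad K" and v: "v \<in> C1_level N K"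
  shows "((\<lambda>s. v (\<xi> + s *\<^sub>R unit_normal (ifc N k) \<xi>) - v (\<xi> - s *\<^sub>R unit_normal (ifc N k) \<xi>))
    \<longlongrightarrow> normal_jump (ifc N k) v \<xi>) (at_right 0)"
proof -
  obtain \<nu> \<beta> where \<nu>: "\<nu> \<bullet> unit_normal (ifc N k) \<xi> > 0"
    "\<And>v. v \<in> C1_level N K \<Longrightarrow> \<exists>p m. normal_jump (ifc N k) v \<xi> = p - m \<and>
       (\<forall>\<eta>. \<nu> \<bullet> \<eta> > 0 \<longrightarrow> ((\<lambda>s. v (\<xi> + s *\<^sub>R \<eta>)) \<longlongrightarrow> p) (at_right 0) \<and> ((\<lambda>s. v (\<xi> - s *\<^sub>R \<eta>)) \<longlongrightarrow> m) (at_right 0))"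
    by (rule jump_limits[OF k \<xi>]) (blast intro: that)
  obtain p m where pm: "normal_jump (ifc N k) v \<xi> = p - m"
    "\<And>\<eta>. \<nu> \<bullet> \<eta> > 0 \<Longrightarrow> ((\<lambda>s. v (\<xi> + s *\<^sub>R \<eta>)) \<longlongrightarrow> p) (at_right 0)"
    "\<And>\<eta>. \<nu> \<bullet> \<eta> > 0 \<Longrightarrow> ((\<lambda>s. v (\<xi> - s *\<^sub>R \<eta>)) \<longlongrightarrow> m) (at_right 0)"
    using \<nu>(2)[OF v] by blast
  show ?thesis unfolding pm(1) by (intro tendsto_diff pm \<nu>(1))
qed

lemma normal_jump_add:
  assumes k: "1 \<le> k" "k \<le> K" and \<xi>: "\<xi> \<in> ifc N k" "\<xi> \<notin> bad K"
    and v: "v \<in> C1_level N K" and w: "w \<in> C1_level N K"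
  shows "normal_jump (ifc N k) (v + w) \<xi> = normal_jump (ifc N k) v \<xi> + normal_jump (ifc N k) w \<xi>"
  unfolding normal_jump_def[of _ "v + w"]
  by (rule tendsto_Lim, simp)
     (use tendsto_add[OF normal_jump_tendsto[OF k \<xi> v] normal_jump_tendsto[OF k \<xi> w]] in \<open>simp add: algebra_simps\<close>)

lemma normal_jump_scale:
  assumes k: "1 \<le> k" "k \<le> K" and \<xi>: "\<xi> \<in> ifc N k" "\<xi> \<notin> bad K"
    and v: "v \<in> C1_level N K"
  shows "normal_jump (ifc N k) (c *\<^sub>R v) \<xi> = c * normal_jump (ifc N k) v \<xi>"
  unfolding normal_jump_def[of _ "c *\<^sub>R v"]
  by (rule tendsto_Lim, simp)
     (use tendsto_mult_left[OF normal_jump_tendsto[OF k \<xi> v], of c] in \<open>simp add: right_diff_distrib\<close>)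

text \<open>\<open>v\<close> is continuous at points of later interfaces, so both sides agree along
  any direction. The result therefore holds at every point, bad ones included.\<close>

lemma normal_jump_higher:
  assumes K: "1 \<le> K" "K < k" and \<xi>: "\<xi> \<in> ifc N k" and v: "v \<in> C1_level N K"
  shows "normal_jump (ifc N k) v \<xi> = 0"
proof -
  have k: "1 \<le> k" using K by simp
  have "\<xi> \<in> region N" using ifc_subset[OF k] \<xi> by blast
  moreover have "\<xi> \<notin> ifc_upto N K"
  proof
    assume "\<xi> \<in> ifc_upto N K"
    then obtain j where "1 \<le> j" "j \<le> K" "\<xi> \<in> ifc N j" unfolding ifc_upto_def by auto
    then show False using ifc_disjointD[OF k, of j \<xi>] K \<xi> by simp
  qed
  ultimately have cont: "isCont v \<xi>" using C1_isCont[OF K(1) v] by blast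
  let ?\<nu> = "unit_normal (ifc N k) \<xi>"
  have lim: "((\<lambda>s. v (\<xi> + s *\<^sub>R \<eta>)) \<longlongrightarrow> v \<xi>) (at_right 0)" for \<eta>
  proof -
    have "((\<lambda>s. \<xi> + s *\<^sub>R \<eta>) \<longlongrightarrow> \<xi> + 0 *\<^sub>R \<eta>) (at_right 0)" by (intro tendsto_intros)
    then show ?thesis using isCont_tendsto_compose[OF cont] by simp
  qed
  have "((\<lambda>s. v (\<xi> + s *\<^sub>R ?\<nu>) - v (\<xi> - s *\<^sub>R ?\<nu>)) \<longlongrightarrow> v \<xi> - v \<xi>) (at_right 0)"
    using lim[of ?\<nu>] lim[of "- ?\<nu>"] by (intro tendsto_diff) auto
  then show ?thesis unfolding normal_jump_def by (intro tendsto_Lim) auto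
qed

section \<open>The spaces of piecewise smooth functions\<close>

lemma region_borel: "region N \<in> sets borel"
  using domain by simp

text \<open>A difference of two open sets, since the cells are open. Individual interfaces are then
  recovered in \<open>ifc_borel\<close> as differences of consecutive unions.\<close>

lemma ifc_upto_borel: "ifc_upto N K \<in> sets borel"
proof (cases "1 \<le> K")
  case True
  have "ifc_upto N K = region N - (region N - ifc_upto N K)" using ifc_upto_subset[of K] by auto
  then show ?thesis using open_level[OF True] region_borel by (metis borel_open sets.Diff)
qed (simp add: ifc_upto_def)

lemma ifc_borel:
  assumes k: "1 \<le> k" shows "ifc N k \<in> sets borel"
proof -
  have "ifc N k = ifc_upto N k - ifc_upto N (k - 1)"
  proof (intro set_eqI iffI)
    fix x assume x: "x \<in> ifc N k"
    have "x \<notin> ifc N j" if "1 \<le> j" "j \<le> k - 1" for j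
      using ifc_disjointD[of k j x] that x k by auto
    then show "x \<in> ifc_upto N k - ifc_upto N (k - 1)" using x k by (auto simp: ifc_upto_def)
  next
    fix x assume x: "x \<in> ifc_upto N k - ifc_upto N (k - 1)"
    then obtain j where j: "1 \<le> j" "j \<le> k" "x \<in> ifc N j" by (auto simp: ifc_upto_def)
    then have "\<not> j \<le> k - 1" using x by (auto simp: ifc_upto_def)
    then show "x \<in> ifc N k" using j by (metis Suc_pred' assms le_SucE less_eq_Suc_le One_nat_def)
  qed
  then show ?thesis using ifc_upto_borel by auto
qed

lemma ifc_all_borel: "ifc_all N \<in> sets borel"
  unfolding ifc_all_def using ifc_borel by (intro sets.countable_UN') auto

lemma negligible_ifc_all: "negligible (ifc_all N)"
proof -
  have "negligible (ifc N k)" if k: "1 \<le> k" for k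
  proof (rule negligible_subset[OF _ hyps(3)[OF k]])
    show "negligible (\<Union>(hyps k))"
    proof (rule negligible_Union[OF hyps(1)[OF k]])
      fix H assume "H \<in> hyps k"
      then obtain a b where "a \<noteq> 0" "H = {x. a \<bullet> x = b}"
        using hyps(2)[OF k] unfolding hyperplane_def by blast
      then show "negligible H" using negligible_hyperplane[of a b] by simp
    qed
  qed
  then have "negligible (\<Union>(ifc N ` {1..}))" by (intro negligible_countable_Union) auto
  then show ?thesis by (simp add: ifc_all_def)
qed

lemma C1_L2_grad: "v \<in> C1_level N K \<Longrightarrow> grad v \<in> L2 (lebesgue_on (region N - ifc_upto N K))"
  and C1_L2_jump: "v \<in> C1_level N K \<Longrightarrow> 1 \<le> k \<Longrightarrow> k \<le> K \<Longrightarrow> normal_jump (ifc N k) v \<in> L2 (surface_measure (ifc N k))"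
  and C1_boundary: "v \<in> C1_level N K \<Longrightarrow> x \<in> frontier (region N) \<Longrightarrow> v x = 0"
  by (auto simp: C1_level_def)

text \<open>Jumps are linear off \<open>bad K\<close>, so the L2 condition on jumps is transported
  by \<open>surface_L2_cong\<close> rather than by equality.\<close>

lemma subspace_C1_level:
  assumes K: "1 \<le> K" shows "subspace (C1_level N K)"
proof (rule subspaceI)
  have g0: "grad (0 :: 'n point \<Rightarrow> real) = 0"
  proof
    fix x :: "'n point"
    have "GDERIV (\<lambda>x. 0) x :> 0" by (rule GDERIV_const)
    from grad_eqI[OF this] show "grad 0 x = 0 x" by (simp add: zero_fun_def)
  qed
  have j0: "normal_jump (ifc N k) 0 = 0" for k
    unfolding normal_jump_def by (auto simp: zero_fun_def intro!: tendsto_Lim)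
  show "0 \<in> C1_level N K"
    unfolding C1_level_def mem_Collect_eq g0 j0
    using GDERIV_const[of 0]
    by (auto simp: subspace_0[OF subspace_L2, unfolded zero_fun_def] zero_fun_def intro!: exI[of _ "\<lambda>_. 0"])
  fix v w and c :: real
  assume v: "v \<in> C1_level N K"
  show "c *\<^sub>R v \<in> C1_level N K"
    unfolding C1_level_def mem_Collect_eq
  proof (intro conjI ballI)
    fix G assume G: "G \<in> cells N K"
    obtain u g where "continuous_on (closure G) u" "continuous_on (closure G) g"
      "\<And>x. x \<in> closure G - ifc_upto N K \<Longrightarrow> v x = u x" "\<And>x. x \<in> G \<Longrightarrow> GDERIV v x :> g x"
      by (rule C1_levelE[OF v G]) (rule that)
    then show "\<exists>u g. continuous_on (closure G) u \<and> continuous_on (closure G) g \<and>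
        (\<forall>x\<in>closure G - ifc_upto N K. (c *\<^sub>R v) x = u x) \<and> (\<forall>x\<in>G. GDERIV (c *\<^sub>R v) x :> g x)"
      unfolding scaleR_fun_def real_scaleR_def
      by (intro exI[of _ "\<lambda>x. c * u x"] exI[of _ "\<lambda>x. c *\<^sub>R g x"]) (auto intro!: continuous_intros GDERIV_scale)
  next
    fix x assume "x \<in> frontier (region N)"
    then show "(c *\<^sub>R v) x = 0" using C1_boundary[OF v] by simp
  next
    show "grad (c *\<^sub>R v) \<in> L2 (lebesgue_on (region N - ifc_upto N K))"
      by (rule L2_cong[of _ "c *\<^sub>R grad v"])
         (use subspace_scale[OF subspace_L2 C1_L2_grad[OF v]] grad_scale_C1[OF K v] in auto)
  next
    fix k assume k: "k \<in> {1..K}"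
    show "normal_jump (ifc N k) (c *\<^sub>R v) \<in> L2 (surface_measure (ifc N k))"
      by (rule surface_L2_cong[OF ifc_borel hausdorff_bad[of K], of k "c *\<^sub>R normal_jump (ifc N k) v"])
         (use k subspace_scale[OF subspace_L2 C1_L2_jump[OF v, of k]] normal_jump_scale[OF _ _ _ _ v, of k] in auto)
  qed
  assume w: "w \<in> C1_level N K"
  show "v + w \<in> C1_level N K"
    unfolding C1_level_def mem_Collect_eq
  proof (intro conjI ballI)
    fix G assume G: "G \<in> cells N K"
    obtain u g where "continuous_on (closure G) u" "continuous_on (closure G) g"
      "\<And>x. x \<in> closure G - ifc_upto N K \<Longrightarrow> v x = u x" "\<And>x. x \<in> G \<Longrightarrow> GDERIV v x :> g x"
      by (rule C1_levelE[OF v G]) (rule that)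
    moreover obtain u' g' where "continuous_on (closure G) u'" "continuous_on (closure G) g'"
      "\<And>x. x \<in> closure G - ifc_upto N K \<Longrightarrow> w x = u' x" "\<And>x. x \<in> G \<Longrightarrow> GDERIV w x :> g' x"
      by (rule C1_levelE[OF w G]) (rule that)
    ultimately show "\<exists>u g. continuous_on (closure G) u \<and> continuous_on (closure G) g \<and>
        (\<forall>x\<in>closure G - ifc_upto N K. (v + w) x = u x) \<and> (\<forall>x\<in>G. GDERIV (v + w) x :> g x)"
      unfolding plus_fun_def
      by (intro exI[of _ "\<lambda>x. u x + u' x"] exI[of _ "\<lambda>x. g x + g' x"]) (auto intro!: continuous_intros GDERIV_add)
  next
    fix x assume "x \<in> frontier (region N)"
    then show "(v + w) x = 0" using C1_boundary[OF v] C1_boundary[OF w] by simp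
  next
    show "grad (v + w) \<in> L2 (lebesgue_on (region N - ifc_upto N K))"
      by (rule L2_cong[of _ "grad v + grad w"])
         (use subspace_add[OF subspace_L2 C1_L2_grad[OF v] C1_L2_grad[OF w]] grad_add_C1[OF K v w] in auto)
  next
    fix k assume k: "k \<in> {1..K}"
    show "normal_jump (ifc N k) (v + w) \<in> L2 (surface_measure (ifc N k))"
      by (rule surface_L2_cong[OF ifc_borel hausdorff_bad[of K], of k "normal_jump (ifc N k) v + normal_jump (ifc N k) w"])
         (use k subspace_add[OF subspace_L2 C1_L2_jump[OF v, of k] C1_L2_jump[OF w, of k]]
            normal_jump_add[OF _ _ _ _ v w, of k] in auto)
  qed
qed

lemma L2_restrict:
  fixes f :: "'a \<Rightarrow> 'b::euclidean_space"
  assumes f: "f \<in> L2 (restrict_space M A)" and A: "A \<in> sets M" and B: "B \<in> sets M" "B \<subseteq> A"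
  shows "f \<in> L2 (restrict_space M B)"
proof (rule L2_I_nn)
  show "f \<in> borel_measurable (restrict_space M B)"
    using measurable_restrict_mono[OF L2_D(1)[OF f] B(2)] .
  have "A \<inter> space M \<in> sets M" "B \<inter> space M \<in> sets M" using A B by auto
  note rs = this[THEN nn_integral_restrict_space]
  have "(\<integral>\<^sup>+x. ennreal ((norm (f x))\<^sup>2) \<partial>restrict_space M B) \<le> (\<integral>\<^sup>+x. ennreal ((norm (f x))\<^sup>2) \<partial>restrict_space M A)"
    unfolding rs using B(2) by (intro nn_integral_mono) (auto simp: indicator_def)
  also have "\<dots> < \<infinity>" using L2_D(2)[OF f] by (simp add: integrable_iff_bounded)
  finally show "(\<integral>\<^sup>+x. ennreal ((norm (f x))\<^sup>2) \<partial>restrict_space M B) < \<infinity>" .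
qed

lemma level_lebesgue: "region N - ifc_upto N K \<in> sets lebesgue" "region N - ifc_all N \<in> sets lebesgue"
  using region_borel ifc_upto_borel ifc_all_borel by auto

text \<open>Every nonempty finer cell lies in a coarser one and inherits its continuous extensions;
  the jumps across newly added interfaces vanish.\<close>

lemma C1_level_mono:
  assumes K: "1 \<le> K" and KL: "K \<le> L" shows "C1_level N K \<subseteq> C1_level N L"
proof
  fix v assume v: "v \<in> C1_level N K"
  show "v \<in> C1_level N L"
    unfolding C1_level_def mem_Collect_eq
  proof (intro conjI ballI)
    fix G assume G: "G \<in> cells N L"
    show "\<exists>u g. continuous_on (closure G) u \<and> continuous_on (closure G) g \<and>
        (\<forall>x\<in>closure G - ifc_upto N L. v x = u x) \<and> (\<forall>x\<in>G. GDERIV v x :> g x)"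
    proof (cases "G = {}")
      case False
      obtain G' where G': "G' \<in> cells N K" "G \<subseteq> G'" using cell_coarsen[OF K KL G False] .
      obtain u g where ug: "continuous_on (closure G') u" "continuous_on (closure G') g"
        "\<And>x. x \<in> closure G' - ifc_upto N K \<Longrightarrow> v x = u x" "\<And>x. x \<in> G' \<Longrightarrow> GDERIV v x :> g x"
        by (rule C1_levelE[OF v G'(1)]) (rule that)
      have "closure G \<subseteq> closure G'" using G'(2) by (rule closure_mono)
      show ?thesis
      proof (intro exI conjI ballI)
        show "continuous_on (closure G) u" "continuous_on (closure G) g"
          using ug(1,2) \<open>closure G \<subseteq> closure G'\<close> by (auto intro: continuous_on_subset)
        fix x assume "x \<in> closure G - ifc_upto N L"
        then show "v x = u x"
          using \<open>closure G \<subseteq> closure G'\<close> ifc_upto_mono[OF KL] by (intro ug(3)) auto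
      next
        fix x assume "x \<in> G"
        then show "GDERIV v x :> g x" using G'(2) by (intro ug(4)) auto
      qed
    qed auto
  next
    fix x assume "x \<in> frontier (region N)"
    then show "v x = 0" using C1_boundary[OF v] by simp
  next
    show "grad v \<in> L2 (lebesgue_on (region N - ifc_upto N L))"
      using ifc_upto_mono[OF KL] by (intro L2_restrict[OF C1_L2_grad[OF v]] level_lebesgue) auto
  next
    fix k assume k: "k \<in> {1..L}"
    show "normal_jump (ifc N k) v \<in> L2 (surface_measure (ifc N k))"
    proof (cases "k \<le> K")
      case True
      then show ?thesis using C1_L2_jump[OF v] k by simp
    next
      case False
      show ?thesis
        by (rule L2_cong[of _ 0]) (use False normal_jump_higher[OF K _ _ v, of k] subspace_0[OF subspace_L2] in auto)
    qed
  qed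
qed

lemma C1_union_level:
  assumes "v \<in> C1_union N" shows "1 \<le> level N v" "v \<in> C1_level N (level N v)"
proof -
  have "1 \<le> level N v \<and> v \<in> C1_level N (level N v)"
    unfolding level_def by (rule LeastI_ex) (use assms in \<open>auto simp: C1_union_def\<close>)
  then show "1 \<le> level N v" "v \<in> C1_level N (level N v)" by auto
qed

lemma C1_level_union: "1 \<le> K \<Longrightarrow> C1_level N K \<subseteq> C1_union N"
  by (auto simp: C1_union_def)

lemma C1_union_common:
  assumes "v \<in> C1_union N" "w \<in> C1_union N"
  shows "1 \<le> max (level N v) (level N w)" "v \<in> C1_level N (max (level N v) (level N w))"
    "w \<in> C1_level N (max (level N v) (level N w))"
  using C1_union_level[OF assms(1)] C1_union_level[OF assms(2)]
    C1_level_mono[of "level N v" "max (level N v) (level N w)"]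
    C1_level_mono[of "level N w" "max (level N v) (level N w)"] by auto

lemma subspace_C1_union: "subspace (C1_union N)"
proof (rule subspaceI)
  have "0 \<in> C1_level N 1" by (rule subspace_0[OF subspace_C1_level]) simp
  then show "0 \<in> C1_union N" using C1_level_union[of 1] by auto
  fix v w and c :: real
  assume v: "v \<in> C1_union N"
  show "c *\<^sub>R v \<in> C1_union N"
    using subspace_scale[OF subspace_C1_level C1_union_level(2)[OF v]] C1_union_level[OF v] C1_level_union by blast
  assume w: "w \<in> C1_union N"
  show "v + w \<in> C1_union N"
    using subspace_add[OF subspace_C1_level C1_union_common(2,3)[OF v w]] C1_union_common(1)[OF v w] C1_level_union by blast
qed

end

section \<open>One-dimensional preliminaries\<close>

text \<open>Induction on the largest break point: the induction hypothesis covers the interval to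
  its left, and none remain to its right. At the break points \<open>f\<close> enters through its
  one-sided limits.\<close>

lemma piecewise_fundamental_theorem:
  fixes f :: "real \<Rightarrow> real"
  assumes F: "finite F" and "a < b" "F \<subseteq> {a<..<b}"
    and "\<And>t. t \<in> {a<..<b} - F \<Longrightarrow> (f has_real_derivative f' t) (at t)"
    and "(f \<longlongrightarrow> La) (at_right a)" "(f \<longlongrightarrow> Lb) (at_left b)"
    and "\<And>s. s \<in> F \<Longrightarrow> (f \<longlongrightarrow> l s) (at_left s)" "\<And>s. s \<in> F \<Longrightarrow> (f \<longlongrightarrow> r s) (at_right s)"
  shows "(f' has_integral (Lb - La - (\<Sum>s\<in>F. r s - l s))) {a..b}"
  using assms
proof (induction F arbitrary: b Lb rule: finite_linorder_max_induct)
  case (empty b Lb)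
  \<comment> \<open>The end values are replaced by the one-sided limits, which makes the function
    continuous on the closed interval.\<close>
  define g where "g t = (if t \<le> a then La else if b \<le> t then Lb else f t)" for t
  have ev: "\<forall>\<^sub>F t in at_right a. g t = f t" "\<forall>\<^sub>F t in at_left b. g t = f t"
    unfolding eventually_at_right_field eventually_at_left_field
    by (rule exI[of _ b], use \<open>a < b\<close> in \<open>simp add: g_def\<close>)
       (rule exI[of _ a], use \<open>a < b\<close> in \<open>simp add: g_def\<close>)
  have near: "\<forall>\<^sub>F s in nhds t. g s = f s" if "a < t" "t < b" for t
    unfolding eventually_nhds using that by (intro exI[of _ "{a<..<b}"]) (auto simp: g_def)
  have deriv: "(g has_real_derivative f' t) (at t)" if "a < t" "t < b" for t
    using empty(3)[of t] that DERIV_cong_ev[OF refl near[OF that] refl] by simp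
  have "continuous_on {a..b} g"
  proof (rule continuous_on_IccI)
    have "(f \<longlongrightarrow> g a) (at_right a)" using empty by (simp add: g_def)
    then show "(g \<longlongrightarrow> g a) (at_right a)" using ev(1) by (simp add: tendsto_cong)
    have "(f \<longlongrightarrow> g b) (at_left b)" using empty by (simp add: g_def)
    then show "(g \<longlongrightarrow> g b) (at_left b)" using ev(2) by (simp add: tendsto_cong)
    show "g \<midarrow>x\<rightarrow> g x" if "a < x" "x < b" for x
      using DERIV_isCont[OF deriv[OF that]] by (simp add: isCont_def)
  qed (rule \<open>a < b\<close>)
  then have "(f' has_integral (g b - g a)) {a..b}"
    using \<open>a < b\<close> deriv
    by (intro fundamental_theorem_of_calculus_interior) (auto simp: has_real_derivative_iff_has_vector_derivative)
  then show ?case using \<open>a < b\<close> by (simp add: g_def)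
next
  case (insert s F b Lb)
  have s: "a < s" "s < b" using insert by auto
  have "(f' has_integral (l s - La - (\<Sum>s\<in>F. r s - l s))) {a..s}"
  proof (rule insert.IH)
    show "F \<subseteq> {a<..<s}" using insert by auto
    show "(f has_real_derivative f' t) (at t)" if "t \<in> {a<..<s} - F" for t
      using that s by (intro insert) auto
  qed (use insert s in auto)
  moreover have "(f' has_integral (Lb - r s)) {s..b}"
  proof -
    define g where "g t = (if t \<le> s then r s else if b \<le> t then Lb else f t)" for t
    have ev: "\<forall>\<^sub>F t in at_right s. g t = f t" "\<forall>\<^sub>F t in at_left b. g t = f t"
      unfolding eventually_at_right_field eventually_at_left_field
      by (rule exI[of _ b], use \<open>s < b\<close> in \<open>simp add: g_def\<close>)
         (rule exI[of _ s], use \<open>s < b\<close> in \<open>simp add: g_def\<close>)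
    have near: "\<forall>\<^sub>F u in nhds t. g u = f u" if "s < t" "t < b" for t
      unfolding eventually_nhds using that by (intro exI[of _ "{s<..<b}"]) (auto simp: g_def)
    have deriv: "(g has_real_derivative f' t) (at t)" if "s < t" "t < b" for t
    proof -
      have "(f has_real_derivative f' t) (at t)" using that s insert(2) by (intro insert) auto
      then show ?thesis using DERIV_cong_ev[OF refl near[OF that] refl] by simp
    qed
    have "continuous_on {s..b} g"
    proof (rule continuous_on_IccI)
      have "(f \<longlongrightarrow> g s) (at_right s)" using insert by (simp add: g_def)
      then show "(g \<longlongrightarrow> g s) (at_right s)" using ev(1) by (simp add: tendsto_cong)
      have "(f \<longlongrightarrow> g b) (at_left b)" using insert s by (simp add: g_def)
      then show "(g \<longlongrightarrow> g b) (at_left b)" using ev(2) by (simp add: tendsto_cong)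
      show "g \<midarrow>x\<rightarrow> g x" if "s < x" "x < b" for x
        using DERIV_isCont[OF deriv[OF that]] by (simp add: isCont_def)
    qed (rule s)
    then have "(f' has_integral (g b - g s)) {s..b}"
      using s deriv
      by (intro fundamental_theorem_of_calculus_interior) (auto simp: has_real_derivative_iff_has_vector_derivative)
    then show ?thesis using s by (simp add: g_def)
  qed
  ultimately have "(f' has_integral ((l s - La - (\<Sum>s\<in>F. r s - l s)) + (Lb - r s))) {a..b}"
    using s by (intro has_integral_combine[of a s b]) auto
  moreover have "s \<notin> F" using insert(2) by auto
  ultimately show ?case using insert(1) by (simp add: algebra_simps)
qed

text \<open>In the finite case this is Cauchy-Schwarz in L2 against the constant 1. An infinite
  right factor settles the rest, except on a null space, where the left side vanishes.\<close>

lemma nn_integral_Cauchy_Schwarz: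
  fixes f :: "'a \<Rightarrow> real"
  assumes f: "f \<in> borel_measurable M" and nn: "\<And>x. 0 \<le> f x" and M: "emeasure M (space M) \<noteq> \<infinity>"
  shows "(\<integral>\<^sup>+x. ennreal (f x) \<partial>M)\<^sup>2 \<le> (\<integral>\<^sup>+x. ennreal ((f x)\<^sup>2) \<partial>M) * emeasure M (space M)"
proof (cases "(\<integral>\<^sup>+x. ennreal ((f x)\<^sup>2) \<partial>M) = \<infinity>")
  case False
  interpret semi_inner "L2 M :: ('a \<Rightarrow> real) set" "\<lambda>f g. LINT x|M. f x \<bullet> g x"
    by (rule semi_inner_L2)
  interpret finite_measure M by (rule finite_measureI) (use M in simp)
  have f2: "f \<in> L2 M" using f False by (intro L2_I_nn) (auto simp: less_top[symmetric])
  have 1: "(\<lambda>_. 1) \<in> (L2 M :: ('a \<Rightarrow> real) set)" by (simp add: L2_def)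
  have int: "integrable M f" using L2_integrable_inner[OF f2 1] by simp
  have "(LINT x|M. f x)\<^sup>2 \<le> (LINT x|M. (f x)\<^sup>2) * measure M (space M)"
    using Cauchy_Schwarz_sq[OF f2 1] by (simp add: power2_eq_square)
  then have "ennreal ((LINT x|M. f x)\<^sup>2) \<le> ennreal ((LINT x|M. (f x)\<^sup>2) * measure M (space M))"
    by (rule ennreal_leI)
  moreover have "(\<integral>\<^sup>+x. ennreal (f x) \<partial>M) = ennreal (LINT x|M. f x)"
    using int nn by (intro nn_integral_eq_integral) auto
  moreover have "(\<integral>\<^sup>+x. ennreal ((f x)\<^sup>2) \<partial>M) = ennreal (LINT x|M. (f x)\<^sup>2)"
    using L2_D(2)[OF f2] by (intro nn_integral_eq_integral) auto
  ultimately show ?thesis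
    using nn by (simp add: ennreal_power ennreal_mult' emeasure_eq_measure)
next
  case True
  show ?thesis
  proof (cases "emeasure M (space M) = 0")
    case True
    then have "(\<integral>\<^sup>+x. ennreal (f x) \<partial>M) = 0"
      by (subst nn_integral_0_iff_AE) (use f in \<open>auto intro!: AE_I'[of "space M"] simp: null_sets_def\<close>)
    then show ?thesis by simp
  qed (use True in \<open>simp add: ennreal_top_mult\<close>)
qed

text \<open>Cauchy-Schwarz against \<open>(1 + c) ^ (- k)\<close>, whose sum over k from 1 on is
  \<open>1 / c\<close>; hence no dependence on \<open>K\<close>.\<close>

lemma weighted_sum_square:
  fixes x :: "nat \<Rightarrow> real"
  assumes c: "0 < c"
  shows "(\<Sum>k=1..K. x k)\<^sup>2 \<le> 1 / c * (\<Sum>k=1..K. (1 + c) ^ k * (x k)\<^sup>2)"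
proof -
  define p where "p k = sqrt ((1 + c) ^ k)" for k
  have p: "p k > 0" "(p k)\<^sup>2 = (1 + c) ^ k" for k using c by (auto simp: p_def)
  have "(\<Sum>k=1..K. x k) = (\<Sum>k=1..K. inverse (p k) * (p k * x k))"
    using p(1) by (intro sum.cong refl) (simp add: field_simps less_imp_neq[symmetric])
  then have "(\<Sum>k=1..K. x k)\<^sup>2 \<le> (\<Sum>k=1..K. (inverse (p k))\<^sup>2) * (\<Sum>k=1..K. (p k * x k)\<^sup>2)"
    using Cauchy_Schwarz_ineq_sum[of "\<lambda>k. inverse (p k)" "\<lambda>k. p k * x k" "{1..K}"] by simp
  also have "(\<Sum>k=1..K. (p k * x k)\<^sup>2) = (\<Sum>k=1..K. (1 + c) ^ k * (x k)\<^sup>2)"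
    by (simp add: power_mult_distrib p)
  also have "(\<Sum>k=1..K. (inverse (p k))\<^sup>2) * (\<Sum>k=1..K. (1 + c) ^ k * (x k)\<^sup>2)
      \<le> 1 / c * (\<Sum>k=1..K. (1 + c) ^ k * (x k)\<^sup>2)"
  proof (rule mult_right_mono)
    have ip: "(inverse (p k))\<^sup>2 = inverse ((1 + c) ^ k)" for k
      by (simp add: power_inverse p(2))
    \<comment> \<open>The finite geometric sum, multiplied by \<open>c\<close> so that it
      telescopes.\<close>
    have eq: "c * (\<Sum>k=1..K. inverse ((1 + c) ^ k)) = 1 - inverse ((1 + c) ^ K)"
    proof (induction K)
      case (Suc K)
      have "inverse ((1 + c) ^ K) = (1 + c) * inverse ((1 + c) ^ Suc K)" using c by simp
      then show ?case using Suc by (simp add: distrib_left distrib_right del: power_Suc)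
    qed simp
    have "c * (\<Sum>k=1..K. inverse ((1 + c) ^ k)) \<le> 1" unfolding eq using c by simp
    then show "(\<Sum>k=1..K. (inverse (p k))\<^sup>2) \<le> 1 / c" unfolding ip using c by (simp add: field_simps)
  qed (use c in \<open>auto intro!: sum_nonneg\<close>)
  finally show ?thesis .
qed

section \<open>Generic directions: from almost all pairs of points to lines with a common
  direction\<close>

lemma AE_lborel_affine:
  fixes x :: "'a::euclidean_space"
  assumes ae: "AE y in lborel. P y" and q: "q \<noteq> 0"
  shows "AE z in lborel. P (x + q *\<^sub>R z)"
proof -
  have "AE y in lebesgue. P y" using ae by (simp add: AE_completion_iff)
  then obtain S where S: "negligible S" "{y. \<not> P y} \<subseteq> S"
    unfolding eventually_ae_filter by (auto simp: negligible_iff_null_sets)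
  define T where "T = (\<lambda>y. (1 / q) *\<^sub>R y) ` ((+) (- x) ` S)"
  have "negligible T"
    unfolding T_def
    by (intro negligible_differentiable_image_negligible negligible_translation S
          linear_imp_differentiable_on linear_scale_self) simp
  moreover have "{z. \<not> P (x + q *\<^sub>R z)} \<subseteq> T"
  proof
    fix z assume "z \<in> {z. \<not> P (x + q *\<^sub>R z)}"
    then have "x + q *\<^sub>R z \<in> S" using S(2) by blast
    moreover have "z = (1 / q) *\<^sub>R (- x + (x + q *\<^sub>R z))" using q by simp
    ultimately show "z \<in> T" unfolding T_def by blast
  qed
  ultimately have "AE z in lebesgue. P (x + q *\<^sub>R z)"
    by (intro AE_I'[of T]) (auto simp: negligible_iff_null_sets)
  then show ?thesis by (simp add: AE_completion_iff)
qed

text \<open>Fubini twice: for almost every \<open>x\<close> the property holds for almost every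
  endpoint, hence for almost every direction \<open>z\<close>, and the two quantifiers are then
  exchanged so that the direction is fixed before the base point.\<close>

lemma AE_shear:
  fixes P :: "'a::euclidean_space \<times> 'a \<Rightarrow> bool"
  assumes ae: "AE p in lborel. P p" and q: "q \<noteq> 0"
  shows "AE z in lborel. AE x in lborel. P (x, x + q *\<^sub>R z)"
proof -
  \<comment> \<open>A Borel null set is used instead of \<open>P\<close> because exchanging the
    quantifiers needs a measurable set of pairs.\<close>
  obtain Z where Z: "{p. \<not> P p} \<subseteq> Z" "Z \<in> sets borel" "emeasure lborel Z = 0"
    using AE_E[OF ae] by auto
  have "AE p in (lborel \<Otimes>\<^sub>M lborel). p \<notin> Z"
    unfolding lborel_prod using Z by (intro AE_not_in) (auto simp: null_sets_def)
  from lborel_pair.AE_pair[OF this] have "AE x in lborel. AE y in lborel. (x, y) \<notin> Z" .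
  then have "AE x in lborel. AE z in lborel. (x, x + q *\<^sub>R z) \<notin> Z"
    by (rule eventually_mono) (rule AE_lborel_affine[OF _ q])
  moreover have "{p \<in> space (lborel \<Otimes>\<^sub>M lborel). (fst p, fst p + q *\<^sub>R snd p) \<notin> Z} \<in> sets (lborel \<Otimes>\<^sub>M lborel)"
  proof -
    have [measurable]: "(\<lambda>p :: 'a \<times> 'a. (fst p, fst p + q *\<^sub>R snd p)) \<in> borel_measurable borel"
      by (intro borel_measurable_continuous_onI continuous_intros)
    have "(\<lambda>p. (fst p, fst p + q *\<^sub>R snd p)) -` (- Z) \<inter> space borel \<in> sets borel"
      using Z by (intro measurable_sets[of _ borel borel]) auto
    moreover have "(\<lambda>p. (fst p, fst p + q *\<^sub>R snd p)) -` (- Z) \<inter> space borel = {p. (fst p, fst p + q *\<^sub>R snd p) \<notin> Z}"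
      by auto
    ultimately show ?thesis unfolding lborel_prod by simp
  qed
  ultimately have "AE z in lborel. AE x in lborel. (x, x + q *\<^sub>R z) \<notin> Z"
    by (subst (asm) lborel_pair.AE_commute) auto
  then show ?thesis
    by (rule eventually_mono) (auto elim!: eventually_mono simp: subsetD[OF Z(1)] intro: ccontr)
qed

context network
begin

text \<open>The line in direction \<open>\<theta>\<close> is not parallel to \<open>H\<close>.
  Quantifying over all equations of \<open>H\<close> avoids the choice of a normal.\<close>

definition transversal :: "'n point \<Rightarrow> 'n point set \<Rightarrow> bool" where
  "transversal \<theta> H \<longleftrightarrow> (\<forall>\<nu> \<beta>. \<nu> \<noteq> 0 \<longrightarrow> H \<noteq> {} \<longrightarrow> H = {x. \<nu> \<bullet> x = \<beta>} \<longrightarrow> \<nu> \<bullet> \<theta> \<noteq> 0)"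

text \<open>A direction parallel to \<open>H\<close> translates \<open>H\<close> into itself, so all
  such directions lie in the hyperplane through 0 with the same normal.\<close>

lemma AE_transversal:
  assumes "hyperplane H" shows "AE \<theta> in lborel. transversal \<theta> H"
proof -
  obtain a b where ab: "a \<noteq> 0" "H = {x. a \<bullet> x = b}" using assms by (auto simp: hyperplane_def)
  have sub: "{\<theta>. \<not> transversal \<theta> H} \<subseteq> {\<theta>. a \<bullet> \<theta> = 0}"
  proof
    fix \<theta> assume "\<theta> \<in> {\<theta>. \<not> transversal \<theta> H}"
    then obtain \<nu> \<beta> x where \<nu>: "H = {x. \<nu> \<bullet> x = \<beta>}" "\<nu> \<bullet> \<theta> = 0" "x \<in> H"
      by (auto simp: transversal_def)
    then have "x + \<theta> \<in> H" by (auto simp: inner_add_right)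
    then show "\<theta> \<in> {\<theta>. a \<bullet> \<theta> = 0}" using \<nu>(3) ab(2) by (simp add: inner_add_right)
  qed
  have "AE \<theta> in lebesgue. transversal \<theta> H"
    by (rule AE_I'[of "{\<theta>. a \<bullet> \<theta> = 0}"])
       (use sub negligible_hyperplane[of a 0] ab in \<open>auto simp: negligible_iff_null_sets\<close>)
  then show ?thesis by (simp add: AE_completion_iff)
qed

text \<open>Restricting to rational step lengths keeps the exceptional set of base points null.\<close>

lemma generic_direction:
  obtains \<theta> where "\<theta> \<noteq> 0" "\<And>k H. 1 \<le> k \<Longrightarrow> H \<in> hyps k \<Longrightarrow> transversal \<theta> H"
    "AE x in lborel. \<forall>k\<ge>1. \<forall>q::rat. q > 0 \<longrightarrow> x \<in> region N \<longrightarrow> x + of_rat q *\<^sub>R \<theta> \<in> region N \<longrightarrow>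
       finite (open_segment x (x + of_rat q *\<^sub>R \<theta>) \<inter> ifc N k) \<and>
       card (open_segment x (x + of_rat q *\<^sub>R \<theta>) \<inter> ifc N k) \<le> crossings N k"
proof -
  define R where "R k p \<longleftrightarrow> (fst p \<in> region N \<and> snd p \<in> region N \<longrightarrow>
          finite (open_segment (fst p) (snd p) \<inter> ifc N k) \<and>
          card (open_segment (fst p) (snd p) \<inter> ifc N k) \<le> crossings N k)" for k p
  have "AE p in lborel. R k p" if "1 \<le> k" for k
    unfolding R_def by (rule crossings[OF that])
  then have "AE \<theta> in lborel. AE x in lborel. R k (x, x + of_rat q *\<^sub>R \<theta>)" if "1 \<le> k" "q > 0" for k and q :: rat
    using that by (intro AE_shear) auto
  then have 1: "AE \<theta> in lborel. \<forall>k\<in>{1..}. \<forall>q\<in>{q::rat. q > 0}. AE x in lborel. R k (x, x + of_rat q *\<^sub>R \<theta>)"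
    by (subst AE_ball_countable, simp, intro ballI, subst AE_ball_countable, simp) auto
  have 2: "AE \<theta> in lborel. \<forall>k\<in>{1..}. \<forall>H\<in>hyps k. transversal \<theta> H"
  proof (subst AE_ball_countable, simp, intro ballI)
    fix k :: nat assume k: "k \<in> {1..}"
    then have "countable (hyps k)" using hyps(1) by (intro countable_finite) auto
    then show "AE \<theta> in lborel. \<forall>H\<in>hyps k. transversal \<theta> H"
      using k hyps(2) by (subst AE_ball_countable) (auto intro!: AE_transversal)
  qed
  have 3: "AE \<theta> in lborel. \<theta> \<noteq> (0 :: 'n point)"
    by (intro AE_I'[of "{0}"]) auto
  have "AE \<theta> in lborel. \<theta> \<noteq> (0 :: 'n point) \<and> (\<forall>k\<in>{1..}. \<forall>H\<in>hyps k. transversal \<theta> H) \<and>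
      (\<forall>k\<in>{1..}. \<forall>q\<in>{q::rat. q > 0}. AE x in lborel. R k (x, x + of_rat q *\<^sub>R \<theta>))"
    using 1 2 3 by eventually_elim blast
  then have "\<exists>\<theta>. \<theta> \<noteq> (0 :: 'n point) \<and> (\<forall>k\<in>{1..}. \<forall>H\<in>hyps k. transversal \<theta> H) \<and>
      (\<forall>k\<in>{1..}. \<forall>q\<in>{q::rat. q > 0}. AE x in lborel. R k (x, x + of_rat q *\<^sub>R \<theta>))"
    by (intro eventually_happens'[of "ae_filter lborel"]) (simp add: ae_filter_eq_bot_iff)
  then obtain \<theta> where \<theta>: "\<theta> \<noteq> (0 :: 'n point)" "\<forall>k\<in>{1..}. \<forall>H\<in>hyps k. transversal \<theta> H"
    "\<forall>k\<in>{1..}. \<forall>q\<in>{q::rat. q > 0}. AE x in lborel. R k (x, x + of_rat q *\<^sub>R \<theta>)" by blast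
  have "AE x in lborel. \<forall>k\<in>{1..}. \<forall>q\<in>{q::rat. q > 0}. R k (x, x + of_rat q *\<^sub>R \<theta>)"
    using \<theta>(3) by (subst AE_ball_countable, simp, subst AE_ball_countable, simp) auto
  then have "AE x in lborel. \<forall>k\<ge>1. \<forall>q::rat. q > 0 \<longrightarrow> x \<in> region N \<longrightarrow> x + of_rat q *\<^sub>R \<theta> \<in> region N \<longrightarrow>
       finite (open_segment x (x + of_rat q *\<^sub>R \<theta>) \<inter> ifc N k) \<and>
       card (open_segment x (x + of_rat q *\<^sub>R \<theta>) \<inter> ifc N k) \<le> crossings N k"
    by (rule eventually_mono) (auto simp: R_def)
  then show ?thesis using that[OF \<theta>(1)] \<theta>(2) by auto
qed

text \<open>A transversal line meets each hyperplane at most once, so the sum of \<open>g\<close> over the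
  crossings of \<open>ifc N k\<close> is at most a sum of one term per hyperplane.\<close>

lemma crossing_sum_majorant:
  assumes T: "0 \<le> T" and trans: "\<And>k H. 1 \<le> k \<Longrightarrow> H \<in> hyps k \<Longrightarrow> transversal \<theta> H"
  obtains C where "0 < C"
    "\<And>k K (g :: 'n point \<Rightarrow> ennreal). 1 \<le> k \<Longrightarrow> k \<le> K \<Longrightarrow> g \<in> borel_measurable (surface_measure (ifc N k)) \<Longrightarrow>
       \<exists>h\<in>borel_measurable borel.
         (\<forall>x S. (\<forall>t\<in>{0..T}. x + t *\<^sub>R \<theta> \<notin> bad K) \<longrightarrow> finite S \<longrightarrow> S \<subseteq> {t\<in>{0..T}. x + t *\<^sub>R \<theta> \<in> ifc N k} \<longrightarrow>
            (\<Sum>t\<in>S. g (x + t *\<^sub>R \<theta>)) \<le> (h x :: ennreal)) \<and>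
         (\<integral>\<^sup>+x. h x \<partial>lborel) \<le> ennreal C * (\<integral>\<^sup>+\<xi>. g \<xi> \<partial>surface_measure (ifc N k))"
proof -
  let ?H = "hausdorff_measure (CARD('n) - 1) :: 'n point measure"
  obtain C where C: "0 < C" and tube: "\<And>g. g \<in> borel_measurable ?H \<Longrightarrow>
       \<exists>h\<in>borel_measurable borel. (\<forall>x. \<forall>t\<in>{0..T}. g (x + t *\<^sub>R \<theta>) \<le> (h x :: ennreal)) \<and>
         (\<integral>\<^sup>+x. h x \<partial>lborel) \<le> ennreal C * (\<integral>\<^sup>+\<xi>. g \<xi> \<partial>?H)"
    using tube_function[OF T, of \<theta>] by blast
  show ?thesis
  proof (rule that[OF C])
    fix k K and g :: "'n point \<Rightarrow> ennreal"
    assume k: "1 \<le> k" "k \<le> K" and g: "g \<in> borel_measurable (surface_measure (ifc N k))"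
    \<comment> \<open>The parts of the interface on the several hyperplanes. Without
      \<open>bad K\<close> they are disjoint, so their indicators sum to at most 1 and the constant
      \<open>C\<close> of a single tube survives.\<close>
    define P where "P H = ifc N k \<inter> H - bad K" for H
    have ifcH: "ifc N k \<inter> space ?H \<in> sets ?H" by (rule borel_Int_surface[OF ifc_borel[OF k(1)]])
    have g1: "(\<lambda>\<xi>. g \<xi> * indicator (ifc N k) \<xi>) \<in> borel_measurable ?H"
      using g ifcH unfolding surface_measure_def
      by (subst (asm) borel_measurable_restrict_space_iff_ennreal) auto
    have PH: "P H \<in> sets ?H" if "H \<in> hyps k" for H
      using hausdorff_null[OF hausdorff_bad[of K]] ifcH closed_hyperplane'[OF hyps(2)[OF k(1) that]]
        borel_hausdorff_measurable[of H]
      unfolding P_def by (auto simp: null_sets_def)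
    define gH where "gH H \<xi> = g \<xi> * indicator (ifc N k) \<xi> * indicator (P H) \<xi>" for H \<xi>
    have gH: "gH H \<in> borel_measurable ?H" if "H \<in> hyps k" for H
    proof -
      note [measurable] = g1 PH[OF that]
      show ?thesis unfolding gH_def by measurable
    qed
    have "\<forall>H\<in>hyps k. \<exists>h. h \<in> borel_measurable borel \<and> (\<forall>x. \<forall>t\<in>{0..T}. gH H (x + t *\<^sub>R \<theta>) \<le> h x) \<and>
         (\<integral>\<^sup>+x. h x \<partial>lborel) \<le> ennreal C * (\<integral>\<^sup>+\<xi>. gH H \<xi> \<partial>?H)"
      using tube[OF gH] by blast
    from bchoice[OF this] obtain h where h: "\<And>H. H \<in> hyps k \<Longrightarrow> h H \<in> borel_measurable borel"
      "\<And>H x t. H \<in> hyps k \<Longrightarrow> t \<in> {0..T} \<Longrightarrow> gH H (x + t *\<^sub>R \<theta>) \<le> h H x"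
      "\<And>H. H \<in> hyps k \<Longrightarrow> (\<integral>\<^sup>+x. h H x \<partial>lborel) \<le> ennreal C * (\<integral>\<^sup>+\<xi>. gH H \<xi> \<partial>?H)" by blast
    note fin = hyps(1)[OF k(1)]
    have disj: "H = H'" if "H \<in> hyps k" "H' \<in> hyps k" "\<xi> \<in> P H" "\<xi> \<in> P H'" for H H' \<xi>
    proof (rule ccontr)
      assume "H \<noteq> H'"
      moreover have "H \<in> hyps_upto K" "H' \<in> hyps_upto K" using that k by (auto simp: hyps_upto_def)
      moreover have "\<xi> \<in> region N" using that(3) ifc_subset[OF k(1)] by (auto simp: P_def)
      ultimately have "\<xi> \<in> bad K" using that(3,4) unfolding bad_def P_def by blast
      then show False using that(3) by (simp add: P_def)
    qed
    have sumP: "(\<Sum>H\<in>hyps k. indicator (P H) \<xi>) \<le> (1 :: ennreal)" for \<xi>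
    proof (cases "\<exists>H\<in>hyps k. \<xi> \<in> P H")
      case True
      then obtain H where H: "H \<in> hyps k" "\<xi> \<in> P H" by blast
      have "(\<Sum>H'\<in>hyps k. indicator (P H') \<xi>) = (\<Sum>H'\<in>hyps k. if H' = H then 1 else (0 :: ennreal))"
        using disj H by (intro sum.cong) (auto simp: indicator_def)
      then show ?thesis using fin H(1) by simp
    next
      case False
      then have "(\<Sum>H\<in>hyps k. indicator (P H) \<xi>) = (0 :: ennreal)"
        by (intro sum.neutral) (auto simp: indicator_def)
      then show ?thesis by simp
    qed
    show "\<exists>h\<in>borel_measurable borel.
         (\<forall>x S. (\<forall>t\<in>{0..T}. x + t *\<^sub>R \<theta> \<notin> bad K) \<longrightarrow> finite S \<longrightarrow> S \<subseteq> {t\<in>{0..T}. x + t *\<^sub>R \<theta> \<in> ifc N k} \<longrightarrow>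
            (\<Sum>t\<in>S. g (x + t *\<^sub>R \<theta>)) \<le> (h x :: ennreal)) \<and>
         (\<integral>\<^sup>+x. h x \<partial>lborel) \<le> ennreal C * (\<integral>\<^sup>+\<xi>. g \<xi> \<partial>surface_measure (ifc N k))"
    proof (intro bexI conjI allI impI)
      show "(\<lambda>x. \<Sum>H\<in>hyps k. h H x) \<in> borel_measurable borel" using h(1) by (rule borel_measurable_sum)
      fix x S assume nb: "\<forall>t\<in>{0..T}. x + t *\<^sub>R \<theta> \<notin> bad K" and S: "finite S"
        "S \<subseteq> {t\<in>{0..T}. x + t *\<^sub>R \<theta> \<in> ifc N k}"
      have "\<forall>t\<in>S. \<exists>H. H \<in> hyps k \<and> x + t *\<^sub>R \<theta> \<in> H" using S(2) hyps(3)[OF k(1)] by blast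
      from bchoice[OF this] obtain \<sigma> where \<sigma>: "\<And>t. t \<in> S \<Longrightarrow> \<sigma> t \<in> hyps k" "\<And>t. t \<in> S \<Longrightarrow> x + t *\<^sub>R \<theta> \<in> \<sigma> t"
        by blast
      have inj: "inj_on \<sigma> S"
      proof (rule inj_onI)
        fix s t assume st: "s \<in> S" "t \<in> S" "\<sigma> s = \<sigma> t"
        obtain a b where ab: "a \<noteq> 0" "\<sigma> t = {x. a \<bullet> x = b}"
          using hyps(2)[OF k(1) \<sigma>(1)[OF st(2)]] by (auto simp: hyperplane_def)
        have "a \<bullet> \<theta> \<noteq> 0"
          using trans[OF k(1) \<sigma>(1)[OF st(2)]] ab \<sigma>(2)[OF st(2)] unfolding transversal_def by blast
        moreover have "a \<bullet> (x + s *\<^sub>R \<theta>) = b" "a \<bullet> (x + t *\<^sub>R \<theta>) = b"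
          using \<sigma>(2)[OF st(1)] \<sigma>(2)[OF st(2)] st(3) ab(2) by auto
        ultimately show "s = t" by (auto simp: inner_add_right)
      qed
      have "(\<Sum>t\<in>S. g (x + t *\<^sub>R \<theta>)) \<le> (\<Sum>t\<in>S. h (\<sigma> t) x)"
      proof (rule sum_mono)
        fix t assume t: "t \<in> S"
        have "x + t *\<^sub>R \<theta> \<in> ifc N k" "t \<in> {0..T}" using S(2) t by auto
        moreover then have "x + t *\<^sub>R \<theta> \<in> P (\<sigma> t)" using \<sigma>(2)[OF t] nb by (auto simp: P_def)
        ultimately have "g (x + t *\<^sub>R \<theta>) = gH (\<sigma> t) (x + t *\<^sub>R \<theta>)" by (simp add: gH_def)
        also have "\<dots> \<le> h (\<sigma> t) x" using h(2)[OF \<sigma>(1)[OF t] \<open>t \<in> {0..T}\<close>] .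
        finally show "g (x + t *\<^sub>R \<theta>) \<le> h (\<sigma> t) x" .
      qed
      also have "\<dots> = (\<Sum>H\<in>\<sigma> ` S. h H x)" by (simp add: sum.reindex[OF inj])
      also have "\<dots> \<le> (\<Sum>H\<in>hyps k. h H x)" using \<sigma>(1) fin by (intro sum_mono2) auto
      finally show "(\<Sum>t\<in>S. g (x + t *\<^sub>R \<theta>)) \<le> (\<Sum>H\<in>hyps k. h H x)" .
    next
      have "(\<integral>\<^sup>+x. (\<Sum>H\<in>hyps k. h H x) \<partial>lborel) = (\<Sum>H\<in>hyps k. \<integral>\<^sup>+x. h H x \<partial>lborel)"
        using h(1) by (intro nn_integral_sum) auto
      also have "\<dots> \<le> (\<Sum>H\<in>hyps k. ennreal C * (\<integral>\<^sup>+\<xi>. gH H \<xi> \<partial>?H))" by (intro sum_mono h(3))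
      also have "\<dots> = ennreal C * (\<integral>\<^sup>+\<xi>. (\<Sum>H\<in>hyps k. gH H \<xi>) \<partial>?H)"
        using gH by (simp add: sum_distrib_left[symmetric] nn_integral_sum)
      also have "\<dots> \<le> ennreal C * (\<integral>\<^sup>+\<xi>. g \<xi> * indicator (ifc N k) \<xi> \<partial>?H)"
      proof (intro mult_left_mono nn_integral_mono)
        fix \<xi>
        have "(\<Sum>H\<in>hyps k. gH H \<xi>) = g \<xi> * indicator (ifc N k) \<xi> * (\<Sum>H\<in>hyps k. indicator (P H) \<xi>)"
          by (simp add: gH_def sum_distrib_left)
        also have "\<dots> \<le> g \<xi> * indicator (ifc N k) \<xi> * 1" by (intro mult_left_mono sumP) auto
        finally show "(\<Sum>H\<in>hyps k. gH H \<xi>) \<le> g \<xi> * indicator (ifc N k) \<xi>" by simp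
      qed auto
      also have "(\<integral>\<^sup>+\<xi>. g \<xi> * indicator (ifc N k) \<xi> \<partial>?H) = (\<integral>\<^sup>+\<xi>. g \<xi> \<partial>surface_measure (ifc N k))"
        unfolding surface_measure_def by (rule nn_integral_restrict_space[OF ifcH, symmetric])
      finally show "(\<integral>\<^sup>+x. (\<Sum>H\<in>hyps k. h H x) \<partial>lborel) \<le> ennreal C * (\<integral>\<^sup>+\<xi>. g \<xi> \<partial>surface_measure (ifc N k))" .
    qed
  qed
qed

end

section \<open>The Poincare inequality\<close>

context network
begin

text \<open>Cut off to zero where \<open>grad v\<close> has no specified value, which makes it a
  Borel function on the whole space that can be integrated along full lines.\<close>

definition dir_deriv :: "nat \<Rightarrow> ('n point \<Rightarrow> real) \<Rightarrow> 'n point \<Rightarrow> 'n point \<Rightarrow> real" where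
  "dir_deriv K v \<theta> y = indicator (region N - ifc_upto N K) y *\<^sub>R (grad v y \<bullet> \<theta>)"

lemma dir_deriv_borel:
  assumes "1 \<le> K" "v \<in> C1_level N K"
  shows "dir_deriv K v \<theta> \<in> borel_measurable borel"
  unfolding dir_deriv_def
  using open_level[OF assms(1)] C1_continuous_grad[OF assms]
  by (intro borel_measurable_continuous_on_indicator continuous_intros) auto

text \<open>The line may cross with or against the normal, which swaps the two one-sided limits; the
  modulus of the jump is the same in both cases.\<close>

lemma crossing_sides:
  assumes v: "v \<in> C1_level N K" and k: "1 \<le> k" "k \<le> K" and s: "x + s *\<^sub>R \<theta> \<in> ifc N k" "x + s *\<^sub>R \<theta> \<notin> bad K"
    and trans: "\<And>k H. 1 \<le> k \<Longrightarrow> H \<in> hyps k \<Longrightarrow> transversal \<theta> H"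
  shows "\<exists>l r. ((\<lambda>t. v (x + t *\<^sub>R \<theta>)) \<longlongrightarrow> l) (at_left s) \<and> ((\<lambda>t. v (x + t *\<^sub>R \<theta>)) \<longlongrightarrow> r) (at_right s) \<and>
    \<bar>r - l\<bar> = \<bar>normal_jump (ifc N k) v (x + s *\<^sub>R \<theta>)\<bar>"
proof -
  define \<xi> where "\<xi> = x + s *\<^sub>R \<theta>"
  have s': "\<xi> \<in> ifc N k" "\<xi> \<notin> bad K" using s by (auto simp: \<xi>_def)
  obtain \<nu> \<beta> where \<nu>: "{x. \<nu> \<bullet> x = \<beta>} \<in> hyps_upto K" "\<nu> \<bullet> \<xi> = \<beta>" "\<nu> \<bullet> unit_normal (ifc N k) \<xi> > 0"
    "\<And>v. v \<in> C1_level N K \<Longrightarrow> \<exists>p m. normal_jump (ifc N k) v \<xi> = p - m \<and>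
       (\<forall>\<eta>. \<nu> \<bullet> \<eta> > 0 \<longrightarrow> ((\<lambda>s. v (\<xi> + s *\<^sub>R \<eta>)) \<longlongrightarrow> p) (at_right 0) \<and> ((\<lambda>s. v (\<xi> - s *\<^sub>R \<eta>)) \<longlongrightarrow> m) (at_right 0))"
    by (rule jump_limits[OF k s']) (rule that)
  obtain p m where pm: "normal_jump (ifc N k) v \<xi> = p - m"
    "\<And>\<eta>. \<nu> \<bullet> \<eta> > 0 \<Longrightarrow> ((\<lambda>s. v (\<xi> + s *\<^sub>R \<eta>)) \<longlongrightarrow> p) (at_right 0)"
    "\<And>\<eta>. \<nu> \<bullet> \<eta> > 0 \<Longrightarrow> ((\<lambda>s. v (\<xi> - s *\<^sub>R \<eta>)) \<longlongrightarrow> m) (at_right 0)"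
    using \<nu>(4)[OF v] by blast
  obtain j where j: "1 \<le> j" "{x. \<nu> \<bullet> x = \<beta>} \<in> hyps j" using \<nu>(1) by (auto simp: hyps_upto_def)
  have "\<nu> \<noteq> 0" using \<nu>(3) by auto
  moreover have "{x. \<nu> \<bullet> x = \<beta>} \<noteq> {}" using \<nu>(2) by blast
  ultimately have nz: "\<nu> \<bullet> \<theta> \<noteq> 0" using trans[OF j] unfolding transversal_def by blast
  have right: "((\<lambda>t. v (x + t *\<^sub>R \<theta>)) \<longlongrightarrow> q) (at_right s) \<longleftrightarrow> ((\<lambda>h. v (\<xi> + h *\<^sub>R \<theta>)) \<longlongrightarrow> q) (at_right 0)" for q
    unfolding filterlim_at_right_to_0[of _ _ s] by (simp add: \<xi>_def algebra_simps)
  have left: "((\<lambda>t. v (x + t *\<^sub>R \<theta>)) \<longlongrightarrow> q) (at_left s) \<longleftrightarrow> ((\<lambda>h. v (\<xi> - h *\<^sub>R \<theta>)) \<longlongrightarrow> q) (at_right 0)" for q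
    unfolding filterlim_at_left_to_right[of _ _ s] filterlim_at_right_to_0[of _ _ "- s"]
    by (simp add: \<xi>_def algebra_simps)
  show ?thesis
  proof (cases "\<nu> \<bullet> \<theta> > 0")
    case True
    then show ?thesis
      using pm(2,3)[of \<theta>] pm(1) right left by (intro exI[of _ m] exI[of _ p]) (simp add: \<xi>_def[symmetric])
  next
    case False
    then have "\<nu> \<bullet> (- \<theta>) > 0" using nz by simp
    then show ?thesis
      using pm(2,3)[of "- \<theta>"] pm(1) right left
      by (intro exI[of _ p] exI[of _ m]) (simp add: \<xi>_def[symmetric] abs_minus_commute)
  qed
qed

lemma line_derivative:
  assumes K: "1 \<le> K" and v: "v \<in> C1_level N K" and y: "x + t *\<^sub>R \<theta> \<in> region N - ifc_upto N K"
  shows "((\<lambda>t. v (x + t *\<^sub>R \<theta>)) has_real_derivative dir_deriv K v \<theta> (x + t *\<^sub>R \<theta>)) (at t)"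
proof -
  have "(v has_derivative (\<lambda>h. h \<bullet> grad v (x + t *\<^sub>R \<theta>))) (at (x + t *\<^sub>R \<theta>))"
    using C1_GDERIV[OF K v y] by (simp add: gderiv_def)
  moreover have "((\<lambda>t. x + t *\<^sub>R \<theta>) has_derivative (\<lambda>h. h *\<^sub>R \<theta>)) (at t)"
    by (auto intro!: derivative_eq_intros)
  ultimately have "((\<lambda>t. v (x + t *\<^sub>R \<theta>)) has_derivative (\<lambda>h. (h *\<^sub>R \<theta>) \<bullet> grad v (x + t *\<^sub>R \<theta>))) (at t)"
    by (rule has_derivative_compose[rotated])
  moreover have "(\<lambda>h. (h *\<^sub>R \<theta>) \<bullet> grad v (x + t *\<^sub>R \<theta>)) = (*) (dir_deriv K v \<theta> (x + t *\<^sub>R \<theta>))"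
    using y by (auto simp: dir_deriv_def inner_commute mult.commute)
  ultimately show ?thesis by (simp add: has_field_derivative_def)
qed

text \<open>The last piece of the line before it leaves the region is connected and stays in one
  cell. The extension of \<open>v\<close> to the closure of that cell is continuous up to the exit
  point, where the boundary condition makes it 0.\<close>

lemma exit_limit:
  assumes K: "1 \<le> K" and v: "v \<in> C1_level N K" and \<delta>: "\<delta> < \<tau>"
    and inside: "\<And>t. \<delta> < t \<Longrightarrow> t < \<tau> \<Longrightarrow> x + t *\<^sub>R \<theta> \<in> region N - ifc_upto N K"
    and exit: "x + \<tau> *\<^sub>R \<theta> \<notin> region N"
  shows "((\<lambda>t. v (x + t *\<^sub>R \<theta>)) \<longlongrightarrow> 0) (at_left \<tau>)"
proof -
  define C where "C = (\<lambda>t. x + t *\<^sub>R \<theta>) ` {\<delta><..<\<tau>}"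
  have "connected C" unfolding C_def by (intro connected_continuous_image continuous_intros) simp
  moreover have "C \<noteq> {}" using \<delta> by (simp add: C_def)
  moreover have "C \<subseteq> region N - ifc_upto N K" using inside by (auto simp: C_def)
  ultimately obtain G where G: "G \<in> cells N K" "C \<subseteq> G" using connected_in_cell[OF K] by metis
  obtain u g where u: "continuous_on (closure G) u" "continuous_on (closure G) g"
    "\<And>x. x \<in> closure G - ifc_upto N K \<Longrightarrow> v x = u x" "\<And>x. x \<in> G \<Longrightarrow> GDERIV v x :> g x"
    by (rule C1_levelE[OF v G(1)]) (rule that)
  have "\<And>t. \<delta> < t \<Longrightarrow> t < \<tau> \<Longrightarrow> x + t *\<^sub>R \<theta> \<in> G" using G(2) by (auto simp: C_def image_subset_iff)
  then have ev: "\<forall>\<^sub>F t in at_left \<tau>. x + t *\<^sub>R \<theta> \<in> G"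
    unfolding eventually_at_left_field using \<delta> by (intro exI[of _ \<delta>]) auto
  have lim: "((\<lambda>t. x + t *\<^sub>R \<theta>) \<longlongrightarrow> x + \<tau> *\<^sub>R \<theta>) (at_left \<tau>)" by (intro tendsto_intros)
  have evc: "\<forall>\<^sub>F t in at_left \<tau>. x + t *\<^sub>R \<theta> \<in> closure G"
    using ev by (rule eventually_mono) (use closure_subset in blast)
  have p: "x + \<tau> *\<^sub>R \<theta> \<in> closure G"
    by (rule Lim_in_closed_set[OF closed_closure evc _ lim]) simp
  have "x + \<tau> *\<^sub>R \<theta> \<in> closure (region N)"
    using p closure_mono[of G "region N"] cell_subset[OF K G(1)] by blast
  then have "x + \<tau> *\<^sub>R \<theta> \<in> frontier (region N)"
    using exit interior_subset[of "region N"] by (auto simp: frontier_def)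
  then have "v (x + \<tau> *\<^sub>R \<theta>) = 0" by (rule C1_boundary[OF v])
  moreover have "x + \<tau> *\<^sub>R \<theta> \<notin> ifc_upto N K" using exit ifc_upto_subset[of K] by blast
  ultimately have "u (x + \<tau> *\<^sub>R \<theta>) = 0" using u(3)[of "x + \<tau> *\<^sub>R \<theta>"] p by simp
  then have "((\<lambda>t. u (x + t *\<^sub>R \<theta>)) \<longlongrightarrow> 0) (at_left \<tau>)"
    using continuous_on_tendsto_compose[OF u(1) lim p evc] by simp
  moreover have "\<forall>\<^sub>F t in at_left \<tau>. u (x + t *\<^sub>R \<theta>) = v (x + t *\<^sub>R \<theta>)"
    using ev
  proof eventually_elim
    case (elim t)
    then have "x + t *\<^sub>R \<theta> \<in> closure G - ifc_upto N K"
      using cell_subset[OF K G(1)] closure_subset by blast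
    then show ?case using u(3) by simp
  qed
  ultimately show ?thesis by (rule Lim_transform_eventually)
qed

text \<open>A finite set of crossing times ends before some rational time still inside the region,
  so the bound for rational segments applies to it. A uniform bound on finite subsets bounds the
  whole set.\<close>

lemma crossings_finite:
  assumes \<theta>: "\<theta> \<noteq> 0" and inside: "\<And>t. 0 \<le> t \<Longrightarrow> t < \<tau> \<Longrightarrow> x + t *\<^sub>R \<theta> \<in> region N"
    and cross: "\<And>q::rat. q > 0 \<Longrightarrow> x + of_rat q *\<^sub>R \<theta> \<in> region N \<Longrightarrow>
       finite (open_segment x (x + of_rat q *\<^sub>R \<theta>) \<inter> ifc N k) \<and>
       card (open_segment x (x + of_rat q *\<^sub>R \<theta>) \<inter> ifc N k) \<le> crossings N k"
  shows "finite {t. 0 < t \<and> t < \<tau> \<and> x + t *\<^sub>R \<theta> \<in> ifc N k} \<and>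
    card {t. 0 < t \<and> t < \<tau> \<and> x + t *\<^sub>R \<theta> \<in> ifc N k} \<le> crossings N k"
proof (rule finite_if_finite_subsets_card_bdd)
  fix G assume G: "G \<subseteq> {t. 0 < t \<and> t < \<tau> \<and> x + t *\<^sub>R \<theta> \<in> ifc N k}" "finite G"
  show "card G \<le> crossings N k"
  proof (cases "G = {}")
    case False
    then have M: "Max G \<in> G" using G(2) by simp
    then have "Max G < \<tau>" using G(1) by auto
    then obtain q where q: "Max G < of_rat q" "of_rat q < \<tau>" using of_rat_dense by blast
    have "0 < Max G" using M G(1) by auto
    then have q0: "(0::real) < of_rat q" using q(1) by linarith
    then have q0': "q > 0" by simp
    have sub: "(\<lambda>t. x + t *\<^sub>R \<theta>) ` G \<subseteq> open_segment x (x + of_rat q *\<^sub>R \<theta>) \<inter> ifc N k"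
    proof clarify
      fix t assume t: "t \<in> G"
      have t1: "0 < t" "x + t *\<^sub>R \<theta> \<in> ifc N k" using G(1) t by auto
      have t2: "t < of_rat q" using Max_ge[OF G(2) t] q(1) by simp
      have "x + t *\<^sub>R \<theta> = (1 - t / of_rat q) *\<^sub>R x + (t / of_rat q) *\<^sub>R (x + of_rat q *\<^sub>R \<theta>)"
        using q0 by (simp add: algebra_simps)
      then have "x + t *\<^sub>R \<theta> \<in> open_segment x (x + of_rat q *\<^sub>R \<theta>)"
        unfolding in_segment using \<theta> q0 t1 t2 by (intro conjI exI[of _ "t / of_rat q"]) auto
      then show "x + t *\<^sub>R \<theta> \<in> open_segment x (x + of_rat q *\<^sub>R \<theta>) \<inter> ifc N k" using t1 by simp
    qed
    have inj: "inj_on (\<lambda>t. x + t *\<^sub>R \<theta>) G" using \<theta> by (auto simp: inj_on_def)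
    have "x + of_rat q *\<^sub>R \<theta> \<in> region N" using q0 q(2) by (intro inside) auto
    note fin = cross[OF q0' this]
    have "card G = card ((\<lambda>t. x + t *\<^sub>R \<theta>) ` G)" using card_image[OF inj] by simp
    also have "\<dots> \<le> card (open_segment x (x + of_rat q *\<^sub>R \<theta>) \<inter> ifc N k)"
      using fin sub by (intro card_mono) auto
    also have "\<dots> \<le> crossings N k" using fin by simp
    finally show ?thesis .
  qed simp
qed

text \<open>The fundamental theorem is applied up to the first exit time, since the line may enter
  the region again. The integral is then enlarged to \<open>{0..T}\<close>, a range that does not
  depend on \<open>x\<close>.\<close>

lemma line_bound:
  assumes K: "1 \<le> K" and v: "v \<in> C1_level N K" and \<theta>: "\<theta> \<noteq> 0"
    and x: "x \<in> region N - ifc_upto N K" and T: "0 < T" "x + T *\<^sub>R \<theta> \<notin> region N"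
    and trans: "\<And>k H. 1 \<le> k \<Longrightarrow> H \<in> hyps k \<Longrightarrow> transversal \<theta> H"
    and cross: "\<And>k (q::rat). 1 \<le> k \<Longrightarrow> q > 0 \<Longrightarrow> x + of_rat q *\<^sub>R \<theta> \<in> region N \<Longrightarrow>
       finite (open_segment x (x + of_rat q *\<^sub>R \<theta>) \<inter> ifc N k) \<and>
       card (open_segment x (x + of_rat q *\<^sub>R \<theta>) \<inter> ifc N k) \<le> crossings N k"
    and nb: "\<forall>t\<in>{0..T}. x + t *\<^sub>R \<theta> \<notin> bad K"
  shows "\<exists>S. (\<forall>k\<in>{1..K}. finite (S k) \<and> card (S k) \<le> crossings N k \<and> S k \<subseteq> {t\<in>{0..T}. x + t *\<^sub>R \<theta> \<in> ifc N k}) \<and>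
    ennreal \<bar>v x\<bar> \<le> (\<integral>\<^sup>+t. ennreal \<bar>dir_deriv K v \<theta> (x + t *\<^sub>R \<theta>)\<bar> * indicator {0..T} t \<partial>lborel) +
      ennreal (\<Sum>k=1..K. \<Sum>t\<in>S k. \<bar>normal_jump (ifc N k) v (x + t *\<^sub>R \<theta>)\<bar>)"
proof -
  let ?f = "\<lambda>t. v (x + t *\<^sub>R \<theta>)" and ?f' = "\<lambda>t. dir_deriv K v \<theta> (x + t *\<^sub>R \<theta>)"
  \<comment> \<open>Closed because the region is open; hence the first exit time is attained and
    positive.\<close>
  define E where "E = {t. 0 \<le> t \<and> x + t *\<^sub>R \<theta> \<notin> region N}"
  define \<tau> where "\<tau> = Inf E"
  have "closed ((\<lambda>t. x + t *\<^sub>R \<theta>) -` (- region N))"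
    using domain(1) by (intro closed_vimage continuous_intros) auto
  moreover have "E = {0..} \<inter> (\<lambda>t. x + t *\<^sub>R \<theta>) -` (- region N)" by (auto simp: E_def)
  ultimately have "closed E" by auto
  have TE: "T \<in> E" using T by (simp add: E_def)
  have bdd: "bdd_below E" by (intro bdd_belowI[of _ 0]) (simp add: E_def)
  have "\<tau> \<in> E" unfolding \<tau>_def using TE bdd \<open>closed E\<close> by (intro closed_contains_Inf) auto
  then have \<tau>: "0 \<le> \<tau>" "x + \<tau> *\<^sub>R \<theta> \<notin> region N" by (auto simp: E_def)
  have \<tau>T: "\<tau> \<le> T" unfolding \<tau>_def by (intro cInf_lower TE bdd)
  have inside: "x + t *\<^sub>R \<theta> \<in> region N" if "0 \<le> t" "t < \<tau>" for t
  proof (rule ccontr)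
    assume "x + t *\<^sub>R \<theta> \<notin> region N"
    then have "\<tau> \<le> t" unfolding \<tau>_def using that by (intro cInf_lower bdd) (simp add: E_def)
    then show False using that by simp
  qed
  have \<tau>0: "0 < \<tau>" using \<tau> x by (cases "\<tau> = 0") auto
  define S where "S k = {t. 0 < t \<and> t < \<tau> \<and> x + t *\<^sub>R \<theta> \<in> ifc N k}" for k
  have S: "finite (S k)" "card (S k) \<le> crossings N k" if "1 \<le> k" for k
    using crossings_finite[OF \<theta> inside cross[OF that]] unfolding S_def by auto
  define F where "F = (\<Union>k\<in>{1..K}. S k)"
  have finF: "finite F" unfolding F_def using S(1) by auto
  have F_iff: "t \<in> F \<longleftrightarrow> 0 < t \<and> t < \<tau> \<and> x + t *\<^sub>R \<theta> \<in> ifc_upto N K" for t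
    by (auto simp: F_def S_def ifc_upto_def)
  \<comment> \<open>The one-sided limits at each crossing. By disjointness only one interface
    contains the crossing point, so quantifying over all \<open>k\<close> costs nothing.\<close>
  have "\<forall>s\<in>F. \<exists>lr. (?f \<longlongrightarrow> fst lr) (at_left s) \<and> (?f \<longlongrightarrow> snd lr) (at_right s) \<and>
      (\<forall>k\<in>{1..K}. s \<in> S k \<longrightarrow> \<bar>snd lr - fst lr\<bar> = \<bar>normal_jump (ifc N k) v (x + s *\<^sub>R \<theta>)\<bar>)"
  proof
    fix s assume s: "s \<in> F"
    then obtain k where k: "1 \<le> k" "k \<le> K" "s \<in> S k" by (auto simp: F_def)
    have sk: "x + s *\<^sub>R \<theta> \<in> ifc N k" "s \<in> {0..T}" using k(3) \<tau>T by (auto simp: S_def)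
    have "\<exists>l r. (?f \<longlongrightarrow> l) (at_left s) \<and> (?f \<longlongrightarrow> r) (at_right s) \<and>
        \<bar>r - l\<bar> = \<bar>normal_jump (ifc N k) v (x + s *\<^sub>R \<theta>)\<bar>"
      by (rule crossing_sides[OF v k(1,2) sk(1) bspec[OF nb sk(2)]]) (rule trans)
    then obtain l r where lr: "(?f \<longlongrightarrow> l) (at_left s)" "(?f \<longlongrightarrow> r) (at_right s)"
      "\<bar>r - l\<bar> = \<bar>normal_jump (ifc N k) v (x + s *\<^sub>R \<theta>)\<bar>" by blast
    have "j = k" if "j \<in> {1..K}" "s \<in> S j" for j
      using ifc_disjointD[OF k(1), of j "x + s *\<^sub>R \<theta>"] that sk(1) by (auto simp: S_def)
    then show "\<exists>lr. (?f \<longlongrightarrow> fst lr) (at_left s) \<and> (?f \<longlongrightarrow> snd lr) (at_right s) \<and>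
      (\<forall>k\<in>{1..K}. s \<in> S k \<longrightarrow> \<bar>snd lr - fst lr\<bar> = \<bar>normal_jump (ifc N k) v (x + s *\<^sub>R \<theta>)\<bar>)"
      using lr by (intro exI[of _ "(l, r)"]) auto
  qed
  from bchoice[OF this] obtain \<sigma> where \<sigma>: "\<And>s. s \<in> F \<Longrightarrow> (?f \<longlongrightarrow> fst (\<sigma> s)) (at_left s)"
    "\<And>s. s \<in> F \<Longrightarrow> (?f \<longlongrightarrow> snd (\<sigma> s)) (at_right s)"
    "\<And>s k. s \<in> F \<Longrightarrow> k \<in> {1..K} \<Longrightarrow> s \<in> S k \<Longrightarrow> \<bar>snd (\<sigma> s) - fst (\<sigma> s)\<bar> = \<bar>normal_jump (ifc N k) v (x + s *\<^sub>R \<theta>)\<bar>"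
    by blast
  have integral: "(?f' has_integral (0 - v x - (\<Sum>s\<in>F. snd (\<sigma> s) - fst (\<sigma> s)))) {0..\<tau>}"
  proof (rule piecewise_fundamental_theorem[OF finF \<tau>0, where f = ?f])
    show "F \<subseteq> {0<..<\<tau>}" by (auto simp: F_iff)
    show "(?f has_real_derivative ?f' t) (at t)" if "t \<in> {0<..<\<tau>} - F" for t
      using that inside by (intro line_derivative[OF K v]) (auto simp: F_iff)
    have "((\<lambda>t. x + t *\<^sub>R \<theta>) \<longlongrightarrow> x + 0 *\<^sub>R \<theta>) (at_right 0)" by (intro tendsto_intros)
    then show "(?f \<longlongrightarrow> v x) (at_right 0)"
      using isCont_tendsto_compose[OF C1_isCont[OF K v x]] by simp
    \<comment> \<open>The last crossing before the exit, or 0 if there is none; afterwards the line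
      stays off the interfaces.\<close>
    define \<delta> where "\<delta> = Max (insert 0 F)"
    have "\<delta> \<in> insert 0 F" unfolding \<delta>_def using finF by (intro Max_in) auto
    then have \<delta>: "0 \<le> \<delta>" "\<delta> < \<tau>" using \<tau>0 by (auto simp: F_iff)
    show "(?f \<longlongrightarrow> 0) (at_left \<tau>)"
    proof (rule exit_limit[OF K v \<delta>(2) _ \<tau>(2)])
      fix t assume t: "\<delta> < t" "t < \<tau>"
      have "t \<notin> F"
      proof
        assume "t \<in> F"
        then have "t \<le> \<delta>" unfolding \<delta>_def using finF by (intro Max_ge) auto
        then show False using t by simp
      qed
      then show "x + t *\<^sub>R \<theta> \<in> region N - ifc_upto N K" using t \<delta> inside[of t] by (auto simp: F_iff)
    qed
  qed (use \<sigma> in auto)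
  define I where "I = 0 - v x - (\<Sum>s\<in>F. snd (\<sigma> s) - fst (\<sigma> s))"
  have sums: "(\<Sum>s\<in>F. \<bar>snd (\<sigma> s) - fst (\<sigma> s)\<bar>) = (\<Sum>k=1..K. \<Sum>t\<in>S k. \<bar>normal_jump (ifc N k) v (x + t *\<^sub>R \<theta>)\<bar>)"
  proof -
    have "(\<Sum>s\<in>F. \<bar>snd (\<sigma> s) - fst (\<sigma> s)\<bar>) = (\<Sum>k=1..K. \<Sum>s\<in>S k. \<bar>snd (\<sigma> s) - fst (\<sigma> s)\<bar>)"
      unfolding F_def
    proof (rule sum.UNION_disjoint)
      show "\<forall>i\<in>{1..K}. \<forall>j\<in>{1..K}. i \<noteq> j \<longrightarrow> S i \<inter> S j = {}"
        using ifc_disjointD by (fastforce simp: S_def)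
    qed (use S(1) in auto)
    also have "\<dots> = (\<Sum>k=1..K. \<Sum>t\<in>S k. \<bar>normal_jump (ifc N k) v (x + t *\<^sub>R \<theta>)\<bar>)"
    proof (intro sum.cong refl)
      fix k s assume "k \<in> {1..K}" "s \<in> S k"
      then show "\<bar>snd (\<sigma> s) - fst (\<sigma> s)\<bar> = \<bar>normal_jump (ifc N k) v (x + s *\<^sub>R \<theta>)\<bar>"
        by (intro \<sigma>(3)) (auto simp: F_def)
    qed
    finally show ?thesis .
  qed
  have "\<bar>v x\<bar> \<le> \<bar>I\<bar> + (\<Sum>s\<in>F. \<bar>snd (\<sigma> s) - fst (\<sigma> s)\<bar>)"
    unfolding I_def using sum_abs[of "\<lambda>s. snd (\<sigma> s) - fst (\<sigma> s)" F] by linarith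
  then have "ennreal \<bar>v x\<bar> \<le> ennreal (\<bar>I\<bar> + (\<Sum>s\<in>F. \<bar>snd (\<sigma> s) - fst (\<sigma> s)\<bar>))" by (rule ennreal_leI)
  also have "\<dots> = ennreal \<bar>I\<bar> + ennreal (\<Sum>k=1..K. \<Sum>t\<in>S k. \<bar>normal_jump (ifc N k) v (x + t *\<^sub>R \<theta>)\<bar>)"
    unfolding sums by (intro ennreal_plus) (auto intro!: sum_nonneg)
  also have "ennreal \<bar>I\<bar> \<le> (\<integral>\<^sup>+t. ennreal \<bar>?f' t\<bar> * indicator {0..T} t \<partial>lborel)" (is "_ \<le> ?R")
  \<comment> \<open>The fundamental theorem yields a gauge integral. A finite \<open>?R\<close>
    makes the derivative Lebesgue integrable on the segment, and then both integrals agree.\<close>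
  proof (cases "?R = \<infinity>")
    case False
    define h where "h t = indicator {0..\<tau>} t * ?f' t" for t
    have [measurable]: "dir_deriv K v \<theta> \<in> borel_measurable borel" by (rule dir_deriv_borel[OF K v])
    have meas: "h \<in> borel_measurable lborel" unfolding h_def by measurable
    have le: "(\<integral>\<^sup>+t. ennreal \<bar>h t\<bar> \<partial>lborel) \<le> ?R"
      using \<tau>T by (intro nn_integral_mono) (auto simp: h_def indicator_def)
    then have int: "integrable lborel h"
      using meas False by (auto simp: integrable_iff_bounded less_top[symmetric] top_unique)
    have "(h has_integral (LINT t|lborel. h t)) UNIV" by (rule has_integral_integral_lborel[OF int])
    moreover have "(h has_integral I) UNIV"
    proof -
      have "h = (\<lambda>t. if t \<in> {0..\<tau>} then ?f' t else 0)" by (auto simp: h_def indicator_def)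
      then show ?thesis using integral unfolding I_def by (simp only: has_integral_restrict_UNIV)
    qed
    ultimately have "I = (LINT t|lborel. h t)" using has_integral_unique by blast
    then have "ennreal \<bar>I\<bar> \<le> (\<integral>\<^sup>+t. ennreal \<bar>h t\<bar> \<partial>lborel)"
      using integral_norm_bound_ennreal[OF int] by simp
    then show ?thesis using le by (rule order_trans)
  qed simp
  finally have main: "ennreal \<bar>v x\<bar> \<le> ?R + ennreal (\<Sum>k=1..K. \<Sum>t\<in>S k. \<bar>normal_jump (ifc N k) v (x + t *\<^sub>R \<theta>)\<bar>)"
    by (simp add: add_right_mono)
  have "S k \<subseteq> {t\<in>{0..T}. x + t *\<^sub>R \<theta> \<in> ifc N k}" for k using \<tau>T by (auto simp: S_def)
  then show ?thesis using S main by (intro exI[of _ S]) auto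
qed

end

lemma ennreal_add_square_le: "(a + b)\<^sup>2 \<le> 2 * a\<^sup>2 + 2 * b\<^sup>2" for a b :: ennreal
proof (cases "a = \<infinity> \<or> b = \<infinity>")
  case True
  then show ?thesis by (auto simp: power2_eq_square ennreal_mult_top)
next
  case False
  then obtain x y where xy: "0 \<le> x" "a = ennreal x" "0 \<le> y" "b = ennreal y"
    by (metis finite_ennrealE)
  have "(x + y)\<^sup>2 \<le> 2 * x\<^sup>2 + 2 * y\<^sup>2"
    using sum_squares_bound[of x y] by (simp add: power2_sum)
  then have "ennreal ((x + y)\<^sup>2) \<le> ennreal (2 * x\<^sup>2 + 2 * y\<^sup>2)" by (rule ennreal_leI)
  also have "ennreal (2 * x\<^sup>2 + 2 * y\<^sup>2) = 2 * a\<^sup>2 + 2 * b\<^sup>2"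
    using xy by (simp add: ennreal_power ennreal_mult')
  also have "ennreal ((x + y)\<^sup>2) = (a + b)\<^sup>2"
    using xy by (simp add: ennreal_power flip: ennreal_plus)
  finally show ?thesis .
qed

lemma nn_integral_lborel_translate:
  fixes f :: "'a::euclidean_space \<Rightarrow> ennreal"
  assumes "f \<in> borel_measurable borel"
  shows "(\<integral>\<^sup>+x. f (x + c) \<partial>lborel) = (\<integral>\<^sup>+x. f x \<partial>lborel)"
proof -
  have "(\<integral>\<^sup>+x. f x \<partial>lborel) = (\<integral>\<^sup>+x. f x \<partial>distr lborel borel ((+) c))" by (simp add: lborel_distr_plus)
  also have "\<dots> = (\<integral>\<^sup>+x. f (c + x) \<partial>lborel)" using assms by (subst nn_integral_distr) auto
  finally show ?thesis by (simp add: add.commute)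
qed

text \<open>Fubini and translation invariance: each time \<open>t\<close> contributes the same
  volume integral.\<close>

lemma nn_integral_line_average:
  fixes w :: "'a::euclidean_space \<Rightarrow> real"
  assumes [measurable]: "w \<in> borel_measurable borel" and T: "0 \<le> T"
  shows "(\<integral>\<^sup>+x. (\<integral>\<^sup>+t. ennreal ((w (x + t *\<^sub>R \<theta>))\<^sup>2) * indicator {0..T} t \<partial>lborel) \<partial>lborel)
    = ennreal T * (\<integral>\<^sup>+x. ennreal ((w x)\<^sup>2) \<partial>lborel)"
proof -
  have [measurable]: "(\<lambda>p :: 'a \<times> real. w (fst p + snd p *\<^sub>R \<theta>)) \<in> borel_measurable (lborel \<Otimes>\<^sub>M lborel)"
  proof -
    have "(\<lambda>p :: 'a \<times> real. fst p + snd p *\<^sub>R \<theta>) \<in> borel_measurable (lborel \<Otimes>\<^sub>M lborel)" by measurable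
    then show ?thesis by measurable
  qed
  have "(\<integral>\<^sup>+x. (\<integral>\<^sup>+t. ennreal ((w (x + t *\<^sub>R \<theta>))\<^sup>2) * indicator {0..T} t \<partial>lborel) \<partial>lborel)
      = (\<integral>\<^sup>+t. (\<integral>\<^sup>+x. ennreal ((w (x + t *\<^sub>R \<theta>))\<^sup>2) * indicator {0..T} t \<partial>lborel) \<partial>lborel)"
    by (rule lborel_pair.Fubini'[symmetric]) (simp add: split_beta)
  also have "\<dots> = (\<integral>\<^sup>+t. (\<integral>\<^sup>+x. ennreal ((w x)\<^sup>2) \<partial>lborel) * indicator {0..T} t \<partial>lborel)"
  proof (rule nn_integral_cong)
    fix t
    have "(\<integral>\<^sup>+x. ennreal ((w (x + t *\<^sub>R \<theta>))\<^sup>2) * indicator {0..T} t \<partial>lborel)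
        = (\<integral>\<^sup>+x. ennreal ((w (x + t *\<^sub>R \<theta>))\<^sup>2) \<partial>lborel) * indicator {0..T} t"
      by (rule nn_integral_multc) measurable
    also have "(\<integral>\<^sup>+x. ennreal ((w (x + t *\<^sub>R \<theta>))\<^sup>2) \<partial>lborel) = (\<integral>\<^sup>+x. ennreal ((w x)\<^sup>2) \<partial>lborel)"
      by (rule nn_integral_lborel_translate) measurable
    finally show "(\<integral>\<^sup>+x. ennreal ((w (x + t *\<^sub>R \<theta>))\<^sup>2) * indicator {0..T} t \<partial>lborel)
        = (\<integral>\<^sup>+x. ennreal ((w x)\<^sup>2) \<partial>lborel) * indicator {0..T} t" .
  qed
  also have "\<dots> = (\<integral>\<^sup>+x. ennreal ((w x)\<^sup>2) \<partial>lborel) * emeasure lborel {0..T}"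
    by (rule nn_integral_cmult_indicator) simp
  also have "emeasure lborel {0..T} = ennreal T" using T by simp
  finally show ?thesis by (simp add: mult.commute)
qed

lemma nn_integral_lebesgue_on:
  fixes f :: "'a::euclidean_space \<Rightarrow> ennreal"
  assumes "A \<in> sets borel"
  shows "(\<integral>\<^sup>+x. f x \<partial>lebesgue_on A) = (\<integral>\<^sup>+x. f x * indicator A x \<partial>lborel)"
proof -
  have "A \<inter> space lebesgue \<in> sets lebesgue" using assms by simp
  then show ?thesis by (simp add: nn_integral_restrict_space nn_integral_completion)
qed

context network
begin

theorem poincare:
  assumes c: "0 < c"
  obtains Cp where "0 < Cp"
    "\<And>K v. 1 \<le> K \<Longrightarrow> v \<in> C1_level N K \<Longrightarrow>
      (\<integral>\<^sup>+x. ennreal ((v x)\<^sup>2) \<partial>lebesgue_on (region N)) \<le> ennreal Cp *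
        ((\<integral>\<^sup>+x. ennreal ((norm (grad v x))\<^sup>2) \<partial>lebesgue_on (region N - ifc_upto N K)) +
         (\<Sum>k=1..K. ennreal (weight N c k) * (\<integral>\<^sup>+\<xi>. ennreal ((normal_jump (ifc N k) v \<xi>)\<^sup>2) \<partial>surface_measure (ifc N k))))"
proof -
  obtain \<theta> where \<theta>: "\<theta> \<noteq> 0" and trans: "\<And>k H. 1 \<le> k \<Longrightarrow> H \<in> hyps k \<Longrightarrow> transversal \<theta> H"
    and cross: "AE x in lborel. \<forall>k\<ge>1. \<forall>q::rat. q > 0 \<longrightarrow> x \<in> region N \<longrightarrow> x + of_rat q *\<^sub>R \<theta> \<in> region N \<longrightarrow>
       finite (open_segment x (x + of_rat q *\<^sub>R \<theta>) \<inter> ifc N k) \<and>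
       card (open_segment x (x + of_rat q *\<^sub>R \<theta>) \<inter> ifc N k) \<le> crossings N k"
    by (rule generic_direction) (rule that)
  obtain R where R: "R > 0" "\<And>x. x \<in> region N \<Longrightarrow> norm x \<le> R" using domain(4) bounded_pos by metis
  \<comment> \<open>The region has diameter at most \<open>2 * R\<close>, so a displacement of
    length \<open>2 * R + 1\<close> leaves it from any starting point.\<close>
  define T where "T = (2 * R + 1) / norm \<theta>"
  have T: "T > 0" using R \<theta> by (simp add: T_def)
  have exit: "x + T *\<^sub>R \<theta> \<notin> region N" if "x \<in> region N" for x
  proof
    assume "x + T *\<^sub>R \<theta> \<in> region N"
    then have "norm (x + T *\<^sub>R \<theta>) \<le> R" by (rule R)
    moreover have "norm (T *\<^sub>R \<theta>) \<le> norm (x + T *\<^sub>R \<theta>) + norm x"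
      using norm_triangle_ineq4[of "x + T *\<^sub>R \<theta>" x] by simp
    moreover have "norm (T *\<^sub>R \<theta>) = 2 * R + 1" using R \<theta> by (simp add: T_def)
    ultimately show False using R(2)[OF that] by simp
  qed
  obtain C where C: "0 < C" and major: "\<And>k K (g :: 'n point \<Rightarrow> ennreal). 1 \<le> k \<Longrightarrow> k \<le> K \<Longrightarrow>
       g \<in> borel_measurable (surface_measure (ifc N k)) \<Longrightarrow>
       \<exists>h\<in>borel_measurable borel.
         (\<forall>x S. (\<forall>t\<in>{0..T}. x + t *\<^sub>R \<theta> \<notin> bad K) \<longrightarrow> finite S \<longrightarrow> S \<subseteq> {t\<in>{0..T}. x + t *\<^sub>R \<theta> \<in> ifc N k} \<longrightarrow>
            (\<Sum>t\<in>S. g (x + t *\<^sub>R \<theta>)) \<le> (h x :: ennreal)) \<and>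
         (\<integral>\<^sup>+x. h x \<partial>lborel) \<le> ennreal C * (\<integral>\<^sup>+\<xi>. g \<xi> \<partial>surface_measure (ifc N k))"
    by (rule crossing_sum_majorant[OF less_imp_le[OF T] trans]) (assumption | rule that)+
  \<comment> \<open>The tube over the Hausdorff null set \<open>bad K\<close> is a Lebesgue null
    set, so almost no line meets it within time \<open>T\<close>.\<close>
  have good: "AE x in lborel. \<forall>t\<in>{0..T}. x + t *\<^sub>R \<theta> \<notin> bad K" for K
  proof -
    obtain C' where "0 < C'" "\<And>E. \<exists>B\<in>sets borel. {x. \<exists>t\<in>{0..T}. x + t *\<^sub>R \<theta> \<in> E} \<subseteq> B \<and>
       emeasure lborel B \<le> ennreal C' * hausdorff_outer (CARD('n) - 1) E"
      by (rule tube_measure[OF less_imp_le[OF T], where \<theta> = \<theta>]) (rule that)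
    then obtain B where B: "B \<in> sets borel" "{x. \<exists>t\<in>{0..T}. x + t *\<^sub>R \<theta> \<in> bad K} \<subseteq> B"
      "emeasure lborel B \<le> ennreal C' * hausdorff_outer (CARD('n) - 1) (bad K)" by blast
    have "emeasure lborel B = 0" using B(3) unfolding hausdorff_bad by simp
    then show ?thesis using B(1,2) by (intro AE_I'[of B]) (auto simp: null_sets_def)
  qed
  have notifc: "AE x in lborel. x \<notin> ifc_upto N K" for K
  proof -
    have "AE x in lebesgue. x \<notin> ifc_upto N K"
      using negligible_subset[OF negligible_ifc_all ifc_upto_ifc_all[of K]]
      by (intro AE_I'[of "ifc_upto N K"]) (auto simp: negligible_iff_null_sets)
    then show ?thesis by (simp add: AE_completion_iff)
  qed
  (* 2 / c is twice the sum of the series of (1 + c) ^ (- k), k \<ge> 1 *)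
  define Cp where "Cp = max (2 * T * T * (norm \<theta>)\<^sup>2) (2 / c * C)"
  have Cp: "Cp > 0" using T \<theta> c C by (simp add: Cp_def less_max_iff_disj)
  show ?thesis
  proof (rule that[OF Cp])
    fix K v assume K: "1 \<le> K" and v: "v \<in> C1_level N K"
    let ?j = "\<lambda>k. normal_jump (ifc N k) v" and ?w = "dir_deriv K v \<theta>"
    have [measurable]: "?w \<in> borel_measurable borel" by (rule dir_deriv_borel[OF K v])
    have "\<forall>k\<in>{1..K}. \<exists>h. h \<in> borel_measurable borel \<and>
         (\<forall>x S. (\<forall>t\<in>{0..T}. x + t *\<^sub>R \<theta> \<notin> bad K) \<longrightarrow> finite S \<longrightarrow> S \<subseteq> {t\<in>{0..T}. x + t *\<^sub>R \<theta> \<in> ifc N k} \<longrightarrow>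
            (\<Sum>t\<in>S. ennreal ((?j k (x + t *\<^sub>R \<theta>))\<^sup>2)) \<le> (h x :: ennreal)) \<and>
         (\<integral>\<^sup>+x. h x \<partial>lborel) \<le> ennreal C * (\<integral>\<^sup>+\<xi>. ennreal ((?j k \<xi>)\<^sup>2) \<partial>surface_measure (ifc N k))"
    proof
      fix k assume k: "k \<in> {1..K}"
      have "(\<lambda>\<xi>. ennreal ((?j k \<xi>)\<^sup>2)) \<in> borel_measurable (surface_measure (ifc N k))"
        using L2_D(1)[OF C1_L2_jump[OF v, of k]] k by simp
      from major[OF _ _ this, of K] k show "\<exists>h. h \<in> borel_measurable borel \<and>
         (\<forall>x S. (\<forall>t\<in>{0..T}. x + t *\<^sub>R \<theta> \<notin> bad K) \<longrightarrow> finite S \<longrightarrow> S \<subseteq> {t\<in>{0..T}. x + t *\<^sub>R \<theta> \<in> ifc N k} \<longrightarrow>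
            (\<Sum>t\<in>S. ennreal ((?j k (x + t *\<^sub>R \<theta>))\<^sup>2)) \<le> (h x :: ennreal)) \<and>
         (\<integral>\<^sup>+x. h x \<partial>lborel) \<le> ennreal C * (\<integral>\<^sup>+\<xi>. ennreal ((?j k \<xi>)\<^sup>2) \<partial>surface_measure (ifc N k))"
        by (auto simp: Bex_def)
    qed
    from bchoice[OF this] obtain h where h: "\<And>k. k \<in> {1..K} \<Longrightarrow> h k \<in> borel_measurable borel"
      "\<And>k x S. k \<in> {1..K} \<Longrightarrow> \<forall>t\<in>{0..T}. x + t *\<^sub>R \<theta> \<notin> bad K \<Longrightarrow> finite S \<Longrightarrow>
          S \<subseteq> {t\<in>{0..T}. x + t *\<^sub>R \<theta> \<in> ifc N k} \<Longrightarrow> (\<Sum>t\<in>S. ennreal ((?j k (x + t *\<^sub>R \<theta>))\<^sup>2)) \<le> (h k x :: ennreal)"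
      "\<And>k. k \<in> {1..K} \<Longrightarrow> (\<integral>\<^sup>+x. h k x \<partial>lborel) \<le> ennreal C * (\<integral>\<^sup>+\<xi>. ennreal ((?j k \<xi>)\<^sup>2) \<partial>surface_measure (ifc N k))"
      by blast
    \<comment> \<open>\<open>A2\<close> is the line integral of the squared derivative, and
      \<open>Hs\<close> majorises the weighted squares of the jumps met by the line. Unlike the
      crossing times themselves, both depend measurably on \<open>x\<close>.\<close>
    define A2 where "A2 x = (\<integral>\<^sup>+t. ennreal ((?w (x + t *\<^sub>R \<theta>))\<^sup>2) * indicator {0..T} t \<partial>lborel)" for x
    define Hs where "Hs x = (\<Sum>k=1..K. ennreal (weight N c k) * h k x)" for x
    have weight: "weight N c k \<ge> 0" for k using c by (simp add: weight_def)
    have pointwise: "AE x in lborel. ennreal ((v x)\<^sup>2) * indicator (region N) x \<le> ennreal (2 * T) * A2 x + ennreal (2 / c) * Hs x"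
      using cross good[of K] notifc[of K]
    proof eventually_elim
      case (elim x)
      show ?case
      proof (cases "x \<in> region N")
        case x: True
        have xK: "x \<in> region N - ifc_upto N K" using x elim by simp
        have "\<exists>S. (\<forall>k\<in>{1..K}. finite (S k) \<and> card (S k) \<le> crossings N k \<and> S k \<subseteq> {t\<in>{0..T}. x + t *\<^sub>R \<theta> \<in> ifc N k}) \<and>
          ennreal \<bar>v x\<bar> \<le> (\<integral>\<^sup>+t. ennreal \<bar>?w (x + t *\<^sub>R \<theta>)\<bar> * indicator {0..T} t \<partial>lborel) +
            ennreal (\<Sum>k=1..K. \<Sum>t\<in>S k. \<bar>?j k (x + t *\<^sub>R \<theta>)\<bar>)"
        proof (rule line_bound[OF K v \<theta> xK T exit[OF x] _ _ elim(2)])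
          show "transversal \<theta> H" if "1 \<le> k" "H \<in> hyps k" for k H using that by (rule trans)
          show "finite (open_segment x (x + of_rat q *\<^sub>R \<theta>) \<inter> ifc N k) \<and>
              card (open_segment x (x + of_rat q *\<^sub>R \<theta>) \<inter> ifc N k) \<le> crossings N k"
            if "1 \<le> k" "q > 0" "x + of_rat q *\<^sub>R \<theta> \<in> region N" for k and q :: rat
            using elim(1) that x by blast
        qed
        then obtain S where S: "\<And>k. k \<in> {1..K} \<Longrightarrow> finite (S k) \<and> card (S k) \<le> crossings N k \<and> S k \<subseteq> {t\<in>{0..T}. x + t *\<^sub>R \<theta> \<in> ifc N k}"
          and bound: "ennreal \<bar>v x\<bar> \<le> (\<integral>\<^sup>+t. ennreal \<bar>?w (x + t *\<^sub>R \<theta>)\<bar> * indicator {0..T} t \<partial>lborel) +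
            ennreal (\<Sum>k=1..K. \<Sum>t\<in>S k. \<bar>?j k (x + t *\<^sub>R \<theta>)\<bar>)"
          by blast
        define A where "A = (\<integral>\<^sup>+t. ennreal \<bar>?w (x + t *\<^sub>R \<theta>)\<bar> * indicator {0..T} t \<partial>lborel)"
        define b where "b = (\<Sum>k=1..K. \<Sum>t\<in>S k. \<bar>?j k (x + t *\<^sub>R \<theta>)\<bar>)"
        have b0: "b \<ge> 0" unfolding b_def by (intro sum_nonneg) auto
        have "ennreal ((v x)\<^sup>2) = (ennreal \<bar>v x\<bar>)\<^sup>2" by (simp add: ennreal_power)
        also have "\<dots> \<le> (A + ennreal b)\<^sup>2" using bound unfolding A_def b_def by (intro power_mono) auto
        also have "\<dots> \<le> 2 * A\<^sup>2 + 2 * (ennreal b)\<^sup>2" by (rule ennreal_add_square_le)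
        also have "A\<^sup>2 \<le> A2 x * ennreal T"
        proof -
          \<comment> \<open>Cauchy-Schwarz on the time interval, whose length is the factor
            \<open>T\<close>.\<close>
          have sp: "{0..T} \<inter> space lborel \<in> sets lborel" by simp
          have em: "emeasure (restrict_space lborel {0..T}) (space (restrict_space lborel {0..T})) = ennreal T"
            using T by (simp add: space_restrict_space emeasure_restrict_space)
          have "(\<integral>\<^sup>+t. ennreal \<bar>?w (x + t *\<^sub>R \<theta>)\<bar> \<partial>restrict_space lborel {0..T})\<^sup>2
              \<le> (\<integral>\<^sup>+t. ennreal (\<bar>?w (x + t *\<^sub>R \<theta>)\<bar>\<^sup>2) \<partial>restrict_space lborel {0..T}) * ennreal T"
            unfolding em[symmetric]
          proof (rule nn_integral_Cauchy_Schwarz)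
            show "(\<lambda>t. \<bar>?w (x + t *\<^sub>R \<theta>)\<bar>) \<in> borel_measurable (restrict_space lborel {0..T})"
              by (intro measurable_restrict_space1) measurable
          qed (use em in auto)
          then show ?thesis unfolding A_def A2_def by (simp add: nn_integral_restrict_space[OF sp])
        qed
        \<comment> \<open>The sum over k costs the weights \<open>(1 + c) ^ k\<close>, and squaring
          a sum of at most \<open>crossings N k\<close> jumps costs that number; the product is
          exactly \<open>weight N c k\<close>.\<close>
        also have "(ennreal b)\<^sup>2 \<le> ennreal (1 / c) * Hs x"
        proof -
          have "b\<^sup>2 \<le> 1 / c * (\<Sum>k=1..K. (1 + c) ^ k * (\<Sum>t\<in>S k. \<bar>?j k (x + t *\<^sub>R \<theta>)\<bar>)\<^sup>2)"
            unfolding b_def by (rule weighted_sum_square[OF c])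
          also have "\<dots> \<le> 1 / c * (\<Sum>k=1..K. weight N c k * (\<Sum>t\<in>S k. (?j k (x + t *\<^sub>R \<theta>))\<^sup>2))"
          proof (intro mult_left_mono sum_mono)
            fix k assume k: "k \<in> {1..K}"
            have "(\<Sum>t\<in>S k. \<bar>?j k (x + t *\<^sub>R \<theta>)\<bar>)\<^sup>2 \<le> (\<Sum>t\<in>S k. \<bar>?j k (x + t *\<^sub>R \<theta>)\<bar>\<^sup>2) * card (S k)"
              by (rule sum_squared_le_sum_of_squares)
            also have "\<dots> \<le> (\<Sum>t\<in>S k. \<bar>?j k (x + t *\<^sub>R \<theta>)\<bar>\<^sup>2) * crossings N k"
              using S[OF k] by (intro mult_left_mono sum_nonneg) auto
            finally have "(1 + c) ^ k * (\<Sum>t\<in>S k. \<bar>?j k (x + t *\<^sub>R \<theta>)\<bar>)\<^sup>2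
                \<le> (1 + c) ^ k * ((\<Sum>t\<in>S k. \<bar>?j k (x + t *\<^sub>R \<theta>)\<bar>\<^sup>2) * crossings N k)"
              using c by (intro mult_left_mono) auto
            then show "(1 + c) ^ k * (\<Sum>t\<in>S k. \<bar>?j k (x + t *\<^sub>R \<theta>)\<bar>)\<^sup>2 \<le> weight N c k * (\<Sum>t\<in>S k. (?j k (x + t *\<^sub>R \<theta>))\<^sup>2)"
              by (simp add: weight_def ac_simps)
          qed (use c in auto)
          finally have "ennreal (b\<^sup>2) \<le> ennreal (1 / c * (\<Sum>k=1..K. weight N c k * (\<Sum>t\<in>S k. (?j k (x + t *\<^sub>R \<theta>))\<^sup>2)))"
            by (rule ennreal_leI)
          also have "\<dots> = ennreal (1 / c) * ennreal (\<Sum>k=1..K. weight N c k * (\<Sum>t\<in>S k. (?j k (x + t *\<^sub>R \<theta>))\<^sup>2))"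
            using c by (intro ennreal_mult') simp
          also have "ennreal (\<Sum>k=1..K. weight N c k * (\<Sum>t\<in>S k. (?j k (x + t *\<^sub>R \<theta>))\<^sup>2))
              = (\<Sum>k=1..K. ennreal (weight N c k) * (\<Sum>t\<in>S k. ennreal ((?j k (x + t *\<^sub>R \<theta>))\<^sup>2)))"
            using weight by (subst sum_ennreal[symmetric]) (auto simp: ennreal_mult' sum_ennreal intro!: sum_nonneg mult_nonneg_nonneg)
          also have "ennreal (1 / c) * \<dots> \<le> ennreal (1 / c) * Hs x"
            unfolding Hs_def using S by (intro mult_left_mono sum_mono h(2) elim(2)) auto
          finally show ?thesis using b0 by (simp add: ennreal_power)
        qed
        finally have "ennreal ((v x)\<^sup>2) \<le> 2 * (A2 x * ennreal T) + 2 * (ennreal (1 / c) * Hs x)"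
          by (simp add: add_mono mult_left_mono)
        also have "\<dots> = ennreal (2 * T) * A2 x + ennreal (2 / c) * Hs x"
        proof -
          have "ennreal (2 * T) = 2 * ennreal T" "ennreal (2 / c) = 2 * ennreal (1 / c)"
            using ennreal_mult'[of 2 T] ennreal_mult'[of 2 "1 / c"] by simp_all
          then show ?thesis by (simp add: ac_simps)
        qed
        finally show ?thesis using x by simp
      qed simp
    qed
    have A2_meas: "A2 \<in> borel_measurable borel"
    proof -
      have "(\<lambda>p :: 'n point \<times> real. fst p + snd p *\<^sub>R \<theta>) \<in> borel_measurable (lborel \<Otimes>\<^sub>M lborel)" by measurable
      then have "(\<lambda>p :: 'n point \<times> real. ennreal ((?w (fst p + snd p *\<^sub>R \<theta>))\<^sup>2) * indicator {0..T} (snd p)) \<in> borel_measurable (lborel \<Otimes>\<^sub>M lborel)"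
        by measurable
      then have "(\<lambda>x. \<integral>\<^sup>+t. ennreal ((?w (x + t *\<^sub>R \<theta>))\<^sup>2) * indicator {0..T} t \<partial>lborel) \<in> borel_measurable (lborel :: 'n point measure)"
        by (intro sigma_finite_measure.borel_measurable_nn_integral sigma_finite_lborel) (simp add: split_beta)
      then show ?thesis by (simp add: A2_def[abs_def])
    qed
    have Hs_meas: "Hs \<in> borel_measurable borel"
      unfolding Hs_def using h(1) by (intro borel_measurable_sum borel_measurable_times_ennreal) auto
    have "(\<integral>\<^sup>+x. ennreal ((v x)\<^sup>2) \<partial>lebesgue_on (region N)) = (\<integral>\<^sup>+x. ennreal ((v x)\<^sup>2) * indicator (region N) x \<partial>lborel)"
      by (rule nn_integral_lebesgue_on[OF region_borel])
    also have "\<dots> \<le> (\<integral>\<^sup>+x. ennreal (2 * T) * A2 x + ennreal (2 / c) * Hs x \<partial>lborel)"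
      by (rule nn_integral_mono_AE[OF pointwise])
    also have "\<dots> = ennreal (2 * T) * (\<integral>\<^sup>+x. A2 x \<partial>lborel) + ennreal (2 / c) * (\<integral>\<^sup>+x. Hs x \<partial>lborel)"
      using A2_meas Hs_meas by (subst nn_integral_add) (auto simp: nn_integral_cmult)
    also have "(\<integral>\<^sup>+x. A2 x \<partial>lborel) = ennreal T * (\<integral>\<^sup>+x. ennreal ((?w x)\<^sup>2) \<partial>lborel)"
      unfolding A2_def using T by (intro nn_integral_line_average) auto
    also have "(\<integral>\<^sup>+x. Hs x \<partial>lborel) = (\<Sum>k=1..K. ennreal (weight N c k) * (\<integral>\<^sup>+x. h k x \<partial>lborel))"
      unfolding Hs_def using h(1) by (subst nn_integral_sum) (auto simp: nn_integral_cmult)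
    also have "ennreal (2 * T) * (ennreal T * (\<integral>\<^sup>+x. ennreal ((?w x)\<^sup>2) \<partial>lborel))
        \<le> ennreal Cp * (\<integral>\<^sup>+x. ennreal ((norm (grad v x))\<^sup>2) \<partial>lebesgue_on (region N - ifc_upto N K))"
    proof -
      let ?A = "region N - ifc_upto N K"
      have "(\<integral>\<^sup>+x. ennreal ((?w x)\<^sup>2) \<partial>lborel)
          \<le> (\<integral>\<^sup>+x. ennreal ((norm \<theta>)\<^sup>2) * (ennreal ((norm (grad v x))\<^sup>2) * indicator ?A x) \<partial>lborel)"
      proof (rule nn_integral_mono)
        fix x
        have "(grad v x \<bullet> \<theta>)\<^sup>2 \<le> (norm \<theta>)\<^sup>2 * (norm (grad v x))\<^sup>2"
          using Cauchy_Schwarz_ineq[of "grad v x" \<theta>] by (simp add: power2_norm_eq_inner mult.commute)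
        then have "ennreal ((grad v x \<bullet> \<theta>)\<^sup>2) \<le> ennreal ((norm \<theta>)\<^sup>2) * ennreal ((norm (grad v x))\<^sup>2)"
          by (simp add: ennreal_leI flip: ennreal_mult')
        then show "ennreal ((?w x)\<^sup>2) \<le> ennreal ((norm \<theta>)\<^sup>2) * (ennreal ((norm (grad v x))\<^sup>2) * indicator ?A x)"
          by (auto simp: dir_deriv_def indicator_def)
      qed
      also have "\<dots> = ennreal ((norm \<theta>)\<^sup>2) * (\<integral>\<^sup>+x. ennreal ((norm (grad v x))\<^sup>2) * indicator ?A x \<partial>lborel)"
      proof (rule nn_integral_cmult)
        have "(\<lambda>x. indicator ?A x *\<^sub>R grad v x) \<in> borel_measurable borel"
          using open_level[OF K] C1_continuous_grad[OF K v] by (intro borel_measurable_continuous_on_indicator) auto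
        then have "(\<lambda>x. ennreal ((norm (indicator ?A x *\<^sub>R grad v x))\<^sup>2)) \<in> borel_measurable borel" by measurable
        moreover have eq: "(\<lambda>x. ennreal ((norm (indicator ?A x *\<^sub>R grad v x))\<^sup>2)) = (\<lambda>x. ennreal ((norm (grad v x))\<^sup>2) * indicator ?A x)"
          by (auto simp: indicator_def)
        ultimately show "(\<lambda>x. ennreal ((norm (grad v x))\<^sup>2) * indicator ?A x) \<in> borel_measurable lborel"
          unfolding eq[symmetric] by (subst measurable_cong_sets[OF sets_lborel refl])
      qed
      also have "(\<integral>\<^sup>+x. ennreal ((norm (grad v x))\<^sup>2) * indicator ?A x \<partial>lborel)
          = (\<integral>\<^sup>+x. ennreal ((norm (grad v x))\<^sup>2) \<partial>lebesgue_on ?A)"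
        using open_level[OF K] by (intro nn_integral_lebesgue_on[symmetric]) simp
      finally have "ennreal (2 * T) * (ennreal T * (\<integral>\<^sup>+x. ennreal ((?w x)\<^sup>2) \<partial>lborel))
          \<le> ennreal (2 * T) * (ennreal T * (ennreal ((norm \<theta>)\<^sup>2) * (\<integral>\<^sup>+x. ennreal ((norm (grad v x))\<^sup>2) \<partial>lebesgue_on ?A)))"
        by (intro mult_left_mono) auto
      also have "\<dots> = ennreal (2 * T * T * (norm \<theta>)\<^sup>2) * (\<integral>\<^sup>+x. ennreal ((norm (grad v x))\<^sup>2) \<partial>lebesgue_on ?A)"
        using T by (simp add: ennreal_mult' mult.assoc)
      also have "\<dots> \<le> ennreal Cp * (\<integral>\<^sup>+x. ennreal ((norm (grad v x))\<^sup>2) \<partial>lebesgue_on ?A)"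
        by (intro mult_right_mono ennreal_leI) (auto simp: Cp_def)
      finally show ?thesis .
    qed
    also have "ennreal (2 / c) * (\<Sum>k=1..K. ennreal (weight N c k) * (\<integral>\<^sup>+x. h k x \<partial>lborel))
        \<le> ennreal Cp * (\<Sum>k=1..K. ennreal (weight N c k) * (\<integral>\<^sup>+\<xi>. ennreal ((?j k \<xi>)\<^sup>2) \<partial>surface_measure (ifc N k)))"
    proof -
      let ?J = "\<lambda>k. \<integral>\<^sup>+\<xi>. ennreal ((?j k \<xi>)\<^sup>2) \<partial>surface_measure (ifc N k)"
      have "ennreal (2 / c) * (\<Sum>k=1..K. ennreal (weight N c k) * (\<integral>\<^sup>+x. h k x \<partial>lborel))
          \<le> ennreal (2 / c) * (\<Sum>k=1..K. ennreal (weight N c k) * (ennreal C * ?J k))"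
        using h(3) by (intro mult_left_mono sum_mono) auto
      also have "\<dots> = (ennreal (2 / c) * ennreal C) * (\<Sum>k=1..K. ennreal (weight N c k) * ?J k)"
        by (simp add: sum_distrib_left ac_simps)
      also have "ennreal (2 / c) * ennreal C = ennreal (2 / c * C)" using c C by (intro ennreal_mult'[symmetric]) simp
      also have "ennreal (2 / c * C) * (\<Sum>k=1..K. ennreal (weight N c k) * ?J k) \<le> ennreal Cp * (\<Sum>k=1..K. ennreal (weight N c k) * ?J k)"
        by (intro mult_right_mono ennreal_leI) (auto simp: Cp_def)
      finally show ?thesis .
    qed
    finally show "(\<integral>\<^sup>+x. ennreal ((v x)\<^sup>2) \<partial>lebesgue_on (region N)) \<le> ennreal Cp *
        ((\<integral>\<^sup>+x. ennreal ((norm (grad v x))\<^sup>2) \<partial>lebesgue_on (region N - ifc_upto N K)) +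
         (\<Sum>k=1..K. ennreal (weight N c k) * (\<integral>\<^sup>+\<xi>. ennreal ((normal_jump (ifc N k) v \<xi>)\<^sup>2) \<partial>surface_measure (ifc N k))))"
      by (simp add: distrib_left add_mono)
  qed
qed

end

section \<open>Lebesgue integrals off a null set\<close>

text \<open>By completeness of Lebesgue measure the values on the null set \<open>A - B\<close> may
  be arbitrary. This matters for gradients, which have no specified values on interfaces.\<close>

lemma lebesgue_on_measurable_extend:
  fixes f :: "'a::euclidean_space \<Rightarrow> 'b::euclidean_space"
  assumes A: "A \<in> sets lebesgue" and B: "B \<in> sets lebesgue" "B \<subseteq> A" "negligible (A - B)"
    and f: "f \<in> borel_measurable (lebesgue_on B)"
  shows "f \<in> borel_measurable (lebesgue_on A)"
proof (rule measurableI)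
  fix S :: "'b set" assume S: "S \<in> sets borel"
  have "negligible (f -` S \<inter> (A - B))" using B(3) by (rule negligible_subset) auto
  then have "f -` S \<inter> (A - B) \<in> sets lebesgue"
    by (rule negligible_imp_sets)
  moreover have "f -` S \<inter> B \<in> sets lebesgue"
  proof -
    have "f -` S \<inter> space (lebesgue_on B) \<in> sets (lebesgue_on B)" by (rule measurable_sets[OF f S])
    then show ?thesis using B(1) by (subst (asm) sets_restrict_space_iff) auto
  qed
  ultimately have "(f -` S \<inter> B) \<union> (f -` S \<inter> (A - B)) \<in> sets lebesgue" by (rule sets.Un[rotated])
  moreover have "(f -` S \<inter> B) \<union> (f -` S \<inter> (A - B)) = f -` S \<inter> A" using B(2) by auto
  ultimately show "f -` S \<inter> space (lebesgue_on A) \<in> sets (lebesgue_on A)"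
    using A by (subst sets_restrict_space_iff) auto
qed simp

lemma lebesgue_on_integral_extend:
  fixes f :: "'a::euclidean_space \<Rightarrow> 'b::euclidean_space"
  assumes A: "A \<in> sets lebesgue" and B: "B \<in> sets lebesgue" "B \<subseteq> A" "negligible (A - B)"
    and f: "f \<in> borel_measurable (lebesgue_on B)"
  shows "(LINT x|lebesgue_on A. f x) = (LINT x|lebesgue_on B. f x)"
proof -
  have AB: "A \<inter> space lebesgue \<in> sets lebesgue" "B \<inter> space lebesgue \<in> sets lebesgue" using A B by auto
  have fA: "f \<in> borel_measurable (lebesgue_on A)" by (rule lebesgue_on_measurable_extend[OF A B f])
  have "(LINT x|lebesgue. indicator A x *\<^sub>R f x) = (LINT x|lebesgue. indicator B x *\<^sub>R f x)"
  proof (rule integral_cong_AE)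
    show "(\<lambda>x. indicator A x *\<^sub>R f x) \<in> borel_measurable lebesgue"
      using fA by (subst (asm) borel_measurable_restrict_space_iff[OF AB(1)])
    show "(\<lambda>x. indicator B x *\<^sub>R f x) \<in> borel_measurable lebesgue"
      using f by (subst (asm) borel_measurable_restrict_space_iff[OF AB(2)])
    show "AE x in lebesgue. indicator A x *\<^sub>R f x = indicator B x *\<^sub>R f x"
      by (rule AE_I'[of "A - B"]) (use B in \<open>auto simp: negligible_iff_null_sets indicator_def\<close>)
  qed
  then show ?thesis by (simp only: integral_restrict_space[OF AB(1)] integral_restrict_space[OF AB(2)])
qed

section \<open>Jumps as functions on the whole network\<close>

context network
begin

definition idx :: "'n point \<Rightarrow> nat" where
  "idx \<xi> = (THE k. 1 \<le> k \<and> \<xi> \<in> ifc N k)"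

lemma idx_eq: "1 \<le> k \<Longrightarrow> \<xi> \<in> ifc N k \<Longrightarrow> idx \<xi> = k"
  unfolding idx_def by (rule the_equality) (blast intro: ifc_disjointD)+

text \<open>Packs one function per interface into a single function. Since the interfaces are
  disjoint, nothing on them is lost; off the network the value is unspecified.\<close>

definition glue :: "(nat \<Rightarrow> 'n point \<Rightarrow> real) \<Rightarrow> 'n point \<Rightarrow> real" where
  "glue j \<xi> = j (idx \<xi>) \<xi>"

lemma glue_eq: "1 \<le> k \<Longrightarrow> \<xi> \<in> ifc N k \<Longrightarrow> glue j \<xi> = j k \<xi>"
  by (simp add: glue_def idx_eq)

text \<open>With this measure the weighted sequence space of the jumps becomes a single \<open>L2\<close> space.\<close>

definition jump_measure :: "real \<Rightarrow> 'n point measure" where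
  "jump_measure c = density (surface_measure (ifc_all N)) (\<lambda>\<xi>. ennreal (weight N c (idx \<xi>)))"

lemma ifc_all_Suc: "ifc_all N = (\<Union>k. ifc N (Suc k))"
proof (intro set_eqI iffI)
  fix x assume "x \<in> ifc_all N"
  then obtain k where "1 \<le> k" "x \<in> ifc N k" by (auto simp: ifc_all_def)
  then show "x \<in> (\<Union>k. ifc N (Suc k))" by (cases k) auto
qed (auto simp: ifc_all_def)

lemma ifc_all_E:
  assumes "\<xi> \<in> ifc_all N" obtains k where "1 \<le> k" "\<xi> \<in> ifc N k"
  using assms by (auto simp: ifc_all_def)

lemma restrict_surface_measure:
  assumes "1 \<le> k"
  shows "restrict_space (surface_measure (ifc_all N)) (ifc N k) = surface_measure (ifc N k)"
proof -
  have "ifc_all N \<inter> ifc N k = ifc N k" using assms by (auto simp: ifc_all_def)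
  then show ?thesis
    unfolding surface_measure_def
    using restrict_restrict_space[OF borel_Int_surface[OF ifc_all_borel] borel_Int_surface[OF ifc_borel[OF assms]]]
    by simp
qed

lemma measurable_surface_all:
  "f \<in> measurable (surface_measure (ifc_all N)) M \<longleftrightarrow> (\<forall>k\<ge>1. f \<in> measurable (surface_measure (ifc N k)) M)"
proof -
  let ?C = "ifc N ` {1..}"
  have "f \<in> measurable (surface_measure (ifc_all N)) M
      \<longleftrightarrow> (\<forall>\<Omega>\<in>?C. f \<in> measurable (restrict_space (surface_measure (ifc_all N)) \<Omega>) M)"
  proof (rule measurable_piecewise_restrict_iff)
    fix \<Omega> assume "\<Omega> \<in> ?C"
    then obtain k where k: "1 \<le> k" "\<Omega> = ifc N k" by auto
    then have "ifc N k \<subseteq> ifc_all N" by (auto simp: ifc_all_def)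
    then show "\<Omega> \<inter> space (surface_measure (ifc_all N)) \<in> sets (surface_measure (ifc_all N))"
      using k ifc_borel[OF k(1)] borel_hausdorff_measurable
      by (subst sets_surface_measure[OF ifc_all_borel]) (auto simp: Int_absorb2)
  qed (auto simp: ifc_all_def)
  then show ?thesis by (auto simp: restrict_surface_measure)
qed

lemma glue_measurable:
  assumes "\<And>k. 1 \<le> k \<Longrightarrow> j k \<in> borel_measurable (surface_measure (ifc N k))"
  shows "glue j \<in> borel_measurable (surface_measure (ifc_all N))"
  unfolding measurable_surface_all
proof (intro allI impI)
  fix k :: nat assume k: "k \<ge> 1"
  have "glue j \<in> borel_measurable (surface_measure (ifc N k)) \<longleftrightarrow> j k \<in> borel_measurable (surface_measure (ifc N k))"
    by (rule measurable_cong) (simp add: glue_eq[OF k])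
  then show "glue j \<in> borel_measurable (surface_measure (ifc N k))" using assms[OF k] by simp
qed

lemma weight_measurable: "(\<lambda>\<xi>. weight N c (idx \<xi>)) \<in> borel_measurable (surface_measure (ifc_all N))"
  using glue_measurable[of "\<lambda>k \<xi>. weight N c k"] by (simp add: glue_def[abs_def])

lemma weight_nonneg: "0 < c \<Longrightarrow> 0 \<le> weight N c k"
  by (simp add: weight_def)

lemma space_jump_measure [simp]: "space (jump_measure c) = ifc_all N"
  and sets_jump_measure [measurable_cong]: "sets (jump_measure c) = sets (surface_measure (ifc_all N))"
  by (simp_all add: jump_measure_def)

text \<open>Countable additivity over the disjoint interfaces, on each of which the density is the
  constant weight.\<close>

lemma nn_integral_jump_measure:
  assumes F: "F \<in> borel_measurable (surface_measure (ifc_all N))"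
  shows "(\<integral>\<^sup>+\<xi>. F \<xi> \<partial>jump_measure c) = (\<Sum>k. ennreal (weight N c (Suc k)) * (\<integral>\<^sup>+\<xi>. F \<xi> \<partial>surface_measure (ifc N (Suc k))))"
proof -
  let ?H = "hausdorff_measure (CARD('n) - 1) :: 'n point measure"
  have W: "(\<lambda>\<xi>. ennreal (weight N c (idx \<xi>))) \<in> borel_measurable (surface_measure (ifc_all N))"
    using weight_measurable by simp
  define G where "G \<xi> = ennreal (weight N c (idx \<xi>)) * F \<xi> * indicator (ifc_all N) \<xi>" for \<xi>
  have "(\<lambda>\<xi>. ennreal (weight N c (idx \<xi>)) * F \<xi>) \<in> borel_measurable (surface_measure (ifc_all N))"
    using W F by (rule borel_measurable_times_ennreal)
  then have G: "G \<in> borel_measurable ?H"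
    unfolding surface_measure_def G_def
    by (subst (asm) borel_measurable_restrict_space_iff_ennreal[OF borel_Int_surface[OF ifc_all_borel]])
  have "(\<integral>\<^sup>+\<xi>. F \<xi> \<partial>jump_measure c) = (\<integral>\<^sup>+\<xi>. ennreal (weight N c (idx \<xi>)) * F \<xi> \<partial>surface_measure (ifc_all N))"
    unfolding jump_measure_def by (rule nn_integral_density[OF W F])
  also have "\<dots> = (\<integral>\<^sup>+\<xi>. G \<xi> \<partial>?H)"
    unfolding surface_measure_def G_def by (rule nn_integral_restrict_space[OF borel_Int_surface[OF ifc_all_borel]])
  also have "\<dots> = (\<integral>\<^sup>+\<xi>\<in>(\<Union>k. ifc N (Suc k)). G \<xi> \<partial>?H)"
    unfolding ifc_all_Suc[symmetric] by (intro nn_integral_cong) (auto simp: G_def indicator_def)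
  also have "\<dots> = (\<Sum>k. \<integral>\<^sup>+\<xi>\<in>ifc N (Suc k). G \<xi> \<partial>?H)"
  proof (rule nn_integral_disjoint_family[OF G])
    show "ifc N (Suc k) \<in> sets ?H" for k using ifc_borel[of "Suc k"] by (intro borel_hausdorff_measurable) simp
    show "disjoint_family (\<lambda>k. ifc N (Suc k))"
      unfolding disjoint_family_on_def
    proof (intro ballI impI)
      fix m n :: nat assume "m \<noteq> n"
      then show "ifc N (Suc m) \<inter> ifc N (Suc n) = {}" using ifc_disjointD[of "Suc m" "Suc n"] by auto
    qed
  qed
  also have "\<dots> = (\<Sum>k. ennreal (weight N c (Suc k)) * (\<integral>\<^sup>+\<xi>. F \<xi> \<partial>surface_measure (ifc N (Suc k))))"
  proof (rule suminf_cong)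
    fix k
    have k: "1 \<le> Suc k" by simp
    have sub: "ifc N (Suc k) \<subseteq> ifc_all N" by (auto simp: ifc_all_Suc)
    have "(\<integral>\<^sup>+\<xi>\<in>ifc N (Suc k). G \<xi> \<partial>?H) = (\<integral>\<^sup>+\<xi>. ennreal (weight N c (Suc k)) * F \<xi> * indicator (ifc N (Suc k)) \<xi> \<partial>?H)"
      using sub idx_eq[OF k] by (intro nn_integral_cong) (auto simp: G_def indicator_def)
    also have "\<dots> = (\<integral>\<^sup>+\<xi>. ennreal (weight N c (Suc k)) * F \<xi> \<partial>surface_measure (ifc N (Suc k)))"
      unfolding surface_measure_def
      by (rule nn_integral_restrict_space[OF borel_Int_surface[OF ifc_borel[OF k]], symmetric])
    also have "\<dots> = ennreal (weight N c (Suc k)) * (\<integral>\<^sup>+\<xi>. F \<xi> \<partial>surface_measure (ifc N (Suc k)))"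
      using F k by (intro nn_integral_cmult) (simp add: measurable_surface_all)
    finally show "(\<integral>\<^sup>+\<xi>\<in>ifc N (Suc k). G \<xi> \<partial>?H) = ennreal (weight N c (Suc k)) * (\<integral>\<^sup>+\<xi>. F \<xi> \<partial>surface_measure (ifc N (Suc k)))" .
  qed
  finally show ?thesis .
qed

lemma integral_jump_measure:
  fixes F :: "'n point \<Rightarrow> real"
  assumes c: "0 < c" and F: "integrable (jump_measure c) F"
  shows "(LINT \<xi>|jump_measure c. F \<xi>) = (\<Sum>k. weight N c (Suc k) * (LINT \<xi>|surface_measure (ifc N (Suc k)). F \<xi>))"
proof -
  let ?H = "hausdorff_measure (CARD('n) - 1) :: 'n point measure"
  have Fm: "F \<in> borel_measurable (surface_measure (ifc_all N))"
    using borel_measurable_integrable[OF F] by (simp add: measurable_cong_sets[OF sets_jump_measure refl])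
  note wn = weight_nonneg[OF c]
  define G where "G \<xi> = weight N c (idx \<xi>) *\<^sub>R F \<xi>" for \<xi>
  have intG: "integrable (surface_measure (ifc_all N)) G"
    using F Fm weight_measurable wn unfolding jump_measure_def G_def by (subst (asm) integrable_density) auto
  have "(LINT \<xi>|jump_measure c. F \<xi>) = (LINT \<xi>|surface_measure (ifc_all N). G \<xi>)"
    unfolding jump_measure_def G_def using Fm weight_measurable wn by (intro integral_density) auto
  also have "\<dots> = (LINT \<xi>:ifc_all N|?H. G \<xi>)"
    unfolding surface_measure_def set_lebesgue_integral_def
    by (rule integral_restrict_space[OF borel_Int_surface[OF ifc_all_borel]])
  also have "\<dots> = (LINT \<xi>:(\<Union>k. ifc N (Suc k))|?H. G \<xi>)" by (simp add: ifc_all_Suc)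
  also have "\<dots> = (\<Sum>k. LINT \<xi>:ifc N (Suc k)|?H. G \<xi>)"
  proof (rule lebesgue_integral_countable_add)
    show "ifc N (Suc k) \<in> sets ?H" for k using ifc_borel[of "Suc k"] by (intro borel_hausdorff_measurable) simp
    show "ifc N (Suc m) \<inter> ifc N (Suc n) = {}" if "m \<noteq> n" for m n
      using ifc_disjointD[of "Suc m" "Suc n"] that by auto
    show "set_integrable ?H (\<Union>k. ifc N (Suc k)) G"
      using intG unfolding surface_measure_def set_integrable_def ifc_all_Suc[symmetric]
      by (subst (asm) integrable_restrict_space[OF borel_Int_surface[OF ifc_all_borel]])
  qed
  also have "\<dots> = (\<Sum>k. weight N c (Suc k) * (LINT \<xi>|surface_measure (ifc N (Suc k)). F \<xi>))"
  proof (rule suminf_cong)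
    fix k
    have k: "1 \<le> Suc k" by simp
    have "(LINT \<xi>:ifc N (Suc k)|?H. G \<xi>) = (LINT \<xi>|surface_measure (ifc N (Suc k)). G \<xi>)"
      unfolding surface_measure_def set_lebesgue_integral_def
      by (rule integral_restrict_space[OF borel_Int_surface[OF ifc_borel[OF k]], symmetric])
    also have "\<dots> = (LINT \<xi>|surface_measure (ifc N (Suc k)). weight N c (Suc k) * F \<xi>)"
      by (rule Bochner_Integration.integral_cong) (simp_all add: G_def idx_eq[OF k])
    finally show "(LINT \<xi>:ifc N (Suc k)|?H. G \<xi>) = weight N c (Suc k) * (LINT \<xi>|surface_measure (ifc N (Suc k)). F \<xi>)"
      by simp
  qed
  finally show ?thesis .
qed

lemma L2_jump_measureI:
  fixes f :: "'n point \<Rightarrow> real"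
  assumes c: "0 < c" and f: "\<And>k. 1 \<le> k \<Longrightarrow> f \<in> L2 (surface_measure (ifc N k))"
    and sm: "summable (\<lambda>k. weight N c (Suc k) * (LINT \<xi>|surface_measure (ifc N (Suc k)). (f \<xi>)\<^sup>2))"
  shows "f \<in> L2 (jump_measure c)"
proof (rule L2_I_nn)
  have m: "f \<in> borel_measurable (surface_measure (ifc_all N))"
    unfolding measurable_surface_all using L2_D(1)[OF f] by blast
  then show "f \<in> borel_measurable (jump_measure c)" by (simp add: measurable_cong_sets[OF sets_jump_measure refl])
  have "(\<integral>\<^sup>+\<xi>. ennreal ((norm (f \<xi>))\<^sup>2) \<partial>jump_measure c)
      = (\<Sum>k. ennreal (weight N c (Suc k)) * (\<integral>\<^sup>+\<xi>. ennreal ((norm (f \<xi>))\<^sup>2) \<partial>surface_measure (ifc N (Suc k))))"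
    using m by (intro nn_integral_jump_measure) simp
  also have "\<dots> = (\<Sum>k. ennreal (weight N c (Suc k) * (LINT \<xi>|surface_measure (ifc N (Suc k)). (f \<xi>)\<^sup>2)))"
  proof (rule suminf_cong)
    fix k
    have "(\<integral>\<^sup>+\<xi>. ennreal ((norm (f \<xi>))\<^sup>2) \<partial>surface_measure (ifc N (Suc k)))
        = ennreal (LINT \<xi>|surface_measure (ifc N (Suc k)). (norm (f \<xi>))\<^sup>2)"
      using L2_D(2)[OF f[of "Suc k"]] by (intro nn_integral_eq_integral) auto
    then show "ennreal (weight N c (Suc k)) * (\<integral>\<^sup>+\<xi>. ennreal ((norm (f \<xi>))\<^sup>2) \<partial>surface_measure (ifc N (Suc k)))
        = ennreal (weight N c (Suc k) * (LINT \<xi>|surface_measure (ifc N (Suc k)). (f \<xi>)\<^sup>2))"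
      using weight_nonneg[OF c] by (simp add: ennreal_mult')
  qed
  also have "\<dots> = ennreal (\<Sum>k. weight N c (Suc k) * (LINT \<xi>|surface_measure (ifc N (Suc k)). (f \<xi>)\<^sup>2))"
    using weight_nonneg[OF c] sm by (intro suminf_ennreal2) auto
  finally show "(\<integral>\<^sup>+\<xi>. ennreal ((norm (f \<xi>))\<^sup>2) \<partial>jump_measure c) < \<infinity>" by simp
qed

text \<open>An interface with \<open>crossings N k = 0\<close> has weight 0 and is invisible to
  \<open>jump_measure c\<close>, hence the condition on the weight in the first claim.\<close>

lemma L2_jump_measureD:
  fixes f :: "'n point \<Rightarrow> real"
  assumes c: "0 < c" and f: "f \<in> L2 (jump_measure c)"
  shows "\<And>k. weight N c (Suc k) \<noteq> 0 \<Longrightarrow> f \<in> L2 (surface_measure (ifc N (Suc k)))"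
    and "summable (\<lambda>k. weight N c (Suc k) * (LINT \<xi>|surface_measure (ifc N (Suc k)). (f \<xi>)\<^sup>2))"
proof -
  have m: "f \<in> borel_measurable (surface_measure (ifc_all N))"
    using L2_D(1)[OF f] by (simp add: measurable_cong_sets[OF sets_jump_measure refl])
  let ?n = "\<lambda>k. \<integral>\<^sup>+\<xi>. ennreal ((norm (f \<xi>))\<^sup>2) \<partial>surface_measure (ifc N (Suc k))"
  have "(\<integral>\<^sup>+\<xi>. ennreal ((norm (f \<xi>))\<^sup>2) \<partial>jump_measure c) = (\<Sum>k. ennreal (weight N c (Suc k)) * ?n k)"
    using m by (intro nn_integral_jump_measure) simp
  moreover have "(\<integral>\<^sup>+\<xi>. ennreal ((norm (f \<xi>))\<^sup>2) \<partial>jump_measure c) < \<infinity>"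
    using L2_D(2)[OF f] by (simp add: integrable_iff_bounded)
  ultimately have fin: "(\<Sum>k. ennreal (weight N c (Suc k)) * ?n k) < \<infinity>" by simp
  note wn = weight_nonneg[OF c]
  show L: "f \<in> L2 (surface_measure (ifc N (Suc k)))" if "weight N c (Suc k) \<noteq> 0" for k
  proof (rule L2_I_nn)
    show "f \<in> borel_measurable (surface_measure (ifc N (Suc k)))" using m by (simp add: measurable_surface_all)
    have "ennreal (weight N c (Suc k)) * ?n k < \<infinity>"
      using ennreal_le_suminf[of "\<lambda>k. ennreal (weight N c (Suc k)) * ?n k" k] fin by (rule le_less_trans)
    then show "?n k < \<infinity>" using that wn[of "Suc k"] by (auto simp: ennreal_mult_less_top less_le)
  qed
  have eq: "ennreal (weight N c (Suc k)) * ?n k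
      = ennreal (weight N c (Suc k) * (LINT \<xi>|surface_measure (ifc N (Suc k)). (f \<xi>)\<^sup>2))" for k
  proof (cases "weight N c (Suc k) = 0")
    case False
    have "?n k = ennreal (LINT \<xi>|surface_measure (ifc N (Suc k)). (norm (f \<xi>))\<^sup>2)"
      using L2_D(2)[OF L[OF False]] by (intro nn_integral_eq_integral) auto
    then show ?thesis using wn by (simp add: ennreal_mult')
  qed simp
  show "summable (\<lambda>k. weight N c (Suc k) * (LINT \<xi>|surface_measure (ifc N (Suc k)). (f \<xi>)\<^sup>2))"
    using fin wn unfolding eq by (intro summable_suminf_not_top) (auto intro!: mult_nonneg_nonneg)
qed

definition jump :: "('n point \<Rightarrow> real) \<Rightarrow> 'n point \<Rightarrow> real" where
  "jump v = glue (\<lambda>k. normal_jump (ifc N k) v)"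

lemma jump_eq: "1 \<le> k \<Longrightarrow> \<xi> \<in> ifc N k \<Longrightarrow> jump v \<xi> = normal_jump (ifc N k) v \<xi>"
  by (simp add: jump_def glue_eq)

lemma C1_union_jump_L2:
  assumes v: "v \<in> C1_union N" and k: "1 \<le> k"
  shows "normal_jump (ifc N k) v \<in> L2 (surface_measure (ifc N k))"
  using C1_L2_jump[of v "max k (level N v)" k] C1_level_mono[of "level N v" "max k (level N v)"]
    C1_union_level[OF v] k by auto

lemma C1_union_jump_zero:
  assumes v: "v \<in> C1_union N" and k: "level N v < k" "\<xi> \<in> ifc N k"
  shows "normal_jump (ifc N k) v \<xi> = 0"
  by (rule normal_jump_higher[OF C1_union_level(1)[OF v] k C1_union_level(2)[OF v]])

lemma jump_sum_finite:
  assumes v: "v \<in> C1_union N" and K: "level N v \<le> K"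
  shows "(\<Sum>k. weight N c (Suc k) * (LINT \<xi>|surface_measure (ifc N (Suc k)). g (Suc k) \<xi> * normal_jump (ifc N (Suc k)) v \<xi>))
    = (\<Sum>k=1..K. weight N c k * (LINT \<xi>|surface_measure (ifc N k). g k \<xi> * normal_jump (ifc N k) v \<xi>))"
    and "summable (\<lambda>k. weight N c (Suc k) * (LINT \<xi>|surface_measure (ifc N (Suc k)). g (Suc k) \<xi> * normal_jump (ifc N (Suc k)) v \<xi>))"
proof -
  have 0: "weight N c (Suc k) * (LINT \<xi>|surface_measure (ifc N (Suc k)). g (Suc k) \<xi> * normal_jump (ifc N (Suc k)) v \<xi>) = 0"
    if "k \<notin> {..<K}" for k
  proof -
    have "(LINT \<xi>|surface_measure (ifc N (Suc k)). g (Suc k) \<xi> * normal_jump (ifc N (Suc k)) v \<xi>)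
        = (LINT \<xi>|surface_measure (ifc N (Suc k)). 0)"
      by (rule Bochner_Integration.integral_cong) (use that K C1_union_jump_zero[OF v, of "Suc k"] in auto)
    then show ?thesis by simp
  qed
  have "(\<Sum>k. weight N c (Suc k) * (LINT \<xi>|surface_measure (ifc N (Suc k)). g (Suc k) \<xi> * normal_jump (ifc N (Suc k)) v \<xi>))
    = (\<Sum>k<K. weight N c (Suc k) * (LINT \<xi>|surface_measure (ifc N (Suc k)). g (Suc k) \<xi> * normal_jump (ifc N (Suc k)) v \<xi>))"
    using 0 by (intro suminf_finite) auto
  also have "\<dots> = (\<Sum>k=1..K. weight N c k * (LINT \<xi>|surface_measure (ifc N k). g k \<xi> * normal_jump (ifc N k) v \<xi>))"
    by (simp add: sum.atLeast1_atMost_eq)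
  finally show "(\<Sum>k. weight N c (Suc k) * (LINT \<xi>|surface_measure (ifc N (Suc k)). g (Suc k) \<xi> * normal_jump (ifc N (Suc k)) v \<xi>))
    = (\<Sum>k=1..K. weight N c k * (LINT \<xi>|surface_measure (ifc N k). g k \<xi> * normal_jump (ifc N k) v \<xi>))" .
  show "summable (\<lambda>k. weight N c (Suc k) * (LINT \<xi>|surface_measure (ifc N (Suc k)). g (Suc k) \<xi> * normal_jump (ifc N (Suc k)) v \<xi>))"
    using 0 by (intro summable_finite[of "{..<K}"]) auto
qed

lemma surface_integral_cong:
  assumes k: "1 \<le> k" and "\<And>\<xi>. \<xi> \<in> ifc N k \<Longrightarrow> f \<xi> = g \<xi>"
  shows "(LINT \<xi>|surface_measure (ifc N k). f \<xi>) = (LINT \<xi>|surface_measure (ifc N k). g \<xi>)"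
  by (rule Bochner_Integration.integral_cong) (use assms in auto)

lemma integral_jump_mult:
  assumes k: "1 \<le> k"
  shows "(LINT \<xi>|surface_measure (ifc N k). jump v \<xi> * jump w \<xi>)
    = (LINT \<xi>|surface_measure (ifc N k). normal_jump (ifc N k) v \<xi> * normal_jump (ifc N k) w \<xi>)"
  by (rule surface_integral_cong[OF k]) (simp add: jump_eq[OF k])

lemma jump_L2:
  assumes c: "0 < c" and v: "v \<in> C1_union N" shows "jump v \<in> L2 (jump_measure c)"
proof (rule L2_jump_measureI[OF c])
  fix k :: nat assume k: "1 \<le> k"
  show "jump v \<in> L2 (surface_measure (ifc N k))"
    by (rule L2_cong[OF _ C1_union_jump_L2[OF v k]]) (simp add: jump_eq[OF k])
next
  have "(\<lambda>k. weight N c (Suc k) * (LINT \<xi>|surface_measure (ifc N (Suc k)). (jump v \<xi>)\<^sup>2))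
    = (\<lambda>k. weight N c (Suc k) * (LINT \<xi>|surface_measure (ifc N (Suc k)). normal_jump (ifc N (Suc k)) v \<xi> * normal_jump (ifc N (Suc k)) v \<xi>))"
    by (simp add: power2_eq_square integral_jump_mult)
  then show "summable (\<lambda>k. weight N c (Suc k) * (LINT \<xi>|surface_measure (ifc N (Suc k)). (jump v \<xi>)\<^sup>2))"
    using jump_sum_finite(2)[OF v order_refl, of c "\<lambda>k. normal_jump (ifc N k) v"] by simp
qed

lemma C1_union_grad_L2:
  assumes v: "v \<in> C1_union N" shows "grad v \<in> L2 (lebesgue_on (region N - ifc_all N))"
  using ifc_upto_ifc_all[of "level N v"]
  by (intro L2_restrict[OF C1_L2_grad[OF C1_union_level(2)[OF v]]] level_lebesgue) auto

text \<open>The scalar product of the union without reference to a level; the gradients are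
  integrated off all interfaces at once.\<close>

definition inner_c :: "real \<Rightarrow> ('n point \<Rightarrow> real) \<Rightarrow> ('n point \<Rightarrow> real) \<Rightarrow> real" where
  "inner_c c v w = (LINT x|lebesgue_on (region N - ifc_all N). grad v x \<bullet> grad w x) +
     (LINT \<xi>|jump_measure c. jump v \<xi> * jump w \<xi>)"

lemma negligible_level_diff: "negligible ((region N - ifc_upto N K) - (region N - ifc_all N))"
  "negligible (region N - (region N - ifc_all N))"
  by (rule negligible_subset[OF negligible_ifc_all], blast)+

text \<open>Removing further interfaces changes the domain by a null set, and the jumps across them
  vanish. So the least level chosen in \<open>union_inner\<close> may be replaced by any larger
  one.\<close>

lemma level_inner_eq:
  assumes c: "0 < c" and K: "1 \<le> K" and v: "v \<in> C1_level N K" and w: "w \<in> C1_level N K"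
  shows "level_inner N c K v w = inner_c c v w"
proof -
  have vw: "v \<in> C1_union N" "w \<in> C1_union N" using v w C1_level_union[OF K] by auto
  have lw: "level N w \<le> K" unfolding level_def using K w by (intro Least_le) simp
  have "(LINT x|lebesgue_on (region N - ifc_upto N K). grad v x \<bullet> grad w x)
      = (LINT x|lebesgue_on (region N - ifc_all N). grad v x \<bullet> grad w x)"
    using ifc_upto_ifc_all[of K]
    by (intro lebesgue_on_integral_extend level_lebesgue negligible_level_diff borel_measurable_inner
          L2_D(1)[OF C1_union_grad_L2] vw) auto
  moreover have "(LINT \<xi>|jump_measure c. jump v \<xi> * jump w \<xi>)
      = (\<Sum>k=1..K. weight N c k * (LINT \<xi>|surface_measure (ifc N k). normal_jump (ifc N k) v \<xi> * normal_jump (ifc N k) w \<xi>))"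
  proof -
    have int: "integrable (jump_measure c) (\<lambda>\<xi>. jump v \<xi> * jump w \<xi>)"
      using L2_integrable_inner[OF jump_L2[OF c vw(1)] jump_L2[OF c vw(2)]] by simp
    have "(LINT \<xi>|jump_measure c. jump v \<xi> * jump w \<xi>)
        = (\<Sum>k. weight N c (Suc k) * (LINT \<xi>|surface_measure (ifc N (Suc k)). jump v \<xi> * jump w \<xi>))"
      by (rule integral_jump_measure[OF c int])
    also have "\<dots> = (\<Sum>k. weight N c (Suc k) * (LINT \<xi>|surface_measure (ifc N (Suc k)). normal_jump (ifc N (Suc k)) v \<xi> * normal_jump (ifc N (Suc k)) w \<xi>))"
      by (simp add: integral_jump_mult)
    finally show ?thesis using jump_sum_finite(1)[OF vw(2) lw, of c "\<lambda>k. normal_jump (ifc N k) v"] by simp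
  qed
  ultimately show ?thesis by (simp add: level_inner_def inner_c_def)
qed

lemma union_inner_eq:
  assumes "0 < c" "v \<in> C1_union N" "w \<in> C1_union N"
  shows "union_inner N c v w = inner_c c v w"
  unfolding union_inner_def by (rule level_inner_eq[OF assms(1) C1_union_common[OF assms(2,3)]])

lemma grad_add:
  assumes "v \<in> C1_union N" "w \<in> C1_union N" "x \<in> region N - ifc_all N"
  shows "grad (v + w) x = grad v x + grad w x"
  using assms(3) ifc_upto_ifc_all by (intro grad_add_C1[OF C1_union_common[OF assms(1,2)]]) blast

lemma grad_scale:
  assumes "v \<in> C1_union N" "x \<in> region N - ifc_all N"
  shows "grad (r *\<^sub>R v) x = r *\<^sub>R grad v x"
  using assms(2) ifc_upto_ifc_all by (intro grad_scale_C1[OF C1_union_level[OF assms(1)]]) blast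

text \<open>Countably many null sets \<open>bad K\<close> are discarded at once, so that a pointwise
  rule may choose its level freely.\<close>

lemma AE_jump_measureI:
  assumes P: "\<And>k \<xi>. 1 \<le> k \<Longrightarrow> \<xi> \<in> ifc N k \<Longrightarrow> \<forall>K. \<xi> \<notin> bad K \<Longrightarrow> P \<xi>"
  shows "AE \<xi> in jump_measure c. P \<xi>"
proof -
  have "hausdorff_outer (CARD('n) - 1) (\<Union>K. bad K) \<le> (\<Sum>K. hausdorff_outer (CARD('n) - 1) (bad K))"
    by (rule outer_measure_space_Union_le[OF outer_measure_space_hausdorff])
  then have 0: "hausdorff_outer (CARD('n) - 1) (\<Union>K. bad K) = 0" unfolding hausdorff_bad by simp
  have "AE \<xi> in surface_measure (ifc_all N). P \<xi>"
    by (rule surface_AE_I[OF ifc_all_borel 0]) (auto elim!: ifc_all_E intro: P)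
  then have "AE \<xi> in surface_measure (ifc_all N). 0 < ennreal (weight N c (idx \<xi>)) \<longrightarrow> P \<xi>"
    by (rule eventually_mono) simp
  then show ?thesis
    unfolding jump_measure_def using weight_measurable[of c] by (subst AE_density) auto
qed

lemma jump_add:
  assumes v: "v \<in> C1_union N" and w: "w \<in> C1_union N"
  shows "AE \<xi> in jump_measure c. jump (v + w) \<xi> = jump v \<xi> + jump w \<xi>"
proof (rule AE_jump_measureI)
  fix k \<xi> assume k: "1 \<le> k" and \<xi>: "\<xi> \<in> ifc N k" "\<forall>K. \<xi> \<notin> bad K"
  let ?K = "max k (max (level N v) (level N w))"
  have "v \<in> C1_level N ?K" "w \<in> C1_level N ?K"
    using C1_union_common[OF v w] C1_level_mono[of "max (level N v) (level N w)" ?K] by auto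
  then have "normal_jump (ifc N k) (v + w) \<xi> = normal_jump (ifc N k) v \<xi> + normal_jump (ifc N k) w \<xi>"
    using k \<xi> by (intro normal_jump_add[where K = ?K]) auto
  then show "jump (v + w) \<xi> = jump v \<xi> + jump w \<xi>" by (simp add: jump_eq[OF k \<xi>(1)])
qed

lemma jump_scale:
  assumes v: "v \<in> C1_union N"
  shows "AE \<xi> in jump_measure c. jump (r *\<^sub>R v) \<xi> = r * jump v \<xi>"
proof (rule AE_jump_measureI)
  fix k \<xi> assume k: "1 \<le> k" and \<xi>: "\<xi> \<in> ifc N k" "\<forall>K. \<xi> \<notin> bad K"
  let ?K = "max k (level N v)"
  have "v \<in> C1_level N ?K"
    using C1_union_level[OF v] C1_level_mono[of "level N v" ?K] by auto
  then have "normal_jump (ifc N k) (r *\<^sub>R v) \<xi> = r * normal_jump (ifc N k) v \<xi>"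
    using k \<xi> by (intro normal_jump_scale[where K = ?K]) auto
  then show "jump (r *\<^sub>R v) \<xi> = r * jump v \<xi>" by (simp add: jump_eq[OF k \<xi>(1)])
qed

end

section \<open>The energy on the fractal space\<close>

locale network_energy = network N for N :: "'n::{finite,linorder} network" +
  fixes c \<aa> \<AA> :: real and A f :: "'n point \<Rightarrow> real"
  assumes c: "0 < c" and bounds: "0 < \<aa>" "\<aa> \<le> 1" "1 \<le> \<AA>"
    and A_measurable: "A \<in> borel_measurable (surface_measure (ifc_all N))"
    and A_bounds: "AE \<xi> in surface_measure (ifc_all N). \<aa> \<le> A \<xi> \<and> A \<xi> \<le> \<AA>"
    and f: "f \<in> L2 (lebesgue_on (region N))"
begin

lemma A_jump_measure:
  "A \<in> borel_measurable (jump_measure c)"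
  "AE \<xi> in jump_measure c. \<aa> \<le> A \<xi> \<and> A \<xi> \<le> \<AA>"
  "AE \<xi> in jump_measure c. \<bar>A \<xi>\<bar> \<le> \<AA>"
proof -
  show "A \<in> borel_measurable (jump_measure c)"
    using A_measurable by (simp add: measurable_cong_sets[OF sets_jump_measure refl])
  have "AE \<xi> in surface_measure (ifc_all N). 0 < ennreal (weight N c (idx \<xi>)) \<longrightarrow> \<aa> \<le> A \<xi> \<and> A \<xi> \<le> \<AA>"
    using A_bounds by (rule eventually_mono) simp
  then show "AE \<xi> in jump_measure c. \<aa> \<le> A \<xi> \<and> A \<xi> \<le> \<AA>"
    unfolding jump_measure_def using weight_measurable[of c] by (subst AE_density) auto
  then show "AE \<xi> in jump_measure c. \<bar>A \<xi>\<bar> \<le> \<AA>"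
    by (rule eventually_mono) (use bounds in auto)
qed

text \<open>The coefficient is a parameter: 1 gives the scalar product and \<open>A\<close> the
  energy form, and linearity is proved once for both.\<close>

definition smooth_form :: "('n point \<Rightarrow> real) \<Rightarrow> ('n point \<Rightarrow> real) \<Rightarrow> ('n point \<Rightarrow> real) \<Rightarrow> real" where
  "smooth_form a v w = (LINT x|lebesgue_on (region N - ifc_all N). grad v x \<bullet> grad w x) +
     (LINT \<xi>|jump_measure c. (a \<xi> * jump v \<xi>) \<bullet> jump w \<xi>)"

lemma inner_c_eq_smooth_form: "inner_c c v w = smooth_form (\<lambda>_. 1) v w"
  by (simp add: inner_c_def smooth_form_def)

lemma smooth_form_sym: "smooth_form a v w = smooth_form a w v"
  by (simp add: smooth_form_def inner_commute ac_simps)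

lemma smooth_form_linear:
  assumes a: "a \<in> borel_measurable (jump_measure c)" "AE \<xi> in jump_measure c. \<bar>a \<xi>\<bar> \<le> C"
    and v: "v \<in> C1_union N" and w: "w \<in> C1_union N" and z: "z \<in> C1_union N"
  shows "smooth_form a (v + w) z = smooth_form a v z + smooth_form a w z" "smooth_form a (r *\<^sub>R v) z = r * smooth_form a v z"
proof -
  let ?l = "lebesgue_on (region N - ifc_all N)" and ?j = "jump_measure c"
  note vw = subspace_add[OF subspace_C1_union v w] and rv = subspace_scale[OF subspace_C1_union v, of r]
  note L = jump_L2[OF c] and La = L2_mult_bounded[OF a jump_L2[OF c]]
  note mes = L2_integrable_inner[OF La L, THEN borel_measurable_integrable]
  have "(LINT x|?l. grad (v + w) x \<bullet> grad z x) = (LINT x|?l. grad v x \<bullet> grad z x + grad w x \<bullet> grad z x)"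
    by (rule Bochner_Integration.integral_cong) (auto simp: grad_add[OF v w] inner_add_left)
  also have "\<dots> = (LINT x|?l. grad v x \<bullet> grad z x) + (LINT x|?l. grad w x \<bullet> grad z x)"
    by (intro Bochner_Integration.integral_add L2_integrable_inner C1_union_grad_L2 v w z)
  finally have 1: "(LINT x|?l. grad (v + w) x \<bullet> grad z x) = (LINT x|?l. grad v x \<bullet> grad z x) + (LINT x|?l. grad w x \<bullet> grad z x)" .
  have "(LINT \<xi>|?j. (a \<xi> * jump (v + w) \<xi>) \<bullet> jump z \<xi>)
      = (LINT \<xi>|?j. (a \<xi> * jump v \<xi>) \<bullet> jump z \<xi> + (a \<xi> * jump w \<xi>) \<bullet> jump z \<xi>)"
  proof (rule integral_cong_AE)
    show "AE \<xi> in ?j. (a \<xi> * jump (v + w) \<xi>) \<bullet> jump z \<xi> = (a \<xi> * jump v \<xi>) \<bullet> jump z \<xi> + (a \<xi> * jump w \<xi>) \<bullet> jump z \<xi>"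
      using jump_add[OF v w] by (rule eventually_mono) (simp add: algebra_simps)
  qed (intro mes vw z borel_measurable_add v w)+
  also have "\<dots> = (LINT \<xi>|?j. (a \<xi> * jump v \<xi>) \<bullet> jump z \<xi>) + (LINT \<xi>|?j. (a \<xi> * jump w \<xi>) \<bullet> jump z \<xi>)"
    by (intro Bochner_Integration.integral_add L2_integrable_inner La L v w z)
  finally show "smooth_form a (v + w) z = smooth_form a v z + smooth_form a w z" using 1 by (simp add: smooth_form_def)
  have "(LINT x|?l. grad (r *\<^sub>R v) x \<bullet> grad z x) = (LINT x|?l. r * (grad v x \<bullet> grad z x))"
    by (rule Bochner_Integration.integral_cong) (auto simp: grad_scale[OF v])
  moreover have "(LINT \<xi>|?j. (a \<xi> * jump (r *\<^sub>R v) \<xi>) \<bullet> jump z \<xi>) = (LINT \<xi>|?j. r * ((a \<xi> * jump v \<xi>) \<bullet> jump z \<xi>))"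
  proof (rule integral_cong_AE)
    show "AE \<xi> in ?j. (a \<xi> * jump (r *\<^sub>R v) \<xi>) \<bullet> jump z \<xi> = r * ((a \<xi> * jump v \<xi>) \<bullet> jump z \<xi>)"
      using jump_scale[OF v, of r] by (rule eventually_mono) (simp add: algebra_simps)
  qed (intro mes rv z borel_measurable_times borel_measurable_const v)+
  ultimately show "smooth_form a (r *\<^sub>R v) z = r * smooth_form a v z" by (simp add: smooth_form_def distrib_left)
qed

lemma C1_union_measurable:
  assumes v: "v \<in> C1_union N" shows "v \<in> borel_measurable (lebesgue_on (region N))"
proof (rule lebesgue_on_measurable_extend)
  let ?B = "region N - ifc_upto N (level N v)"
  show "v \<in> borel_measurable (lebesgue_on ?B)"
    using C1_continuous[OF C1_union_level[OF v]] level_lebesgue(1)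
    by (intro continuous_imp_measurable_on_sets_lebesgue)
  show "negligible (region N - ?B)"
    by (rule negligible_subset[OF negligible_ifc_all]) (use ifc_upto_ifc_all in blast)
qed (use region_borel level_lebesgue in auto)

lemma inner_c_nonneg: "0 \<le> inner_c c v v"
  unfolding inner_c_def by (intro add_nonneg_nonneg integral_nonneg_AE) auto

text \<open>Square integrability of \<open>v\<close> itself is not part of \<open>C1_level\<close>;
  it results from the finite right-hand side of the Poincare inequality, which then becomes an
  inequality of real numbers.\<close>

lemma poincare_L2:
  obtains Cp where "0 < Cp" "\<And>v. v \<in> C1_union N \<Longrightarrow> v \<in> L2 (lebesgue_on (region N))"
    "\<And>v. v \<in> C1_union N \<Longrightarrow> (LINT x|lebesgue_on (region N). (v x)\<^sup>2) \<le> Cp * inner_c c v v"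
proof -
  obtain Cp where Cp: "0 < Cp" and P: "\<And>K v. 1 \<le> K \<Longrightarrow> v \<in> C1_level N K \<Longrightarrow>
      (\<integral>\<^sup>+x. ennreal ((v x)\<^sup>2) \<partial>lebesgue_on (region N)) \<le> ennreal Cp *
        ((\<integral>\<^sup>+x. ennreal ((norm (grad v x))\<^sup>2) \<partial>lebesgue_on (region N - ifc_upto N K)) +
         (\<Sum>k=1..K. ennreal (weight N c k) * (\<integral>\<^sup>+\<xi>. ennreal ((normal_jump (ifc N k) v \<xi>)\<^sup>2) \<partial>surface_measure (ifc N k))))"
    by (rule poincare[OF c]) (rule that)
  have bound: "(\<integral>\<^sup>+x. ennreal ((v x)\<^sup>2) \<partial>lebesgue_on (region N)) \<le> ennreal (Cp * inner_c c v v)"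
    if v: "v \<in> C1_union N" for v
  proof -
    let ?K = "level N v"
    note K = C1_union_level[OF v]
    have 1: "(\<integral>\<^sup>+x. ennreal ((norm (grad v x))\<^sup>2) \<partial>lebesgue_on (region N - ifc_upto N ?K))
        = ennreal (LINT x|lebesgue_on (region N - ifc_upto N ?K). grad v x \<bullet> grad v x)"
      unfolding power2_norm_eq_inner
      using L2_D(2)[OF C1_L2_grad[OF K(2)]]
      by (intro nn_integral_eq_integral) (auto simp: power2_norm_eq_inner)
    have 2: "ennreal (weight N c k) * (\<integral>\<^sup>+\<xi>. ennreal ((normal_jump (ifc N k) v \<xi>)\<^sup>2) \<partial>surface_measure (ifc N k))
        = ennreal (weight N c k * (LINT \<xi>|surface_measure (ifc N k). normal_jump (ifc N k) v \<xi> * normal_jump (ifc N k) v \<xi>))"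
      if k: "k \<in> {1..?K}" for k
    proof -
      have "(\<integral>\<^sup>+\<xi>. ennreal ((normal_jump (ifc N k) v \<xi>)\<^sup>2) \<partial>surface_measure (ifc N k))
          = ennreal (LINT \<xi>|surface_measure (ifc N k). (normal_jump (ifc N k) v \<xi>)\<^sup>2)"
        using L2_D(2)[OF C1_L2_jump[OF K(2), of k]] k by (intro nn_integral_eq_integral) auto
      then show ?thesis using weight_nonneg[OF c, of k] by (simp add: ennreal_mult' power2_eq_square)
    qed
    have nn: "0 \<le> weight N c k * (LINT \<xi>|surface_measure (ifc N k). normal_jump (ifc N k) v \<xi> * normal_jump (ifc N k) v \<xi>)" for k
      using weight_nonneg[OF c, of k] by (intro mult_nonneg_nonneg integral_nonneg_AE) auto
    have "(\<Sum>k=1..?K. ennreal (weight N c k) * (\<integral>\<^sup>+\<xi>. ennreal ((normal_jump (ifc N k) v \<xi>)\<^sup>2) \<partial>surface_measure (ifc N k)))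
        = ennreal (\<Sum>k=1..?K. weight N c k * (LINT \<xi>|surface_measure (ifc N k). normal_jump (ifc N k) v \<xi> * normal_jump (ifc N k) v \<xi>))"
      using 2 nn by (subst sum_ennreal[symmetric]) auto
    then have "(\<integral>\<^sup>+x. ennreal ((norm (grad v x))\<^sup>2) \<partial>lebesgue_on (region N - ifc_upto N ?K)) +
         (\<Sum>k=1..?K. ennreal (weight N c k) * (\<integral>\<^sup>+\<xi>. ennreal ((normal_jump (ifc N k) v \<xi>)\<^sup>2) \<partial>surface_measure (ifc N k)))
        = ennreal (level_inner N c ?K v v)"
      unfolding 1 level_inner_def using nn
      by (subst ennreal_plus) (auto intro!: sum_nonneg integral_nonneg_AE)
    then show ?thesis using P[OF K] Cp level_inner_eq[OF c K(1) K(2) K(2)] by (simp add: ennreal_mult')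
  qed
  have L: "v \<in> L2 (lebesgue_on (region N))" if v: "v \<in> C1_union N" for v
    using C1_union_measurable[OF v] le_less_trans[OF bound[OF v]] by (intro L2_I_nn) auto
  have "(LINT x|lebesgue_on (region N). (v x)\<^sup>2) \<le> Cp * inner_c c v v" if v: "v \<in> C1_union N" for v
  proof -
    have "ennreal (LINT x|lebesgue_on (region N). (norm (v x))\<^sup>2) = (\<integral>\<^sup>+x. ennreal ((norm (v x))\<^sup>2) \<partial>lebesgue_on (region N))"
      using L2_D(2)[OF L[OF v]] by (intro nn_integral_eq_integral[symmetric]) auto
    then have "ennreal (LINT x|lebesgue_on (region N). (v x)\<^sup>2) \<le> ennreal (Cp * inner_c c v v)"
      using bound[OF v] by simp
    then show ?thesis using Cp inner_c_nonneg[of v] by (subst (asm) ennreal_le_iff) auto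
  qed
  then show ?thesis using that Cp L by blast
qed

text \<open>A fixed choice of constant, needed to name the bound of the load as a parameter of
  \<open>energy_space\<close>.\<close>

definition poincare_const :: real where
  "poincare_const = (SOME Cp. 0 < Cp \<and> (\<forall>v\<in>C1_union N. v \<in> L2 (lebesgue_on (region N)) \<and>
     (LINT x|lebesgue_on (region N). (v x)\<^sup>2) \<le> Cp * inner_c c v v))"

lemma poincare_const:
  shows "0 < poincare_const" and "\<And>v. v \<in> C1_union N \<Longrightarrow> v \<in> L2 (lebesgue_on (region N))"
    and "\<And>v. v \<in> C1_union N \<Longrightarrow> (LINT x|lebesgue_on (region N). (v x)\<^sup>2) \<le> poincare_const * inner_c c v v"
proof -
  have "\<exists>Cp>0. \<forall>v\<in>C1_union N. v \<in> L2 (lebesgue_on (region N)) \<and>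
     (LINT x|lebesgue_on (region N). (v x)\<^sup>2) \<le> Cp * inner_c c v v"
    by (rule poincare_L2) blast
  then have "0 < poincare_const \<and> (\<forall>v\<in>C1_union N. v \<in> L2 (lebesgue_on (region N)) \<and>
     (LINT x|lebesgue_on (region N). (v x)\<^sup>2) \<le> poincare_const * inner_c c v v)"
    unfolding poincare_const_def by (rule someI_ex)
  then show "0 < poincare_const" and "\<And>v. v \<in> C1_union N \<Longrightarrow> v \<in> L2 (lebesgue_on (region N))"
    and "\<And>v. v \<in> C1_union N \<Longrightarrow> (LINT x|lebesgue_on (region N). (v x)\<^sup>2) \<le> poincare_const * inner_c c v v"
    by auto
qed

definition smooth_load :: "('n point \<Rightarrow> real) \<Rightarrow> real" where
  "smooth_load v = (LINT x|lebesgue_on (region N). f x \<bullet> v x)"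

definition load_bound :: real where
  "load_bound = sqrt (LINT x|lebesgue_on (region N). f x \<bullet> f x) * sqrt poincare_const"

text \<open>The bounds on \<open>A\<close> give those on the jump term;
  \<open>\<aa> \<le> 1 \<le> \<AA>\<close> extends them to the gradient term. The load is bounded by
  Cauchy-Schwarz in L2 followed by the Poincare inequality.\<close>

sublocale D: energy_space "C1_union N" "inner_c c" "smooth_form A" smooth_load \<aa> \<AA> load_bound
proof
  show "subspace (C1_union N)" by (rule subspace_C1_union)
  show "0 < \<aa>" by (rule bounds)
  have one: "(\<lambda>_. 1) \<in> borel_measurable (jump_measure c)" "AE \<xi> in jump_measure c. \<bar>1::real\<bar> \<le> 1" by auto
  fix v w z and r :: real assume v: "v \<in> C1_union N"
  show "inner_c c v w = inner_c c w v" "smooth_form A v w = smooth_form A w v"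
    unfolding inner_c_eq_smooth_form by (rule smooth_form_sym)+
  show "0 \<le> inner_c c v v" by (rule inner_c_nonneg)
  note L = jump_L2[OF c v]
  have jj: "integrable (jump_measure c) (\<lambda>\<xi>. jump v \<xi> * jump v \<xi>)"
    using L2_integrable_inner[OF L L] by simp
  have Ajj: "integrable (jump_measure c) (\<lambda>\<xi>. A \<xi> * jump v \<xi> * jump v \<xi>)"
    using L2_integrable_inner[OF L2_mult_bounded[OF A_jump_measure(1,3) L] L] by simp
  have g0: "0 \<le> (LINT x|lebesgue_on (region N - ifc_all N). grad v x \<bullet> grad v x)"
    by (intro integral_nonneg_AE) auto
  have "(LINT \<xi>|jump_measure c. \<aa> * (jump v \<xi> * jump v \<xi>)) \<le> (LINT \<xi>|jump_measure c. A \<xi> * jump v \<xi> * jump v \<xi>)"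
  proof (rule integral_mono_AE)
    show "AE \<xi> in jump_measure c. \<aa> * (jump v \<xi> * jump v \<xi>) \<le> A \<xi> * jump v \<xi> * jump v \<xi>"
      using A_jump_measure(2) by (rule eventually_mono) (simp add: mult.assoc mult_right_mono)
  qed (use jj Ajj in auto)
  moreover have "\<aa> * (LINT x|lebesgue_on (region N - ifc_all N). grad v x \<bullet> grad v x)
      \<le> (LINT x|lebesgue_on (region N - ifc_all N). grad v x \<bullet> grad v x)"
    using bounds g0 by (intro mult_left_le_one_le) auto
  ultimately show "\<aa> * inner_c c v v \<le> smooth_form A v v"
    by (simp add: inner_c_def smooth_form_def distrib_left)
  have "(LINT \<xi>|jump_measure c. A \<xi> * jump v \<xi> * jump v \<xi>) \<le> (LINT \<xi>|jump_measure c. \<AA> * (jump v \<xi> * jump v \<xi>))"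
  proof (rule integral_mono_AE)
    show "AE \<xi> in jump_measure c. A \<xi> * jump v \<xi> * jump v \<xi> \<le> \<AA> * (jump v \<xi> * jump v \<xi>)"
      using A_jump_measure(2) by (rule eventually_mono) (simp add: mult.assoc mult_right_mono)
  qed (use jj Ajj in auto)
  moreover have "(LINT x|lebesgue_on (region N - ifc_all N). grad v x \<bullet> grad v x)
      \<le> \<AA> * (LINT x|lebesgue_on (region N - ifc_all N). grad v x \<bullet> grad v x)"
    using mult_right_mono[OF bounds(3) g0] by simp
  ultimately show "smooth_form A v v \<le> \<AA> * inner_c c v v"
    by (simp add: inner_c_def smooth_form_def distrib_left)
  show "smooth_load (r *\<^sub>R v) = r * smooth_load v" by (simp add: smooth_load_def algebra_simps flip: integral_mult_right_zero)
  show "\<bar>smooth_load v\<bar> \<le> load_bound * sqrt (inner_c c v v)"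
  proof -
    interpret Q: semi_inner "L2 (lebesgue_on (region N)) :: ('n point \<Rightarrow> real) set" "\<lambda>f g. LINT x|lebesgue_on (region N). f x \<bullet> g x"
      by (rule semi_inner_L2)
    have "\<bar>smooth_load v\<bar> \<le> Q.nrm f * Q.nrm v" unfolding smooth_load_def by (rule Q.Cauchy_Schwarz[OF f poincare_const(2)[OF v]])
    also have "Q.nrm v \<le> sqrt (poincare_const * inner_c c v v)"
      unfolding Q.nrm_def using poincare_const(3)[OF v] by (simp add: power2_eq_square)
    finally have "\<bar>smooth_load v\<bar> \<le> Q.nrm f * (sqrt poincare_const * sqrt (inner_c c v v))"
      using Q.nrm_nonneg[OF f] by (simp add: real_sqrt_mult mult_left_mono)
    also have "Q.nrm f = sqrt (LINT x|lebesgue_on (region N). f x \<bullet> f x)" by (rule Q.nrm_def)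
    finally show ?thesis by (simp only: load_bound_def mult.assoc)
  qed
  assume z: "z \<in> C1_union N"
  show "inner_c c (r *\<^sub>R v) z = r * inner_c c v z" unfolding inner_c_eq_smooth_form by (rule smooth_form_linear(2)[OF one v v z])
  show "smooth_form A (r *\<^sub>R v) z = r * smooth_form A v z" by (rule smooth_form_linear(2)[OF A_jump_measure(1,3) v v z])
  assume w: "w \<in> C1_union N"
  show "inner_c c (v + w) z = inner_c c v z + inner_c c w z" unfolding inner_c_eq_smooth_form by (rule smooth_form_linear(1)[OF one v w z])
  show "smooth_form A (v + w) z = smooth_form A v z + smooth_form A w z" by (rule smooth_form_linear(1)[OF A_jump_measure(1,3) v w z])
  show "smooth_load (v + w) = smooth_load v + smooth_load w"
    using L2_integrable_inner[OF f poincare_const(2)[OF v]] L2_integrable_inner[OF f poincare_const(2)[OF w]]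
    by (simp add: smooth_load_def distrib_left)
qed

text \<open>\<open>D\<close> speaks about piecewise smooth functions, \<open>S\<close> about Cauchy
  sequences of them. Every statement about classes below is one of \<open>S\<close>, read modulo
  vanishing \<open>S.nrm\<close>.\<close>

sublocale S: energy_space D.cauchy_sequences "D.ext (inner_c c)" "D.ext (smooth_form A)" D.ext_l \<aa> \<AA> load_bound
  by (rule D.energy_space_cauchy_sequences)

section \<open>Classes of Cauchy sequences as the quotient by vanishing distance\<close>

lemma union_norm_eq: "v \<in> C1_union N \<Longrightarrow> union_norm N c v = D.nrm v"
  by (simp add: union_norm_def D.nrm_def union_inner_eq[OF c])

lemma cauchy_seqs_eq: "cauchy_seqs N c = D.cauchy_sequences"
proof -
  have eq: "union_norm N c (\<lambda>x. X m x - X n x) = D.nrm (X m - X n)" if "\<forall>n. X n \<in> C1_union N" for X m n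
    using union_norm_eq[OF D.D_diff[of "X m" "X n"]] that by (simp add: fun_diff_def)
  have "(\<forall>e>0. \<exists>n0. \<forall>m\<ge>n0. \<forall>n\<ge>n0. union_norm N c (\<lambda>x. X m x - X n x) < e)
      \<longleftrightarrow> (\<forall>e>0. \<exists>n0. \<forall>m\<ge>n0. \<forall>n\<ge>n0. D.nrm (X m - X n) < e)" if "\<forall>n. X n \<in> C1_union N" for X
    by (simp only: eq[OF that])
  then show ?thesis
    unfolding cauchy_seqs_def D.cauchy_sequences_def by (intro Collect_cong conj_cong refl)
qed

lemma D_diff_seq_nrm_tendsto:
  assumes "X \<in> D.cauchy_sequences" "Y \<in> D.cauchy_sequences"
  shows "(\<lambda>n. D.nrm (X n - Y n)) \<longlonglongrightarrow> S.nrm (X - Y)"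
  using D.nrm_tendsto[OF S.D_diff[OF assms]] by (simp add: S.nrm_def)

lemma cauchy_rel_iff:
  "(X, Y) \<in> cauchy_rel N c \<longleftrightarrow> X \<in> D.cauchy_sequences \<and> Y \<in> D.cauchy_sequences \<and> S.nrm (X - Y) = 0"
proof -
  have "(\<lambda>n. union_norm N c (\<lambda>x. X n x - Y n x)) \<longlonglongrightarrow> 0 \<longleftrightarrow> S.nrm (X - Y) = 0"
    if X: "X \<in> D.cauchy_sequences" and Y: "Y \<in> D.cauchy_sequences"
  proof -
    have "union_norm N c (\<lambda>x. X n x - Y n x) = D.nrm (X n - Y n)" for n
      using union_norm_eq[OF D.D_diff[OF D.cauchy_D[OF X, of n] D.cauchy_D[OF Y, of n]]]
      by (simp add: fun_diff_def)
    then show ?thesis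
      using D_diff_seq_nrm_tendsto[OF X Y] LIMSEQ_unique by auto
  qed
  then show ?thesis unfolding cauchy_rel_def by (auto simp: cauchy_seqs_eq)
qed

lemma equiv_cauchy_rel: "equiv D.cauchy_sequences (cauchy_rel N c)"
proof (rule equivI)
  show "refl_on D.cauchy_sequences (cauchy_rel N c)"
    by (auto simp: refl_on_def cauchy_rel_iff S.nrm_0)
  show "sym (cauchy_rel N c)"
    by (auto simp: sym_def cauchy_rel_iff S.nrm_minus_commute)
  show "trans (cauchy_rel N c)"
  proof (rule transI)
    fix X Y Z assume "(X, Y) \<in> cauchy_rel N c" "(Y, Z) \<in> cauchy_rel N c"
    then show "(X, Z) \<in> cauchy_rel N c"
      using S.nrm_triangle_diff[of X Y Z] S.nrm_nonneg[of "X - Z"] S.D_diff[of X Z]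
      by (auto simp: cauchy_rel_iff)
  qed
qed (auto simp: cauchy_rel_iff)

definition cls :: "(nat \<Rightarrow> 'n point \<Rightarrow> real) \<Rightarrow> 'n fractal_elem" where
  "cls X = cauchy_rel N c `` {X}"

lemma fractal_space_eq: "fractal_space N c = cls ` D.cauchy_sequences"
  unfolding fractal_space_def cauchy_seqs_eq quotient_def cls_def by auto

lemma cls_iff: "Y \<in> cls X \<longleftrightarrow> X \<in> D.cauchy_sequences \<and> Y \<in> D.cauchy_sequences \<and> S.nrm (X - Y) = 0"
  by (simp add: cls_def cauchy_rel_iff)

lemma cls_self: "X \<in> D.cauchy_sequences \<Longrightarrow> X \<in> cls X"
  by (simp add: cls_iff S.nrm_0)

lemma cls_eq_iff:
  "X \<in> D.cauchy_sequences \<Longrightarrow> Y \<in> D.cauchy_sequences \<Longrightarrow> cls X = cls Y \<longleftrightarrow> S.nrm (X - Y) = 0"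
  unfolding cls_def using eq_equiv_class_iff[OF equiv_cauchy_rel, of X Y] by (simp add: cauchy_rel_iff)

lemma fractal_level_eq:
  assumes K: "1 \<le> K"
  shows "fractal_level N c K = cls ` {X \<in> D.cauchy_sequences. \<forall>n. X n \<in> C1_level N K}"
proof (intro set_eqI iffI)
  fix V assume "V \<in> fractal_level N c K"
  then obtain Y X where *: "V = cls Y" "X \<in> V" "\<forall>n. X n \<in> C1_level N K"
    by (auto simp: fractal_level_def fractal_space_eq)
  then have "V = cls X" using cls_eq_iff[of Y X] by (simp add: cls_iff)
  then show "V \<in> cls ` {X \<in> D.cauchy_sequences. \<forall>n. X n \<in> C1_level N K}"
    using * by (auto simp: cls_iff)
qed (auto simp: fractal_level_def fractal_space_eq intro: cls_self)

subsection \<open>Weak gradients, jumps and functions of classes\<close>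

lemma part_le_nrm:
  assumes z: "z \<in> C1_union N"
  shows "(LINT x|lebesgue_on (region N - ifc_all N). (norm (grad z x))\<^sup>2) \<le> (D.nrm z)\<^sup>2"
    and "(LINT \<xi>|jump_measure c. (norm (jump z \<xi>))\<^sup>2) \<le> (D.nrm z)\<^sup>2"
    and "(LINT x|lebesgue_on (region N). (norm (z x))\<^sup>2) \<le> poincare_const * (D.nrm z)\<^sup>2"
proof -
  have "0 \<le> (LINT x|lebesgue_on (region N - ifc_all N). grad z x \<bullet> grad z x)"
    "0 \<le> (LINT \<xi>|jump_measure c. jump z \<xi> * jump z \<xi>)" by (intro integral_nonneg_AE; simp)+
  then show "(LINT x|lebesgue_on (region N - ifc_all N). (norm (grad z x))\<^sup>2) \<le> (D.nrm z)\<^sup>2"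
    "(LINT \<xi>|jump_measure c. (norm (jump z \<xi>))\<^sup>2) \<le> (D.nrm z)\<^sup>2"
    unfolding D.nrm_sq[OF z] inner_c_def power2_norm_eq_inner by simp_all
  show "(LINT x|lebesgue_on (region N). (norm (z x))\<^sup>2) \<le> poincare_const * (D.nrm z)\<^sup>2"
    using poincare_const(3)[OF z] by (simp add: D.nrm_sq[OF z])
qed

text \<open>Common to gradient, jump and identity. The bound compares \<open>\<Phi> v\<close> with
  \<open>\<Phi> w\<close> instead of assuming \<open>\<Phi>\<close> linear, since gradients and
  jumps are linear only almost everywhere.\<close>

definition bounded_map :: "'a measure \<Rightarrow> (('n point \<Rightarrow> real) \<Rightarrow> 'a \<Rightarrow> 'b::euclidean_space) \<Rightarrow> bool" where
  "bounded_map M \<Phi> \<longleftrightarrow> (\<forall>v\<in>C1_union N. \<Phi> v \<in> L2 M) \<and> (\<exists>b\<ge>0. \<forall>v\<in>C1_union N. \<forall>w\<in>C1_union N.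
     (LINT x|M. (norm (\<Phi> v x - \<Phi> w x))\<^sup>2) \<le> b * (D.nrm (v - w))\<^sup>2)"

lemma bounded_map_limit:
  assumes \<Phi>: "bounded_map M \<Phi>" and X: "X \<in> D.cauchy_sequences"
  shows "\<exists>g. L2_tendsto M (\<lambda>n. \<Phi> (X n)) g"
proof -
  note XD = D.cauchy_D[OF X]
  obtain b where b: "b \<ge> 0" "\<And>v w. v \<in> C1_union N \<Longrightarrow> w \<in> C1_union N \<Longrightarrow>
     (LINT x|M. (norm (\<Phi> v x - \<Phi> w x))\<^sup>2) \<le> b * (D.nrm (v - w))\<^sup>2"
    using \<Phi> unfolding bounded_map_def by blast
  obtain g where "L2_tendsto M (\<lambda>n. \<Phi> (X n)) g"
  proof (rule L2_complete[of "\<lambda>n. \<Phi> (X n)" M])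
    show "\<Phi> (X n) \<in> L2 M" for n using \<Phi> XD by (auto simp: bounded_map_def)
    fix e :: real assume e: "e > 0"
    have "sqrt (e / (b + 1)) > 0" using e b by simp
    then obtain n0 where n0: "\<And>m n. m \<ge> n0 \<Longrightarrow> n \<ge> n0 \<Longrightarrow> D.nrm (X m - X n) < sqrt (e / (b + 1))"
      using D.cauchyE[OF X] by blast
    have "(LINT x|M. (norm (\<Phi> (X m) x - \<Phi> (X n) x))\<^sup>2) < e" if "m \<ge> n0" "n \<ge> n0" for m n
    proof -
      have "D.nrm (X m - X n) \<ge> 0" using XD D.D_diff D.nrm_nonneg by blast
      then have "(D.nrm (X m - X n))\<^sup>2 < (sqrt (e / (b + 1)))\<^sup>2"
        using n0[OF that] by (intro power_strict_mono) auto
      then have lt: "(D.nrm (X m - X n))\<^sup>2 < e / (b + 1)" using e b by simp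
      have "(LINT x|M. (norm (\<Phi> (X m) x - \<Phi> (X n) x))\<^sup>2) \<le> b * (D.nrm (X m - X n))\<^sup>2"
        by (rule b(2)[OF XD XD])
      also have "\<dots> \<le> (b + 1) * (D.nrm (X m - X n))\<^sup>2" by (intro mult_right_mono) auto
      also have "\<dots> < e" using lt b by (simp add: field_simps)
      finally show ?thesis .
    qed
    then show "\<exists>n0. \<forall>m\<ge>n0. \<forall>n\<ge>n0. (LINT x|M. (norm (\<Phi> (X m) x - \<Phi> (X n) x))\<^sup>2) < e" by blast
  qed
  then show ?thesis by blast
qed

text \<open>The definitions by \<open>SOME\<close> allow any representative \<open>Y\<close> of a
  class to witness the limit; this carries the limit over to the given representative
  \<open>X\<close>.\<close>

lemma bounded_map_transfer:
  assumes \<Phi>: "bounded_map M \<Phi>" and X: "X \<in> D.cauchy_sequences" and Y: "Y \<in> cls X"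
    and lim: "L2_tendsto M (\<lambda>n. \<Phi> (Y n)) g"
  shows "L2_tendsto M (\<lambda>n. \<Phi> (X n)) g"
proof (rule L2_tendsto_transfer[OF lim])
  have YS: "Y \<in> D.cauchy_sequences" "S.nrm (X - Y) = 0" using Y by (auto simp: cls_iff)
  show "\<Phi> (X n) \<in> L2 M" for n using \<Phi> D.cauchy_D[OF X] by (auto simp: bounded_map_def)
  obtain b where b: "b \<ge> 0" "\<And>v w. v \<in> C1_union N \<Longrightarrow> w \<in> C1_union N \<Longrightarrow>
     (LINT x|M. (norm (\<Phi> v x - \<Phi> w x))\<^sup>2) \<le> b * (D.nrm (v - w))\<^sup>2"
    using \<Phi> unfolding bounded_map_def by blast
  have "S.nrm (Y - X) = 0" using S.nrm_minus_commute[OF X YS(1)] YS(2) by simp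
  then have "(\<lambda>n. D.nrm (Y n - X n)) \<longlonglongrightarrow> 0" using D_diff_seq_nrm_tendsto[OF YS(1) X] by simp
  then have "(\<lambda>n. b * (D.nrm (Y n - X n))\<^sup>2) \<longlonglongrightarrow> b * 0\<^sup>2" by (intro tendsto_intros)
  then have lim0: "(\<lambda>n. b * (D.nrm (Y n - X n))\<^sup>2) \<longlonglongrightarrow> 0" by simp
  show "(\<lambda>n. LINT x|M. (norm (\<Phi> (Y n) x - \<Phi> (X n) x))\<^sup>2) \<longlonglongrightarrow> 0"
  proof (rule tendsto_0_le[OF lim0])
    fix n
    show "\<bar>LINT x|M. (norm (\<Phi> (Y n) x - \<Phi> (X n) x))\<^sup>2\<bar> \<le> b * (D.nrm (Y n - X n))\<^sup>2"
      using b(2)[OF D.cauchy_D[OF YS(1), of n] D.cauchy_D[OF X, of n]]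
      by (subst abs_of_nonneg) (auto intro!: integral_nonneg_AE)
  qed
qed

lemma bounded_map_grad: "bounded_map (lebesgue_on (region N - ifc_all N)) grad"
  unfolding bounded_map_def
proof (intro conjI ballI exI[of _ 1])
  fix v w assume v: "v \<in> C1_union N" and w: "w \<in> C1_union N"
  have "grad v x - grad w x = grad (v - w) x" if "x \<in> region N - ifc_all N" for x
    using grad_add[OF D.D_diff[OF v w] w that] by simp
  then have "(LINT x|lebesgue_on (region N - ifc_all N). (norm (grad v x - grad w x))\<^sup>2)
      = (LINT x|lebesgue_on (region N - ifc_all N). (norm (grad (v - w) x))\<^sup>2)"
    by (intro Bochner_Integration.integral_cong) auto
  then show "(LINT x|lebesgue_on (region N - ifc_all N). (norm (grad v x - grad w x))\<^sup>2) \<le> 1 * (D.nrm (v - w))\<^sup>2"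
    using part_le_nrm(1)[OF D.D_diff[OF v w]] by simp
qed (auto intro: C1_union_grad_L2)

lemma bounded_map_jump: "bounded_map (jump_measure c) jump"
  unfolding bounded_map_def
proof (intro conjI ballI exI[of _ 1])
  fix v w assume v: "v \<in> C1_union N" and w: "w \<in> C1_union N"
  note d = D.D_diff[OF v w]
  have "(LINT \<xi>|jump_measure c. (norm (jump v \<xi> - jump w \<xi>))\<^sup>2) = (LINT \<xi>|jump_measure c. (norm (jump (v - w) \<xi>))\<^sup>2)"
  proof (rule integral_cong_AE)
    show "AE \<xi> in jump_measure c. (norm (jump v \<xi> - jump w \<xi>))\<^sup>2 = (norm (jump (v - w) \<xi>))\<^sup>2"
      using jump_add[OF d w] by (rule eventually_mono) simp
    note [measurable] = L2_D(1)[OF jump_L2[OF c v]] L2_D(1)[OF jump_L2[OF c w]] L2_D(1)[OF jump_L2[OF c d]]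
    show "(\<lambda>\<xi>. (norm (jump v \<xi> - jump w \<xi>))\<^sup>2) \<in> borel_measurable (jump_measure c)" by measurable
    show "(\<lambda>\<xi>. (norm (jump (v - w) \<xi>))\<^sup>2) \<in> borel_measurable (jump_measure c)" by measurable
  qed
  then show "(LINT \<xi>|jump_measure c. (norm (jump v \<xi> - jump w \<xi>))\<^sup>2) \<le> 1 * (D.nrm (v - w))\<^sup>2"
    using part_le_nrm(2)[OF d] by simp
qed (auto intro: jump_L2[OF c])

lemma bounded_map_id: "bounded_map (lebesgue_on (region N)) (\<lambda>v. v)"
  unfolding bounded_map_def
proof (intro conjI ballI exI[of _ poincare_const])
  fix v w assume v: "v \<in> C1_union N" and w: "w \<in> C1_union N"
  show "(LINT x|lebesgue_on (region N). (norm (v x - w x))\<^sup>2) \<le> poincare_const * (D.nrm (v - w))\<^sup>2"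
    using part_le_nrm(3)[OF D.D_diff[OF v w]] by simp
qed (use poincare_const in auto)

lemma weak_grad_tendsto:
  assumes X: "X \<in> D.cauchy_sequences"
  shows "L2_tendsto (lebesgue_on (region N - ifc_all N)) (\<lambda>n. grad (X n)) (weak_grad N (cls X))"
proof -
  have "\<exists>g. \<exists>Y\<in>cls X. L2_tendsto (lebesgue_on (region N - ifc_all N)) (\<lambda>n. grad (Y n)) g"
    using bounded_map_limit[OF bounded_map_grad X] cls_self[OF X] by blast
  then have "\<exists>Y\<in>cls X. L2_tendsto (lebesgue_on (region N - ifc_all N)) (\<lambda>n. grad (Y n)) (weak_grad N (cls X))"
    unfolding weak_grad_def by (rule someI_ex)
  then show ?thesis using bounded_map_transfer[OF bounded_map_grad X] by blast
qed

lemma fractal_fun_tendsto: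
  assumes X: "X \<in> D.cauchy_sequences"
  shows "L2_tendsto (lebesgue_on (region N)) X (fractal_fun N (cls X))"
proof -
  have "\<exists>g. \<exists>Y\<in>cls X. L2_tendsto (lebesgue_on (region N)) Y g"
    using bounded_map_limit[OF bounded_map_id X] cls_self[OF X] by blast
  then have "\<exists>Y\<in>cls X. L2_tendsto (lebesgue_on (region N)) Y (fractal_fun N (cls X))"
    unfolding fractal_fun_def by (rule someI_ex)
  then show ?thesis using bounded_map_transfer[OF bounded_map_id X] by blast
qed

lemma jump_space_glue:
  assumes j: "j \<in> jump_space N c" shows "glue j \<in> L2 (jump_measure c)"
proof (rule L2_jump_measureI[OF c])
  have jk: "j k \<in> L2 (surface_measure (ifc N k))" if "1 \<le> k" for k
    using j that by (simp add: jump_space_def)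
  show "glue j \<in> L2 (surface_measure (ifc N k))" if k: "1 \<le> k" for k
    by (rule L2_cong[OF _ jk[OF k]]) (simp add: glue_eq[OF k])
  have "(LINT \<xi>|surface_measure (ifc N (Suc k)). (glue j \<xi>)\<^sup>2) = (LINT \<xi>|surface_measure (ifc N (Suc k)). (j (Suc k) \<xi>)\<^sup>2)" for k
    by (rule surface_integral_cong) (simp_all add: glue_eq[of "Suc k"])
  then show "summable (\<lambda>k. weight N c (Suc k) * (LINT \<xi>|surface_measure (ifc N (Suc k)). (glue j \<xi>)\<^sup>2))"
    using j by (simp add: jump_space_def)
qed

text \<open>Identifies the weighted sequence norm with an L2 norm, so that
  \<open>bounded_map\<close> covers the jumps too.\<close>

lemma jump_norm_diff:
  assumes j: "j \<in> jump_space N c" and v: "v \<in> C1_union N"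
  shows "jump_norm N c (\<lambda>k \<xi>. normal_jump (ifc N k) v \<xi> - j k \<xi>)
    = sqrt (LINT \<xi>|jump_measure c. (norm (jump v \<xi> - glue j \<xi>))\<^sup>2)"
proof -
  have "jump v - glue j \<in> L2 (jump_measure c)"
    by (rule subspace_diff[OF subspace_L2 jump_L2[OF c v] jump_space_glue[OF j]])
  from L2_D(2)[OF this] have int: "integrable (jump_measure c) (\<lambda>\<xi>. (norm (jump v \<xi> - glue j \<xi>))\<^sup>2)" by simp
  have eq: "(LINT \<xi>|surface_measure (ifc N (Suc k)). (norm (jump v \<xi> - glue j \<xi>))\<^sup>2)
      = (LINT \<xi>|surface_measure (ifc N (Suc k)). (normal_jump (ifc N (Suc k)) v \<xi> - j (Suc k) \<xi>)\<^sup>2)" for k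
    by (rule surface_integral_cong) (simp_all add: glue_eq[of "Suc k"] jump_eq[of "Suc k"])
  show ?thesis
    unfolding jump_norm_def integral_jump_measure[OF c int] eq ..
qed

text \<open>An admissible jump sequence is first built from the L2 limit, which makes the
  \<open>SOME\<close> in \<open>gen_jump\<close> meaningful; the chosen sequence is then shown to be
  the limit along \<open>X\<close>.\<close>

lemma gen_jump_tendsto:
  assumes X: "X \<in> D.cauchy_sequences"
  shows "gen_jump N c (cls X) \<in> jump_space N c"
    and "L2_tendsto (jump_measure c) (\<lambda>n. jump (X n)) (glue (gen_jump N c (cls X)))"
proof -
  obtain g where g: "L2_tendsto (jump_measure c) (\<lambda>n. jump (X n)) g"
    using bounded_map_limit[OF bounded_map_jump X] by blast
  then have gL: "g \<in> L2 (jump_measure c)" by (simp add: L2_tendsto_def)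
  (* jump_measure c does not control g on interfaces of weight 0 *)
  define j where "j k = (if k = 0 \<or> weight N c k = 0 then 0 else g)" for k
  have "j k \<in> L2 (surface_measure (ifc N k))" for k
    using L2_jump_measureD(1)[OF c gL, of "k - 1"] subspace_0[OF subspace_L2] by (cases k) (auto simp: j_def)
  moreover have "(\<lambda>k. weight N c (Suc k) * (LINT \<xi>|surface_measure (ifc N (Suc k)). (j (Suc k) \<xi>)\<^sup>2))
      = (\<lambda>k. weight N c (Suc k) * (LINT \<xi>|surface_measure (ifc N (Suc k)). (g \<xi>)\<^sup>2))"
    by (auto simp: j_def)
  ultimately have j: "j \<in> jump_space N c"
    using L2_jump_measureD(2)[OF c gL] by (simp add: jump_space_def)
  have ae: "AE \<xi> in jump_measure c. glue j \<xi> = g \<xi>"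
  proof -
    have "\<forall>\<xi>\<in>ifc_all N. 0 < weight N c (idx \<xi>) \<longrightarrow> glue j \<xi> = g \<xi>"
      by (auto elim!: ifc_all_E simp: glue_def j_def idx_eq)
    then have "AE \<xi> in surface_measure (ifc_all N). 0 < ennreal (weight N c (idx \<xi>)) \<longrightarrow> glue j \<xi> = g \<xi>"
      by (intro AE_I2) simp
    then show ?thesis
      unfolding jump_measure_def using weight_measurable[of c] by (subst AE_density) auto
  qed
  have "(LINT \<xi>|jump_measure c. (norm (jump (X n) \<xi> - glue j \<xi>))\<^sup>2) = (LINT \<xi>|jump_measure c. (norm (jump (X n) \<xi> - g \<xi>))\<^sup>2)" for n
  proof (rule integral_cong_AE)
    note [measurable] = L2_D(1)[OF jump_L2[OF c D.cauchy_D[OF X, of n]]] L2_D(1)[OF gL] L2_D(1)[OF jump_space_glue[OF j]]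
    show "(\<lambda>\<xi>. (norm (jump (X n) \<xi> - glue j \<xi>))\<^sup>2) \<in> borel_measurable (jump_measure c)" by measurable
    show "(\<lambda>\<xi>. (norm (jump (X n) \<xi> - g \<xi>))\<^sup>2) \<in> borel_measurable (jump_measure c)" by measurable
  qed (use ae in \<open>auto elim!: eventually_mono\<close>)
  then have "(\<lambda>n. sqrt (LINT \<xi>|jump_measure c. (norm (jump (X n) \<xi> - glue j \<xi>))\<^sup>2)) \<longlonglongrightarrow> sqrt 0"
    using g unfolding L2_tendsto_def by (intro tendsto_real_sqrt) auto
  then have "(\<lambda>n. jump_norm N c (\<lambda>k \<xi>. normal_jump (ifc N k) (X n) \<xi> - j k \<xi>)) \<longlonglongrightarrow> 0"
    by (simp add: jump_norm_diff[OF j D.cauchy_D[OF X]])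
  then have "\<exists>j. j \<in> jump_space N c \<and>
        (\<exists>Y\<in>cls X. (\<lambda>n. jump_norm N c (\<lambda>k \<xi>. normal_jump (ifc N k) (Y n) \<xi> - j k \<xi>)) \<longlonglongrightarrow> 0)"
    using j cls_self[OF X] by blast
  then have P: "gen_jump N c (cls X) \<in> jump_space N c \<and>
        (\<exists>Y\<in>cls X. (\<lambda>n. jump_norm N c (\<lambda>k \<xi>. normal_jump (ifc N k) (Y n) \<xi> - gen_jump N c (cls X) k \<xi>)) \<longlonglongrightarrow> 0)"
    unfolding gen_jump_def by (rule someI_ex)
  then show J: "gen_jump N c (cls X) \<in> jump_space N c" by blast
  obtain Y where Y: "Y \<in> cls X"
    "(\<lambda>n. jump_norm N c (\<lambda>k \<xi>. normal_jump (ifc N k) (Y n) \<xi> - gen_jump N c (cls X) k \<xi>)) \<longlonglongrightarrow> 0"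
    using P by blast
  have YS: "Y \<in> D.cauchy_sequences" using Y(1) by (simp add: cls_iff)
  have "(\<lambda>n. sqrt (LINT \<xi>|jump_measure c. (norm (jump (Y n) \<xi> - glue (gen_jump N c (cls X)) \<xi>))\<^sup>2)) \<longlonglongrightarrow> 0"
    using Y(2) by (simp only: jump_norm_diff[OF J D.cauchy_D[OF YS]])
  from tendsto_power[OF this, of 2]
  have "(\<lambda>n. LINT \<xi>|jump_measure c. (norm (jump (Y n) \<xi> - glue (gen_jump N c (cls X)) \<xi>))\<^sup>2) \<longlonglongrightarrow> 0"
    by simp
  then have "L2_tendsto (jump_measure c) (\<lambda>n. jump (Y n)) (glue (gen_jump N c (cls X)))"
    using jump_L2[OF c D.cauchy_D[OF YS]] jump_space_glue[OF J] by (simp add: L2_tendsto_def)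
  then show "L2_tendsto (jump_measure c) (\<lambda>n. jump (X n)) (glue (gen_jump N c (cls X)))"
    by (rule bounded_map_transfer[OF bounded_map_jump X Y(1)])
qed

subsection \<open>Forms, load and norm as limits\<close>

lemma glue_form:
  assumes X: "X \<in> D.cauchy_sequences" and Y: "Y \<in> D.cauchy_sequences"
  shows "(LINT \<xi>|jump_measure c. (A \<xi> * glue (gen_jump N c (cls X)) \<xi>) \<bullet> glue (gen_jump N c (cls Y)) \<xi>)
    = (\<Sum>k. weight N c (Suc k) * (LINT \<xi>|surface_measure (ifc N (Suc k)).
         A \<xi> * gen_jump N c (cls X) (Suc k) \<xi> * gen_jump N c (cls Y) (Suc k) \<xi>))"
proof -
  let ?g = "glue (gen_jump N c (cls X))" and ?h = "glue (gen_jump N c (cls Y))"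
  have int: "integrable (jump_measure c) (\<lambda>\<xi>. (A \<xi> * ?g \<xi>) \<bullet> ?h \<xi>)"
    by (intro L2_integrable_inner L2_mult_bounded[OF A_jump_measure(1,3)] jump_space_glue gen_jump_tendsto X Y)
  have eq: "(LINT \<xi>|surface_measure (ifc N (Suc k)). (A \<xi> * ?g \<xi>) \<bullet> ?h \<xi>)
      = (LINT \<xi>|surface_measure (ifc N (Suc k)). A \<xi> * gen_jump N c (cls X) (Suc k) \<xi> * gen_jump N c (cls Y) (Suc k) \<xi>)" for k
    by (rule surface_integral_cong) (simp_all add: glue_eq[of "Suc k"])
  show ?thesis unfolding integral_jump_measure[OF c int] eq ..
qed

text \<open>Weak gradients and generalized jumps are L2 limits, and the products under the integrals
  are continuous in L2, so both sides are limits of the same sequence.\<close>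

lemma form_eq:
  assumes X: "X \<in> D.cauchy_sequences" and Y: "Y \<in> D.cauchy_sequences"
  shows "form N c A (cls X) (cls Y) = D.ext (smooth_form A) X Y"
proof -
  have "(\<lambda>n. smooth_form A (X n) (Y n)) \<longlonglongrightarrow>
      (LINT x|lebesgue_on (region N - ifc_all N). weak_grad N (cls X) x \<bullet> weak_grad N (cls Y) x) +
      (LINT \<xi>|jump_measure c. (A \<xi> * glue (gen_jump N c (cls X)) \<xi>) \<bullet> glue (gen_jump N c (cls Y)) \<xi>)"
    unfolding smooth_form_def
    by (intro tendsto_add L2_tendsto_inner L2_tendsto_mult_bounded[OF A_jump_measure(1,3)]
          weak_grad_tendsto gen_jump_tendsto X Y)
  then show ?thesis
    using LIMSEQ_unique[OF D.ext_B_tendsto[OF X Y]] by (simp only: form_def glue_form[OF X Y])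
qed

lemma load_eq:
  assumes X: "X \<in> D.cauchy_sequences"
  shows "load N f (cls X) = D.ext_l X"
proof -
  have "L2_tendsto (lebesgue_on (region N)) (\<lambda>_. f) f" using f by (simp add: L2_tendsto_def)
  from L2_tendsto_inner[OF this fractal_fun_tendsto[OF X]]
  have "(\<lambda>n. smooth_load (X n)) \<longlonglongrightarrow> load N f (cls X)" by (simp add: smooth_load_def load_def)
  then show ?thesis using LIMSEQ_unique[OF D.ext_l_tendsto[OF X]] by simp
qed

lemma energy_eq:
  assumes X: "X \<in> D.cauchy_sequences" shows "energy N c A f (cls X) = S.E X"
  by (simp add: energy_def S.E_def form_eq[OF X X] load_eq[OF X])

lemma fractal_norm_eq:
  assumes X: "X \<in> D.cauchy_sequences"
  shows "fractal_norm N c (cls X) = S.nrm X"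
  unfolding fractal_norm_def
proof (rule the_equality)
  have lim: "(\<lambda>n. union_norm N c (Y n)) \<longlonglongrightarrow> S.nrm Y" if "Y \<in> D.cauchy_sequences" for Y
    using D.nrm_tendsto[OF that] union_norm_eq[OF D.cauchy_D[OF that]] by (simp add: S.nrm_def)
  show "\<exists>Y\<in>cls X. (\<lambda>n. union_norm N c (Y n)) \<longlonglongrightarrow> S.nrm X" using lim[OF X] cls_self[OF X] by blast
  fix r assume "\<exists>Y\<in>cls X. (\<lambda>n. union_norm N c (Y n)) \<longlonglongrightarrow> r"
  then obtain Y where Y: "Y \<in> D.cauchy_sequences" "S.nrm (X - Y) = 0" "(\<lambda>n. union_norm N c (Y n)) \<longlonglongrightarrow> r"
    by (auto simp: cls_iff)
  have "r = S.nrm Y" using LIMSEQ_unique[OF Y(3) lim[OF Y(1)]] .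
  then show "r = S.nrm X" using S.nrm_diff_le[OF X Y(1)] Y(2) by simp
qed

lemma fractal_minus_eq:
  assumes X: "X \<in> D.cauchy_sequences" and Y: "Y \<in> D.cauchy_sequences"
  shows "fractal_minus N c (cls X) (cls Y) = cls (X - Y)"
proof (intro set_eqI iffI)
  fix Z assume "Z \<in> fractal_minus N c (cls X) (cls Y)"
  then obtain X' Y' where *: "X' \<in> cls X" "Y' \<in> cls Y" "((\<lambda>n x. X' n x - Y' n x), Z) \<in> cauchy_rel N c"
    by (auto simp: fractal_minus_def)
  have S': "X' \<in> D.cauchy_sequences" "Y' \<in> D.cauchy_sequences" "S.nrm (X - X') = 0" "S.nrm (Y - Y') = 0"
    using * by (auto simp: cls_iff)
  have "(\<lambda>n x. X' n x - Y' n x) = X' - Y'" by (simp add: fun_eq_iff)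
  then have Z: "Z \<in> cls (X' - Y')" using *(3) by (simp add: cls_def)
  have "S.nrm ((X - Y) - (X' - Y')) \<le> S.nrm (X - X') + S.nrm (Y' - Y)"
    using S.nrm_triangle[of "X - X'" "Y' - Y"] S.D_diff X Y S'(1,2) by (simp add: algebra_simps)
  then have "S.nrm ((X - Y) - (X' - Y')) = 0"
    using S' S.nrm_minus_commute[OF Y S'(2)] S.nrm_nonneg[of "(X - Y) - (X' - Y')"] S.D_diff X Y by simp
  then have "cls (X - Y) = cls (X' - Y')" using X Y S' by (simp add: cls_eq_iff S.D_diff)
  then show "Z \<in> cls (X - Y)" using Z by simp
next
  fix Z assume "Z \<in> cls (X - Y)"
  moreover have "(\<lambda>n x. X n x - Y n x) = X - Y" by (simp add: fun_eq_iff)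
  ultimately show "Z \<in> fractal_minus N c (cls X) (cls Y)"
    unfolding fractal_minus_def cls_def[of "X - Y"] mem_Collect_eq
    by (intro bexI[OF _ cls_self[OF X]] bexI[OF _ cls_self[OF Y]]) simp
qed

text \<open>The approximating functions have no jump on this interface, so neither has the limit, up
  to a null set. The factor in front covers interfaces of weight 0, on which the limit is not
  controlled.\<close>

lemma gen_jump_level:
  assumes K: "1 \<le> K" and X: "X \<in> D.cauchy_sequences" "\<forall>n. X n \<in> C1_level N K" and k: "K \<le> k"
  shows "weight N c (Suc k) * (LINT \<xi>|surface_measure (ifc N (Suc k)). A \<xi> * gen_jump N c (cls X) (Suc k) \<xi> * h \<xi>) = 0"
proof (cases "weight N c (Suc k) = 0")
  case False
  let ?j = "gen_jump N c (cls X)" and ?M = "surface_measure (ifc N (Suc k))"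
  note J = gen_jump_tendsto[OF X(1)]
  have jL: "?j (Suc k) \<in> L2 ?M" using J(1) by (simp add: jump_space_def)
  \<comment> \<open>The approximating jump is zero here, so the left side is a single term of the
    series for the squared L2 distance.\<close>
  have le: "weight N c (Suc k) * (LINT \<xi>|?M. (?j (Suc k) \<xi>)\<^sup>2)
      \<le> (LINT \<xi>|jump_measure c. (norm (jump (X n) \<xi> - glue ?j \<xi>))\<^sup>2)" for n
  proof -
    have v: "X n \<in> C1_union N" using D.cauchy_D[OF X(1)] .
    have d: "jump (X n) - glue ?j \<in> L2 (jump_measure c)"
      by (rule subspace_diff[OF subspace_L2 jump_L2[OF c v] jump_space_glue[OF J(1)]])
    let ?s = "\<lambda>i. weight N c (Suc i) * (LINT \<xi>|surface_measure (ifc N (Suc i)). (norm (jump (X n) \<xi> - glue ?j \<xi>))\<^sup>2)"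
    have "(LINT \<xi>|?M. (?j (Suc k) \<xi>)\<^sup>2) = (LINT \<xi>|?M. (norm (jump (X n) \<xi> - glue ?j \<xi>))\<^sup>2)"
    proof (rule surface_integral_cong)
      fix \<xi> assume \<xi>: "\<xi> \<in> ifc N (Suc k)"
      have "normal_jump (ifc N (Suc k)) (X n) \<xi> = 0"
        using normal_jump_higher[OF K _ \<xi>, of "X n"] X(2) k by simp
      then show "(?j (Suc k) \<xi>)\<^sup>2 = (norm (jump (X n) \<xi> - glue ?j \<xi>))\<^sup>2"
        using \<xi> by (simp add: jump_eq[of "Suc k"] glue_eq[of "Suc k"])
    qed simp
    moreover have "?s k \<le> (\<Sum>i. ?s i)"
    proof -
      have "summable ?s" using L2_jump_measureD(2)[OF c d] by simp
      then show ?thesis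
        using sum_le_suminf[of ?s "{k}"] weight_nonneg[OF c] by (simp add: integral_nonneg_AE)
    qed
    moreover have "(LINT \<xi>|jump_measure c. (norm (jump (X n) \<xi> - glue ?j \<xi>))\<^sup>2) = (\<Sum>i. ?s i)"
      using L2_D(2)[OF d] by (intro integral_jump_measure[OF c]) simp
    ultimately show ?thesis by simp
  qed
  have "(\<lambda>n. LINT \<xi>|jump_measure c. (norm (jump (X n) \<xi> - glue ?j \<xi>))\<^sup>2) \<longlonglongrightarrow> 0"
    using J(2) by (simp add: L2_tendsto_def)
  then have "weight N c (Suc k) * (LINT \<xi>|?M. (?j (Suc k) \<xi>)\<^sup>2) \<le> 0"
    by (rule LIMSEQ_le_const) (use le in blast)
  then have "(LINT \<xi>|?M. (?j (Suc k) \<xi>)\<^sup>2) \<le> 0"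
    using False weight_nonneg[OF c, of "Suc k"] by (simp add: mult_le_0_iff)
  then have "(LINT \<xi>|?M. (?j (Suc k) \<xi>)\<^sup>2) = 0"
    by (intro antisym integral_nonneg_AE) auto
  then have "AE \<xi> in ?M. (?j (Suc k) \<xi>)\<^sup>2 = 0"
    using L2_D(2)[OF jL] by (subst (asm) integral_nonneg_eq_0_iff_AE) auto
  then have "AE \<xi> in ?M. A \<xi> * ?j (Suc k) \<xi> * h \<xi> = 0" by (rule eventually_mono) simp
  then have "(LINT \<xi>|?M. A \<xi> * ?j (Suc k) \<xi> * h \<xi>) = 0" by (rule integral_eq_zero_AE)
  then show ?thesis by simp
qed simp

text \<open>The level-K problem becomes the restriction of the full one to a subspace. It is enough
  that one of the two arguments has level K, since its jump kills every later term.\<close>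

lemma level_form_eq:
  assumes K: "1 \<le> K" and X: "X \<in> D.cauchy_sequences" "\<forall>n. X n \<in> C1_level N K"
    and Y: "Y \<in> D.cauchy_sequences"
  shows "level_form N c A K (cls X) (cls Y) = form N c A (cls X) (cls Y)"
proof -
  have "(LINT x|lebesgue_on (region N - ifc_upto N K). weak_grad N (cls X) x \<bullet> weak_grad N (cls Y) x)
      = (LINT x|lebesgue_on (region N - ifc_all N). weak_grad N (cls X) x \<bullet> weak_grad N (cls Y) x)"
    using ifc_upto_ifc_all[of K] weak_grad_tendsto[OF X(1)] weak_grad_tendsto[OF Y]
    by (intro lebesgue_on_integral_extend level_lebesgue negligible_level_diff borel_measurable_inner L2_D(1))
       (auto simp: L2_tendsto_def)
  moreover have "(\<Sum>k. weight N c (Suc k) * (LINT \<xi>|surface_measure (ifc N (Suc k)).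
         A \<xi> * gen_jump N c (cls X) (Suc k) \<xi> * gen_jump N c (cls Y) (Suc k) \<xi>))
      = (\<Sum>k<K. weight N c (Suc k) * (LINT \<xi>|surface_measure (ifc N (Suc k)).
         A \<xi> * gen_jump N c (cls X) (Suc k) \<xi> * gen_jump N c (cls Y) (Suc k) \<xi>))"
    by (rule suminf_finite) (use gen_jump_level[OF K X] in auto)
  ultimately show ?thesis
    by (simp add: form_def level_form_def sum.atLeast1_atMost_eq)
qed

lemma level_energy_eq:
  assumes K: "1 \<le> K" and X: "X \<in> D.cauchy_sequences" "\<forall>n. X n \<in> C1_level N K"
  shows "level_energy N c A f K (cls X) = S.E X"
  using energy_eq[OF X(1)] by (simp add: energy_def level_energy_def level_form_eq[OF K X X(1)])

subsection \<open>Minimisers\<close>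

text \<open>With \<open>C1_level N K\<close> these sequences represent the level space and with
  \<open>C1_union N\<close> the whole space, so both minimisation problems are treated
  together.\<close>

definition seqs :: "('n point \<Rightarrow> real) set \<Rightarrow> (nat \<Rightarrow> 'n point \<Rightarrow> real) set" where
  "seqs U = {X \<in> D.cauchy_sequences. \<forall>n. X n \<in> U}"

lemma subspace_seqs:
  assumes "subspace U" shows "subspace (seqs U)"
  by (rule subspaceI)
     (auto simp: seqs_def S.D_0 S.D_add S.D_scale subspace_0[OF assms] subspace_add[OF assms] subspace_scale[OF assms])

text \<open>The limiting energy of \<open>X\<close> lies below each energy on \<open>U\<close>,
  hence also below the limit of such energies along any sequence in \<open>U\<close>.\<close>

lemma minimizer_exists:
  assumes U: "subspace U" "U \<subseteq> C1_union N"
  obtains X where "X \<in> seqs U" "\<And>Y. Y \<in> seqs U \<Longrightarrow> S.E X \<le> S.E Y"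
proof -
  obtain X where X: "X \<in> D.cauchy_sequences" "\<And>n. X n \<in> U"
    "\<And>v. v \<in> U \<Longrightarrow> 1 / 2 * D.ext (smooth_form A) X X - D.ext_l X \<le> D.E v"
    by (rule D.minimizing_sequence[OF U]) (rule that)
  have "S.E X \<le> S.E Y" if Y: "Y \<in> seqs U" for Y
  proof -
    have YS: "Y \<in> D.cauchy_sequences" using Y by (simp add: seqs_def)
    have "(\<lambda>n. D.E (Y n)) \<longlonglongrightarrow> S.E Y"
      unfolding D.E_def S.E_def by (intro tendsto_intros D.ext_B_tendsto D.ext_l_tendsto YS)
    then show ?thesis
      by (rule LIMSEQ_le_const) (use X(3) Y in \<open>auto simp: S.E_def seqs_def\<close>)
  qed
  then show ?thesis using that X(1,2) by (auto simp: seqs_def)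
qed

lemma seqs_subset: "seqs U \<subseteq> D.cauchy_sequences"
  by (auto simp: seqs_def)

lemma minimizer_unique:
  assumes U: "subspace U" and X: "X \<in> seqs U" "\<And>Z. Z \<in> seqs U \<Longrightarrow> S.E X \<le> S.E Z"
    and Y: "Y \<in> seqs U" "\<And>Z. Z \<in> seqs U \<Longrightarrow> S.E Y \<le> S.E Z"
  shows "cls X = cls Y"
proof -
  note V = subspace_seqs[OF U] seqs_subset[of U]
  have "S.nrm (X - Y) = 0"
    using S.minimizer_iff[OF V X(1)] S.minimizer_iff[OF V Y(1)] X Y
    by (intro S.solution_unique[OF V X(1) Y(1)]) auto
  then show ?thesis using X(1) Y(1) seqs_subset by (subst cls_eq_iff) auto
qed

lemma seqs_union: "seqs (C1_union N) = D.cauchy_sequences"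
  using D.cauchy_D by (auto simp: seqs_def)

lemma fractal_level_seqs: "1 \<le> K \<Longrightarrow> fractal_level N c K = cls ` seqs (C1_level N K)"
  by (simp add: fractal_level_eq seqs_def)

lemma arg_min_energy_iff:
  assumes X: "X \<in> D.cauchy_sequences"
  shows "is_arg_min (energy N c A f) (\<lambda>v. v \<in> fractal_space N c) (cls X) \<longleftrightarrow> (\<forall>Y\<in>D.cauchy_sequences. S.E X \<le> S.E Y)"
  unfolding is_arg_min_linorder fractal_space_eq using X by (auto simp: energy_eq)

lemma arg_min_level_iff:
  assumes K: "1 \<le> K" and X: "X \<in> seqs (C1_level N K)"
  shows "is_arg_min (level_energy N c A f K) (\<lambda>v. v \<in> fractal_level N c K) (cls X) \<longleftrightarrow> (\<forall>Y\<in>seqs (C1_level N K). S.E X \<le> S.E Y)"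
  unfolding is_arg_min_linorder fractal_level_seqs[OF K] using X
  by (auto simp: level_energy_eq[OF K] seqs_def)

lemma weak_solution_iff:
  assumes X: "X \<in> D.cauchy_sequences"
  shows "(\<forall>v\<in>fractal_space N c. form N c A (cls X) v = load N f v) \<longleftrightarrow> (\<forall>Y\<in>D.cauchy_sequences. S.E X \<le> S.E Y)"
  unfolding S.minimizer_iff[OF subspace_seqs[OF subspace_C1_union] seqs_subset, unfolded seqs_union, OF X] fractal_space_eq
  using X by (auto simp: form_eq load_eq)

theorem equivalence:
  "is_arg_min (energy N c A f) (\<lambda>v. v \<in> fractal_space N c) u \<longleftrightarrow>
     u \<in> fractal_space N c \<and> (\<forall>v\<in>fractal_space N c. form N c A u v = load N f v)"
proof (cases "u \<in> fractal_space N c")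
  case True
  then obtain X where X: "X \<in> D.cauchy_sequences" "u = cls X" by (auto simp: fractal_space_eq)
  show ?thesis using arg_min_energy_iff[OF X(1)] weak_solution_iff[OF X(1)] True unfolding X(2) by simp
qed (simp add: is_arg_min_def)

theorem existence_uniqueness:
  "\<exists>!u. u \<in> fractal_space N c \<and> (\<forall>v\<in>fractal_space N c. form N c A u v = load N f v)"
proof -
  obtain X where X: "X \<in> seqs (C1_union N)" "\<And>Y. Y \<in> seqs (C1_union N) \<Longrightarrow> S.E X \<le> S.E Y"
    by (rule minimizer_exists[OF subspace_C1_union order_refl]) (rule that)
  have XS: "X \<in> D.cauchy_sequences" using X(1) by (simp add: seqs_union)
  show ?thesis
  proof (rule ex1I[of _ "cls X"])
    show "cls X \<in> fractal_space N c \<and> (\<forall>v\<in>fractal_space N c. form N c A (cls X) v = load N f v)"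
      unfolding weak_solution_iff[OF XS] using XS X(2) by (auto simp: fractal_space_eq seqs_union)
    fix u assume u: "u \<in> fractal_space N c \<and> (\<forall>v\<in>fractal_space N c. form N c A u v = load N f v)"
    then obtain Y where Y: "Y \<in> D.cauchy_sequences" "u = cls Y" by (auto simp: fractal_space_eq)
    have "\<forall>Z\<in>D.cauchy_sequences. S.E Y \<le> S.E Z" using u weak_solution_iff[OF Y(1)] Y(2) by blast
    then have "cls Y = cls X"
      using Y(1) X by (intro minimizer_unique[OF subspace_C1_union]) (auto simp: seqs_union)
    then show "u = cls X" using Y(2) by simp
  qed
qed

theorem level_minimizer:
  assumes K: "1 \<le> K"
  shows "\<exists>!u. is_arg_min (level_energy N c A f K) (\<lambda>v. v \<in> fractal_level N c K) u"
proof -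
  obtain X where X: "X \<in> seqs (C1_level N K)" "\<And>Y. Y \<in> seqs (C1_level N K) \<Longrightarrow> S.E X \<le> S.E Y"
    by (rule minimizer_exists[OF subspace_C1_level[OF K] C1_level_union[OF K]]) (rule that)
  show ?thesis
  proof (rule ex1I[of _ "cls X"])
    show "is_arg_min (level_energy N c A f K) (\<lambda>v. v \<in> fractal_level N c K) (cls X)"
      using X arg_min_level_iff[OF K X(1)] by blast
    fix u assume u: "is_arg_min (level_energy N c A f K) (\<lambda>v. v \<in> fractal_level N c K) u"
    then have "u \<in> fractal_level N c K" by (simp add: is_arg_min_def)
    then obtain Y where Y: "Y \<in> seqs (C1_level N K)" "u = cls Y" by (auto simp: fractal_level_seqs[OF K])
    have "\<forall>Z\<in>seqs (C1_level N K). S.E Y \<le> S.E Z" using u arg_min_level_iff[OF K Y(1)] Y(2) by simp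
    then have "cls Y = cls X" using Y(1) X by (intro minimizer_unique[OF subspace_C1_level[OF K]]) auto
    then show "u = cls X" using Y(2) by simp
  qed
qed

lemma Cea_seqs:
  assumes K: "1 \<le> K" and X: "X \<in> D.cauchy_sequences" "\<forall>Y\<in>D.cauchy_sequences. S.E X \<le> S.E Y"
    and W: "W \<in> seqs (C1_level N K)" "\<forall>Y\<in>seqs (C1_level N K). S.E W \<le> S.E Y"
    and Z: "Z \<in> seqs (C1_level N K)"
  shows "S.nrm (X - W) \<le> \<AA> / \<aa> * S.nrm (X - Z)"
proof (rule S.Cea[OF subspace_seqs[OF subspace_C1_level[OF K]] seqs_subset X(1) W(1) Z])
  note full = S.minimizer_iff[OF subspace_seqs[OF subspace_C1_union] seqs_subset, unfolded seqs_union, OF X(1)]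
  show "D.ext (smooth_form A) X v = D.ext_l v" if "v \<in> seqs (C1_level N K)" for v
    using full X(2) that seqs_subset by blast
  show "D.ext (smooth_form A) W v = D.ext_l v" if "v \<in> seqs (C1_level N K)" for v
    using S.minimizer_iff[OF subspace_seqs[OF subspace_C1_level[OF K]] seqs_subset W(1)] W(2) that by blast
qed (use bounds in simp)

text \<open>The estimate is \<open>Cea_seqs\<close> read on classes. Convergence follows by density:
  each member of a sequence representing \<open>u\<close> has a finite level and may be inserted as
  \<open>v\<close> from that level on.\<close>

theorem error_estimate:
  assumes u: "is_arg_min (energy N c A f) (\<lambda>v. v \<in> fractal_space N c) u"
    and uK: "\<forall>K\<ge>1. is_arg_min (level_energy N c A f K) (\<lambda>v. v \<in> fractal_level N c K) (uK K)"
  shows "\<forall>K\<ge>1. fractal_norm N c (fractal_minus N c u (uK K))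
      \<le> \<AA> / \<aa> * (INF v\<in>fractal_level N c K. fractal_norm N c (fractal_minus N c u v))"
    and "(\<lambda>K. fractal_norm N c (fractal_minus N c u (uK K))) \<longlonglongrightarrow> 0"
proof -
  obtain X where X: "X \<in> D.cauchy_sequences" "u = cls X"
    using u by (auto simp: is_arg_min_def fractal_space_eq)
  have XE: "\<forall>Y\<in>D.cauchy_sequences. S.E X \<le> S.E Y" using u arg_min_energy_iff[OF X(1)] X(2) by simp
  have "\<exists>W. W \<in> seqs (C1_level N K) \<and> uK K = cls W \<and> (\<forall>Y\<in>seqs (C1_level N K). S.E W \<le> S.E Y)"
    if K: "1 \<le> K" for K
  proof -
    have a: "is_arg_min (level_energy N c A f K) (\<lambda>v. v \<in> fractal_level N c K) (uK K)" using uK K by simp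
    then have "uK K \<in> fractal_level N c K" by (simp add: is_arg_min_def)
    then obtain W where W: "W \<in> seqs (C1_level N K)" "uK K = cls W" by (auto simp: fractal_level_seqs[OF K])
    then show ?thesis using a arg_min_level_iff[OF K W(1)] by auto
  qed
  then obtain W where W: "\<And>K. 1 \<le> K \<Longrightarrow> W K \<in> seqs (C1_level N K)" "\<And>K. 1 \<le> K \<Longrightarrow> uK K = cls (W K)"
    "\<And>K. 1 \<le> K \<Longrightarrow> \<forall>Y\<in>seqs (C1_level N K). S.E (W K) \<le> S.E Y" by metis
  have dist: "fractal_norm N c (fractal_minus N c u (cls Z)) = S.nrm (X - Z)" if "Z \<in> D.cauchy_sequences" for Z
    using X that by (simp add: fractal_minus_eq fractal_norm_eq S.D_diff)
  have distW: "fractal_norm N c (fractal_minus N c u (uK K)) = S.nrm (X - W K)" if "1 \<le> K" for K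
    using dist[of "W K"] W(1,2)[OF that] seqs_subset[of "C1_level N K"] by auto
  have ratio: "0 < \<AA> / \<aa>" using bounds by simp
  show "\<forall>K\<ge>1. fractal_norm N c (fractal_minus N c u (uK K))
      \<le> \<AA> / \<aa> * (INF v\<in>fractal_level N c K. fractal_norm N c (fractal_minus N c u v))"
  proof (intro allI impI)
    fix K :: nat assume K: "1 \<le> K"
    \<comment> \<open>The positive constant is moved to the left, which leaves an ordinary lower
      bound to be compared with the infimum.\<close>
    have "S.nrm (X - W K) / (\<AA> / \<aa>) \<le> (INF v\<in>fractal_level N c K. fractal_norm N c (fractal_minus N c u v))"
    proof (rule cINF_greatest)
      show "fractal_level N c K \<noteq> {}" using W(1)[OF K] by (auto simp: fractal_level_seqs[OF K])
      fix v assume "v \<in> fractal_level N c K"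
      then obtain Z where Z: "Z \<in> seqs (C1_level N K)" "v = cls Z" by (auto simp: fractal_level_seqs[OF K])
      have "S.nrm (X - W K) \<le> \<AA> / \<aa> * S.nrm (X - Z)"
        by (rule Cea_seqs[OF K X(1) XE W(1)[OF K] W(3)[OF K] Z(1)])
      then have "S.nrm (X - W K) / (\<AA> / \<aa>) \<le> S.nrm (X - Z)"
        using ratio by (simp only: pos_divide_le_eq mult.commute)
      then show "S.nrm (X - W K) / (\<AA> / \<aa>) \<le> fractal_norm N c (fractal_minus N c u v)"
        using dist[of Z] Z seqs_subset[of "C1_level N K"] by (auto simp: subset_iff)
    qed
    then have "S.nrm (X - W K) \<le> \<AA> / \<aa> * (INF v\<in>fractal_level N c K. fractal_norm N c (fractal_minus N c u v))"
      using ratio by (simp only: pos_divide_le_eq mult.commute)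
    then show "fractal_norm N c (fractal_minus N c u (uK K))
      \<le> \<AA> / \<aa> * (INF v\<in>fractal_level N c K. fractal_norm N c (fractal_minus N c u v))"
      by (simp only: distW[OF K])
  qed
  show "(\<lambda>K. fractal_norm N c (fractal_minus N c u (uK K))) \<longlonglongrightarrow> 0"
  proof (rule LIMSEQ_I)
    fix e :: real assume e: "e > 0"
    \<comment> \<open>Multiplication by \<open>\<AA> / \<aa>\<close> turns this into
      \<open>e / 2\<close>, half the tolerance, which keeps the final inequality strict.\<close>
    define d where "d = e / (\<AA> / \<aa>) / 2"
    have d: "d > 0" unfolding d_def using e bounds by (intro divide_pos_pos) auto
    obtain n0 where n0: "\<And>m n. m \<ge> n0 \<Longrightarrow> n \<ge> n0 \<Longrightarrow> D.nrm (X m - X n) < d"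
      using D.cauchyE[OF X(1) d] by blast
    define v where "v = X n0"
    have v: "v \<in> C1_union N" unfolding v_def by (rule D.cauchy_D[OF X(1)])
    \<comment> \<open>The constant sequence embeds the piecewise smooth function \<open>v\<close>
      into the completion; its distance from \<open>X\<close> is a limit of distances below
      \<open>d\<close>.\<close>
    define Z where "Z = (\<lambda>_::nat. v)"
    have ZS: "Z \<in> D.cauchy_sequences" unfolding Z_def by (rule D.const_cauchy[OF v])
    have XZ: "S.nrm (X - Z) \<le> d"
      by (rule LIMSEQ_le_const2[OF D_diff_seq_nrm_tendsto[OF X(1) ZS]])
         (use n0 in \<open>auto simp: Z_def v_def intro!: exI[of _ n0] less_imp_le\<close>)
    have "norm (fractal_norm N c (fractal_minus N c u (uK K)) - 0) < e" if K: "K \<ge> level N v" for K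
    proof -
      have K1: "1 \<le> K" using C1_union_level(1)[OF v] K by simp
      have "v \<in> C1_level N K" using C1_union_level[OF v] C1_level_mono[OF _ K] by blast
      then have ZK: "Z \<in> seqs (C1_level N K)" using ZS by (simp add: seqs_def Z_def)
      have WS: "W K \<in> D.cauchy_sequences" using W(1)[OF K1] seqs_subset by blast
      have "S.nrm (X - W K) \<le> \<AA> / \<aa> * S.nrm (X - Z)"
        by (rule Cea_seqs[OF K1 X(1) XE W(1)[OF K1] W(3)[OF K1] ZK])
      also have "\<dots> \<le> \<AA> / \<aa> * d" using XZ ratio by (intro mult_left_mono) auto
      also have "\<dots> = e / 2" using bounds by (simp add: d_def)
      finally have "S.nrm (X - W K) < e" using e by simp
      then show ?thesis using distW[OF K1] S.nrm_nonneg[OF S.D_diff[OF X(1) WS]] by simp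
    qed
    then show "\<exists>n0. \<forall>K\<ge>n0. norm (fractal_norm N c (fractal_minus N c u (uK K)) - 0) < e" by blast
  qed
qed

end

text \<open>The error estimate is stated for arbitrary minimisers \<open>u\<close> and
  \<open>uK\<close>; the preceding conjuncts guarantee that they exist and are unique.\<close>

theorem theorem3p12:
  fixes N :: "'n::{finite,linorder} network"
    and c \<aa> \<AA> :: real
    and A f :: "'n point \<Rightarrow> real"
  assumes network: "multiscale_network N"
    and c: "0 < c"
    and bounds: "0 < \<aa>" "\<aa> \<le> 1" "1 \<le> \<AA>"
    and A_measurable: "A \<in> borel_measurable (surface_measure (ifc_all N))"
    and A_bounds: "AE \<xi> in surface_measure (ifc_all N). \<aa> \<le> A \<xi> \<and> A \<xi> \<le> \<AA>"
    and f: "f \<in> L2 (lebesgue_on (region N))"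
  shows
    "(\<forall>u. is_arg_min (energy N c A f) (\<lambda>v. v \<in> fractal_space N c) u \<longleftrightarrow>
          u \<in> fractal_space N c \<and> (\<forall>v\<in>fractal_space N c. form N c A u v = load N f v)) \<and>
     (\<exists>!u. u \<in> fractal_space N c \<and> (\<forall>v\<in>fractal_space N c. form N c A u v = load N f v)) \<and>
     (\<forall>K\<ge>1. \<exists>!u. is_arg_min (level_energy N c A f K) (\<lambda>v. v \<in> fractal_level N c K) u) \<and>
     (\<forall>u uK.
        is_arg_min (energy N c A f) (\<lambda>v. v \<in> fractal_space N c) u \<longrightarrow>
        (\<forall>K\<ge>1. is_arg_min (level_energy N c A f K) (\<lambda>v. v \<in> fractal_level N c K) (uK K)) \<longrightarrow>
        (\<forall>K\<ge>1. fractal_norm N c (fractal_minus N c u (uK K))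
           \<le> \<AA> / \<aa> * (INF v\<in>fractal_level N c K. fractal_norm N c (fractal_minus N c u v))) \<and>
        (\<lambda>K. fractal_norm N c (fractal_minus N c u (uK K))) \<longlonglongrightarrow> 0)"
proof -
  interpret network_energy N c \<aa> \<AA> A f
    by (intro network_energy.intro network.intro network_energy_axioms.intro assms)
  show ?thesis
    using error_estimate
    by (intro conjI[OF _ conjI[OF existence_uniqueness conjI]] allI impI equivalence level_minimizer) blast+
qed

end
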